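(* Let $c>0$, $x_0\in[0,c)$, and let $\tau^c$ be the hitting time of level $c$ by the $\delta$-dimensional Bessel process starting from $x_0$. For any $\eta\in(0,1)$ and $\delta>0$ $$\mathbb{P}\left(\tau^c\le(1-\eta)\mathbb{E}\tau^c\right)=\mathbb{P}\left(\tau^c\le\frac{c^2-x_0^2}{\delta}(1-\eta)\right)\le\exp\left(-\frac{\delta}{8}\,\frac{c^2-x_0^2}{c^2}\,\frac{\eta^2}{1-\eta}\right),$$ while for any $\eta\in(0,1)$ and $\delta>1$ $$\mathbb{P}\left(\tau^c\le2c\,\frac{c-x_0}{\delta-1}(1-\eta)\right)\ge\frac13\exp\left(-2(\delta-1)\frac{c-x_0}{c}\,\frac{1}{1-\eta}\right).$$
   Context: For $\delta>0$ and $x_0\ge 0$, the $\delta$-dimensional Bessel process starting from $x_0$ is the nonnegative process $X_t$, $t\ge0$, with $X_t^2=Z_t$, where $Z$ is the unique strong (nonnegative) solution of $$Z_t=x_0^2+2\int_0^t\sqrt{|Z_s|}\,\mathrm{d}\beta_s+\delta t,$$ with $\beta$ a standard one-dimensional Wiener process. For $c>x_0$, $\tau^c:=\inf\{t\ge0: Z_t=c^2\}=\inf\{t\ge 0:X_t=c\}$. One has $\mathbb{E}\tau^c=(c^2-x_0^2)/\delta$. *)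

theory Defs
  imports "HOL-Probability.Probability"
begin

text \<open>
  Stochastic processes are functions of type \<open>real \<Rightarrow> 'a \<Rightarrow> real\<close>; only their values at times
  \<open>t \<ge> 0\<close> are constrained or used.
\<close>

section \<open>Wiener process and its filtration\<close>

definition wiener_process :: "'a measure \<Rightarrow> (real \<Rightarrow> 'a \<Rightarrow> real) \<Rightarrow> bool" where
  "wiener_process M \<beta> \<longleftrightarrow>
     prob_space M \<and>
     (\<forall>t\<ge>0. \<beta> t \<in> borel_measurable M) \<and>
     (AE \<omega> in M. \<beta> 0 \<omega> = 0) \<and>
     (AE \<omega> in M. continuous_on {0..} (\<lambda>t. \<beta> t \<omega>)) \<and>
     (\<forall>s t. 0 \<le> s \<and> s < t \<longrightarrow>
        distributed M lborel (\<lambda>\<omega>. \<beta> t \<omega> - \<beta> s \<omega>) (\<lambda>x. ennreal (normal_density 0 (sqrt (t - s)) x))) \<and>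
     (\<forall>(n::nat) ts. 0 \<le> ts 0 \<and> (\<forall>i<n. ts i \<le> ts (Suc i)) \<longrightarrow>
        prob_space.indep_vars M (\<lambda>_. borel) (\<lambda>i \<omega>. \<beta> (ts (Suc i)) \<omega> - \<beta> (ts i) \<omega>) {..<n})"

text \<open>The natural filtration augmented by the null sets. Only the \<open>\<sigma>\<close>-algebra component of this
  measure is meaningful.\<close>

definition augmented_filtration :: "'a measure \<Rightarrow> (real \<Rightarrow> 'a \<Rightarrow> real) \<Rightarrow> real \<Rightarrow> 'a measure" where
  "augmented_filtration M \<beta> t =
     sigma (space M)
       ({\<beta> s -` B \<inter> space M | s B. 0 \<le> s \<and> s \<le> t \<and> B \<in> sets borel} \<union> null_sets M)"

section \<open>The Ito integral\<close>

text \<open>A simple integrand is \<open>\<Sum>i<n. \<xi> i * indicator {ts i<..ts (Suc i)}\<close> with \<open>\<xi> i\<close>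
  bounded and measurable at time \<open>ts i\<close>.\<close>

definition simple_integrand ::
  "'a measure \<Rightarrow> (real \<Rightarrow> 'a measure) \<Rightarrow> nat \<Rightarrow> (nat \<Rightarrow> real) \<Rightarrow> (nat \<Rightarrow> 'a \<Rightarrow> real) \<Rightarrow> bool" where
  "simple_integrand M F n ts \<xi> \<longleftrightarrow>
     0 \<le> ts 0 \<and> (\<forall>i<n. ts i \<le> ts (Suc i)) \<and>
     (\<forall>i<n. \<xi> i \<in> borel_measurable (F (ts i)) \<and> bounded (\<xi> i ` space M))"

definition simple_process :: "nat \<Rightarrow> (nat \<Rightarrow> real) \<Rightarrow> (nat \<Rightarrow> 'a \<Rightarrow> real) \<Rightarrow> real \<Rightarrow> 'a \<Rightarrow> real" where
  "simple_process n ts \<xi> s \<omega> = (\<Sum>i<n. \<xi> i \<omega> * indicator {ts i<..ts (Suc i)} s)"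

definition simple_ito_integral ::
  "(real \<Rightarrow> 'a \<Rightarrow> real) \<Rightarrow> nat \<Rightarrow> (nat \<Rightarrow> real) \<Rightarrow> (nat \<Rightarrow> 'a \<Rightarrow> real) \<Rightarrow> real \<Rightarrow> 'a \<Rightarrow> real" where
  "simple_ito_integral \<beta> n ts \<xi> t \<omega> =
     (\<Sum>i<n. \<xi> i \<omega> * (\<beta> (min (ts (Suc i)) t) \<omega> - \<beta> (min (ts i) t) \<omega>))"

text \<open>\<open>has_ito_integral M F \<beta> H t J\<close>: the random variable \<open>J\<close> is a version of
  \<open>\<integral>\<^sub>0\<^sup>t H\<^sub>s d\<beta>\<^sub>s\<close>. This is the usual extension of the integral from simple integrands to progressively
  measurable \<open>H\<close> with \<open>\<integral>\<^sub>0\<^sup>t H\<^sub>s\<^sup>2 ds < \<infinity>\<close> almost surely: if simple \<open>H\<^sup>k\<close> satisfy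
  \<open>\<integral>\<^sub>0\<^sup>t (H\<^sup>k\<^sub>s - H\<^sub>s)\<^sup>2 ds \<rightarrow> 0\<close> in probability, then \<open>\<integral>\<^sub>0\<^sup>t H\<^sup>k\<^sub>s d\<beta>\<^sub>s \<rightarrow> \<integral>\<^sub>0\<^sup>t H\<^sub>s d\<beta>\<^sub>s\<close> in probability.\<close>

definition has_ito_integral ::
  "'a measure \<Rightarrow> (real \<Rightarrow> 'a measure) \<Rightarrow> (real \<Rightarrow> 'a \<Rightarrow> real) \<Rightarrow> (real \<Rightarrow> 'a \<Rightarrow> real) \<Rightarrow>
    real \<Rightarrow> ('a \<Rightarrow> real) \<Rightarrow> bool" where
  "has_ito_integral M F \<beta> H t J \<longleftrightarrow>
     (\<forall>T. 0 \<le> T \<and> T \<le> t \<longrightarrow>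
        (\<lambda>(s, \<omega>). H s \<omega>) \<in> borel_measurable (restrict_space borel {0..T} \<Otimes>\<^sub>M F T)) \<and>
     J \<in> borel_measurable M \<and>
     (\<exists>(n :: nat \<Rightarrow> nat) (ts :: nat \<Rightarrow> nat \<Rightarrow> real) (\<xi> :: nat \<Rightarrow> nat \<Rightarrow> 'a \<Rightarrow> real).
        (\<forall>k. simple_integrand M F (n k) (ts k) (\<xi> k)) \<and>
        (\<forall>\<epsilon>>0. (\<lambda>k. measure M {\<omega> \<in> space M.
             (\<integral>\<^sup>+ s\<in>{0..t}. ennreal ((simple_process (n k) (ts k) (\<xi> k) s \<omega> - H s \<omega>)\<^sup>2) \<partial>lborel)
               > ennreal \<epsilon>}) \<longlonglongrightarrow> 0) \<and>
        (\<forall>\<epsilon>>0. (\<lambda>k. measure M {\<omega> \<in> space M.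
             \<bar>simple_ito_integral \<beta> (n k) (ts k) (\<xi> k) t \<omega> - J \<omega>\<bar> > \<epsilon>}) \<longlonglongrightarrow> 0))"

section \<open>Bessel processes\<close>

text \<open>Strong solutions of \<open>Z\<^sub>t = x0\<^sup>2 + 2 \<integral>\<^sub>0\<^sup>t sqrt \<bar>Z\<^sub>s\<bar> d\<beta>\<^sub>s + \<delta> t\<close>; the solution is strong because it is
  adapted to the augmented filtration of the driving process.\<close>

definition squared_bessel_solution ::
  "'a measure \<Rightarrow> (real \<Rightarrow> 'a \<Rightarrow> real) \<Rightarrow> real \<Rightarrow> real \<Rightarrow> (real \<Rightarrow> 'a \<Rightarrow> real) \<Rightarrow> bool" where
  "squared_bessel_solution M \<beta> \<delta> x0 Z \<longleftrightarrow>
     (\<forall>t\<ge>0. Z t \<in> borel_measurable (augmented_filtration M \<beta> t)) \<and>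
     (\<forall>\<omega>\<in>space M. continuous_on {0..} (\<lambda>t. Z t \<omega>)) \<and>
     (\<forall>\<omega>\<in>space M. \<forall>t\<ge>0. 0 \<le> Z t \<omega>) \<and>
     (\<forall>t\<ge>0. \<exists>J. has_ito_integral M (augmented_filtration M \<beta>) \<beta> (\<lambda>s \<omega>. sqrt \<bar>Z s \<omega>\<bar>) t J \<and>
        (AE \<omega> in M. Z t \<omega> = x0\<^sup>2 + 2 * J \<omega> + \<delta> * t))"

definition bessel_process ::
  "'a measure \<Rightarrow> real \<Rightarrow> real \<Rightarrow> (real \<Rightarrow> 'a \<Rightarrow> real) \<Rightarrow> bool" where
  "bessel_process M \<delta> x0 X \<longleftrightarrow>
     (\<forall>\<omega>\<in>space M. \<forall>t\<ge>0. 0 \<le> X t \<omega>) \<and>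
     (\<exists>\<beta>. wiener_process M \<beta> \<and> squared_bessel_solution M \<beta> \<delta> x0 (\<lambda>t \<omega>. (X t \<omega>)\<^sup>2))"

text \<open>The value is \<open>\<infinity>\<close> if the level is never reached.\<close>

definition hitting_time :: "(real \<Rightarrow> 'a \<Rightarrow> real) \<Rightarrow> real \<Rightarrow> 'a \<Rightarrow> ennreal" where
  "hitting_time X c \<omega> = Inf {ennreal t | t. 0 \<le> t \<and> X t \<omega> = c}"

end

theory Submission
  imports Defs
begin

text \<open>Write \<open>Z\<^sub>t = x0\<^sup>2 + 2 N\<^sub>t + \<delta> t\<close>. For step integrands \<open>exp (\<integral>G dB - \<integral>G\<^sup>2 ds / 2)\<close> has mean exactly \<open>1\<close>;
  Fatou's lemma turns this into the inequality \<open>E exp (\<integral>H dB - \<integral>H\<^sup>2 ds / 2) \<le> 1\<close> for \<open>H = l sqrt Z + \<theta>\<close>, also between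
  stopping times, and nothing else about the Ito integral is needed. Up to the hitting time of \<open>c\<close> one has
  \<open>\<integral>Z ds \<le> c\<^sup>2 T\<close>, so the Chernoff bound with the optimal \<open>l\<close> gives the upper estimate. The inequalities for \<open>l\<close> and
  \<open>-l\<close> near \<open>0\<close> determine the first two moments of \<open>N\<close>, hence optional stopping yields
  \<open>\<delta> E (\<tau> \<and> T) = E Z\<^bsub>\<tau> \<and> T\<^esub> - x0\<^sup>2\<close> and the mean of \<open>\<tau>\<close>. For the lower estimate, \<open>sqrt Z \<ge> x0 + B\<close> almost surely
  if \<open>\<delta> \<ge> 1\<close>, so the level is reached whenever \<open>B\<^sub>T \<ge> c - x0\<close>.\<close>

section \<open>The exponential identity for step integrals\<close>

text \<open>The integral is available only through step integrals that converge in probability,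
  separately for each time; paths and moments have to be recovered. Such limits preserve upper
  bounds, by Fatou's lemma, but not equalities, so all facts about \<open>N\<close> are drawn from
  one family of inequalities, and nonnegative weights known at the left end of an interval play the
  part of conditional expectations. The lower estimate formally rests on
  \<open>d sqrt Z = dB + (\<delta> - 1) / (2 sqrt Z) dt\<close>, whose drift is singular at zero and
  whose derivation calls for Ito's formula. Both obstacles are met by
  \<open>exp (- (sqrt (Z + \<epsilon>) - B) / sqrt \<epsilon>)\<close>: a Taylor expansion together
  with moments up to the fourth controls its mean increment over a short interval. The scale
  \<open>1 / sqrt \<epsilon>\<close> keeps the drift nonpositive down to \<open>Z = 0\<close>, and
  it also makes Markov's bound \<open>exp (1 - r / sqrt \<epsilon>)\<close> for the event
  \<open>sqrt Z - B \<le> x0 - r\<close> vanish with \<open>\<epsilon>\<close>.\<close>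

lemma nn_integral_normal_exp:
  fixes a h :: real
  assumes "0 < h"
  shows "(\<integral>\<^sup>+x. ennreal (normal_density 0 (sqrt h) x) * ennreal (exp (a * x - a\<^sup>2 * h / 2)) \<partial>lborel) = 1"
proof -
  \<comment> \<open>Completing the square turns the tilted centred density into the density with
    mean \<open>a * h\<close> and the same variance, so the integral is a total mass.\<close>
  have "normal_density 0 (sqrt h) x * exp (a * x - a\<^sup>2 * h / 2) = normal_density (a * h) (sqrt h) x" for x
    using assms by (simp add: normal_density_def exp_add[symmetric] mult_exp_exp field_simps power2_eq_square)
  then have "(\<integral>\<^sup>+x. ennreal (normal_density 0 (sqrt h) x) * ennreal (exp (a * x - a\<^sup>2 * h / 2)) \<partial>lborel)
     = (\<integral>\<^sup>+x. ennreal (normal_density (a * h) (sqrt h) x) \<partial>lborel)"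
    by (simp add: ennreal_mult''[symmetric] flip: ennreal_mult')
  also have "\<dots> = 1"
    using assms by (subst nn_integral_eq_integral) auto
  finally show ?thesis .
qed

text \<open>The filtration is abstract: \<open>B\<close> is adapted to it and each increment is
  independent of the past. The augmented filtration fits, although it is larger than the natural
  one. Start and continuity are demanded at every point of the space, so that hitting times and path
  integrals can be handled pointwise.\<close>

locale brownian_filtration = prob_space M
  for M :: "'a measure" and F :: "real \<Rightarrow> 'a measure" and B :: "real \<Rightarrow> 'a \<Rightarrow> real" +
  assumes subalg: "0 \<le> t \<Longrightarrow> subalgebra M (F t)"
    and sets_mono: "0 \<le> s \<Longrightarrow> s \<le> t \<Longrightarrow> sets (F s) \<subseteq> sets (F t)"
    and adapted: "0 \<le> t \<Longrightarrow> B t \<in> borel_measurable (F t)"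
    and start: "\<omega> \<in> space M \<Longrightarrow> B 0 \<omega> = 0"
    and continuous: "\<omega> \<in> space M \<Longrightarrow> continuous_on {0..} (\<lambda>t. B t \<omega>)"
    and increment_distr: "0 \<le> s \<Longrightarrow> s < t \<Longrightarrow>
      distributed M lborel (\<lambda>\<omega>. B t \<omega> - B s \<omega>) (\<lambda>x. ennreal (normal_density 0 (sqrt (t - s)) x))"
    and increment_indep: "0 \<le> s \<Longrightarrow> s < t \<Longrightarrow>
      indep_set (sets (F s)) {(\<lambda>\<omega>. B t \<omega> - B s \<omega>) -` C \<inter> space M | C. C \<in> sets borel}"
begin

section \<open>Integration of an increment that is independent of the past\<close>

lemma space_F: "0 \<le> t \<Longrightarrow> space (F t) = space M"
  using subalg by (auto simp: subalgebra_def)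

lemma measurable_F_M: "0 \<le> t \<Longrightarrow> f \<in> measurable (F t) N \<Longrightarrow> f \<in> measurable M N"
  using subalg measurable_from_subalg by blast

lemma measurable_F_mono: "0 \<le> s \<Longrightarrow> s \<le> t \<Longrightarrow> f \<in> measurable (F s) N \<Longrightarrow> f \<in> measurable (F t) N"
  using sets_mono[of s t] space_F[of s] space_F[of t] by (auto simp: measurable_def)

lemma measurable_B: "0 \<le> s \<Longrightarrow> s \<le> t \<Longrightarrow> B s \<in> borel_measurable (F t)"
  using adapted measurable_F_mono by blast

text \<open>Independence makes the joint law of the past and the increment a product law. Tonelli's
  theorem then lets \<open>\<omega>\<close> be frozen in the first argument while the second is
  integrated against the normal density.\<close>

lemma nn_integral_increment:
  assumes "0 \<le> s" "s < t" and g: "g \<in> borel_measurable (F s \<Otimes>\<^sub>M borel)"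
  shows "(\<integral>\<^sup>+\<omega>. g (\<omega>, B t \<omega> - B s \<omega>) \<partial>M) =
    (\<integral>\<^sup>+\<omega>. (\<integral>\<^sup>+x. ennreal (normal_density 0 (sqrt (t - s)) x) * g (\<omega>, x) \<partial>lborel) \<partial>M)"
proof -
  let ?D = "\<lambda>\<omega>. B t \<omega> - B s \<omega>"
  have id: "(\<lambda>\<omega>. \<omega>) \<in> measurable M (F s)"
    using subalg[OF assms(1)] unfolding subalgebra_def by (intro measurableI) (auto dest: sets.sets_into_space)
  have D: "?D \<in> borel_measurable M"
    using increment_distr[OF assms(1,2)] by (auto simp: distributed_def)
  \<comment> \<open>\<open>?R\<close> is \<open>M\<close> restricted to the \<sigma>-algebra of
    \<open>F s\<close>. Transport along the identity is needed because the measure carried by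
    \<open>F s\<close> itself has no meaning.\<close>
  let ?R = "distr M (F s) (\<lambda>\<omega>. \<omega>)"
  let ?N = "distr M borel ?D"
  interpret R: prob_space ?R by (rule prob_space_distr) fact
  interpret N: prob_space ?N by (rule prob_space_distr) fact
  have pair: "?R \<Otimes>\<^sub>M ?N = distr M (F s \<Otimes>\<^sub>M borel) (\<lambda>\<omega>. (\<omega>, ?D \<omega>))"
  proof (rule pair_measure_eqI)
    show "sigma_finite_measure ?R" "sigma_finite_measure ?N" by unfold_locales
    show "sets (?R \<Otimes>\<^sub>M ?N) = sets (distr M (F s \<Otimes>\<^sub>M borel) (\<lambda>\<omega>. (\<omega>, ?D \<omega>)))"
      by (simp cong: sets_pair_measure_cong)
    fix A C assume "A \<in> sets ?R" "C \<in> sets ?N"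
    then have AC: "A \<in> sets (F s)" "C \<in> sets borel" by auto
    have A: "A \<subseteq> space M" using sets.sets_into_space[OF AC(1)] space_F[OF assms(1)] by simp
    have "prob (A \<inter> (?D -` C \<inter> space M)) = prob A * prob (?D -` C \<inter> space M)"
      using increment_indep[OF assms(1,2)] AC unfolding indep_sets2_eq by blast
    moreover have "(\<lambda>\<omega>. \<omega>) -` A \<inter> space M = A"
      "(\<lambda>\<omega>. (\<omega>, ?D \<omega>)) -` (A \<times> C) \<inter> space M = A \<inter> (?D -` C \<inter> space M)" using A by auto
    ultimately show "emeasure ?R A * emeasure ?N C = emeasure (distr M (F s \<Otimes>\<^sub>M borel) (\<lambda>\<omega>. (\<omega>, ?D \<omega>))) (A \<times> C)"
      using AC id D by (simp add: emeasure_distr emeasure_eq_measure ennreal_mult''[symmetric])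
  qed
  have N: "?N = density lborel (\<lambda>x. ennreal (normal_density 0 (sqrt (t - s)) x))"
  proof -
    have "?N = distr M lborel ?D" by (rule distr_cong) auto
    then show ?thesis using increment_distr[OF assms(1,2)] unfolding distributed_def by simp
  qed
  have "(\<integral>\<^sup>+\<omega>. g (\<omega>, ?D \<omega>) \<partial>M) = (\<integral>\<^sup>+z. g z \<partial>distr M (F s \<Otimes>\<^sub>M borel) (\<lambda>\<omega>. (\<omega>, ?D \<omega>)))"
    using id D g by (subst nn_integral_distr) auto
  also have "\<dots> = (\<integral>\<^sup>+z. g z \<partial>(?R \<Otimes>\<^sub>M ?N))"
    using pair by simp
  also have "\<dots> = (\<integral>\<^sup>+\<omega>. (\<integral>\<^sup>+x. g (\<omega>, x) \<partial>?N) \<partial>?R)"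
    using g by (subst N.nn_integral_fst[symmetric]) (auto cong: measurable_cong_sets)
  also have "\<dots> = (\<integral>\<^sup>+\<omega>. (\<integral>\<^sup>+x. g (\<omega>, x) \<partial>?N) \<partial>M)"
    using g id by (subst nn_integral_distr) (auto cong: measurable_cong_sets intro!: N.borel_measurable_nn_integral_fst)
  also have "\<dots> = (\<integral>\<^sup>+\<omega>. (\<integral>\<^sup>+x. ennreal (normal_density 0 (sqrt (t - s)) x) * g (\<omega>, x) \<partial>lborel) \<partial>M)"
  proof (rule nn_integral_cong)
    fix \<omega> assume "\<omega> \<in> space M"
    then have "\<omega> \<in> space (F s)" using space_F assms by auto
    then have "(\<lambda>x. g (\<omega>, x)) \<in> borel_measurable borel" using g by measurable
    then show "(\<integral>\<^sup>+x. g (\<omega>, x) \<partial>?N) = (\<integral>\<^sup>+x. ennreal (normal_density 0 (sqrt (t - s)) x) * g (\<omega>, x) \<partial>lborel)"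
      unfolding N by (subst nn_integral_density) auto
  qed
  finally show ?thesis .
qed

text \<open>The identity for all nonnegative \<open>V\<close> known at time \<open>s\<close> says
  that the conditional expectation of the exponential given \<open>F s\<close> is one.\<close>

lemma nn_integral_exp_increment:
  assumes "0 \<le> s" "s \<le> t" and [measurable]: "V \<in> borel_measurable (F s)" "\<xi> \<in> borel_measurable (F s)"
    and V0: "\<And>\<omega>. \<omega> \<in> space M \<Longrightarrow> 0 \<le> V \<omega>"
  shows "(\<integral>\<^sup>+\<omega>. ennreal (V \<omega> * exp (\<xi> \<omega> * (B t \<omega> - B s \<omega>) - (\<xi> \<omega>)\<^sup>2 * (t - s) / 2)) \<partial>M) =
    (\<integral>\<^sup>+\<omega>. ennreal (V \<omega>) \<partial>M)"
proof (cases "s = t")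
  case False
  then have st: "s < t" using assms by simp
  have m: "(\<lambda>(\<omega>, x). ennreal (V \<omega> * exp (\<xi> \<omega> * x - (\<xi> \<omega>)\<^sup>2 * (t - s) / 2))) \<in> borel_measurable (F s \<Otimes>\<^sub>M borel)"
    by measurable
  show ?thesis
    using nn_integral_increment[OF assms(1) st m]
  proof (simp only: prod.case, intro nn_integral_cong)
    fix \<omega> assume "\<omega> \<in> space M"
    then have V: "0 \<le> V \<omega>" by (rule V0)
    have "(\<integral>\<^sup>+x. ennreal (normal_density 0 (sqrt (t - s)) x) * ennreal (V \<omega> * exp (\<xi> \<omega> * x - (\<xi> \<omega>)\<^sup>2 * (t - s) / 2)) \<partial>lborel)
      = (\<integral>\<^sup>+x. ennreal (V \<omega>) * (ennreal (normal_density 0 (sqrt (t - s)) x) * ennreal (exp (\<xi> \<omega> * x - (\<xi> \<omega>)\<^sup>2 * (t - s) / 2))) \<partial>lborel)"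
      using V by (intro nn_integral_cong) (simp add: ennreal_mult' mult_ac)
    also have "\<dots> = ennreal (V \<omega>)"
      using st by (subst nn_integral_cmult) (auto simp: nn_integral_normal_exp)
    finally show "(\<integral>\<^sup>+x. ennreal (normal_density 0 (sqrt (t - s)) x) * ennreal (V \<omega> * exp (\<xi> \<omega> * x - (\<xi> \<omega>)\<^sup>2 * (t - s) / 2)) \<partial>lborel) = ennreal (V \<omega>)" .
  qed
qed simp

text \<open>A step integrand \<open>G\<close> together with its integral \<open>I t = \<integral>\<^sub>0\<^sup>t G dB\<close>; only the behaviour between
  consecutive breakpoints is recorded, so that sums need no common refinement.\<close>

definition step_on :: "real set \<Rightarrow> (real \<Rightarrow> 'a \<Rightarrow> real) \<Rightarrow> (real \<Rightarrow> 'a \<Rightarrow> real) \<Rightarrow> bool" where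
  "step_on S G I \<longleftrightarrow> (\<forall>u v. 0 \<le> u \<and> u < v \<and> S \<inter> {u<..<v} = {} \<longrightarrow>
     (\<exists>\<xi>\<in>borel_measurable (F u). \<forall>\<omega>\<in>space M.
        (\<forall>s\<in>{u<..v}. G s \<omega> = \<xi> \<omega>) \<and> I v \<omega> - I u \<omega> = \<xi> \<omega> * (B v \<omega> - B u \<omega>)))"

definition step_pair :: "(real \<Rightarrow> 'a \<Rightarrow> real) \<Rightarrow> (real \<Rightarrow> 'a \<Rightarrow> real) \<Rightarrow> bool" where
  "step_pair G I \<longleftrightarrow> (\<exists>S. finite S \<and> step_on S G I)"

lemma step_pair_zero: "step_pair (\<lambda>s \<omega>. 0) (\<lambda>u \<omega>. 0)"
  unfolding step_pair_def step_on_def by (intro exI[of _ "{}"]) (auto intro!: bexI[of _ "\<lambda>\<omega>. 0"])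

lemma step_pair_B: "step_pair (\<lambda>s \<omega>. 1) B"
  unfolding step_pair_def step_on_def by (intro exI[of _ "{}"]) (auto intro!: bexI[of _ "\<lambda>\<omega>. 1"])

lemma step_pair_add:
  assumes "step_pair G I" "step_pair G' I'"
  shows "step_pair (\<lambda>s \<omega>. G s \<omega> + G' s \<omega>) (\<lambda>u \<omega>. I u \<omega> + I' u \<omega>)"
proof -
  obtain S S' where S: "finite S" "step_on S G I" "finite S'" "step_on S' G' I'"
    using assms unfolding step_pair_def by blast
  have "step_on (S \<union> S') (\<lambda>s \<omega>. G s \<omega> + G' s \<omega>) (\<lambda>u \<omega>. I u \<omega> + I' u \<omega>)"
    unfolding step_on_def
  proof (intro allI impI)
    fix u v :: real assume uv: "0 \<le> u \<and> u < v \<and> (S \<union> S') \<inter> {u<..<v} = {}"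
    then have e: "S \<inter> {u<..<v} = {}" "S' \<inter> {u<..<v} = {}" by auto
    obtain \<xi> where \<xi>: "\<xi> \<in> borel_measurable (F u)" "\<forall>\<omega>\<in>space M.
        (\<forall>s\<in>{u<..v}. G s \<omega> = \<xi> \<omega>) \<and> I v \<omega> - I u \<omega> = \<xi> \<omega> * (B v \<omega> - B u \<omega>)"
      using S(2)[unfolded step_on_def, rule_format, of u v] uv e(1) by blast
    obtain \<xi>' where \<xi>': "\<xi>' \<in> borel_measurable (F u)" "\<forall>\<omega>\<in>space M.
        (\<forall>s\<in>{u<..v}. G' s \<omega> = \<xi>' \<omega>) \<and> I' v \<omega> - I' u \<omega> = \<xi>' \<omega> * (B v \<omega> - B u \<omega>)"
      using S(4)[unfolded step_on_def, rule_format, of u v] uv e(2) by blast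
    show "\<exists>\<xi>\<in>borel_measurable (F u). \<forall>\<omega>\<in>space M. (\<forall>s\<in>{u<..v}. G s \<omega> + G' s \<omega> = \<xi> \<omega>) \<and>
        I v \<omega> + I' v \<omega> - (I u \<omega> + I' u \<omega>) = \<xi> \<omega> * (B v \<omega> - B u \<omega>)"
    proof (rule bexI[of _ "\<lambda>\<omega>. \<xi> \<omega> + \<xi>' \<omega>"], intro ballI conjI)
      fix \<omega> assume \<omega>: "\<omega> \<in> space M"
      have "I v \<omega> + I' v \<omega> - (I u \<omega> + I' u \<omega>) = (I v \<omega> - I u \<omega>) + (I' v \<omega> - I' u \<omega>)" by simp
      also have "\<dots> = \<xi> \<omega> * (B v \<omega> - B u \<omega>) + \<xi>' \<omega> * (B v \<omega> - B u \<omega>)" using \<xi>(2) \<xi>'(2) \<omega> by metis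
      finally show "I v \<omega> + I' v \<omega> - (I u \<omega> + I' u \<omega>) = (\<xi> \<omega> + \<xi>' \<omega>) * (B v \<omega> - B u \<omega>)"
        by (simp add: distrib_right)
    qed (use \<xi> \<xi>' in auto)
  qed
  then show ?thesis using S(1,3) unfolding step_pair_def by blast
qed

lemma step_pair_sum:
  fixes n :: nat
  assumes "\<And>i. i < n \<Longrightarrow> step_pair (G i) (I i)"
  shows "step_pair (\<lambda>s \<omega>. \<Sum>i<n. G i s \<omega>) (\<lambda>u \<omega>. \<Sum>i<n. I i u \<omega>)"
  using assms
proof (induction n)
  case 0 then show ?case using step_pair_zero by simp
next
  case (Suc n)
  then show ?case using step_pair_add[of "\<lambda>s \<omega>. \<Sum>i<n. G i s \<omega>" "\<lambda>u \<omega>. \<Sum>i<n. I i u \<omega>" "G n" "I n"] by simp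
qed

text \<open>Allows coefficients that are random but known at time \<open>p\<close>. Adding
  \<open>p\<close> to the breakpoints guarantees that a piece on which the factor is active starts
  no earlier than \<open>p\<close>, so the factor is measurable there.\<close>

lemma step_pair_scale_from:
  assumes "step_pair G I" "0 \<le> p" "\<xi>' \<in> borel_measurable (F p)"
  shows "step_pair (\<lambda>s \<omega>. if p < s then \<xi>' \<omega> * G s \<omega> else 0) (\<lambda>u \<omega>. \<xi>' \<omega> * (I (max p u) \<omega> - I p \<omega>))"
proof -
  obtain S where S: "finite S" "step_on S G I"
    using assms unfolding step_pair_def by blast
  have "step_on (insert p S) (\<lambda>s \<omega>. if p < s then \<xi>' \<omega> * G s \<omega> else 0) (\<lambda>u \<omega>. \<xi>' \<omega> * (I (max p u) \<omega> - I p \<omega>))"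
    unfolding step_on_def
  proof (intro allI impI)
    fix u v :: real assume uv: "0 \<le> u \<and> u < v \<and> insert p S \<inter> {u<..<v} = {}"
    then have e: "S \<inter> {u<..<v} = {}" "v \<le> p \<or> p \<le> u" by auto
    show "\<exists>\<xi>\<in>borel_measurable (F u). \<forall>\<omega>\<in>space M.
        (\<forall>s\<in>{u<..v}. (if p < s then \<xi>' \<omega> * G s \<omega> else 0) = \<xi> \<omega>) \<and>
        \<xi>' \<omega> * (I (max p v) \<omega> - I p \<omega>) - \<xi>' \<omega> * (I (max p u) \<omega> - I p \<omega>) = \<xi> \<omega> * (B v \<omega> - B u \<omega>)"
    proof (cases "v \<le> p")
      case True
      then have "max p v = p" "max p u = p" using uv by auto
      then show ?thesis using True by (intro bexI[of _ "\<lambda>\<omega>. 0"]) auto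
    next
      case False
      then have pu: "p \<le> u" using e by simp
      obtain \<xi> where \<xi>: "\<xi> \<in> borel_measurable (F u)" "\<forall>\<omega>\<in>space M.
        (\<forall>s\<in>{u<..v}. G s \<omega> = \<xi> \<omega>) \<and> I v \<omega> - I u \<omega> = \<xi> \<omega> * (B v \<omega> - B u \<omega>)"
        using S(2)[unfolded step_on_def, rule_format, of u v] uv e(1) by blast
      have "\<xi>' \<in> borel_measurable (F u)" using measurable_F_mono[OF assms(2) pu assms(3)] .
      moreover have "\<xi>' \<omega> * (I (max p v) \<omega> - I p \<omega>) - \<xi>' \<omega> * (I (max p u) \<omega> - I p \<omega>) = \<xi>' \<omega> * \<xi> \<omega> * (B v \<omega> - B u \<omega>)"
        if "\<omega> \<in> space M" for \<omega>
      proof -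
        have "I v \<omega> - I u \<omega> = \<xi> \<omega> * (B v \<omega> - B u \<omega>)" using \<xi>(2) that by blast
        moreover have "max p v = v" "max p u = u" using False pu uv by auto
        ultimately show ?thesis by (simp add: right_diff_distrib[symmetric])
      qed
      ultimately show ?thesis
        using \<xi> pu by (intro bexI[of _ "\<lambda>\<omega>. \<xi>' \<omega> * \<xi> \<omega>"] ballI conjI borel_measurable_times) simp_all
    qed
  qed
  then show ?thesis using S(1) unfolding step_pair_def by (meson finite_insert)
qed

lemma step_pair_diff:
  assumes "step_pair G I" "step_pair G' I'"
  shows "step_pair (\<lambda>s \<omega>. G s \<omega> - G' s \<omega>) (\<lambda>u \<omega>. I u \<omega> - I' u \<omega>)"
proof -
  obtain S' where S': "finite S'" "step_on S' G' I'" using assms unfolding step_pair_def by blast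
  have "step_on S' (\<lambda>s \<omega>. - G' s \<omega>) (\<lambda>u \<omega>. - I' u \<omega>)"
    unfolding step_on_def
  proof (intro allI impI)
    fix u v :: real assume uv: "0 \<le> u \<and> u < v \<and> S' \<inter> {u<..<v} = {}"
    obtain \<xi> where \<xi>: "\<xi> \<in> borel_measurable (F u)" "\<forall>\<omega>\<in>space M.
        (\<forall>s\<in>{u<..v}. G' s \<omega> = \<xi> \<omega>) \<and> I' v \<omega> - I' u \<omega> = \<xi> \<omega> * (B v \<omega> - B u \<omega>)"
      using S'(2)[unfolded step_on_def, rule_format, of u v] uv by blast
    show "\<exists>\<xi>\<in>borel_measurable (F u). \<forall>\<omega>\<in>space M. (\<forall>s\<in>{u<..v}. - G' s \<omega> = \<xi> \<omega>) \<and>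
        - I' v \<omega> - - I' u \<omega> = \<xi> \<omega> * (B v \<omega> - B u \<omega>)"
    proof (rule bexI[of _ "\<lambda>\<omega>. - \<xi> \<omega>"], intro ballI conjI)
      fix \<omega> assume \<omega>: "\<omega> \<in> space M"
      have "- I' v \<omega> - - I' u \<omega> = - (I' v \<omega> - I' u \<omega>)" by simp
      also have "\<dots> = - (\<xi> \<omega> * (B v \<omega> - B u \<omega>))" using \<xi>(2) \<omega> by metis
      finally show "- I' v \<omega> - - I' u \<omega> = - \<xi> \<omega> * (B v \<omega> - B u \<omega>)" by simp
    qed (use \<xi> in auto)
  qed
  then have "step_pair (\<lambda>s \<omega>. - G' s \<omega>) (\<lambda>u \<omega>. - I' u \<omega>)" using S' unfolding step_pair_def by blast
  from step_pair_add[OF assms(1) this] show ?thesis by simp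
qed

lemma step_pair_interval:
  assumes "0 \<le> a" "a \<le> b" and \<xi>: "\<xi> \<in> borel_measurable (F a)"
  shows "step_pair (\<lambda>s \<omega>. \<xi> \<omega> * indicator {a<..b} s) (\<lambda>u \<omega>. \<xi> \<omega> * (B (min b u) \<omega> - B (min a u) \<omega>))"
proof -
  have "step_on {a, b} (\<lambda>s \<omega>. \<xi> \<omega> * indicator {a<..b} s) (\<lambda>u \<omega>. \<xi> \<omega> * (B (min b u) \<omega> - B (min a u) \<omega>))"
    unfolding step_on_def
  proof (intro allI impI)
    fix u v :: real assume uv: "0 \<le> u \<and> u < v \<and> {a, b} \<inter> {u<..<v} = {}"
    then have "a \<le> u \<or> v \<le> a" "b \<le> u \<or> v \<le> b" by auto
    then consider "v \<le> a" | "b \<le> u" | "a \<le> u" "v \<le> b" by blast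
    then show "\<exists>\<xi>'\<in>borel_measurable (F u). \<forall>\<omega>\<in>space M. (\<forall>s\<in>{u<..v}. \<xi> \<omega> * indicator {a<..b} s = \<xi>' \<omega>) \<and>
       \<xi> \<omega> * (B (min b v) \<omega> - B (min a v) \<omega>) - \<xi> \<omega> * (B (min b u) \<omega> - B (min a u) \<omega>) = \<xi>' \<omega> * (B v \<omega> - B u \<omega>)"
    proof cases
      case 1
      then have "min b v = v" "min b u = u" "min a v = v" "min a u = u" using uv assms by auto
      then show ?thesis using 1 by (intro bexI[of _ "\<lambda>\<omega>. 0"]) auto
    next
      case 2
      then have "min b v = b" "min b u = b" "min a v = a" "min a u = a" using uv assms by auto
      then show ?thesis using 2 by (intro bexI[of _ "\<lambda>\<omega>. 0"]) auto
    next
      case 3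
      then have "min b v = v" "min b u = u" "min a v = a" "min a u = a" using uv assms by auto
      moreover have "\<xi> \<in> borel_measurable (F u)" using measurable_F_mono[OF assms(1) 3(1) \<xi>] .
      ultimately show ?thesis using 3 by (intro bexI[of _ \<xi>]) (auto simp: right_diff_distrib)
    qed
  qed
  then show ?thesis unfolding step_pair_def by (meson finite.emptyI finite_insert)
qed

lemma step_pair_simple:
  assumes "simple_integrand M F n ts \<xi>"
  shows "step_pair (simple_process n ts \<xi>) (simple_ito_integral B n ts \<xi>)"
proof -
  have m: "0 \<le> ts i" if "i \<le> n" for i
    using that
  proof (induction i)
    case (Suc i)
    then have "ts i \<le> ts (Suc i)" using assms by (simp add: simple_integrand_def)
    then show ?case using Suc by simp
  qed (use assms in \<open>simp add: simple_integrand_def\<close>)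
  have "step_pair (\<lambda>s \<omega>. \<Sum>i<n. \<xi> i \<omega> * indicator {ts i<..ts (Suc i)} s)
      (\<lambda>u \<omega>. \<Sum>i<n. \<xi> i \<omega> * (B (min (ts (Suc i)) u) \<omega> - B (min (ts i) u) \<omega>))"
  proof (rule step_pair_sum, rule step_pair_interval)
    fix i assume "i < n"
    then show "0 \<le> ts i" "ts i \<le> ts (Suc i)" "\<xi> i \<in> borel_measurable (F (ts i))"
      using m[of i] assms by (auto simp: simple_integrand_def)
  qed
  then show ?thesis by (simp add: simple_process_def[abs_def] simple_ito_integral_def[abs_def])
qed

section \<open>Energy and the exponential identity across breakpoints\<close>

definition energy :: "(real \<Rightarrow> 'a \<Rightarrow> real) \<Rightarrow> real \<Rightarrow> real \<Rightarrow> 'a \<Rightarrow> real" where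
  "energy G p t \<omega> = (LINT s:{p<..t}|lborel. (G s \<omega>)\<^sup>2)"

text \<open>Induction on the number of breakpoints strictly inside the interval. Without any, this
  is the identity for a single increment. Otherwise a breakpoint \<open>q\<close> splits the
  interval; the exponential of the left half is known at time \<open>q\<close> and joins the weight
  of the right half, which is why the identity is stated for all weights. The measurability claims
  are carried along because this new weight needs them.\<close>

lemma step_on_exp:
  assumes "finite S" "step_on S G I" "0 \<le> p" "p \<le> t"
  shows "(\<forall>\<omega>\<in>space M. set_integrable lborel {p<..t} (\<lambda>s. (G s \<omega>)\<^sup>2)) \<and>
     energy G p t \<in> borel_measurable (F t) \<and> (\<lambda>\<omega>. I t \<omega> - I p \<omega>) \<in> borel_measurable (F t) \<and>
     (\<forall>V\<in>borel_measurable (F p). (\<forall>\<omega>\<in>space M. 0 \<le> V \<omega>) \<longrightarrow>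
       (\<integral>\<^sup>+\<omega>. ennreal (V \<omega> * exp (I t \<omega> - I p \<omega> - energy G p t \<omega> / 2)) \<partial>M) = (\<integral>\<^sup>+\<omega>. ennreal (V \<omega>) \<partial>M))"
  using assms(3,4)
proof (induction "card (S \<inter> {p<..<t})" arbitrary: p t rule: less_induct)
  case less
  consider "p = t" | "p < t" "S \<inter> {p<..<t} = {}" | q where "q \<in> S" "p < q" "q < t" using less.prems by force
  then show ?case
  proof cases
    case 1
    have "energy G t t = (\<lambda>\<omega>. 0)" by (simp add: fun_eq_iff energy_def set_lebesgue_integral_def)
    then show ?thesis using 1 by (auto simp: set_integrable_def)
  next
    case 2
    obtain \<xi> where \<xi>[measurable]: "\<xi> \<in> borel_measurable (F p)" and e: "\<And>\<omega>. \<omega> \<in> space M \<Longrightarrow>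
        (\<forall>s\<in>{p<..t}. G s \<omega> = \<xi> \<omega>) \<and> I t \<omega> - I p \<omega> = \<xi> \<omega> * (B t \<omega> - B p \<omega>)"
      using assms(2)[unfolded step_on_def, rule_format, of p t] 2 less.prems by blast
    have 3: "set_integrable lborel {p<..t} (\<lambda>s. (G s \<omega>)\<^sup>2)" "energy G p t \<omega> = (\<xi> \<omega>)\<^sup>2 * (t - p)" if "\<omega> \<in> space M" for \<omega>
    proof -
      have "set_integrable lborel {p<..t} (\<lambda>s. (\<xi> \<omega>)\<^sup>2)"
        unfolding set_integrable_def using less.prems by (auto simp: integrable_indicator_iff)
      then show "set_integrable lborel {p<..t} (\<lambda>s. (G s \<omega>)\<^sup>2)"
        using e[OF that] by (subst set_integrable_cong[where f'="\<lambda>s. (\<xi> \<omega>)\<^sup>2"]) auto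
      have "energy G p t \<omega> = (LINT s:{p<..t}|lborel. (\<xi> \<omega>)\<^sup>2)"
        unfolding energy_def using e[OF that] by (intro set_lebesgue_integral_cong) auto
      then show "energy G p t \<omega> = (\<xi> \<omega>)\<^sup>2 * (t - p)"
        using less.prems by (simp add: set_lebesgue_integral_def)
    qed
    have \<xi>t[measurable]: "\<xi> \<in> borel_measurable (F t)" using measurable_F_mono[OF _ _ \<xi>] less.prems by auto
    have [measurable]: "B t \<in> borel_measurable (F t)" "B p \<in> borel_measurable (F t)"
      using measurable_B less.prems by auto
    have sp: "space (F t) = space M" using space_F less.prems by auto
    have "(\<lambda>\<omega>. (\<xi> \<omega>)\<^sup>2 * (t - p)) \<in> borel_measurable (F t)" by measurable
    then have m1: "energy G p t \<in> borel_measurable (F t)" using 3(2) sp by (subst measurable_cong) auto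
    have "(\<lambda>\<omega>. \<xi> \<omega> * (B t \<omega> - B p \<omega>)) \<in> borel_measurable (F t)" by measurable
    then have m2: "(\<lambda>\<omega>. I t \<omega> - I p \<omega>) \<in> borel_measurable (F t)" using e sp by (subst measurable_cong) auto
    have m3: "(\<integral>\<^sup>+\<omega>. ennreal (V \<omega> * exp (I t \<omega> - I p \<omega> - energy G p t \<omega> / 2)) \<partial>M) = (\<integral>\<^sup>+\<omega>. ennreal (V \<omega>) \<partial>M)"
      if V: "V \<in> borel_measurable (F p)" "\<forall>\<omega>\<in>space M. 0 \<le> V \<omega>" for V
    proof -
      have "(\<integral>\<^sup>+\<omega>. ennreal (V \<omega> * exp (I t \<omega> - I p \<omega> - energy G p t \<omega> / 2)) \<partial>M) =
        (\<integral>\<^sup>+\<omega>. ennreal (V \<omega> * exp (\<xi> \<omega> * (B t \<omega> - B p \<omega>) - (\<xi> \<omega>)\<^sup>2 * (t - p) / 2)) \<partial>M)"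
        using 3(2) e by (intro nn_integral_cong) auto
      also have "\<dots> = (\<integral>\<^sup>+\<omega>. ennreal (V \<omega>) \<partial>M)"
        using nn_integral_exp_increment[OF less.prems V(1) \<xi>] V(2) by blast
      finally show ?thesis .
    qed
    show ?thesis using 3(1) m1 m2 m3 by blast
  next
    case (3 q)
    \<comment> \<open>Both halves lose \<open>q\<close> itself, so the count drops strictly.\<close>
    have c1: "card (S \<inter> {p<..<q}) < card (S \<inter> {p<..<t})" and c2: "card (S \<inter> {q<..<t}) < card (S \<inter> {p<..<t})"
      using 3 assms(1) by (auto intro!: psubset_card_mono)
    have q0: "0 \<le> q" "p \<le> q" "q \<le> t" using 3 less.prems by auto
    note L = less.hyps[OF c1 less.prems(1) q0(2)] and R = less.hyps[OF c2 q0(1,3)]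
    have U: "{p<..t} = {p<..q} \<union> {q<..t}" using q0 by auto
    have int: "set_integrable lborel {p<..t} (\<lambda>s. (G s \<omega>)\<^sup>2)" if "\<omega> \<in> space M" for \<omega>
      unfolding U using L R that by (intro set_integrable_Un) auto
    have en: "energy G p t \<omega> = energy G p q \<omega> + energy G q t \<omega>" if "\<omega> \<in> space M" for \<omega>
      unfolding energy_def U using L R that by (intro set_integral_Un) auto
    have [measurable]: "energy G p q \<in> borel_measurable (F q)" "(\<lambda>\<omega>. I q \<omega> - I p \<omega>) \<in> borel_measurable (F q)"
      using L by auto
    have m[measurable]: "energy G p q \<in> borel_measurable (F t)" "(\<lambda>\<omega>. I q \<omega> - I p \<omega>) \<in> borel_measurable (F t)"
      "energy G q t \<in> borel_measurable (F t)" "(\<lambda>\<omega>. I t \<omega> - I q \<omega>) \<in> borel_measurable (F t)"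
      subgoal by (rule measurable_F_mono[OF q0(1,3)]) (use L in blast)
      subgoal by (rule measurable_F_mono[OF q0(1,3)]) (use L in blast)
      using R by blast+
    have sp: "space (F t) = space M" using space_F less.prems by auto
    have "(\<lambda>\<omega>. energy G p q \<omega> + energy G q t \<omega>) \<in> borel_measurable (F t)" by measurable
    then have m1: "energy G p t \<in> borel_measurable (F t)" using en sp by (subst measurable_cong) auto
    have "(\<lambda>\<omega>. (I q \<omega> - I p \<omega>) + (I t \<omega> - I q \<omega>)) \<in> borel_measurable (F t)" using m by (intro borel_measurable_add)
    then have m2: "(\<lambda>\<omega>. I t \<omega> - I p \<omega>) \<in> borel_measurable (F t)" by (simp add: algebra_simps)
    have m3: "(\<integral>\<^sup>+\<omega>. ennreal (V \<omega> * exp (I t \<omega> - I p \<omega> - energy G p t \<omega> / 2)) \<partial>M) = (\<integral>\<^sup>+\<omega>. ennreal (V \<omega>) \<partial>M)"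
      if V: "V \<in> borel_measurable (F p)" "\<forall>\<omega>\<in>space M. 0 \<le> V \<omega>" for V
    proof -
      let ?W = "\<lambda>\<omega>. V \<omega> * exp (I q \<omega> - I p \<omega> - energy G p q \<omega> / 2)"
      have [measurable]: "V \<in> borel_measurable (F q)" using measurable_F_mono[OF _ q0(2) V(1)] less.prems by simp
      have W: "?W \<in> borel_measurable (F q)" by measurable
      have W0: "\<forall>\<omega>\<in>space M. 0 \<le> ?W \<omega>" using V by simp
      have "(\<integral>\<^sup>+\<omega>. ennreal (V \<omega> * exp (I t \<omega> - I p \<omega> - energy G p t \<omega> / 2)) \<partial>M) =
        (\<integral>\<^sup>+\<omega>. ennreal (?W \<omega> * exp (I t \<omega> - I q \<omega> - energy G q t \<omega> / 2)) \<partial>M)"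
        proof (intro nn_integral_cong)
        fix \<omega> assume "\<omega> \<in> space M"
        then have "I t \<omega> - I p \<omega> - energy G p t \<omega> / 2 = (I q \<omega> - I p \<omega> - energy G p q \<omega> / 2) + (I t \<omega> - I q \<omega> - energy G q t \<omega> / 2)"
          using en by (simp add: add_divide_distrib)
        then show "ennreal (V \<omega> * exp (I t \<omega> - I p \<omega> - energy G p t \<omega> / 2)) = ennreal (?W \<omega> * exp (I t \<omega> - I q \<omega> - energy G q t \<omega> / 2))"
          by (simp only: exp_add mult.assoc)
      qed
      also have "\<dots> = (\<integral>\<^sup>+\<omega>. ennreal (?W \<omega>) \<partial>M)" by (rule R[THEN conjunct2, THEN conjunct2, THEN conjunct2, rule_format, OF W]) (use W0 in blast)
      also have "\<dots> = (\<integral>\<^sup>+\<omega>. ennreal (V \<omega>) \<partial>M)"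
        by (rule L[THEN conjunct2, THEN conjunct2, THEN conjunct2, rule_format, OF V(1)]) (use V(2) in blast)
      finally show ?thesis .
    qed
    show ?thesis using int m1 m2 m3 by blast
  qed
qed

lemma
  assumes "step_pair G I" "0 \<le> p" "p \<le> t"
  shows step_pair_integrable: "\<And>\<omega>. \<omega> \<in> space M \<Longrightarrow> set_integrable lborel {p<..t} (\<lambda>s. (G s \<omega>)\<^sup>2)"
    and step_pair_measurable_energy: "energy G p t \<in> borel_measurable (F t)"
    and step_pair_measurable: "(\<lambda>\<omega>. I t \<omega> - I p \<omega>) \<in> borel_measurable (F t)"
    and step_pair_exp: "\<And>V. V \<in> borel_measurable (F p) \<Longrightarrow> (\<And>\<omega>. \<omega> \<in> space M \<Longrightarrow> 0 \<le> V \<omega>) \<Longrightarrow>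
       (\<integral>\<^sup>+\<omega>. ennreal (V \<omega> * exp (I t \<omega> - I p \<omega> - energy G p t \<omega> / 2)) \<partial>M) = (\<integral>\<^sup>+\<omega>. ennreal (V \<omega>) \<partial>M)"
  using assms step_on_exp unfolding step_pair_def by blast+

end

section \<open>The exponential inequality in the limit\<close>

context prob_space
begin

text \<open>Values in \<open>ennreal\<close> admit integrals that may be infinite, and the value
  \<open>\<top>\<close> on an exceptional null set.\<close>

definition conv0 :: "(nat \<Rightarrow> 'a \<Rightarrow> ennreal) \<Rightarrow> bool" where
  "conv0 Q \<longleftrightarrow> (\<forall>k. Q k \<in> borel_measurable M) \<and>
     (\<forall>\<epsilon>>0. (\<lambda>k. prob {\<omega> \<in> space M. Q k \<omega> > ennreal \<epsilon>}) \<longlonglongrightarrow> 0)"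

lemma conv0_measurable: "conv0 Q \<Longrightarrow> Q k \<in> borel_measurable M"
  unfolding conv0_def by blast

lemma conv0D: "conv0 Q \<Longrightarrow> \<epsilon> > 0 \<Longrightarrow> (\<lambda>k. prob {\<omega> \<in> space M. Q k \<omega> > ennreal \<epsilon>}) \<longlonglongrightarrow> 0"
  unfolding conv0_def by blast

lemma tendsto_zero_prob_mono:
  assumes "(\<lambda>k. prob (A k)) \<longlonglongrightarrow> 0" "\<And>k. A k \<in> events" "\<And>k. C k \<subseteq> A k"
  shows "(\<lambda>k. prob (C k)) \<longlonglongrightarrow> 0"
  by (rule tendsto_sandwich[OF _ _ tendsto_const assms(1)])
     (auto intro!: always_eventually finite_measure_mono assms)

lemma conv0_mono:
  assumes "conv0 Q'" "\<And>k. Q k \<in> borel_measurable M" "\<And>k \<omega>. \<omega> \<in> space M \<Longrightarrow> Q k \<omega> \<le> Q' k \<omega>"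
  shows "conv0 Q"
  unfolding conv0_def
proof (intro conjI allI impI assms(2))
  fix \<epsilon> :: real assume "\<epsilon> > 0"
  have [measurable]: "Q' k \<in> borel_measurable M" for k using assms(1) by (rule conv0_measurable)
  show "(\<lambda>k. prob {\<omega> \<in> space M. Q k \<omega> > ennreal \<epsilon>}) \<longlonglongrightarrow> 0"
    by (rule tendsto_zero_prob_mono[OF conv0D[OF assms(1) \<open>\<epsilon> > 0\<close>]])
       (use assms(3) in \<open>auto intro: less_le_trans\<close>)
qed

lemma conv0_add:
  assumes "conv0 Q" "conv0 Q'"
  shows "conv0 (\<lambda>k \<omega>. Q k \<omega> + Q' k \<omega>)"
  unfolding conv0_def
proof (intro conjI allI impI)
  have [measurable]: "Q k \<in> borel_measurable M" "Q' k \<in> borel_measurable M" for k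
    using assms by (auto intro: conv0_measurable)
  show "(\<lambda>\<omega>. Q k \<omega> + Q' k \<omega>) \<in> borel_measurable M" for k by measurable
  fix \<epsilon> :: real assume \<epsilon>: "\<epsilon> > 0"
  let ?A = "\<lambda>k. {\<omega> \<in> space M. Q k \<omega> > ennreal (\<epsilon>/2)}" and ?A' = "\<lambda>k. {\<omega> \<in> space M. Q' k \<omega> > ennreal (\<epsilon>/2)}"
  have lim: "(\<lambda>k. prob (?A k) + prob (?A' k)) \<longlonglongrightarrow> 0"
    using tendsto_add[OF conv0D[OF assms(1), of "\<epsilon>/2"] conv0D[OF assms(2), of "\<epsilon>/2"]] \<epsilon> by simp
  have le: "prob {\<omega> \<in> space M. Q k \<omega> + Q' k \<omega> > ennreal \<epsilon>} \<le> prob (?A k) + prob (?A' k)" for k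
  proof -
    have "{\<omega> \<in> space M. Q k \<omega> + Q' k \<omega> > ennreal \<epsilon>} \<subseteq> ?A k \<union> ?A' k"
    proof (rule ccontr)
      assume "\<not> ?thesis"
      then obtain \<omega> where "Q k \<omega> + Q' k \<omega> > ennreal \<epsilon>" "\<not> ennreal (\<epsilon>/2) < Q k \<omega>" "\<not> ennreal (\<epsilon>/2) < Q' k \<omega>"
        by blast
      moreover from this have "Q k \<omega> + Q' k \<omega> \<le> ennreal (\<epsilon>/2) + ennreal (\<epsilon>/2)" by (intro add_mono) (simp_all add: not_less)
      moreover have "ennreal (\<epsilon>/2) + ennreal (\<epsilon>/2) = ennreal \<epsilon>"
        using \<epsilon> by (subst ennreal_plus[symmetric]) auto
      ultimately show False by (metis not_less)
    qed
    then have "prob {\<omega> \<in> space M. Q k \<omega> + Q' k \<omega> > ennreal \<epsilon>} \<le> prob (?A k \<union> ?A' k)"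
      by (intro finite_measure_mono) auto
    also have "\<dots> \<le> prob (?A k) + prob (?A' k)" by (intro measure_Un_le) auto
    finally show ?thesis .
  qed
  show "(\<lambda>k. prob {\<omega> \<in> space M. Q k \<omega> + Q' k \<omega> > ennreal \<epsilon>}) \<longlonglongrightarrow> 0"
    by (rule tendsto_sandwich[OF always_eventually always_eventually tendsto_const lim]) (simp_all add: le)
qed

lemma conv0_cmult:
  assumes "conv0 Q" "0 < c"
  shows "conv0 (\<lambda>k \<omega>. ennreal c * Q k \<omega>)"
  unfolding conv0_def
proof (intro conjI allI impI)
  have [measurable]: "Q k \<in> borel_measurable M" for k
    using assms by (auto intro: conv0_measurable)
  show "(\<lambda>\<omega>. ennreal c * Q k \<omega>) \<in> borel_measurable M" for k by measurable
  fix \<epsilon> :: real assume \<epsilon>: "\<epsilon> > 0"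
  have "{\<omega> \<in> space M. ennreal c * Q k \<omega> > ennreal \<epsilon>} \<subseteq> {\<omega> \<in> space M. Q k \<omega> > ennreal (\<epsilon> / c)}" for k
  proof (rule ccontr)
    assume "\<not> ?thesis"
    then obtain \<omega> where "ennreal c * Q k \<omega> > ennreal \<epsilon>" "\<not> ennreal (\<epsilon>/c) < Q k \<omega>" by blast
    moreover from this have "ennreal c * Q k \<omega> \<le> ennreal c * ennreal (\<epsilon> / c)" by (intro mult_left_mono) (simp_all add: not_less)
    moreover have "ennreal c * ennreal (\<epsilon> / c) = ennreal \<epsilon>"
      using \<epsilon> assms by (subst ennreal_mult[symmetric]) auto
    ultimately show False by (metis not_less)
  qed
  then show "(\<lambda>k. prob {\<omega> \<in> space M. ennreal c * Q k \<omega> > ennreal \<epsilon>}) \<longlonglongrightarrow> 0"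
    using \<epsilon> assms by (intro tendsto_zero_prob_mono[OF conv0D[OF assms(1), of "\<epsilon> / c"]]) auto
qed

text \<open>Fatou's lemma along convergence in probability. Truncation at \<open>N\<close> limits
  the contribution of \<open>A k\<close> to \<open>N\<close> times its probability, which vanishes
  as \<open>k\<close> grows. Monotone convergence in \<open>N\<close> then removes the truncation,
  and no almost surely convergent subsequence has to be extracted.\<close>

lemma nn_integral_le_in_prob:
  assumes [measurable]: "Y \<in> borel_measurable M" and A: "\<And>k. A k \<in> events"
    and lim: "(\<lambda>k. prob (A k)) \<longlonglongrightarrow> 0"
    and le: "\<And>k. (\<integral>\<^sup>+\<omega>. Y \<omega> * indicator (space M - A k) \<omega> \<partial>M) \<le> C"
  shows "(\<integral>\<^sup>+\<omega>. Y \<omega> \<partial>M) \<le> C"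
proof -
  have 1: "(\<integral>\<^sup>+\<omega>. min (of_nat N) (Y \<omega>) \<partial>M) \<le> C" for N
  proof -
    have "(\<integral>\<^sup>+\<omega>. min (of_nat N) (Y \<omega>) \<partial>M) \<le> C + of_nat N * ennreal (prob (A k))" for k
    proof -
      have [measurable]: "A k \<in> events" by (rule A)
      have "(\<integral>\<^sup>+\<omega>. min (of_nat N) (Y \<omega>) \<partial>M) \<le>
        (\<integral>\<^sup>+\<omega>. Y \<omega> * indicator (space M - A k) \<omega> + of_nat N * indicator (A k) \<omega> \<partial>M)"
        by (intro nn_integral_mono) (auto split: split_indicator)
      also have "\<dots> = (\<integral>\<^sup>+\<omega>. Y \<omega> * indicator (space M - A k) \<omega> \<partial>M) + of_nat N * ennreal (prob (A k))"
        by (subst nn_integral_add) (auto simp: nn_integral_cmult emeasure_eq_measure)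
      also have "\<dots> \<le> C + of_nat N * ennreal (prob (A k))" using le by (intro add_mono) auto
      finally show ?thesis .
    qed
    moreover have "(\<lambda>k. C + of_nat N * ennreal (prob (A k))) \<longlonglongrightarrow> C + of_nat N * ennreal 0"
      by (intro tendsto_add tendsto_const ennreal_tendsto_cmult tendsto_ennrealI lim) (simp add: of_nat_less_top)
    ultimately show ?thesis by (intro LIMSEQ_le_const[of _ "C"]) auto
  qed
  have "(\<integral>\<^sup>+\<omega>. Y \<omega> \<partial>M) = (\<integral>\<^sup>+\<omega>. (SUP N. min (of_nat N) (Y \<omega>)) \<partial>M)"
  proof (intro nn_integral_cong)
    fix \<omega>
    have "(SUP N. min (of_nat N) (Y \<omega>)) = inf (SUP N::nat. of_nat N) (Y \<omega>)"
      unfolding inf_min[symmetric] by (subst SUP_inf) simp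
    then show "Y \<omega> = (SUP N. min (of_nat N) (Y \<omega>))" by (simp add: ennreal_SUP_of_nat_eq_top)
  qed
  also have "\<dots> = (SUP N. \<integral>\<^sup>+\<omega>. min (of_nat N) (Y \<omega>) \<partial>M)"
    by (intro nn_integral_monotone_convergence_SUP) (auto simp: incseq_def le_fun_def intro: min.coboundedI1)
  also have "\<dots> \<le> C" using 1 by (intro SUP_least)
  finally show ?thesis .
qed

end

section \<open>Limits of step integrals\<close>

context brownian_filtration
begin

text \<open>Off two exceptional sets, the increment of \<open>I\<close> is within \<open>r\<close>
  of \<open>J\<close>, and the energy of \<open>G\<close> exceeds that of \<open>H\<close> by at
  most a factor \<open>1 + r\<close> and a summand \<open>r\<close>. The identity for step integrals
  then gives the claim up to constants depending on \<open>r\<close>; the exceptional sets shrink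
  first, and \<open>r\<close> tends to zero afterwards.\<close>

lemma nn_integral_exp_limit:
  assumes step: "\<And>k. step_pair (G k) (I k)" and pt: "0 \<le> p" "p \<le> t"
    and I: "conv0 (\<lambda>k \<omega>. ennreal \<bar>I k t \<omega> - I k p \<omega> - J \<omega>\<bar>)"
    and Q: "conv0 Q" and GQ: "\<And>k \<omega>. \<omega> \<in> space M \<Longrightarrow> (\<integral>\<^sup>+s\<in>{p<..t}. ennreal ((G k s \<omega> - H s \<omega>)\<^sup>2) \<partial>lborel) \<le> Q k \<omega>"
    and H: "\<And>\<omega>. \<omega> \<in> space M \<Longrightarrow> set_integrable lborel {p<..t} (\<lambda>s. (H s \<omega>)\<^sup>2)"
    and G: "\<And>k \<omega>. \<omega> \<in> space M \<Longrightarrow> set_borel_measurable borel {p<..t} (\<lambda>s. G k s \<omega> - H s \<omega>)"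
    and [measurable]: "energy H p t \<in> borel_measurable M" "J \<in> borel_measurable M"
    and V: "V \<in> borel_measurable (F p)" and V0: "\<And>\<omega>. \<omega> \<in> space M \<Longrightarrow> 0 \<le> V \<omega>"
  shows "(\<integral>\<^sup>+\<omega>. ennreal (V \<omega> * exp (J \<omega> - energy H p t \<omega> / 2)) \<partial>M) \<le> (\<integral>\<^sup>+\<omega>. ennreal (V \<omega>) \<partial>M)"
proof -
  have VM[measurable]: "V \<in> borel_measurable M" using V pt measurable_F_M by blast
  have Qm[measurable]: "Q k \<in> borel_measurable M" for k using Q by (rule conv0_measurable)
  have Im[measurable]: "(\<lambda>\<omega>. ennreal \<bar>I k t \<omega> - I k p \<omega> - J \<omega>\<bar>) \<in> borel_measurable M" for k
    using conv0_measurable[OF I, of k] .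
  let ?v = "\<integral>\<^sup>+\<omega>. ennreal (V \<omega>) \<partial>M"
  have 1: "(\<integral>\<^sup>+\<omega>. ennreal (V \<omega> * exp (J \<omega> - (1 + r) * energy H p t \<omega> / 2)) \<partial>M) \<le> ennreal (exp (2 * r)) * ?v"
    if r: "r > 0" for r :: real
  proof -
    \<comment> \<open>Solves \<open>(1 + 1/r) * q = r\<close>: a squared distance of at most
      \<open>q\<close> then costs at most \<open>r\<close> in the comparison of energies.\<close>
    define q where "q = r / (1 + 1 / r)"
    have "1 + 1/r > 0" using r by (intro add_pos_pos) auto
    then have q: "q > 0" "(1 + 1/r) * q = r" using r unfolding q_def by auto
    let ?A1 = "\<lambda>k. {\<omega> \<in> space M. ennreal \<bar>I k t \<omega> - I k p \<omega> - J \<omega>\<bar> > ennreal r}"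
    let ?A2 = "\<lambda>k. {\<omega> \<in> space M. Q k \<omega> > ennreal q}"
    have lim: "(\<lambda>k. prob (?A1 k \<union> ?A2 k)) \<longlonglongrightarrow> 0"
    proof (rule tendsto_sandwich[OF _ _ tendsto_const])
      show "(\<lambda>k. prob (?A1 k) + prob (?A2 k)) \<longlonglongrightarrow> 0"
        using tendsto_add[OF conv0D[OF I r] conv0D[OF Q q(1)]] by simp
      show "\<forall>\<^sub>F k in sequentially. prob (?A1 k \<union> ?A2 k) \<le> prob (?A1 k) + prob (?A2 k)"
        by (intro always_eventually allI measure_Un_le) measurable
    qed simp
    show ?thesis
    proof (rule nn_integral_le_in_prob[OF _ _ lim])
      fix k
      show "?A1 k \<union> ?A2 k \<in> events" by measurable
      have "(\<integral>\<^sup>+\<omega>. ennreal (V \<omega> * exp (J \<omega> - (1 + r) * energy H p t \<omega> / 2)) * indicator (space M - (?A1 k \<union> ?A2 k)) \<omega> \<partial>M)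
        \<le> (\<integral>\<^sup>+\<omega>. ennreal (exp (2 * r)) * ennreal (V \<omega> * exp (I k t \<omega> - I k p \<omega> - energy (G k) p t \<omega> / 2)) \<partial>M)"
      proof (rule nn_integral_mono)
        fix \<omega> assume \<omega>: "\<omega> \<in> space M"
        show "ennreal (V \<omega> * exp (J \<omega> - (1 + r) * energy H p t \<omega> / 2)) * indicator (space M - (?A1 k \<union> ?A2 k)) \<omega>
          \<le> ennreal (exp (2 * r)) * ennreal (V \<omega> * exp (I k t \<omega> - I k p \<omega> - energy (G k) p t \<omega> / 2))"
        proof (cases "\<omega> \<in> ?A1 k \<union> ?A2 k")
          case False
          then have a: "\<bar>I k t \<omega> - I k p \<omega> - J \<omega>\<bar> \<le> r" and b: "Q k \<omega> \<le> ennreal q"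
            using \<omega> r by (auto simp: not_less)
          let ?d = "\<lambda>s. (G k s \<omega> - H s \<omega>)\<^sup>2"
          have nn: "(\<integral>\<^sup>+s\<in>{p<..t}. ennreal (?d s) \<partial>lborel) \<le> ennreal q" using GQ[OF \<omega>] b by (rule order_trans)
          have m: "set_borel_measurable lborel {p<..t} ?d"
          proof -
            have "(\<lambda>s. (indicator {p<..t} s *\<^sub>R (G k s \<omega> - H s \<omega>))\<^sup>2) \<in> borel_measurable lborel"
              using G[OF \<omega>, of k] unfolding set_borel_measurable_def by measurable
            also have "(\<lambda>s. (indicator {p<..t} s *\<^sub>R (G k s \<omega> - H s \<omega>))\<^sup>2) = (\<lambda>s. indicator {p<..t} s *\<^sub>R ?d s)"
              by (auto split: split_indicator)
            finally show ?thesis unfolding set_borel_measurable_def by simp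
          qed
          have e: "(\<integral>\<^sup>+s\<in>{p<..t}. ennreal (?d s) \<partial>lborel) = (\<integral>\<^sup>+s. ennreal (indicator {p<..t} s *\<^sub>R ?d s) \<partial>lborel)"
            by (intro nn_integral_cong) (auto split: split_indicator)
          have di: "set_integrable lborel {p<..t} ?d"
            unfolding set_integrable_def using m nn e unfolding set_borel_measurable_def
            by (intro integrableI_bounded) (auto simp: less_top[symmetric] top_unique)
          have dq: "(LINT s:{p<..t}|lborel. ?d s) \<le> q"
          proof -
            have "ennreal (LINT s:{p<..t}|lborel. ?d s) \<le> ennreal q"
              using nn unfolding e using di unfolding set_integrable_def set_lebesgue_integral_def
              by (subst (asm) nn_integral_eq_integral) auto
            then show ?thesis using q by (simp add: ennreal_le_iff)
          qed
          have "energy (G k) p t \<omega> \<le> (LINT s:{p<..t}|lborel. (1 + r) * (H s \<omega>)\<^sup>2 + (1 + 1 / r) * ?d s)"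
            unfolding energy_def
          proof (rule set_integral_mono)
            show "set_integrable lborel {p<..t} (\<lambda>s. (G k s \<omega>)\<^sup>2)"
              by (rule step_pair_integrable[OF step pt \<omega>])
            show "set_integrable lborel {p<..t} (\<lambda>s. (1 + r) * (H s \<omega>)\<^sup>2 + (1 + 1 / r) * ?d s)"
              using H[OF \<omega>] di by (intro set_integral_add set_integrable_mult_right) auto
            fix s
            \<comment> \<open>Young's inequality with weight \<open>r\<close> for the cross term in
              the square of \<open>H + (G - H)\<close>.\<close>
            have "0 \<le> (sqrt r * H s \<omega> - (G k s \<omega> - H s \<omega>) / sqrt r)\<^sup>2" by simp
            also have "\<dots> = r * (H s \<omega>)\<^sup>2 - 2 * H s \<omega> * (G k s \<omega> - H s \<omega>) + ?d s / r"
              using r by (simp add: power2_diff power_mult_distrib power_divide)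
            finally show "(G k s \<omega>)\<^sup>2 \<le> (1 + r) * (H s \<omega>)\<^sup>2 + (1 + 1 / r) * ?d s"
              by (simp add: power2_eq_square algebra_simps add_divide_distrib diff_divide_distrib)
          qed
          also have "\<dots> = (1 + r) * energy H p t \<omega> + (1 + 1 / r) * (LINT s:{p<..t}|lborel. ?d s)"
            unfolding energy_def using H[OF \<omega>] di by (subst set_integral_add) auto
          also have "\<dots> \<le> (1 + r) * energy H p t \<omega> + r"
            using mult_left_mono[OF dq, of "1 + 1/r"] r q by simp
          finally have c: "energy (G k) p t \<omega> \<le> (1 + r) * energy H p t \<omega> + r" .
          \<comment> \<open>The integrals contribute at most \<open>r\<close> and half of the energy
            error at most \<open>r / 2\<close>.\<close>
          have "J \<omega> - (1 + r) * energy H p t \<omega> / 2 \<le> 2 * r + (I k t \<omega> - I k p \<omega> - energy (G k) p t \<omega> / 2)"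
            using a c r by (simp add: abs_le_iff field_simps)
          then have "exp (J \<omega> - (1 + r) * energy H p t \<omega> / 2) \<le> exp (2 * r) * exp (I k t \<omega> - I k p \<omega> - energy (G k) p t \<omega> / 2)"
            by (simp flip: exp_add)
          then have "V \<omega> * exp (J \<omega> - (1 + r) * energy H p t \<omega> / 2) \<le> exp (2 * r) * (V \<omega> * exp (I k t \<omega> - I k p \<omega> - energy (G k) p t \<omega> / 2))"
            by (subst mult.left_commute) (rule mult_left_mono[OF _ V0[OF \<omega>]])
          then show ?thesis using False \<omega> by (simp add: ennreal_mult'[symmetric] ennreal_leI)
        qed simp
      qed
      also have "\<dots> = ennreal (exp (2 * r)) * ?v"
      proof -
        have [measurable]: "energy (G k) p t \<in> borel_measurable M" "(\<lambda>\<omega>. I k t \<omega> - I k p \<omega>) \<in> borel_measurable M"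
          using step_pair_measurable_energy[OF step pt] step_pair_measurable[OF step pt] measurable_F_M pt by (blast intro: order_trans)+
        show ?thesis
          by (subst nn_integral_cmult) (auto simp: step_pair_exp[OF step pt V V0])
      qed
      finally show "(\<integral>\<^sup>+\<omega>. ennreal (V \<omega> * exp (J \<omega> - (1 + r) * energy H p t \<omega> / 2)) * indicator (space M - (?A1 k \<union> ?A2 k)) \<omega> \<partial>M) \<le> ennreal (exp (2 * r)) * ?v" .
    qed measurable
  qed
  \<comment> \<open>A second use of Fatou's lemma removes the factors \<open>1 + r\<close> and
    \<open>exp (2 * r)\<close>. An infinite right-hand side is treated apart, because the limit rule
    for products asks for a finite factor.\<close>
  let ?r = "\<lambda>n. inverse (real (Suc n))"
  have r0: "?r \<longlonglongrightarrow> 0" by (rule LIMSEQ_inverse_real_of_nat)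
  have "(\<integral>\<^sup>+\<omega>. ennreal (V \<omega> * exp (J \<omega> - energy H p t \<omega> / 2)) \<partial>M) =
    (\<integral>\<^sup>+\<omega>. liminf (\<lambda>n. ennreal (V \<omega> * exp (J \<omega> - (1 + ?r n) * energy H p t \<omega> / 2))) \<partial>M)"
  proof (rule nn_integral_cong)
    fix \<omega>
    have "(\<lambda>n. ennreal (V \<omega> * exp (J \<omega> - (1 + ?r n) * energy H p t \<omega> / 2))) \<longlonglongrightarrow> ennreal (V \<omega> * exp (J \<omega> - (1 + 0) * energy H p t \<omega> / 2))"
      by (intro tendsto_ennrealI tendsto_intros r0) simp
    from lim_imp_Liminf[OF _ this] show "ennreal (V \<omega> * exp (J \<omega> - energy H p t \<omega> / 2)) = liminf (\<lambda>n. ennreal (V \<omega> * exp (J \<omega> - (1 + ?r n) * energy H p t \<omega> / 2)))"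
      by simp
  qed
  also have "\<dots> \<le> liminf (\<lambda>n. \<integral>\<^sup>+\<omega>. ennreal (V \<omega> * exp (J \<omega> - (1 + ?r n) * energy H p t \<omega> / 2)) \<partial>M)"
    by (rule nn_integral_liminf) measurable
  also have "\<dots> \<le> liminf (\<lambda>n. ennreal (exp (2 * ?r n)) * ?v)"
    by (intro Liminf_mono always_eventually allI 1) simp
  also have "\<dots> = ?v"
  proof (cases "?v = \<top>")
    case True
    then show ?thesis by (simp add: ennreal_mult_top Liminf_const)
  next
    case False
    have "(\<lambda>n. ennreal (exp (2 * ?r n)) * ?v) \<longlonglongrightarrow> ennreal (exp (2 * 0)) * ?v"
      using False by (subst (1 2) mult.commute)
        (intro ennreal_tendsto_cmult tendsto_ennrealI tendsto_intros r0, simp add: less_top)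
    from lim_imp_Liminf[OF _ this] show ?thesis by simp
  qed
  finally show ?thesis .
qed

lemma ennreal_energy:
  assumes "set_integrable lborel {p<..t} (\<lambda>s. (G s \<omega>)\<^sup>2)"
  shows "ennreal (energy G p t \<omega>) = (\<integral>\<^sup>+s\<in>{p<..t}. ennreal ((G s \<omega>)\<^sup>2) \<partial>lborel)"
proof -
  have "(\<integral>\<^sup>+s\<in>{p<..t}. ennreal ((G s \<omega>)\<^sup>2) \<partial>lborel) = (\<integral>\<^sup>+s. ennreal (indicator {p<..t} s *\<^sub>R (G s \<omega>)\<^sup>2) \<partial>lborel)"
    by (intro nn_integral_cong) (auto split: split_indicator)
  then show ?thesis
    using assms unfolding energy_def set_integrable_def set_lebesgue_integral_def
    by (subst (asm) nn_integral_eq_integral) auto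
qed

lemma step_pair_exp_cmult:
  fixes l :: real
  assumes "step_pair G I" "0 \<le> p" "p \<le> t"
  shows "(\<integral>\<^sup>+\<omega>. ennreal (exp (l * (I t \<omega> - I p \<omega>) - l\<^sup>2 * energy G p t \<omega> / 2)) \<partial>M) = 1"
proof -
  let ?G = "\<lambda>s \<omega>. if p < s then l * G s \<omega> else 0" and ?I = "\<lambda>u \<omega>. l * (I (max p u) \<omega> - I p \<omega>)"
  have sp: "step_pair ?G ?I" using step_pair_scale_from[OF assms(1,2), of "\<lambda>_. l"] by simp
  have "energy ?G p t \<omega> = (LINT s:{p<..t}|lborel. l\<^sup>2 * (G s \<omega>)\<^sup>2)" for \<omega>
    unfolding energy_def by (intro set_lebesgue_integral_cong) (auto simp: power_mult_distrib)
  then have e: "energy ?G p t \<omega> = l\<^sup>2 * energy G p t \<omega>" for \<omega>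
    unfolding energy_def by simp
  show ?thesis
    using step_pair_exp[OF sp assms(2,3), of "\<lambda>_. 1"] assms e emeasure_space_1 by (simp add: max_def)
qed

text \<open>Takes the place of the Ito isometry: step integrals with small energy are small. If an
  increment exceeds \<open>\<epsilon>\<close> while the energy is at most
  \<open>\<epsilon> / l\<close>, the exponential with parameter \<open>l\<close> is at least
  \<open>exp (l * \<epsilon> / 2)\<close>, yet its mean is one. So the tail is at most
  \<open>exp (- l * \<epsilon> / 2)\<close>, apart from the event of a large energy, whose
  probability vanishes for each fixed \<open>l\<close>.\<close>

lemma conv0_step:
  assumes step: "\<And>k. step_pair (G k) (I k)" and pt: "0 \<le> p" "p \<le> t"
    and Q: "conv0 Q" and GQ: "\<And>k \<omega>. \<omega> \<in> space M \<Longrightarrow> (\<integral>\<^sup>+s\<in>{p<..t}. ennreal ((G k s \<omega>)\<^sup>2) \<partial>lborel) \<le> Q k \<omega>"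
  shows "conv0 (\<lambda>k \<omega>. ennreal \<bar>I k t \<omega> - I k p \<omega>\<bar>)"
  unfolding conv0_def
proof (intro conjI allI impI)
  have [measurable]: "(\<lambda>\<omega>. I k t \<omega> - I k p \<omega>) \<in> borel_measurable M" "energy (G k) p t \<in> borel_measurable M" for k
    using step_pair_measurable[OF step pt] step_pair_measurable_energy[OF step pt] pt
    by (auto intro: measurable_F_M[of t])
  have [measurable]: "Q k \<in> borel_measurable M" for k using Q by (rule conv0_measurable)
  show "(\<lambda>\<omega>. ennreal \<bar>I k t \<omega> - I k p \<omega>\<bar>) \<in> borel_measurable M" for k by measurable
  fix \<epsilon> :: real assume \<epsilon>: "\<epsilon> > 0"
  let ?D = "\<lambda>k \<omega>. I k t \<omega> - I k p \<omega>"
  have bound: "prob {\<omega> \<in> space M. ennreal \<bar>?D k \<omega>\<bar> > ennreal \<epsilon>} \<le> prob {\<omega> \<in> space M. Q k \<omega> > ennreal (\<epsilon> / l)} + 2 * exp (- (l * \<epsilon> / 2))"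
    if l: "l > 0" for k l
  proof -
    \<comment> \<open>\<open>r\<close> will be \<open>1\<close> or \<open>-1\<close> and selects the
      tail. At the threshold \<open>\<epsilon> / l\<close> the quadratic term consumes at most half
      of the gain \<open>l * \<epsilon>\<close>.\<close>
    define E where "E = (\<lambda>r::real. {\<omega> \<in> space M. r * ?D k \<omega> > \<epsilon> \<and> energy (G k) p t \<omega> \<le> \<epsilon> / l})"
    have [measurable]: "E r \<in> events" for r unfolding E_def by measurable
    have E: "prob (E r) \<le> exp (- (l * \<epsilon> / 2))" if r: "r\<^sup>2 = 1" for r
    proof -
      have "ennreal (prob (E r)) = (\<integral>\<^sup>+\<omega>. indicator (E r) \<omega> \<partial>M)" by (simp add: emeasure_eq_measure)
      also have "\<dots> \<le> (\<integral>\<^sup>+\<omega>. ennreal (exp (- (l * \<epsilon> / 2))) * ennreal (exp ((l * r) * ?D k \<omega> - (l * r)\<^sup>2 * energy (G k) p t \<omega> / 2)) \<partial>M)"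
      proof (rule nn_integral_mono)
        fix \<omega> assume "\<omega> \<in> space M"
        show "indicator (E r) \<omega> \<le> ennreal (exp (- (l * \<epsilon> / 2))) * ennreal (exp ((l * r) * ?D k \<omega> - (l * r)\<^sup>2 * energy (G k) p t \<omega> / 2))"
        proof (cases "\<omega> \<in> E r")
          case True
          have "l * \<epsilon> \<le> l * (r * ?D k \<omega>)" using True l by (intro mult_left_mono) (auto simp: E_def)
          moreover have "l\<^sup>2 * energy (G k) p t \<omega> \<le> l\<^sup>2 * (\<epsilon> / l)" using True l by (intro mult_left_mono) (auto simp: E_def)
          moreover have "l\<^sup>2 * (\<epsilon> / l) = l * \<epsilon>" using l by (simp add: power2_eq_square)
          moreover have "(l * r)\<^sup>2 * energy (G k) p t \<omega> = l\<^sup>2 * energy (G k) p t \<omega>" "l * r * ?D k \<omega> = l * (r * ?D k \<omega>)"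
            using r by (simp_all add: power_mult_distrib)
          moreover have "0 \<le> - (a / 2) + (x - y / 2)" if "a \<le> x" "y \<le> a" for a x y :: real using that by linarith
          ultimately have "0 \<le> - (l * \<epsilon> / 2) + ((l * r) * ?D k \<omega> - (l * r)\<^sup>2 * energy (G k) p t \<omega> / 2)"
            by metis
          then have "1 \<le> exp (- (l * \<epsilon> / 2) + ((l * r) * ?D k \<omega> - (l * r)\<^sup>2 * energy (G k) p t \<omega> / 2))" by simp
          then show ?thesis using True
            by (simp only: exp_add) (simp add: ennreal_mult'[symmetric] ennreal_1[symmetric] ennreal_leI del: ennreal_1)
        qed simp
      qed
      also have "\<dots> = ennreal (exp (- (l * \<epsilon> / 2)))"
        using step_pair_exp_cmult[OF step pt, of "l * r"] by (subst nn_integral_cmult) auto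
      finally show ?thesis by (simp add: ennreal_le_iff)
    qed
    let ?A = "{\<omega> \<in> space M. Q k \<omega> > ennreal (\<epsilon> / l)}"
    have "{\<omega> \<in> space M. ennreal \<bar>?D k \<omega>\<bar> > ennreal \<epsilon>} \<subseteq> ?A \<union> (E 1 \<union> E (-1))"
    proof
      fix \<omega> assume "\<omega> \<in> {\<omega> \<in> space M. ennreal \<bar>?D k \<omega>\<bar> > ennreal \<epsilon>}"
      then have \<omega>: "\<omega> \<in> space M" "\<bar>?D k \<omega>\<bar> > \<epsilon>" using \<epsilon> by (auto simp: ennreal_less_iff)
      show "\<omega> \<in> ?A \<union> (E 1 \<union> E (-1))"
      proof (cases "\<omega> \<in> ?A")
        case False
        then have "ennreal (energy (G k) p t \<omega>) \<le> ennreal (\<epsilon> / l)"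
          using ennreal_energy[of p t "G k" \<omega>, OF step_pair_integrable[OF step pt \<omega>(1)]] GQ[OF \<omega>(1), of k] \<omega>
          by (auto simp: not_less intro: order_trans)
        then have "energy (G k) p t \<omega> \<le> \<epsilon> / l" using \<epsilon> l by (simp add: ennreal_le_iff)
        then show ?thesis using \<omega> \<epsilon> unfolding E_def by (auto simp: abs_if split: if_splits)
      qed simp
    qed
    then have "prob {\<omega> \<in> space M. ennreal \<bar>?D k \<omega>\<bar> > ennreal \<epsilon>} \<le> prob (?A \<union> (E 1 \<union> E (-1)))"
      by (intro finite_measure_mono) auto
    also have "\<dots> \<le> prob ?A + prob (E 1 \<union> E (-1))" by (intro measure_Un_le) auto
    also have "\<dots> \<le> prob ?A + (prob (E 1) + prob (E (-1)))" by (intro add_left_mono measure_Un_le) auto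
    also have "\<dots> \<le> prob ?A + 2 * exp (- (l * \<epsilon> / 2))" using E[of 1] E[of "-1"] by simp
    finally show ?thesis .
  qed
  show "(\<lambda>k. prob {\<omega> \<in> space M. ennreal \<bar>?D k \<omega>\<bar> > ennreal \<epsilon>}) \<longlonglongrightarrow> 0"
  proof (rule LIMSEQ_I)
    fix e :: real assume e: "0 < e"
    \<comment> \<open>The order of choices matters: \<open>l\<close> is fixed by the exponential
      term, and only then \<open>k0\<close> by the energy at the threshold
      \<open>\<epsilon> / l\<close>.\<close>
    have "((\<lambda>l. 2 * exp (- (l * \<epsilon> / 2))) \<longlongrightarrow> 0) at_top" using \<epsilon> by real_asymp
    then have "\<forall>\<^sub>F l in at_top. 2 * exp (- (l * \<epsilon> / 2)) < e / 2" using e by (intro order_tendstoD) auto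
    then have "\<forall>\<^sub>F l in at_top. 2 * exp (- (l * \<epsilon> / 2)) < e / 2 \<and> l > 0"
      using eventually_gt_at_top[of "0::real"] by eventually_elim auto
    then obtain l where l: "2 * exp (- (l * \<epsilon> / 2)) < e / 2" "l > 0"
      using eventually_happens'[OF trivial_limit_at_top_linorder] by blast
    have "(\<lambda>k. prob {\<omega> \<in> space M. Q k \<omega> > ennreal (\<epsilon> / l)}) \<longlonglongrightarrow> 0" using \<epsilon> l by (intro conv0D[OF Q]) auto
    then obtain k0 where k0: "\<And>k. k \<ge> k0 \<Longrightarrow> norm (prob {\<omega> \<in> space M. Q k \<omega> > ennreal (\<epsilon> / l)} - 0) < e / 2"
      using e by (meson LIMSEQ_D half_gt_zero)
    show "\<exists>k0. \<forall>k\<ge>k0. norm (prob {\<omega> \<in> space M. ennreal \<bar>?D k \<omega>\<bar> > ennreal \<epsilon>} - 0) < e"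
    proof (intro exI[of _ k0] allI impI)
      fix k assume "k \<ge> k0"
      from k0[OF this] bound[OF l(2), of k] l(1) show "norm (prob {\<omega> \<in> space M. ennreal \<bar>?D k \<omega>\<bar> > ennreal \<epsilon>} - 0) < e" by simp
    qed
  qed
qed

end

section \<open>Squared Bessel processes\<close>

text \<open>\<open>energy\<close> lives on half-open intervals, where a breakpoint belongs to the
  piece on its left, while path integrals of \<open>Z\<close> are taken over closed ones.\<close>

lemma integral_Ioc_eq_Icc:
  fixes f :: "real \<Rightarrow> real"
  assumes "continuous_on {p..t} f"
  shows "set_integrable lborel {p<..t} f" "(LINT s:{p<..t}|lborel. f s) = integral {p..t} f"
proof -
  have "set_integrable lborel {p..t} f" using assms by (rule borel_integrable_atLeastAtMost')
  then show 1: "set_integrable lborel {p<..t} f" by (rule set_integrable_subset) auto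
  have "integral {p<..t} f = integral {p..t} f"
    by (rule integral_subset_negligible) (auto intro: negligible_subset[of "{p}"])
  then show "(LINT s:{p<..t}|lborel. f s) = integral {p..t} f"
    using set_borel_integral_eq_integral[OF 1] by simp
qed

text \<open>The last assumption says \<open>Z\<^sub>t = x0\<^sup>2 + 2 \<integral>\<^sub>0\<^sup>t sqrt Z dB + \<delta> t\<close>. The measurable bound \<open>Q\<close> replaces the \<open>L\<^sup>2\<close>
  distance of the integrands, whose measurability in \<open>\<omega>\<close> is then not an issue.\<close>

locale squared_bessel = brownian_filtration M F B
  for M :: "'a measure" and F :: "real \<Rightarrow> 'a measure" and B :: "real \<Rightarrow> 'a \<Rightarrow> real" +
  fixes Z :: "real \<Rightarrow> 'a \<Rightarrow> real" and \<delta> x0 :: real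
  assumes Z_adapted: "0 \<le> t \<Longrightarrow> Z t \<in> borel_measurable (F t)"
    and Z_continuous: "\<omega> \<in> space M \<Longrightarrow> continuous_on {0..} (\<lambda>t. Z t \<omega>)"
    and Z_start: "\<omega> \<in> space M \<Longrightarrow> Z 0 \<omega> = x0\<^sup>2"
    and Z_nonneg: "\<omega> \<in> space M \<Longrightarrow> 0 \<le> t \<Longrightarrow> 0 \<le> Z t \<omega>"
    and Z_progressive: "0 \<le> T \<Longrightarrow> (\<lambda>(s, \<omega>). Z (max 0 (min T s)) \<omega>) \<in> borel_measurable (borel \<Otimes>\<^sub>M F T)"
    and Z_approx: "0 \<le> t \<Longrightarrow> \<exists>G I Q. (\<forall>k. step_pair (G k) (I k)) \<and>
      (\<forall>k. \<forall>\<omega>\<in>space M. I k 0 \<omega> = 0 \<and> (\<lambda>s. G k s \<omega>) \<in> borel_measurable borel) \<and>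
      conv0 (\<lambda>k \<omega>. ennreal \<bar>I k t \<omega> - (Z t \<omega> - x0\<^sup>2 - \<delta> * t) / 2\<bar>) \<and> conv0 Q \<and>
      (\<forall>k. \<forall>\<omega>\<in>space M. (\<integral>\<^sup>+s\<in>{0<..t}. ennreal ((G k s \<omega> - sqrt (Z s \<omega>))\<^sup>2) \<partial>lborel) \<le> Q k \<omega>)"
begin

text \<open>The process \<open>\<integral> sqrt Z dB\<close>, read off from the equation and not
  from the approximations. In this way it inherits continuity and adaptedness from \<open>Z\<close>,
  whereas the approximations determine it only at one time after the other and up to null
  sets.\<close>

definition N :: "real \<Rightarrow> 'a \<Rightarrow> real" where
  "N t \<omega> = (Z t \<omega> - x0\<^sup>2 - \<delta> * t) / 2"

lemma measurable_Z: "0 \<le> s \<Longrightarrow> s \<le> t \<Longrightarrow> Z s \<in> borel_measurable (F t)"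
  using Z_adapted measurable_F_mono by blast

lemma measurable_N: "0 \<le> s \<Longrightarrow> s \<le> t \<Longrightarrow> N s \<in> borel_measurable (F t)"
  unfolding N_def[abs_def] using measurable_Z by (intro borel_measurable_divide borel_measurable_diff) auto

lemma continuous_integrand:
  assumes "\<omega> \<in> space M" "0 \<le> p"
  shows "continuous_on {p..t} (\<lambda>s. (l * sqrt (Z s \<omega>) + \<theta>)\<^sup>2)"
  using continuous_on_subset[OF Z_continuous[OF assms(1)]] assms by (intro continuous_intros) auto

text \<open>The quadratic variation over \<open>[p, t]\<close> of \<open>l N + \<theta> B\<close>
  with coefficients frozen in time; they may be random, so that they can be chosen according to the
  state at time \<open>p\<close>.\<close>

definition bracket :: "('a \<Rightarrow> real) \<Rightarrow> ('a \<Rightarrow> real) \<Rightarrow> real \<Rightarrow> real \<Rightarrow> 'a \<Rightarrow> real" where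
  "bracket l \<theta> p t \<omega> = integral {p..t} (\<lambda>s. (l \<omega> * sqrt (Z s \<omega>) + \<theta> \<omega>)\<^sup>2)"

lemma bracket_eq_energy:
  assumes "\<omega> \<in> space M" "0 \<le> p"
  shows "energy (\<lambda>s \<omega>. l \<omega> * sqrt (Z s \<omega>) + \<theta> \<omega>) p t \<omega> = bracket l \<theta> p t \<omega>"
  unfolding energy_def bracket_def using integral_Ioc_eq_Icc[OF continuous_integrand[OF assms]] by simp

lemma measurable_bracket:
  assumes "0 \<le> p" "p \<le> t" and l[measurable]: "l \<in> borel_measurable (F t)" and \<theta>[measurable]: "\<theta> \<in> borel_measurable (F t)"
  shows "bracket l \<theta> p t \<in> borel_measurable (F t)"
proof -
  \<comment> \<open>Clamping the time makes the integrand jointly measurable on the whole line with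
    respect to \<open>F t\<close>, and changes nothing on \<open>{p<..t}\<close>.\<close>
  have [measurable]: "(\<lambda>(s, \<omega>). Z (max 0 (min t s)) \<omega>) \<in> borel_measurable (borel \<Otimes>\<^sub>M F t)"
    using Z_progressive assms by simp
  have sw: "(\<lambda>x. Z (max 0 (min t (snd x))) (fst x)) \<in> borel_measurable (F t \<Otimes>\<^sub>M borel)"
    using measurable_compose[OF measurable_pair_swap' Z_progressive[of t]] assms by (simp add: split_beta)
  have [measurable]: "(\<lambda>x. Z (max 0 (min t (snd x))) (fst x)) \<in> borel_measurable (F t \<Otimes>\<^sub>M lborel)"
    using sw by (simp cong: measurable_cong_sets sets_pair_measure_cong)
  have "(\<lambda>\<omega>. \<integral>s. indicator {p<..t} s *\<^sub>R (l \<omega> * sqrt (Z (max 0 (min t s)) \<omega>) + \<theta> \<omega>)\<^sup>2 \<partial>lborel) \<in> borel_measurable (F t)"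
    by (rule lborel.borel_measurable_lebesgue_integral) (simp add: split_beta, measurable)
  moreover have "bracket l \<theta> p t \<omega> = (\<integral>s. indicator {p<..t} s *\<^sub>R (l \<omega> * sqrt (Z (max 0 (min t s)) \<omega>) + \<theta> \<omega>)\<^sup>2 \<partial>lborel)"
    if "\<omega> \<in> space M" for \<omega>
    unfolding bracket_eq_energy[OF that assms(1), symmetric] energy_def set_lebesgue_integral_def
    using assms by (intro Bochner_Integration.integral_cong) (auto split: split_indicator)
  ultimately show ?thesis using space_F[of t] assms by (subst measurable_cong) auto
qed

end

lemma power2_diff_le: "(a - b :: real)\<^sup>2 \<le> 2 * (a - c)\<^sup>2 + 2 * (b - c)\<^sup>2"
proof -
  have "0 \<le> ((a - c) + (b - c))\<^sup>2" by simp
  then show ?thesis by (simp add: power2_eq_square algebra_simps)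
qed

section \<open>The exponential inequality for the integral of \<open>sqrt Z\<close> and for
  \<open>B\<close>\<close>

context squared_bessel
begin

text \<open>\<open>Z_approx\<close> at time \<open>t\<close> gives step integrals whose values at
  \<open>t\<close> approach \<open>N t\<close>, but it does not tell what they do at the earlier
  time \<open>p\<close>. The step integrals supplied for time \<open>p\<close> settle this: both
  integrands approximate \<open>sqrt Z\<close> on \<open>{0<..p}\<close>, so the energy of their
  difference is small there and both integrals have the limit \<open>N p\<close>. Hence the
  increments over \<open>{p<..t}\<close> converge and the limit inequality applies.\<close>

lemma N_exp_le:
  assumes pt: "0 \<le> p" "p \<le> t" and l: "l \<in> borel_measurable (F p)" "\<And>\<omega>. \<omega> \<in> space M \<Longrightarrow> \<bar>l \<omega>\<bar> \<le> L"
    and \<theta>: "\<theta> \<in> borel_measurable (F p)"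
    and V: "V \<in> borel_measurable (F p)" "\<And>\<omega>. \<omega> \<in> space M \<Longrightarrow> 0 \<le> V \<omega>"
  shows "(\<integral>\<^sup>+\<omega>. ennreal (V \<omega> * exp (l \<omega> * (N t \<omega> - N p \<omega>) + \<theta> \<omega> * (B t \<omega> - B p \<omega>) - bracket l \<theta> p t \<omega> / 2)) \<partial>M)
    \<le> (\<integral>\<^sup>+\<omega>. ennreal (V \<omega>) \<partial>M)"
proof -
  have t0: "0 \<le> t" using pt by simp
  \<comment> \<open>Rescaling a null sequence asks for a positive factor, and \<open>L\<close> may
    vanish.\<close>
  define L' where "L' = max L 1"
  have L': "L' > 0" "\<And>\<omega>. \<omega> \<in> space M \<Longrightarrow> \<bar>l \<omega>\<bar> \<le> L'" using l by (auto simp: L'_def intro: max.coboundedI1)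
  from Z_approx[OF t0] obtain G I Q where step: "\<And>k. step_pair (G k) (I k)"
    and I0: "\<And>k \<omega>. \<omega> \<in> space M \<Longrightarrow> I k 0 \<omega> = 0" and Gm: "\<And>k \<omega>. \<omega> \<in> space M \<Longrightarrow> (\<lambda>s. G k s \<omega>) \<in> borel_measurable borel"
    and IN: "conv0 (\<lambda>k \<omega>. ennreal \<bar>I k t \<omega> - N t \<omega>\<bar>)" and Q: "conv0 Q"
    and GQ: "\<And>k \<omega>. \<omega> \<in> space M \<Longrightarrow> (\<integral>\<^sup>+s\<in>{0<..t}. ennreal ((G k s \<omega> - sqrt (Z s \<omega>))\<^sup>2) \<partial>lborel) \<le> Q k \<omega>"
    unfolding N_def by blast
  from Z_approx[OF pt(1)] obtain G' I' Q' where step': "\<And>k. step_pair (G' k) (I' k)"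
    and I0': "\<And>k \<omega>. \<omega> \<in> space M \<Longrightarrow> I' k 0 \<omega> = 0" and Gm': "\<And>k \<omega>. \<omega> \<in> space M \<Longrightarrow> (\<lambda>s. G' k s \<omega>) \<in> borel_measurable borel"
    and IN': "conv0 (\<lambda>k \<omega>. ennreal \<bar>I' k p \<omega> - N p \<omega>\<bar>)" and Q': "conv0 Q'"
    and GQ': "\<And>k \<omega>. \<omega> \<in> space M \<Longrightarrow> (\<integral>\<^sup>+s\<in>{0<..p}. ennreal ((G' k s \<omega> - sqrt (Z s \<omega>))\<^sup>2) \<partial>lborel) \<le> Q' k \<omega>"
    unfolding N_def by blast
  \<comment> \<open>Paths of \<open>Z\<close> are controlled at nonnegative times only; the
    indicator gives a function that is measurable on the whole line.\<close>
  have Xm: "(\<lambda>s. indicator {0<..t} s * sqrt (Z s \<omega>)) \<in> borel_measurable borel" if "\<omega> \<in> space M" for \<omega>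
  proof -
    have "continuous_on {0<..t} (\<lambda>s. sqrt (Z s \<omega>))"
      by (intro continuous_on_real_sqrt continuous_on_subset[OF Z_continuous[OF that]]) auto
    then have "(\<lambda>s. sqrt (Z s \<omega>)) \<in> borel_measurable (restrict_space borel {0<..t})"
      by (rule borel_measurable_continuous_on_restrict)
    then show ?thesis by (subst (asm) borel_measurable_restrict_space_iff) auto
  qed
  have Im: "(\<lambda>\<omega>. I k s \<omega>) \<in> borel_measurable M" if "0 \<le> s" for k s
  proof -
    have "(\<lambda>\<omega>. I k s \<omega> - I k 0 \<omega>) \<in> borel_measurable M"
      using step_pair_measurable[OF step, of 0 s k] that measurable_F_M[of s] by blast
    then show ?thesis by (subst measurable_cong[where g="\<lambda>\<omega>. I k s \<omega> - I k 0 \<omega>"]) (auto simp: I0)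
  qed
  have Nm: "N s \<in> borel_measurable M" if "0 \<le> s" for s
    using measurable_N[of s s] measurable_F_M[of s] that by blast
  have D: "conv0 (\<lambda>k \<omega>. ennreal \<bar>(I k p \<omega> - I' k p \<omega>) - (I k 0 \<omega> - I' k 0 \<omega>)\<bar>)"
  proof (rule conv0_step)
    show "step_pair (\<lambda>s \<omega>. G k s \<omega> - G' k s \<omega>) (\<lambda>s \<omega>. I k s \<omega> - I' k s \<omega>)" for k
      by (rule step_pair_diff[OF step step'])
    show "conv0 (\<lambda>k \<omega>. ennreal 2 * Q k \<omega> + ennreal 2 * Q' k \<omega>)"
      by (intro conv0_add conv0_cmult Q Q') auto
    fix k \<omega> assume \<omega>: "\<omega> \<in> space M"
    note [measurable] = Xm[OF \<omega>] Gm[OF \<omega>, of k] Gm'[OF \<omega>, of k]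
    have m1: "(\<lambda>s. ennreal ((G k s \<omega> - sqrt (Z s \<omega>))\<^sup>2) * indicator {0<..p} s) \<in> borel_measurable lborel"
    proof -
      have "(\<lambda>s. ennreal ((G k s \<omega> - indicator {0<..t} s * sqrt (Z s \<omega>))\<^sup>2) * indicator {0<..p} s) \<in> borel_measurable lborel" by measurable
      also have "(\<lambda>s. ennreal ((G k s \<omega> - indicator {0<..t} s * sqrt (Z s \<omega>))\<^sup>2) * indicator {0<..p} s)
        = (\<lambda>s. ennreal ((G k s \<omega> - sqrt (Z s \<omega>))\<^sup>2) * indicator {0<..p} s)" using pt by (auto split: split_indicator)
      finally show ?thesis .
    qed
    have m2: "(\<lambda>s. ennreal ((G' k s \<omega> - sqrt (Z s \<omega>))\<^sup>2) * indicator {0<..p} s) \<in> borel_measurable lborel"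
    proof -
      have "(\<lambda>s. ennreal ((G' k s \<omega> - indicator {0<..t} s * sqrt (Z s \<omega>))\<^sup>2) * indicator {0<..p} s) \<in> borel_measurable lborel" by measurable
      also have "(\<lambda>s. ennreal ((G' k s \<omega> - indicator {0<..t} s * sqrt (Z s \<omega>))\<^sup>2) * indicator {0<..p} s)
        = (\<lambda>s. ennreal ((G' k s \<omega> - sqrt (Z s \<omega>))\<^sup>2) * indicator {0<..p} s)" using pt by (auto split: split_indicator)
      finally show ?thesis .
    qed
    have "(\<integral>\<^sup>+s\<in>{0<..p}. ennreal ((G k s \<omega> - G' k s \<omega>)\<^sup>2) \<partial>lborel)
      \<le> (\<integral>\<^sup>+s. ennreal 2 * (ennreal ((G k s \<omega> - sqrt (Z s \<omega>))\<^sup>2) * indicator {0<..p} s) +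
            ennreal 2 * (ennreal ((G' k s \<omega> - sqrt (Z s \<omega>))\<^sup>2) * indicator {0<..p} s) \<partial>lborel)"
    proof (rule nn_integral_mono)
      fix s
      have "ennreal ((G k s \<omega> - G' k s \<omega>)\<^sup>2) \<le> ennreal (2 * (G k s \<omega> - sqrt (Z s \<omega>))\<^sup>2 + 2 * (G' k s \<omega> - sqrt (Z s \<omega>))\<^sup>2)"
        by (intro ennreal_leI power2_diff_le)
      also have "\<dots> = ennreal 2 * ennreal ((G k s \<omega> - sqrt (Z s \<omega>))\<^sup>2) + ennreal 2 * ennreal ((G' k s \<omega> - sqrt (Z s \<omega>))\<^sup>2)"
        by (subst ennreal_plus) (auto simp: ennreal_mult)
      finally show "ennreal ((G k s \<omega> - G' k s \<omega>)\<^sup>2) * indicator {0<..p} s \<le> ennreal 2 * (ennreal ((G k s \<omega> - sqrt (Z s \<omega>))\<^sup>2) * indicator {0<..p} s) +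
            ennreal 2 * (ennreal ((G' k s \<omega> - sqrt (Z s \<omega>))\<^sup>2) * indicator {0<..p} s)"
        by (auto split: split_indicator)
    qed
    also have "\<dots> = ennreal 2 * (\<integral>\<^sup>+s\<in>{0<..p}. ennreal ((G k s \<omega> - sqrt (Z s \<omega>))\<^sup>2) \<partial>lborel)
       + ennreal 2 * (\<integral>\<^sup>+s\<in>{0<..p}. ennreal ((G' k s \<omega> - sqrt (Z s \<omega>))\<^sup>2) \<partial>lborel)"
      using m1 m2 by (subst nn_integral_add) (auto simp: nn_integral_cmult simp del: ennreal_numeral)
    also have "\<dots> \<le> ennreal 2 * Q k \<omega> + ennreal 2 * Q' k \<omega>"
    proof (intro add_mono mult_left_mono GQ'[OF \<omega>])
      have "(\<integral>\<^sup>+s\<in>{0<..p}. ennreal ((G k s \<omega> - sqrt (Z s \<omega>))\<^sup>2) \<partial>lborel) \<le> (\<integral>\<^sup>+s\<in>{0<..t}. ennreal ((G k s \<omega> - sqrt (Z s \<omega>))\<^sup>2) \<partial>lborel)"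
        using pt by (intro nn_integral_mono) (auto split: split_indicator)
      then show "(\<integral>\<^sup>+s\<in>{0<..p}. ennreal ((G k s \<omega> - sqrt (Z s \<omega>))\<^sup>2) \<partial>lborel) \<le> Q k \<omega>" using GQ[OF \<omega>] by (rule order_trans)
    qed auto
    finally show "(\<integral>\<^sup>+s\<in>{0<..p}. ennreal ((G k s \<omega> - G' k s \<omega>)\<^sup>2) \<partial>lborel) \<le> ennreal 2 * Q k \<omega> + ennreal 2 * Q' k \<omega>" .
  qed (use pt in auto)
  have INp: "conv0 (\<lambda>k \<omega>. ennreal \<bar>I k p \<omega> - N p \<omega>\<bar>)"
  proof (rule conv0_mono[OF conv0_add[OF D IN']])
    show "(\<lambda>\<omega>. ennreal \<bar>I k p \<omega> - N p \<omega>\<bar>) \<in> borel_measurable M" for k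
      using Im[OF pt(1), of k] Nm[OF pt(1)] by measurable
    fix k \<omega> assume "\<omega> \<in> space M"
    then have "\<bar>I k p \<omega> - N p \<omega>\<bar> \<le> \<bar>(I k p \<omega> - I' k p \<omega>) - (I k 0 \<omega> - I' k 0 \<omega>)\<bar> + \<bar>I' k p \<omega> - N p \<omega>\<bar>"
      using I0 I0' by simp
    then show "ennreal \<bar>I k p \<omega> - N p \<omega>\<bar> \<le> ennreal \<bar>(I k p \<omega> - I' k p \<omega>) - (I k 0 \<omega> - I' k 0 \<omega>)\<bar> + ennreal \<bar>I' k p \<omega> - N p \<omega>\<bar>"
      by (simp only: ennreal_plus[OF abs_ge_zero abs_ge_zero, symmetric]) (rule ennreal_leI)
  qed
  \<comment> \<open>The approximating integrand \<open>l * G + \<theta>\<close>, switched on after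
    \<open>p\<close>. The term with \<open>\<theta>\<close> multiplies the constant integrand one,
    whose integral is \<open>B\<close> itself, so it contributes no error.\<close>
  let ?G = "\<lambda>k s \<omega>. (if p < s then l \<omega> * G k s \<omega> else 0) + (if p < s then \<theta> \<omega> * 1 else 0)"
  let ?I = "\<lambda>k u \<omega>. l \<omega> * (I k (max p u) \<omega> - I k p \<omega>) + \<theta> \<omega> * (B (max p u) \<omega> - B p \<omega>)"
  let ?J = "\<lambda>\<omega>. l \<omega> * (N t \<omega> - N p \<omega>) + \<theta> \<omega> * (B t \<omega> - B p \<omega>)"
  let ?H = "\<lambda>s \<omega>. l \<omega> * sqrt (Z s \<omega>) + \<theta> \<omega>"
  have lM[measurable]: "l \<in> borel_measurable M" "\<theta> \<in> borel_measurable M" using l \<theta> measurable_F_M pt by auto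
  have Bm[measurable]: "B t \<in> borel_measurable M" "B p \<in> borel_measurable M" using adapted measurable_F_M pt t0 by blast+
  note [measurable] = Nm[OF t0] Nm[OF pt(1)]
  have br: "bracket l \<theta> p t \<in> borel_measurable M"
    using measurable_bracket[OF pt, of l \<theta>] measurable_F_mono[OF pt l(1)] measurable_F_mono[OF pt \<theta>] measurable_F_M[OF t0] by blast
  have "(\<integral>\<^sup>+\<omega>. ennreal (V \<omega> * exp (?J \<omega> - energy ?H p t \<omega> / 2)) \<partial>M) \<le> (\<integral>\<^sup>+\<omega>. ennreal (V \<omega>) \<partial>M)"
  proof (rule nn_integral_exp_limit[where G="?G" and I="?I" and Q="\<lambda>k \<omega>. ennreal (L'\<^sup>2) * Q k \<omega>", OF _ pt])
    show "step_pair (?G k) (?I k)" for k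
      by (intro step_pair_add step_pair_scale_from step step_pair_B pt l \<theta>)
    show "conv0 (\<lambda>k \<omega>. ennreal \<bar>?I k t \<omega> - ?I k p \<omega> - ?J \<omega>\<bar>)"
    proof (rule conv0_mono[OF conv0_cmult[OF conv0_add[OF IN INp] L'(1)]])
      show "(\<lambda>\<omega>. ennreal \<bar>?I k t \<omega> - ?I k p \<omega> - ?J \<omega>\<bar>) \<in> borel_measurable M" for k
        using Im[OF pt(1), of k] Im[OF t0, of k] pt(2) by (simp add: max_absorb2)
      fix k \<omega> assume \<omega>: "\<omega> \<in> space M"
      have "?I k t \<omega> - ?I k p \<omega> - ?J \<omega> = l \<omega> * ((I k t \<omega> - N t \<omega>) - (I k p \<omega> - N p \<omega>))"
        using pt by (simp add: max_absorb2 algebra_simps)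
      then have "\<bar>?I k t \<omega> - ?I k p \<omega> - ?J \<omega>\<bar> = \<bar>l \<omega>\<bar> * \<bar>(I k t \<omega> - N t \<omega>) - (I k p \<omega> - N p \<omega>)\<bar>"
        by (simp only: abs_mult)
      also have "\<dots> \<le> L' * (\<bar>I k t \<omega> - N t \<omega>\<bar> + \<bar>I k p \<omega> - N p \<omega>\<bar>)"
        using L'(2)[OF \<omega>] L'(1) by (intro mult_mono) auto
      finally have "ennreal \<bar>?I k t \<omega> - ?I k p \<omega> - ?J \<omega>\<bar> \<le> ennreal (L' * (\<bar>I k t \<omega> - N t \<omega>\<bar> + \<bar>I k p \<omega> - N p \<omega>\<bar>))"
        by (rule ennreal_leI)
      also have "\<dots> = ennreal L' * (ennreal \<bar>I k t \<omega> - N t \<omega>\<bar> + ennreal \<bar>I k p \<omega> - N p \<omega>\<bar>)"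
        using L'(1) by (simp add: ennreal_mult)
      finally show "ennreal \<bar>?I k t \<omega> - ?I k p \<omega> - ?J \<omega>\<bar> \<le> ennreal L' * (ennreal \<bar>I k t \<omega> - N t \<omega>\<bar> + ennreal \<bar>I k p \<omega> - N p \<omega>\<bar>)" .
    qed
    show "conv0 (\<lambda>k \<omega>. ennreal (L'\<^sup>2) * Q k \<omega>)" using L' by (intro conv0_cmult Q) auto
    show "energy ?H p t \<in> borel_measurable M"
      using br by (subst measurable_cong[OF bracket_eq_energy]) (use pt in auto)
    show "V \<in> borel_measurable (F p)" "\<And>\<omega>. \<omega> \<in> space M \<Longrightarrow> 0 \<le> V \<omega>" by fact+
    show "?J \<in> borel_measurable M" by measurable
    fix \<omega> assume \<omega>: "\<omega> \<in> space M"
    show "set_integrable lborel {p<..t} (\<lambda>s. (?H s \<omega>)\<^sup>2)"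
      by (rule integral_Ioc_eq_Icc[OF continuous_integrand[OF \<omega> pt(1)]])
    fix k
    note [measurable] = Xm[OF \<omega>] Gm[OF \<omega>, of k]
    have "(\<lambda>s. indicator {p<..t} s * (l \<omega> * (G k s \<omega> - indicator {0<..t} s * sqrt (Z s \<omega>)))) \<in> borel_measurable borel" by measurable
    also have "(\<lambda>s. indicator {p<..t} s * (l \<omega> * (G k s \<omega> - indicator {0<..t} s * sqrt (Z s \<omega>))))
      = (\<lambda>s. indicator {p<..t} s *\<^sub>R (?G k s \<omega> - ?H s \<omega>))"
      using pt by (auto split: split_indicator simp: algebra_simps)
    finally show "set_borel_measurable borel {p<..t} (\<lambda>s. ?G k s \<omega> - ?H s \<omega>)" unfolding set_borel_measurable_def .
    have m1: "(\<lambda>s. ennreal ((G k s \<omega> - sqrt (Z s \<omega>))\<^sup>2) * indicator {0<..t} s) \<in> borel_measurable lborel"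
    proof -
      have "(\<lambda>s. ennreal ((G k s \<omega> - indicator {0<..t} s * sqrt (Z s \<omega>))\<^sup>2) * indicator {0<..t} s) \<in> borel_measurable lborel" by measurable
      also have "(\<lambda>s. ennreal ((G k s \<omega> - indicator {0<..t} s * sqrt (Z s \<omega>))\<^sup>2) * indicator {0<..t} s)
        = (\<lambda>s. ennreal ((G k s \<omega> - sqrt (Z s \<omega>))\<^sup>2) * indicator {0<..t} s)" using pt by (auto split: split_indicator)
      finally show ?thesis .
    qed
    have "(\<integral>\<^sup>+s\<in>{p<..t}. ennreal ((?G k s \<omega> - ?H s \<omega>)\<^sup>2) \<partial>lborel)
      \<le> (\<integral>\<^sup>+s. ennreal (L'\<^sup>2) * (ennreal ((G k s \<omega> - sqrt (Z s \<omega>))\<^sup>2) * indicator {0<..t} s) \<partial>lborel)"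
    proof (rule nn_integral_mono)
      fix s
      have "(?G k s \<omega> - ?H s \<omega>)\<^sup>2 \<le> L'\<^sup>2 * (G k s \<omega> - sqrt (Z s \<omega>))\<^sup>2" if "p < s"
      proof -
        have "(?G k s \<omega> - ?H s \<omega>)\<^sup>2 = (l \<omega>)\<^sup>2 * (G k s \<omega> - sqrt (Z s \<omega>))\<^sup>2"
          using that by (simp add: power_mult_distrib[symmetric] algebra_simps)
        also have "\<dots> \<le> L'\<^sup>2 * (G k s \<omega> - sqrt (Z s \<omega>))\<^sup>2"
          using L'(2)[OF \<omega>] by (intro mult_right_mono power2_le_iff_abs_le[THEN iffD2]) (use L'(1) in auto)
        finally show ?thesis .
      qed
      then show "ennreal ((?G k s \<omega> - ?H s \<omega>)\<^sup>2) * indicator {p<..t} s \<le> ennreal (L'\<^sup>2) * (ennreal ((G k s \<omega> - sqrt (Z s \<omega>))\<^sup>2) * indicator {0<..t} s)"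
        using pt by (auto split: split_indicator simp: ennreal_mult'[symmetric] intro!: ennreal_leI)
    qed
    also have "\<dots> \<le> ennreal (L'\<^sup>2) * Q k \<omega>"
      using m1 GQ[OF \<omega>] by (subst nn_integral_cmult) (auto intro: mult_left_mono)
    finally show "(\<integral>\<^sup>+s\<in>{p<..t}. ennreal ((?G k s \<omega> - ?H s \<omega>)\<^sup>2) \<partial>lborel) \<le> ennreal (L'\<^sup>2) * Q k \<omega>" .
  qed
  also have "(\<integral>\<^sup>+\<omega>. ennreal (V \<omega> * exp (?J \<omega> - energy ?H p t \<omega> / 2)) \<partial>M) =
    (\<integral>\<^sup>+\<omega>. ennreal (V \<omega> * exp (?J \<omega> - bracket l \<theta> p t \<omega> / 2)) \<partial>M)"
    using bracket_eq_energy[OF _ pt(1)] by (intro nn_integral_cong) auto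
  finally show ?thesis .
qed

end

section \<open>Stopping\<close>

text \<open>The first point of the grid \<open>p, p + h, p + 2 h, \<dots>\<close> that is at least \<open>s\<close>, capped at \<open>p + j h\<close>.\<close>

primrec grid_stop :: "real \<Rightarrow> real \<Rightarrow> real \<Rightarrow> nat \<Rightarrow> real" where
  "grid_stop p h s 0 = p"
| "grid_stop p h s (Suc j) = (if s \<le> p + real j * h then grid_stop p h s j else p + real (Suc j) * h)"

lemma grid_stop_bounds:
  assumes "0 \<le> h"
  shows "min (p + real j * h) (max p s) \<le> grid_stop p h s j \<and> grid_stop p h s j \<le> min (p + real j * h) (max p s) + h
    \<and> p \<le> grid_stop p h s j \<and> grid_stop p h s j \<le> p + real j * h"
proof (induction j)
  case (Suc j)
  have jh: "0 \<le> real j * h" using assms by simp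
  show ?case
  proof (cases "s \<le> p + real j * h")
    case True
    have "min (p + real (Suc j) * h) (max p s) = max p s" "min (p + real j * h) (max p s) = max p s"
      using True jh assms by (auto simp: algebra_simps)
    then show ?thesis using Suc True assms by (auto simp: algebra_simps)
  next
    case False
    then show ?thesis using jh assms by (auto simp: algebra_simps)
  qed
qed (use assms in auto)

lemma grid_stop_alive: "p + real j * h < s \<Longrightarrow> 0 \<le> h \<Longrightarrow> grid_stop p h s j = p + real j * h"
  by (cases j) (auto simp: algebra_simps)

section \<open>Optional stopping along grids\<close>

context brownian_filtration
begin

definition stopping :: "('a \<Rightarrow> real) \<Rightarrow> bool" where
  "stopping \<sigma> \<longleftrightarrow> (\<forall>\<omega>\<in>space M. 0 \<le> \<sigma> \<omega>) \<and> (\<forall>u\<ge>0. {\<omega> \<in> space M. \<sigma> \<omega> \<le> u} \<in> sets (F u))"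

context
  fixes \<sigma> :: "'a \<Rightarrow> real" and p t :: real and Y :: "real \<Rightarrow> 'a \<Rightarrow> real"
  assumes \<sigma>: "stopping \<sigma>" and pt: "0 \<le> p" "p \<le> t"
    and Y: "\<And>u. p \<le> u \<Longrightarrow> u \<le> t \<Longrightarrow> Y u \<in> borel_measurable (F u)"
    and cont: "\<And>\<omega>. \<omega> \<in> space M \<Longrightarrow> continuous_on {p..t} (\<lambda>u. Y u \<omega>)"
begin

text \<open>Whether the recursion moves on from one grid time to the next is decided by whether
  \<open>\<sigma>\<close> is at most the earlier of the two, which is known by then; this keeps the
  stopped value measurable at each grid time.\<close>

lemma measurable_grid_stop:
  assumes "0 \<le> h" "p + real j * h \<le> t"
  shows "(\<lambda>\<omega>. Y (grid_stop p h (\<sigma> \<omega>) j) \<omega>) \<in> borel_measurable (F (p + real j * h))"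
  using assms(2)
proof (induction j)
  case 0 then show ?case using Y[of p] pt by simp
next
  case (Suc j)
  have jh: "0 \<le> real j * h" using assms by simp
  have le: "p + real j * h \<le> p + real (Suc j) * h" using assms by (simp add: algebra_simps)
  have 1: "(\<lambda>\<omega>. Y (grid_stop p h (\<sigma> \<omega>) j) \<omega>) \<in> borel_measurable (F (p + real (Suc j) * h))"
    using Suc le jh pt by (intro measurable_F_mono[OF _ le]) auto
  have 2: "Y (p + real (Suc j) * h) \<in> borel_measurable (F (p + real (Suc j) * h))"
    using Suc le jh by (intro Y) auto
  have "{\<omega> \<in> space M. \<sigma> \<omega> \<le> p + real j * h} \<in> sets (F (p + real (Suc j) * h))"
    using \<sigma> jh pt sets_mono[OF _ le] unfolding stopping_def by force
  then have 3: "{\<omega> \<in> space (F (p + real (Suc j) * h)). \<sigma> \<omega> \<le> p + real j * h} \<in> sets (F (p + real (Suc j) * h))"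
    using space_F[of "p + real (Suc j) * h"] jh pt le by simp
  have "(\<lambda>\<omega>. if \<sigma> \<omega> \<le> p + real j * h then Y (grid_stop p h (\<sigma> \<omega>) j) \<omega> else Y (p + real (Suc j) * h) \<omega>) \<in> borel_measurable (F (p + real (Suc j) * h))"
    by (rule measurable_If[OF 1 2 3])
  then show ?case by (simp add: if_distrib[of "\<lambda>x. Y x _"] cong: if_cong)
qed

text \<open>The grid times approach \<open>min t (max p (\<sigma> \<omega>))\<close> from above,
  within one mesh width. With \<open>n + 1\<close> steps of width \<open>(t - p) / (n + 1)\<close>
  the cap is exactly \<open>t\<close>, and continuity of the path gives the limit.\<close>

lemma grid_stop_tendsto:
  assumes "\<omega> \<in> space M"
  shows "(\<lambda>n. Y (grid_stop p ((t - p) / real (Suc n)) (\<sigma> \<omega>) (Suc n)) \<omega>) \<longlonglongrightarrow> Y (min t (max p (\<sigma> \<omega>))) \<omega>"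
proof -
  let ?h = "\<lambda>n. (t - p) / real (Suc n)"
  have h: "0 \<le> ?h n" "p + real (Suc n) * ?h n = t" for n using pt by auto

  have b: "min t (max p (\<sigma> \<omega>)) \<le> grid_stop p (?h n) (\<sigma> \<omega>) (Suc n)"
    "grid_stop p (?h n) (\<sigma> \<omega>) (Suc n) \<le> min t (max p (\<sigma> \<omega>)) + ?h n"
    "grid_stop p (?h n) (\<sigma> \<omega>) (Suc n) \<in> {p..t}" for n
    using grid_stop_bounds[OF h(1)[of n], of p "Suc n" "\<sigma> \<omega>"] h(2)[of n] by auto
  have "?h \<longlonglongrightarrow> 0" by real_asymp
  then have "(\<lambda>n. min t (max p (\<sigma> \<omega>)) + ?h n) \<longlonglongrightarrow> min t (max p (\<sigma> \<omega>))"
    using tendsto_add[OF tendsto_const, of ?h 0 sequentially "min t (max p (\<sigma> \<omega>))"] by simp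
  then have "(\<lambda>n. grid_stop p (?h n) (\<sigma> \<omega>) (Suc n)) \<longlonglongrightarrow> min t (max p (\<sigma> \<omega>))"
    by (rule tendsto_sandwich[OF always_eventually always_eventually tendsto_const, rotated 2]) (use b in \<open>blast+\<close>)
  then show ?thesis
    by (rule continuous_on_tendsto_compose[OF cont[OF assms]])
       (use pt b(3) in \<open>auto intro!: always_eventually simp del: grid_stop.simps\<close>)
qed

lemma measurable_stopped: "(\<lambda>\<omega>. Y (min t (max p (\<sigma> \<omega>))) \<omega>) \<in> borel_measurable (F t)"
proof (rule borel_measurable_LIMSEQ_real)
  show "(\<lambda>n. Y (grid_stop p ((t - p) / real (Suc n)) (\<sigma> \<omega>) (Suc n)) \<omega>) \<longlonglongrightarrow> Y (min t (max p (\<sigma> \<omega>))) \<omega>"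
    if "\<omega> \<in> space (F t)" for \<omega>
    using grid_stop_tendsto that space_F[of t] pt by simp
  show "(\<lambda>\<omega>. Y (grid_stop p ((t - p) / real (Suc n)) (\<sigma> \<omega>) (Suc n)) \<omega>) \<in> borel_measurable (F t)" for n
    using measurable_grid_stop[of "(t - p) / real (Suc n)" "Suc n"] pt by simp
qed

text \<open>Discrete optional stopping followed by Fatou's lemma. Going back one grid point, paths
  that have already stopped are left alone and the others are handled by the supermartingale
  inequality; the limit over ever finer grids loses nothing, as only an upper bound is
  claimed.\<close>

lemma nn_integral_stopped_le:
  assumes Y0: "\<And>u \<omega>. \<omega> \<in> space M \<Longrightarrow> p \<le> u \<Longrightarrow> u \<le> t \<Longrightarrow> 0 \<le> Y u \<omega>"
    and super: "\<And>u v V. p \<le> u \<Longrightarrow> u \<le> v \<Longrightarrow> v \<le> t \<Longrightarrow> V \<in> borel_measurable (F u) \<Longrightarrow> (\<And>\<omega>. \<omega> \<in> space M \<Longrightarrow> 0 \<le> V \<omega>) \<Longrightarrow>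
      (\<integral>\<^sup>+\<omega>. ennreal (V \<omega> * Y v \<omega>) \<partial>M) \<le> (\<integral>\<^sup>+\<omega>. ennreal (V \<omega> * Y u \<omega>) \<partial>M)"
    and V: "V \<in> borel_measurable (F p)" "\<And>\<omega>. \<omega> \<in> space M \<Longrightarrow> 0 \<le> V \<omega>"
  shows "(\<integral>\<^sup>+\<omega>. ennreal (V \<omega> * Y (min t (max p (\<sigma> \<omega>))) \<omega>) \<partial>M) \<le> (\<integral>\<^sup>+\<omega>. ennreal (V \<omega> * Y p \<omega>) \<partial>M)"
proof -
  have 1: "(\<integral>\<^sup>+\<omega>. ennreal (V \<omega> * Y (grid_stop p h (\<sigma> \<omega>) j) \<omega>) \<partial>M) \<le> (\<integral>\<^sup>+\<omega>. ennreal (V \<omega> * Y p \<omega>) \<partial>M)"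
    if h: "0 \<le> h" "p + real j * h \<le> t" for h j
    using h(2)
  proof (induction j)
    case (Suc j)
    let ?u = "p + real j * h" and ?v = "p + real (Suc j) * h"
    have uv: "p \<le> ?u" "?u \<le> ?v" "?v \<le> t" "0 \<le> ?u" using Suc.prems h pt by (auto simp: algebra_simps)
    let ?W = "\<lambda>\<omega>. Y (grid_stop p h (\<sigma> \<omega>) j) \<omega>"
    have Vu: "V \<in> borel_measurable (F ?u)" using measurable_F_mono[OF pt(1) uv(1) V(1)] .
    have Wu: "?W \<in> borel_measurable (F ?u)" using measurable_grid_stop[OF h(1), of j] uv by simp
    have S: "{\<omega> \<in> space M. \<sigma> \<omega> \<le> ?u} \<in> sets (F ?u)" using \<sigma> uv unfolding stopping_def by blast
    let ?S = "{\<omega> \<in> space M. \<sigma> \<omega> \<le> ?u}"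
    have Sc: "space M - ?S \<in> sets (F ?u)" using S sets.compl_sets[of ?S "F ?u"] space_F[of ?u] uv by simp
    note [measurable] = measurable_F_M[OF uv(4) Vu] measurable_F_M[OF uv(4) Wu] measurable_F_M[OF _ Y[of ?v]]
    have [measurable]: "?S \<in> events" "space M - ?S \<in> events" using S Sc subalg[OF uv(4)] unfolding subalgebra_def by auto
    have Yu: "Y ?u \<in> borel_measurable M" "Y ?v \<in> borel_measurable M"
      using Y[of ?u] Y[of ?v] measurable_F_M[of ?u] measurable_F_M[of ?v] uv by auto
    note [measurable] = Yu
    have "(\<integral>\<^sup>+\<omega>. ennreal (V \<omega> * Y (grid_stop p h (\<sigma> \<omega>) (Suc j)) \<omega>) \<partial>M)
      = (\<integral>\<^sup>+\<omega>. ennreal (V \<omega> * ?W \<omega>) * indicator ?S \<omega> + ennreal (V \<omega> * indicator (space M - ?S) \<omega> * Y ?v \<omega>) \<partial>M)"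
      by (intro nn_integral_cong) (auto split: split_indicator)
    also have "\<dots> = (\<integral>\<^sup>+\<omega>. ennreal (V \<omega> * ?W \<omega>) * indicator ?S \<omega> \<partial>M) + (\<integral>\<^sup>+\<omega>. ennreal (V \<omega> * indicator (space M - ?S) \<omega> * Y ?v \<omega>) \<partial>M)"
      by (rule nn_integral_add) measurable
    \<comment> \<open>Only the part not yet stopped is moved from \<open>?v\<close> back to
      \<open>?u\<close>. Restricting \<open>V\<close> to it gives again a weight known at time
      \<open>?u\<close>.\<close>
    also have "\<dots> \<le> (\<integral>\<^sup>+\<omega>. ennreal (V \<omega> * ?W \<omega>) * indicator ?S \<omega> \<partial>M) + (\<integral>\<^sup>+\<omega>. ennreal (V \<omega> * indicator (space M - ?S) \<omega> * Y ?u \<omega>) \<partial>M)"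
    proof (rule add_left_mono, rule super[OF uv(1-3)])
      show "(\<lambda>\<omega>. V \<omega> * indicator (space M - ?S) \<omega>) \<in> borel_measurable (F ?u)"
        using Vu Sc by (intro borel_measurable_times borel_measurable_indicator)
    qed (use V in auto)
    also have "\<dots> = (\<integral>\<^sup>+\<omega>. ennreal (V \<omega> * ?W \<omega>) * indicator ?S \<omega> + ennreal (V \<omega> * indicator (space M - ?S) \<omega> * Y ?u \<omega>) \<partial>M)"
      by (rule nn_integral_add[symmetric]) measurable
    also have "\<dots> = (\<integral>\<^sup>+\<omega>. ennreal (V \<omega> * ?W \<omega>) \<partial>M)"
      using grid_stop_alive[OF _ h(1), of p j] by (intro nn_integral_cong) (auto split: split_indicator simp: not_le)
    also have "\<dots> \<le> (\<integral>\<^sup>+\<omega>. ennreal (V \<omega> * Y p \<omega>) \<partial>M)" using Suc.IH uv by simp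
    finally show ?case .
  qed simp
  let ?g = "\<lambda>n \<omega>. grid_stop p ((t - p) / real (Suc n)) (\<sigma> \<omega>) (Suc n)"
  have [measurable]: "V \<in> borel_measurable M" using measurable_F_M[OF pt(1) V(1)] .
  have [measurable]: "(\<lambda>\<omega>. Y (?g n \<omega>) \<omega>) \<in> borel_measurable M" for n
    using measurable_grid_stop[of "(t - p) / real (Suc n)" "Suc n"] measurable_F_M[of t] pt by simp
  have "(\<integral>\<^sup>+\<omega>. ennreal (V \<omega> * Y (min t (max p (\<sigma> \<omega>))) \<omega>) \<partial>M) = (\<integral>\<^sup>+\<omega>. liminf (\<lambda>n. ennreal (V \<omega> * Y (?g n \<omega>) \<omega>)) \<partial>M)"
  proof (rule nn_integral_cong)
    fix \<omega> assume "\<omega> \<in> space M"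
    then have "(\<lambda>n. ennreal (V \<omega> * Y (?g n \<omega>) \<omega>)) \<longlonglongrightarrow> ennreal (V \<omega> * Y (min t (max p (\<sigma> \<omega>))) \<omega>)"
      by (intro tendsto_ennrealI tendsto_mult tendsto_const grid_stop_tendsto)
    from lim_imp_Liminf[OF _ this]
    show "ennreal (V \<omega> * Y (min t (max p (\<sigma> \<omega>))) \<omega>) = liminf (\<lambda>n. ennreal (V \<omega> * Y (?g n \<omega>) \<omega>))" by simp
  qed
  also have "\<dots> \<le> liminf (\<lambda>n. \<integral>\<^sup>+\<omega>. ennreal (V \<omega> * Y (?g n \<omega>) \<omega>) \<partial>M)"
    by (rule nn_integral_liminf) measurable
  also have "\<dots> \<le> liminf (\<lambda>n::nat. \<integral>\<^sup>+\<omega>. ennreal (V \<omega> * Y p \<omega>) \<partial>M)"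
    using pt by (intro Liminf_mono always_eventually allI 1) auto
  finally show ?thesis by (simp add: Liminf_const)
qed

end

section \<open>Hitting times of continuous adapted processes\<close>

text \<open>The horizon \<open>T\<close> is built in, so that the time is real-valued and bounded,
  with value \<open>T\<close> if the level is not reached before. For a continuous path that starts
  below \<open>K\<close>, the first time at or above \<open>K\<close> is the first time at
  \<open>K\<close>.\<close>

definition hit :: "(real \<Rightarrow> 'a \<Rightarrow> real) \<Rightarrow> real \<Rightarrow> real \<Rightarrow> 'a \<Rightarrow> real" where
  "hit Y K T \<omega> = Inf (insert T {s \<in> {0..T}. K \<le> Y s \<omega>})"

text \<open>Two reductions to countably many conditions: a continuous path on a compact interval
  stays below \<open>K\<close> exactly if it is at most \<open>K - 1 / (n + 1)\<close> for some
  \<open>n\<close>, and this closed condition may be tested at rational times. Clamping carries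
  every rational into \<open>{0..u}\<close>, which also takes care of the endpoints.\<close>

lemma sets_path_less:
  fixes Y :: "real \<Rightarrow> 'a \<Rightarrow> real"
  assumes u: "0 \<le> u" and Y: "\<And>s. 0 \<le> s \<Longrightarrow> s \<le> u \<Longrightarrow> Y s \<in> borel_measurable (F u)"
    and cont: "\<And>\<omega>. \<omega> \<in> space M \<Longrightarrow> continuous_on {0..u} (\<lambda>s. Y s \<omega>)"
  shows "{\<omega> \<in> space M. \<forall>s\<in>{0..u}. Y s \<omega> < K} \<in> sets (F u)"
proof -
  let ?c = "\<lambda>s. max 0 (min u s)"
  have c: "?c s \<in> {0..u}" for s using u by auto
  have "{\<omega> \<in> space M. \<forall>s\<in>{0..u}. Y s \<omega> < K} =
    (\<Union>n::nat. {\<omega> \<in> space (F u). \<forall>r\<in>\<rat>. Y (?c r) \<omega> \<le> K - inverse (real (Suc n))})" (is "?L = ?R")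
  proof (intro equalityI subsetI)
    fix \<omega> assume "\<omega> \<in> ?L"
    then have \<omega>: "\<omega> \<in> space M" "\<forall>s\<in>{0..u}. Y s \<omega> < K" by auto
    obtain s0 where s0: "s0 \<in> {0..u}" "\<forall>s\<in>{0..u}. Y s \<omega> \<le> Y s0 \<omega>"
      using continuous_attains_sup[OF _ _ cont[OF \<omega>(1)]] u by auto
    have "0 < K - Y s0 \<omega>" using \<omega> s0 by simp
    then obtain n where n: "inverse (real (Suc n)) < K - Y s0 \<omega>" using reals_Archimedean by blast
    have "Y (?c r) \<omega> \<le> K - inverse (real (Suc n))" for r using s0(2) c[of r] n by fastforce
    then show "\<omega> \<in> ?R" using \<omega> space_F[OF u] by blast
  next
    fix \<omega> assume "\<omega> \<in> ?R"
    then obtain n :: nat where n: "\<omega> \<in> space M" "\<forall>r\<in>\<rat>. Y (?c r) \<omega> \<le> K - inverse (real (Suc n))"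
      using space_F[OF u] by auto
    have "continuous_on UNIV (\<lambda>s. Y (?c s) \<omega>)"
      by (rule continuous_on_compose2[OF cont[OF n(1)]]) (use u in \<open>auto intro!: continuous_intros\<close>)
    then have "closed {s. Y (?c s) \<omega> \<le> K - inverse (real (Suc n))}"
      by (intro closed_Collect_le) auto
    then have "closure \<rat> \<subseteq> {s. Y (?c s) \<omega> \<le> K - inverse (real (Suc n))}"
      using n(2) by (intro closure_minimal) auto
    then have le: "Y (?c s) \<omega> \<le> K - inverse (real (Suc n))" for s using Rats_closure_real by auto
    have "Y s \<omega> < K" if "s \<in> {0..u}" for s
    proof -
      have "?c s = s" using that by auto
      then have "Y s \<omega> \<le> K - inverse (real (Suc n))" using le[of s] by metis
      moreover have "0 < inverse (real (Suc n))" by simp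
      ultimately show ?thesis by linarith
    qed
    then show "\<omega> \<in> ?L" using n by blast
  qed
  also have "\<dots> \<in> sets (F u)"
  proof (intro sets.countable_UN image_subsetI)
    fix n :: nat
    show "{\<omega> \<in> space (F u). \<forall>r\<in>\<rat>. Y (?c r) \<omega> \<le> K - inverse (real (Suc n))} \<in> sets (F u)"
    proof -
      have m: "{\<omega> \<in> space (F u). Y (?c r) \<omega> \<le> K - inverse (real (Suc n))} \<in> sets (F u)" for r
      proof -
        have [measurable]: "Y (?c r) \<in> borel_measurable (F u)"
          using measurable_F_mono[of "?c r" u "Y (?c r)" borel] Y c[of r] by auto
        show ?thesis by measurable
      qed
      have "{\<omega> \<in> space (F u). \<forall>r\<in>\<rat>. Y (?c r) \<omega> \<le> K - inverse (real (Suc n))}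
        = space (F u) \<inter> (\<Inter>r\<in>\<rat>. {\<omega> \<in> space (F u). Y (?c r) \<omega> \<le> K - inverse (real (Suc n))})"
        by (auto intro: Rats_0)
      also have "\<dots> \<in> sets (F u)"
        using m countable_rat by (intro sets.Int sets.top sets.countable_INT') auto
      finally show ?thesis .
    qed
  qed
  finally show ?thesis .
qed

lemma
  assumes T: "0 \<le> T" and cont: "continuous_on {0..T} (\<lambda>s. Y s \<omega>)"
  shows hit_bounds: "0 \<le> hit Y K T \<omega>" "hit Y K T \<omega> \<le> T"
    and hit_less: "\<And>s. 0 \<le> s \<Longrightarrow> s < hit Y K T \<omega> \<Longrightarrow> Y s \<omega> < K"
    and hit_ge: "hit Y K T \<omega> < T \<Longrightarrow> K \<le> Y (hit Y K T \<omega>) \<omega>"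
    and hit_le_iff: "\<And>u. 0 \<le> u \<Longrightarrow> u < T \<Longrightarrow> hit Y K T \<omega> \<le> u \<longleftrightarrow> (\<exists>s\<in>{0..u}. K \<le> Y s \<omega>)"
proof -
  let ?S = "{s \<in> {0..T}. K \<le> Y s \<omega>}"
  let ?A = "insert T ?S"
  have bdd: "bdd_below ?A" by (rule bdd_belowI[of _ 0]) (use T in auto)
  have cl: "closed ?S" by (rule continuous_on_closed_Collect_le[OF continuous_on_const cont]) simp
  \<comment> \<open>The superlevel set of a continuous path is closed, so the infimum is attained:
    it is \<open>T\<close>, or the path is at or above \<open>K\<close> there.\<close>
  have mem: "Inf ?A \<in> ?A" using cl bdd by (intro closed_contains_Inf) (auto intro: closed_insert)
  show 0: "0 \<le> hit Y K T \<omega>" unfolding hit_def using T by (intro cInf_greatest) auto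
  show 1: "hit Y K T \<omega> \<le> T" unfolding hit_def using bdd by (intro cInf_lower) auto
  show 2: "Y s \<omega> < K" if s: "0 \<le> s" "s < hit Y K T \<omega>" for s
  proof (rule ccontr)
    assume "\<not> Y s \<omega> < K"
    then have "hit Y K T \<omega> \<le> s" unfolding hit_def using s 1 bdd by (intro cInf_lower) auto
    then show False using s by simp
  qed
  show 3: "K \<le> Y (hit Y K T \<omega>) \<omega>" if "hit Y K T \<omega> < T" using mem that unfolding hit_def by auto
  show "hit Y K T \<omega> \<le> u \<longleftrightarrow> (\<exists>s\<in>{0..u}. K \<le> Y s \<omega>)" if u: "0 \<le> u" "u < T" for u
  proof
    assume "hit Y K T \<omega> \<le> u"
    then show "\<exists>s\<in>{0..u}. K \<le> Y s \<omega>" using 0 3 u by (intro bexI[of _ "hit Y K T \<omega>"]) auto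
  next
    assume "\<exists>s\<in>{0..u}. K \<le> Y s \<omega>"
    then show "hit Y K T \<omega> \<le> u" using 2 by (meson atLeastAtMost_iff leI less_le_trans not_less)
  qed
qed

lemma stopping_hit:
  assumes T: "0 \<le> T" and Y: "\<And>s. 0 \<le> s \<Longrightarrow> Y s \<in> borel_measurable (F s)"
    and cont: "\<And>\<omega>. \<omega> \<in> space M \<Longrightarrow> continuous_on {0..} (\<lambda>s. Y s \<omega>)"
  shows "stopping (hit Y K T)"
  unfolding stopping_def
proof (intro conjI ballI allI impI)
  have c: "continuous_on {0..u} (\<lambda>s. Y s \<omega>)" if "\<omega> \<in> space M" for u \<omega>
    by (rule continuous_on_subset[OF cont[OF that]]) auto
  show "0 \<le> hit Y K T \<omega>" if "\<omega> \<in> space M" for \<omega> using hit_bounds[where Y=Y, OF T c[OF that]] by simp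
  fix u :: real assume u: "0 \<le> u"
  show "{\<omega> \<in> space M. hit Y K T \<omega> \<le> u} \<in> sets (F u)"
  proof (cases "u < T")
    case True
    have "{\<omega> \<in> space M. hit Y K T \<omega> \<le> u} = space (F u) - {\<omega> \<in> space M. \<forall>s\<in>{0..u}. Y s \<omega> < K}"
      using space_F[OF u] by (auto simp: hit_le_iff[where Y=Y, OF T c u True] not_less) (auto simp: not_le[symmetric])
    moreover have "{\<omega> \<in> space M. \<forall>s\<in>{0..u}. Y s \<omega> < K} \<in> sets (F u)"
      by (rule sets_path_less[OF u measurable_F_mono[OF _ _ Y] c])
    ultimately show ?thesis by (simp add: sets.compl_sets)
  next
    case False
    then have "hit Y K T \<omega> \<le> u" if "\<omega> \<in> space M" for \<omega>
      using hit_bounds(2)[where Y=Y, OF T c[OF that], of K] by linarith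
    then have "{\<omega> \<in> space M. hit Y K T \<omega> \<le> u} = space (F u)"
      using space_F[OF u] by auto
    then show ?thesis by simp
  qed
qed

end

section \<open>The exponential inequality between stopping times\<close>

context squared_bessel
begin

lemma bracket_add:
  assumes "\<omega> \<in> space M" "0 \<le> p" "p \<le> u" "u \<le> t"
  shows "bracket l \<theta> p t \<omega> = bracket l \<theta> p u \<omega> + bracket l \<theta> u t \<omega>"
  unfolding bracket_def using assms
  by (subst Henstock_Kurzweil_Integration.integral_combine[OF assms(3,4)]) (auto intro!: integrable_continuous_real continuous_integrand)

lemma bracket_refl [simp]: "bracket l \<theta> p p \<omega> = 0"
  by (simp add: bracket_def)

lemma bracket_le:
  assumes "\<omega> \<in> space M" "0 \<le> p" "p \<le> t" "\<And>s. p \<le> s \<Longrightarrow> s \<le> t \<Longrightarrow> (l \<omega> * sqrt (Z s \<omega>) + \<theta> \<omega>)\<^sup>2 \<le> c"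
  shows "bracket l \<theta> p t \<omega> \<le> c * (t - p)"
proof -
  have "bracket l \<theta> p t \<omega> \<le> integral {p..t} (\<lambda>_. c)"
    unfolding bracket_def
    by (rule integral_le[OF integrable_continuous_real[OF continuous_integrand[OF assms(1,2)]]]) (use assms in auto)
  then show ?thesis using assms(3) by (simp add: mult.commute)
qed

lemma bracket_nonneg: "0 \<le> bracket l \<theta> p t \<omega>"
  unfolding bracket_def by (cases "(\<lambda>s. (l \<omega> * sqrt (Z s \<omega>) + \<theta> \<omega>)\<^sup>2) integrable_on {p..t}") (auto intro!: integral_nonneg simp: not_integrable_integral)

text \<open>Optional stopping for the exponential started at \<open>p\<close>, where it equals one.
  Its supermartingale property over \<open>[u, v]\<close> is \<open>N_exp_le\<close> with the
  exponential up to \<open>u\<close> absorbed in the weight. Passing from \<open>p\<close> to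
  \<open>min p (\<sigma> \<omega>)\<close> costs nothing: if
  \<open>\<sigma> \<omega> \<le> p\<close>, both ends of the stopped interval coincide and the
  exponential is one.\<close>

lemma N_exp_stopped_le:
  assumes \<sigma>: "stopping \<sigma>"
    and pt: "0 \<le> p" "p \<le> t" and l: "l \<in> borel_measurable (F p)" "\<And>\<omega>. \<omega> \<in> space M \<Longrightarrow> \<bar>l \<omega>\<bar> \<le> L"
    and \<theta>: "\<theta> \<in> borel_measurable (F p)"
    and V: "V \<in> borel_measurable (F p)" "\<And>\<omega>. \<omega> \<in> space M \<Longrightarrow> 0 \<le> V \<omega>"
  shows "(\<integral>\<^sup>+\<omega>. ennreal (V \<omega> * exp (l \<omega> * (N (min t (\<sigma> \<omega>)) \<omega> - N (min p (\<sigma> \<omega>)) \<omega>) +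
      \<theta> \<omega> * (B (min t (\<sigma> \<omega>)) \<omega> - B (min p (\<sigma> \<omega>)) \<omega>) - bracket l \<theta> (min p (\<sigma> \<omega>)) (min t (\<sigma> \<omega>)) \<omega> / 2)) \<partial>M)
    \<le> (\<integral>\<^sup>+\<omega>. ennreal (V \<omega>) \<partial>M)"
proof -
  let ?Y = "\<lambda>u \<omega>. exp (l \<omega> * (N u \<omega> - N p \<omega>) + \<theta> \<omega> * (B u \<omega> - B p \<omega>) - bracket l \<theta> p u \<omega> / 2)"
  have Ym: "?Y u \<in> borel_measurable (F u)" if u: "p \<le> u" "u \<le> t" for u
  proof -
    have [measurable]: "l \<in> borel_measurable (F u)" "\<theta> \<in> borel_measurable (F u)"
      using measurable_F_mono[OF pt(1) u(1)] l \<theta> by auto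
    have [measurable]: "N u \<in> borel_measurable (F u)" "N p \<in> borel_measurable (F u)"
      "B u \<in> borel_measurable (F u)" "B p \<in> borel_measurable (F u)" "bracket l \<theta> p u \<in> borel_measurable (F u)"
      using measurable_N measurable_B measurable_bracket[of p u l \<theta>] pt u by auto
    show ?thesis by measurable
  qed
  have cont: "continuous_on {p..t} (\<lambda>u. ?Y u \<omega>)" if \<omega>: "\<omega> \<in> space M" for \<omega>
  proof -
    have "continuous_on {p..t} (\<lambda>u. Z u \<omega>)" "continuous_on {p..t} (\<lambda>u. B u \<omega>)"
      using pt by (auto intro: continuous_on_subset[OF Z_continuous[OF \<omega>]] continuous_on_subset[OF continuous[OF \<omega>]])
    moreover have "continuous_on {p..t} (\<lambda>u. bracket l \<theta> p u \<omega>)"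
      unfolding bracket_def by (intro indefinite_integral_continuous_1 integrable_continuous_real continuous_integrand \<omega> pt)
    ultimately show ?thesis unfolding N_def by (intro continuous_intros) auto
  qed
  have "(\<integral>\<^sup>+\<omega>. ennreal (V \<omega> * ?Y (min t (max p (\<sigma> \<omega>))) \<omega>) \<partial>M) \<le> (\<integral>\<^sup>+\<omega>. ennreal (V \<omega> * ?Y p \<omega>) \<partial>M)"
  proof (rule nn_integral_stopped_le[where Y="?Y", OF \<sigma> pt Ym cont _ _ V])
    fix u v :: real and W :: "'a \<Rightarrow> real"
    assume uv: "p \<le> u" "u \<le> v" "v \<le> t" and W: "W \<in> borel_measurable (F u)" "\<And>\<omega>. \<omega> \<in> space M \<Longrightarrow> 0 \<le> W \<omega>"
    have u0: "0 \<le> u" using pt uv by simp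
    have "(\<integral>\<^sup>+\<omega>. ennreal (W \<omega> * ?Y v \<omega>) \<partial>M) =
      (\<integral>\<^sup>+\<omega>. ennreal ((W \<omega> * ?Y u \<omega>) * exp (l \<omega> * (N v \<omega> - N u \<omega>) + \<theta> \<omega> * (B v \<omega> - B u \<omega>) - bracket l \<theta> u v \<omega> / 2)) \<partial>M)"
    proof (rule nn_integral_cong)
      fix \<omega> assume "\<omega> \<in> space M"
      then have "l \<omega> * (N v \<omega> - N p \<omega>) + \<theta> \<omega> * (B v \<omega> - B p \<omega>) - bracket l \<theta> p v \<omega> / 2 =
        (l \<omega> * (N u \<omega> - N p \<omega>) + \<theta> \<omega> * (B u \<omega> - B p \<omega>) - bracket l \<theta> p u \<omega> / 2) +
        (l \<omega> * (N v \<omega> - N u \<omega>) + \<theta> \<omega> * (B v \<omega> - B u \<omega>) - bracket l \<theta> u v \<omega> / 2)"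
        using bracket_add[OF _ pt(1) uv(1,2)] by (simp add: algebra_simps add_divide_distrib)
      then show "ennreal (W \<omega> * ?Y v \<omega>) = ennreal ((W \<omega> * ?Y u \<omega>) * exp (l \<omega> * (N v \<omega> - N u \<omega>) + \<theta> \<omega> * (B v \<omega> - B u \<omega>) - bracket l \<theta> u v \<omega> / 2))"
        by (simp only: exp_add mult.assoc)
    qed
    also have "\<dots> \<le> (\<integral>\<^sup>+\<omega>. ennreal (W \<omega> * ?Y u \<omega>) \<partial>M)"
    proof (rule N_exp_le[OF u0 uv(2) _ l(2)])
      show "l \<in> borel_measurable (F u)" "\<theta> \<in> borel_measurable (F u)" using measurable_F_mono[OF pt(1) uv(1)] l \<theta> by auto
      show "(\<lambda>\<omega>. W \<omega> * ?Y u \<omega>) \<in> borel_measurable (F u)" using uv by (intro borel_measurable_times W Ym) auto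
    qed (use W in auto)
    finally show "(\<integral>\<^sup>+\<omega>. ennreal (W \<omega> * ?Y v \<omega>) \<partial>M) \<le> (\<integral>\<^sup>+\<omega>. ennreal (W \<omega> * ?Y u \<omega>) \<partial>M)" .
  qed auto
  also have "(\<integral>\<^sup>+\<omega>. ennreal (V \<omega> * ?Y p \<omega>) \<partial>M) = (\<integral>\<^sup>+\<omega>. ennreal (V \<omega>) \<partial>M)" by simp
  also have "(\<integral>\<^sup>+\<omega>. ennreal (V \<omega> * ?Y (min t (max p (\<sigma> \<omega>))) \<omega>) \<partial>M) =
    (\<integral>\<^sup>+\<omega>. ennreal (V \<omega> * exp (l \<omega> * (N (min t (\<sigma> \<omega>)) \<omega> - N (min p (\<sigma> \<omega>)) \<omega>) +
      \<theta> \<omega> * (B (min t (\<sigma> \<omega>)) \<omega> - B (min p (\<sigma> \<omega>)) \<omega>) - bracket l \<theta> (min p (\<sigma> \<omega>)) (min t (\<sigma> \<omega>)) \<omega> / 2)) \<partial>M)"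
  proof (rule nn_integral_cong)
    fix \<omega>
    show "ennreal (V \<omega> * ?Y (min t (max p (\<sigma> \<omega>))) \<omega>) = ennreal (V \<omega> * exp (l \<omega> * (N (min t (\<sigma> \<omega>)) \<omega> - N (min p (\<sigma> \<omega>)) \<omega>) +
      \<theta> \<omega> * (B (min t (\<sigma> \<omega>)) \<omega> - B (min p (\<sigma> \<omega>)) \<omega>) - bracket l \<theta> (min p (\<sigma> \<omega>)) (min t (\<sigma> \<omega>)) \<omega> / 2))"
    proof (cases "\<sigma> \<omega> \<le> p")
      case True
      then have "min t (max p (\<sigma> \<omega>)) = p" "min t (\<sigma> \<omega>) = \<sigma> \<omega>" "min p (\<sigma> \<omega>) = \<sigma> \<omega>" using pt by auto
      then show ?thesis by simp
    next
      case False
      then have "min t (max p (\<sigma> \<omega>)) = min t (\<sigma> \<omega>)" "min p (\<sigma> \<omega>) = p" using pt by auto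
      then show ?thesis by simp
    qed
  qed
  finally show ?thesis .
qed

end

section \<open>From exponential inequalities to moments\<close>

lemma cosh_ge_quartic: "1 + x\<^sup>2 / 2 + x ^ 4 / 24 \<le> cosh (x :: real)"
proof -
  have "(\<lambda>n. if even n then x ^ n / fact n else 0) sums cosh x"
    using cosh_converges[of x] by (simp add: divide_inverse mult.commute scaleR_conv_of_real cong: if_cong)
  \<comment> \<open>All terms of the series are nonnegative, so a partial sum is a lower bound. The
    quartic term is kept for the sake of fourth moments.\<close>
  then have "(\<Sum>n<5. if even n then x ^ n / fact n else 0) \<le> cosh x"
    using sum_le_suminf[of "\<lambda>n. if even n then x ^ n / fact n else 0" "{..<5}"]
    by (simp add: sums_iff zero_le_even_power)
  moreover have "{..<5} = {0, 1, 2, 3, 4::nat}" by auto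
  moreover have "fact 2 = (2::real)" "fact 4 = (24::real)" by (simp_all add: fact_numeral)
  ultimately show ?thesis by simp
qed

lemma exp_average:
  fixes v r y a :: real
  shows "v * (cosh (r * y) * exp (- (r\<^sup>2 * a / 2))) = (v * exp (r * y - r\<^sup>2 * a / 2) + v * exp (- r * y - (- r)\<^sup>2 * a / 2)) / 2"
proof -
  have "exp (r * y - r\<^sup>2 * a / 2) = exp (r * y) * exp (- (r\<^sup>2 * a / 2))"
    "exp (- r * y - (- r)\<^sup>2 * a / 2) = exp (- (r * y)) * exp (- (r\<^sup>2 * a / 2))"
    by (simp_all flip: exp_add)
  then show ?thesis by (simp only: cosh_field_def) (simp add: algebra_simps)
qed

context prob_space
begin

text \<open>The moment bounds only use the inequality for the exponentials, not equality: adding the inequalities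
  for \<open>r\<close> and \<open>-r\<close> bounds \<open>E (V cosh (r y) exp (- r\<^sup>2 A / 2))\<close>.\<close>

lemma exp_le_moments:
  fixes y A V :: "'a \<Rightarrow> real"
  assumes [measurable]: "y \<in> borel_measurable M" "A \<in> borel_measurable M" "V \<in> borel_measurable M"
    and V: "\<And>\<omega>. \<omega> \<in> space M \<Longrightarrow> 0 \<le> V \<omega>" "\<And>\<omega>. \<omega> \<in> space M \<Longrightarrow> V \<omega> \<le> v"
    and A: "\<And>\<omega>. \<omega> \<in> space M \<Longrightarrow> 0 \<le> A \<omega>" "\<And>\<omega>. \<omega> \<in> space M \<Longrightarrow> A \<omega> \<le> a" and a: "0 < a"
    and y: "\<And>\<omega>. \<omega> \<in> space M \<Longrightarrow> \<bar>y \<omega>\<bar> \<le> b"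
    and le: "\<And>r::real. (\<integral>\<^sup>+\<omega>. ennreal (V \<omega> * exp (r * y \<omega> - r\<^sup>2 * A \<omega> / 2)) \<partial>M) \<le> (\<integral>\<^sup>+\<omega>. ennreal (V \<omega>) \<partial>M)"
  shows "expectation (\<lambda>\<omega>. V \<omega> * y \<omega>) = 0"
    and "expectation (\<lambda>\<omega>. V \<omega> * (y \<omega>)\<^sup>2) \<le> expectation (\<lambda>\<omega>. V \<omega> * A \<omega>)"
    and "expectation (\<lambda>\<omega>. V \<omega> * (y \<omega>) ^ 4) \<le> 24 * a\<^sup>2 * expectation V"
proof -
  have v0: "0 \<le> v" "0 \<le> b"
  proof -
    obtain \<omega> where "\<omega> \<in> space M" using not_empty by blast
    then show "0 \<le> v" "0 \<le> b" using V[of \<omega>] y[of \<omega>] by auto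
  qed
  have int: "integrable M (\<lambda>\<omega>. V \<omega> * f \<omega>)" if "f \<in> borel_measurable M" "\<And>\<omega>. \<omega> \<in> space M \<Longrightarrow> \<bar>f \<omega>\<bar> \<le> c" for f c
  proof (rule integrable_const_bound[of _ "v * c"])
    show "AE \<omega> in M. norm (V \<omega> * f \<omega>) \<le> v * c"
      using V that v0 by (intro AE_I2) (auto simp: abs_mult intro!: mult_mono)
  qed (use that in measurable)
  have iV: "integrable M V" using int[of "\<lambda>_. 1" 1] by simp
  have eb: "exp (r * y \<omega> - r\<^sup>2 * A \<omega> / 2) \<le> exp (\<bar>r\<bar> * b)" if "\<omega> \<in> space M" for \<omega> and r :: real
  proof -
    have "r * y \<omega> \<le> \<bar>r\<bar> * b" using abs_ge_self[of "r * y \<omega>"] mult_left_mono[OF y[OF that], of "\<bar>r\<bar>"] by (simp add: abs_mult)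
    moreover have "0 \<le> r\<^sup>2 * A \<omega> / 2" using A that by simp
    ultimately show ?thesis by simp
  qed
  have ie: "integrable M (\<lambda>\<omega>. V \<omega> * exp (r * y \<omega> - r\<^sup>2 * A \<omega> / 2))" for r
    by (rule int[of _ "exp (\<bar>r\<bar> * b)"]) (use eb in auto)
  have E: "expectation (\<lambda>\<omega>. V \<omega> * exp (r * y \<omega> - r\<^sup>2 * A \<omega> / 2)) \<le> expectation V" for r
    using le[of r] V ie[of r] iV
    by (subst (asm) (1 2) nn_integral_eq_integral) (auto simp: ennreal_le_iff integral_nonneg_AE)
  have iVA: "integrable M (\<lambda>\<omega>. V \<omega> * A \<omega>)" by (rule int[of _ a]) (use A in auto)
  have iVy: "integrable M (\<lambda>\<omega>. V \<omega> * y \<omega>)" by (rule int[of _ b]) (use y in auto)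
  have iVy2: "integrable M (\<lambda>\<omega>. V \<omega> * (y \<omega>)\<^sup>2)"
  proof (rule int[of _ "b\<^sup>2"])
    show "\<bar>(y \<omega>)\<^sup>2\<bar> \<le> b\<^sup>2" if "\<omega> \<in> space M" for \<omega>
      unfolding power_abs by (rule power_mono[OF y[OF that]]) simp
  qed measurable
  have iVy4: "integrable M (\<lambda>\<omega>. V \<omega> * (y \<omega>) ^ 4)"
  proof (rule int[of _ "b ^ 4"])
    show "\<bar>(y \<omega>) ^ 4\<bar> \<le> b ^ 4" if "\<omega> \<in> space M" for \<omega>
      unfolding power_abs by (rule power_mono[OF y[OF that]]) simp
  qed measurable
  \<comment> \<open>Since \<open>exp x \<ge> 1 + x\<close> and \<open>A \<le> a\<close>, the
    inequality is linear in \<open>r\<close> on the left and quadratic on the right. Dividing by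
    small \<open>r\<close> of either sign forces the first moment to vanish.\<close>
  have lin: "r * expectation (\<lambda>\<omega>. V \<omega> * y \<omega>) \<le> r\<^sup>2 * (a * expectation V / 2)" for r
  proof -
    have "expectation (\<lambda>\<omega>. V \<omega> + r * (V \<omega> * y \<omega>) - r\<^sup>2 * a / 2 * V \<omega>) \<le> expectation (\<lambda>\<omega>. V \<omega> * exp (r * y \<omega> - r\<^sup>2 * A \<omega> / 2))"
    proof (rule integral_mono)
      fix \<omega> assume \<omega>: "\<omega> \<in> space M"
      have "1 + (r * y \<omega> - r\<^sup>2 * A \<omega> / 2) \<le> exp (r * y \<omega> - r\<^sup>2 * A \<omega> / 2)" by (rule exp_ge_add_one_self)
      moreover have "r\<^sup>2 * A \<omega> \<le> r\<^sup>2 * a" using A \<omega> by (intro mult_left_mono) auto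
      ultimately have "1 + r * y \<omega> - r\<^sup>2 * a / 2 \<le> exp (r * y \<omega> - r\<^sup>2 * A \<omega> / 2)" by linarith
      from mult_left_mono[OF this V(1)[OF \<omega>]]
      show "V \<omega> + r * (V \<omega> * y \<omega>) - r\<^sup>2 * a / 2 * V \<omega> \<le> V \<omega> * exp (r * y \<omega> - r\<^sup>2 * A \<omega> / 2)"
        by (simp add: algebra_simps)
    qed (use iV iVy ie in auto)
    also have "\<dots> \<le> expectation V" by (rule E)
    finally have le: "expectation (\<lambda>\<omega>. V \<omega> + r * (V \<omega> * y \<omega>) - r\<^sup>2 * a / 2 * V \<omega>) \<le> expectation V" .
    have "expectation (\<lambda>\<omega>. V \<omega> + r * (V \<omega> * y \<omega>) - r\<^sup>2 * a / 2 * V \<omega>) =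
      expectation V + r * expectation (\<lambda>\<omega>. V \<omega> * y \<omega>) - r\<^sup>2 * a / 2 * expectation V"
      using iV iVy by simp
    with le show ?thesis by simp
  qed
  have small: "x \<le> 0" if "\<And>r. 0 < r \<Longrightarrow> x \<le> r * c" for x c :: real
  proof (rule field_le_epsilon)
    fix e :: real assume "0 < e"
    then have "x \<le> e / (\<bar>c\<bar> + 1) * c" by (intro that) (auto simp: add_pos_nonneg add_nonneg_pos)
    also have "\<dots> \<le> e / (\<bar>c\<bar> + 1) * (\<bar>c\<bar> + 1)" using \<open>0 < e\<close> by (intro mult_left_mono) auto
    also have "\<dots> = 0 + e" by (simp add: add_nonneg_pos)
    finally show "x \<le> 0 + e" .
  qed
  have "expectation (\<lambda>\<omega>. V \<omega> * y \<omega>) \<le> 0"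
  proof (rule small)
    fix r :: real assume "0 < r"
    then show "expectation (\<lambda>\<omega>. V \<omega> * y \<omega>) \<le> r * (a * expectation V / 2)"
      using lin[of r] by (simp add: power2_eq_square)
  qed
  moreover have "- expectation (\<lambda>\<omega>. V \<omega> * y \<omega>) \<le> 0"
  proof (rule small)
    fix r :: real assume "0 < r"
    have "r * (- expectation (\<lambda>\<omega>. V \<omega> * y \<omega>)) \<le> r * (r * (a * expectation V / 2))"
      using lin[of "-r"] by (simp add: power2_eq_square)
    then show "- expectation (\<lambda>\<omega>. V \<omega> * y \<omega>) \<le> r * (a * expectation V / 2)"
      using \<open>0 < r\<close> by (simp only: mult_le_cancel_left_pos)
  qed
  ultimately show "expectation (\<lambda>\<omega>. V \<omega> * y \<omega>) = 0" by simp
  have ich: "integrable M (\<lambda>\<omega>. V \<omega> * (cosh (r * y \<omega>) * exp (- (r\<^sup>2 * A \<omega> / 2))))" for r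
  proof -
    show ?thesis using ie[of r] ie[of "-r"] unfolding exp_average by simp
  qed
  have ch: "expectation (\<lambda>\<omega>. V \<omega> * (cosh (r * y \<omega>) * exp (- (r\<^sup>2 * A \<omega> / 2)))) \<le> expectation V" for r
  proof -
    show ?thesis using ie[of r] ie[of "-r"] E[of r] E[of "-r"] unfolding exp_average by simp
  qed
  have e1: "1 - x \<le> exp (- x)" for x :: real using exp_ge_add_one_self[of "-x"] by simp
  show "expectation (\<lambda>\<omega>. V \<omega> * (y \<omega>)\<^sup>2) \<le> expectation (\<lambda>\<omega>. V \<omega> * A \<omega>)"
  proof -
    \<comment> \<open>With \<open>q = r\<^sup>2\<close>, the product of
      \<open>cosh \<ge> 1 + q y\<^sup>2 / 2\<close> and \<open>exp \<ge> 1 - q A / 2\<close> gives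
      the claim up to a term proportional to \<open>q\<close>.\<close>
    have "expectation (\<lambda>\<omega>. V \<omega> * (y \<omega>)\<^sup>2) - expectation (\<lambda>\<omega>. V \<omega> * A \<omega>) \<le> q * (a / 2 * expectation (\<lambda>\<omega>. V \<omega> * (y \<omega>)\<^sup>2))"
      if q: "0 < q" for q
    proof -
      define r where "r = sqrt q"
      have r: "r\<^sup>2 = q" using q by (simp add: r_def)
      have "expectation (\<lambda>\<omega>. V \<omega> - q / 2 * (V \<omega> * A \<omega>) + q / 2 * (1 - q * a / 2) * (V \<omega> * (y \<omega>)\<^sup>2))
        \<le> expectation (\<lambda>\<omega>. V \<omega> * (cosh (r * y \<omega>) * exp (- (r\<^sup>2 * A \<omega> / 2))))"
      proof (rule integral_mono)
        fix \<omega> assume \<omega>: "\<omega> \<in> space M"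
        have "1 - q * A \<omega> / 2 + q / 2 * (1 - q * a / 2) * (y \<omega>)\<^sup>2 \<le> 1 - q * A \<omega> / 2 + q / 2 * (y \<omega>)\<^sup>2 * (1 - q * A \<omega> / 2)"
        proof -
          have "q * A \<omega> \<le> q * a" using q A[OF \<omega>] by (intro mult_left_mono) auto
          then have "q / 2 * (y \<omega>)\<^sup>2 * (1 - q * a / 2) \<le> q / 2 * (y \<omega>)\<^sup>2 * (1 - q * A \<omega> / 2)"
            using q by (intro mult_left_mono) auto
          then show ?thesis by (simp add: mult_ac)
        qed
        also have "\<dots> = (1 + q * (y \<omega>)\<^sup>2 / 2) * (1 - q * A \<omega> / 2)" by (simp add: algebra_simps)
        also have "\<dots> \<le> (1 + q * (y \<omega>)\<^sup>2 / 2) * exp (- (q * A \<omega> / 2))"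
          using q by (intro mult_left_mono e1) auto
        also have "\<dots> \<le> cosh (r * y \<omega>) * exp (- (q * A \<omega> / 2))"
        proof (intro mult_right_mono)
          have "1 + q * (y \<omega>)\<^sup>2 / 2 \<le> 1 + (r * y \<omega>)\<^sup>2 / 2 + (r * y \<omega>) ^ 4 / 24" using r by (simp add: power_mult_distrib)
          then show "1 + q * (y \<omega>)\<^sup>2 / 2 \<le> cosh (r * y \<omega>)" using cosh_ge_quartic[of "r * y \<omega>"] by simp
        qed simp
        finally have "V \<omega> * (1 - q * A \<omega> / 2 + q / 2 * (1 - q * a / 2) * (y \<omega>)\<^sup>2) \<le> V \<omega> * (cosh (r * y \<omega>) * exp (- (q * A \<omega> / 2)))"
          by (rule mult_left_mono[OF _ V(1)[OF \<omega>]])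
        moreover have "V \<omega> * (1 - q * A \<omega> / 2 + q / 2 * (1 - q * a / 2) * (y \<omega>)\<^sup>2) =
          V \<omega> - q / 2 * (V \<omega> * A \<omega>) + q / 2 * (1 - q * a / 2) * (V \<omega> * (y \<omega>)\<^sup>2)"
          by (simp add: algebra_simps)
        ultimately show "V \<omega> - q / 2 * (V \<omega> * A \<omega>) + q / 2 * (1 - q * a / 2) * (V \<omega> * (y \<omega>)\<^sup>2)
           \<le> V \<omega> * (cosh (r * y \<omega>) * exp (- (r\<^sup>2 * A \<omega> / 2)))"
          using r by simp
      qed (use iV iVA iVy2 ich in auto)
      also have "\<dots> \<le> expectation V" by (rule ch)
      finally have le: "expectation (\<lambda>\<omega>. V \<omega> - q / 2 * (V \<omega> * A \<omega>) + q / 2 * (1 - q * a / 2) * (V \<omega> * (y \<omega>)\<^sup>2)) \<le> expectation V" .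
      have "expectation (\<lambda>\<omega>. V \<omega> - q / 2 * (V \<omega> * A \<omega>) + q / 2 * (1 - q * a / 2) * (V \<omega> * (y \<omega>)\<^sup>2))
        = expectation V - q / 2 * expectation (\<lambda>\<omega>. V \<omega> * A \<omega>) + q / 2 * (1 - q * a / 2) * expectation (\<lambda>\<omega>. V \<omega> * (y \<omega>)\<^sup>2)"
        using iV iVA iVy2 by simp
      moreover have "q / 2 * (w * e2 - ea) \<le> 0" if "x = e - q / 2 * ea + q / 2 * w * e2" "x \<le> e" for w e2 ea e x :: real
        using that by (simp add: right_diff_distrib)
      ultimately have "q / 2 * ((1 - q * a / 2) * expectation (\<lambda>\<omega>. V \<omega> * (y \<omega>)\<^sup>2) - expectation (\<lambda>\<omega>. V \<omega> * A \<omega>)) \<le> 0"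
        using le by blast
      then have "(1 - q * a / 2) * expectation (\<lambda>\<omega>. V \<omega> * (y \<omega>)\<^sup>2) - expectation (\<lambda>\<omega>. V \<omega> * A \<omega>) \<le> 0"
        using q by (simp add: mult_le_0_iff)
      then show ?thesis by (simp add: algebra_simps)
    qed
    from small[OF this] show ?thesis by simp
  qed
  show "expectation (\<lambda>\<omega>. V \<omega> * (y \<omega>) ^ 4) \<le> 24 * a\<^sup>2 * expectation V"
  proof -
    \<comment> \<open>With \<open>r\<^sup>2 = 1 / a\<close> the factor
      \<open>exp (- r\<^sup>2 A / 2)\<close> is at least one half, and the quartic term of
      \<open>cosh\<close> is \<open>y ^ 4 / (24 a\<^sup>2)\<close>. Dropping the quadratic term
      leaves the constant \<open>24\<close>.\<close>
    define r where "r = sqrt (1 / a)"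
    have r: "r\<^sup>2 = 1 / a" "r ^ 4 = 1 / a\<^sup>2"
      using a by (auto simp: r_def power_divide real_sqrt_divide) (simp add: eval_nat_numeral)
    have "expectation (\<lambda>\<omega>. 1 / 2 * V \<omega> + 1 / (48 * a\<^sup>2) * (V \<omega> * (y \<omega>) ^ 4))
      \<le> expectation (\<lambda>\<omega>. V \<omega> * (cosh (r * y \<omega>) * exp (- (r\<^sup>2 * A \<omega> / 2))))"
    proof (rule integral_mono)
      fix \<omega> assume \<omega>: "\<omega> \<in> space M"
      have "r\<^sup>2 * A \<omega> / 2 \<le> 1 / 2" unfolding r using A[OF \<omega>] a by simp
      then have h: "1 / 2 \<le> exp (- (r\<^sup>2 * A \<omega> / 2))" using e1[of "r\<^sup>2 * A \<omega> / 2"] by linarith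
      have "1 + (y \<omega>) ^ 4 / (24 * a\<^sup>2) \<le> 1 + (r * y \<omega>)\<^sup>2 / 2 + (r * y \<omega>) ^ 4 / 24"
      proof -
        have "(r * y \<omega>) ^ 4 / 24 = (y \<omega>) ^ 4 / (24 * a\<^sup>2)" unfolding power_mult_distrib r by simp
        then show ?thesis using zero_le_power2[of "r * y \<omega>"] by linarith
      qed
      then have "1 + (y \<omega>) ^ 4 / (24 * a\<^sup>2) \<le> cosh (r * y \<omega>)" using cosh_ge_quartic[of "r * y \<omega>"] by simp
      from mult_mono[OF this h] have "1 / 2 + 1 / (48 * a\<^sup>2) * (y \<omega>) ^ 4 \<le> cosh (r * y \<omega>) * exp (- (r\<^sup>2 * A \<omega> / 2))"
        by (simp add: algebra_simps)
      from mult_left_mono[OF this V(1)[OF \<omega>]]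
      show "1 / 2 * V \<omega> + 1 / (48 * a\<^sup>2) * (V \<omega> * (y \<omega>) ^ 4) \<le> V \<omega> * (cosh (r * y \<omega>) * exp (- (r\<^sup>2 * A \<omega> / 2)))"
        by (simp add: algebra_simps)
    qed (use iV iVy4 ich in auto)
    also have "\<dots> \<le> expectation V" by (rule ch)
    finally have "1 / (48 * a\<^sup>2) * expectation (\<lambda>\<omega>. V \<omega> * (y \<omega>) ^ 4) \<le> 1 / 2 * expectation V"
      using iV iVy4 by simp
    then show ?thesis using a by (simp add: field_simps)
  qed
qed

end

section \<open>Comparison with Brownian motion\<close>

lemma exp_le_cubic: "exp x \<le> 1 + x + x\<^sup>2 / 2 + exp \<bar>x\<bar> * \<bar>x\<bar> ^ 3" for x :: real
proof -
  obtain t where t: "\<bar>t\<bar> \<le> \<bar>x\<bar>" "exp x = (\<Sum>m<3. x ^ m / fact m) + exp t / fact 3 * x ^ 3"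
    using Maclaurin_exp_le[of x 3] by auto
  have "exp t / fact 3 * x ^ 3 \<le> exp \<bar>x\<bar> * \<bar>x\<bar> ^ 3"
  proof -
    have "exp t / fact 3 * x ^ 3 \<le> \<bar>exp t / fact 3 * x ^ 3\<bar>" by (rule abs_ge_self)
    also have "\<dots> = exp t / fact 3 * \<bar>x\<bar> ^ 3" by (simp add: abs_mult power_abs)
    also have "\<dots> \<le> exp \<bar>x\<bar> * \<bar>x\<bar> ^ 3"
    proof (rule mult_right_mono)
      have "exp t / fact 3 \<le> exp t" by (simp add: fact_numeral)
      also have "\<dots> \<le> exp \<bar>x\<bar>" using t by simp
      finally show "exp t / fact 3 \<le> exp \<bar>x\<bar>" .
    qed simp
    finally show ?thesis .
  qed
  moreover have "(\<Sum>m<3. x ^ m / fact m) = 1 + x + x\<^sup>2 / 2" by (simp add: eval_nat_numeral)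
  ultimately show ?thesis using t(2) by simp
qed

text \<open>Power mean inequality; \<open>9\<close> is sharp, as equal arguments show. It separates
  the three contributions to a cube, so that their moments can be bounded one by one.\<close>

lemma sum3_power3_le:
  fixes a b c :: real
  assumes "0 \<le> a" "0 \<le> b" "0 \<le> c"
  shows "(a + b + c) ^ 3 \<le> 9 * (a ^ 3 + b ^ 3 + c ^ 3)"
proof -
  have 1: "x\<^sup>2 * y + x * y\<^sup>2 \<le> x ^ 3 + y ^ 3" if "0 \<le> x" "0 \<le> y" for x y :: real
  proof -
    have "0 \<le> (x + y) * (x - y)\<^sup>2" using that by simp
    then show ?thesis by (simp add: power2_eq_square power3_eq_cube algebra_simps)
  qed
  have 2: "6 * (a * b * c) \<le> 2 * (a ^ 3 + b ^ 3 + c ^ 3)"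
  proof -
    have "0 \<le> (a + b + c) * ((a - b)\<^sup>2 + (b - c)\<^sup>2 + (c - a)\<^sup>2)" using assms by simp
    then show ?thesis by (simp add: power2_eq_square power3_eq_cube algebra_simps)
  qed
  have "(a + b + c) ^ 3 = a ^ 3 + b ^ 3 + c ^ 3 + 3 * (a\<^sup>2 * b + a * b\<^sup>2) + 3 * (b\<^sup>2 * c + b * c\<^sup>2) + 3 * (a\<^sup>2 * c + a * c\<^sup>2) + 6 * (a * b * c)"
    by (simp add: power2_eq_square power3_eq_cube algebra_simps)
  moreover have "u + v + w + 3 * p + 3 * q + 3 * s + 6 * t \<le> 9 * (u + v + w)"
    if "p \<le> u + v" "q \<le> v + w" "s \<le> u + w" "6 * t \<le> 2 * (u + v + w)" for u v w p q s t :: real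
    using that by argo
  ultimately show ?thesis using 1[OF assms(1,2)] 1[OF assms(2,3)] 1[OF assms(1,3)] 2 by simp
qed

text \<open>All the error terms below are of third order in \<open>e = \<bar>m\<bar> + \<bar>b\<bar> + sqrt h\<close>. The expansion rests on
  \<open>R' - R = (2 m + \<delta> h' - (R' - R)\<^sup>2) / (2 R)\<close> for \<open>R = sqrt (z + \<epsilon>)\<close>, \<open>R' = sqrt (z' + \<epsilon>)\<close>.\<close>

lemma exp_step_bound:
  fixes \<epsilon> \<gamma> \<delta> K :: real
  assumes pos: "0 < \<epsilon>" "0 < \<gamma>" "0 < \<delta>" "0 < K"
  shows "\<exists>C\<ge>0. \<forall>z z' b m h' h. 0 \<le> z \<and> z \<le> K \<and> 0 \<le> z' \<and> z' \<le> K \<and> \<bar>b\<bar> \<le> 2 * K \<and> 0 \<le> h' \<and> h' \<le> h \<and> h \<le> 1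
    \<and> z' - z = 2 * m + \<delta> * h' \<longrightarrow>
    exp (- \<gamma> * (sqrt (z' + \<epsilon>) - sqrt (z + \<epsilon>) - b)) \<le> 1 - \<gamma> * (m / sqrt (z + \<epsilon>) - b) + \<gamma> * m\<^sup>2 / (2 * sqrt (z + \<epsilon>) ^ 3)
      + \<gamma>\<^sup>2 / 2 * (m / sqrt (z + \<epsilon>) - b)\<^sup>2 - \<gamma> * \<delta> * h' / (2 * sqrt (z + \<epsilon>)) + C * (\<bar>m\<bar> ^ 3 + \<bar>b\<bar> ^ 3 + sqrt h ^ 3)"
proof -
  define r where "r = sqrt \<epsilon>"
  have r: "0 < r" using pos by (simp add: r_def)
  \<comment> \<open>A bound for \<open>e\<close>, from
    \<open>\<bar>m\<bar> \<le> (K + \<delta>) / 2\<close>, \<open>\<bar>b\<bar> \<le> 2 * K\<close>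
    and \<open>sqrt h \<le> 1\<close>. It converts surplus powers of \<open>e\<close> into
    constants.\<close>
  define E where "E = (K + \<delta>) / 2 + 2 * K + 1"
  have E: "0 < E" using pos by (simp add: E_def add_pos_pos)
  \<comment> \<open>The constants \<open>c1\<close> to \<open>c5\<close> bound, in this order,
    \<open>D / e\<close>, \<open>x1 / e ^ 3\<close>, \<open>w / e\<close>,
    \<open>q / e\<^sup>2\<close> and \<open>(w + q) / e\<close> for the quantities introduced below;
    \<open>r\<close> is a lower bound for both roots.\<close>
  define c1 where "c1 = (2 + \<delta> * E) / (2 * r)"
  define c2 where "c2 = \<gamma> / (2 * r) * ((\<delta> + \<delta>\<^sup>2 * E / 4) / r\<^sup>2 + c1 ^ 3 / r + c1 ^ 4 * E / (4 * r\<^sup>2))"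
  define c3 where "c3 = \<gamma> * (1 / r + 1)"
  define c4 where "c4 = \<gamma> * \<delta> / (2 * r) + \<gamma> / (2 * r ^ 3) + c2 * E"
  define c5 where "c5 = c3 + c4 * E"
  define C where "C = c2 + (2 * c3 * c4 + c4\<^sup>2 * E) / 2 + exp (c5 * E) * c5 ^ 3"
  have c: "0 \<le> c1" "0 \<le> c2" "0 \<le> c3" "0 \<le> c4" "0 \<le> c5"
    using pos r E unfolding c1_def c2_def c3_def c4_def c5_def
    by (intro add_nonneg_nonneg mult_nonneg_nonneg divide_nonneg_nonneg zero_le_power; simp)+
  have C: "0 \<le> C" unfolding C_def using c E by simp
  show ?thesis
  proof (intro exI[of _ "9 * C"] conjI allI impI)
    show "0 \<le> 9 * C" using C by simp
    fix z z' b m h' h :: real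
    assume A: "0 \<le> z \<and> z \<le> K \<and> 0 \<le> z' \<and> z' \<le> K \<and> \<bar>b\<bar> \<le> 2 * K \<and> 0 \<le> h' \<and> h' \<le> h \<and> h \<le> 1 \<and> z' - z = 2 * m + \<delta> * h'"
    define R where "R = sqrt (z + \<epsilon>)"
    define R' where "R' = sqrt (z' + \<epsilon>)"
    define D where "D = R' - R"
    define d where "d = 2 * m + \<delta> * h'"
    define e where "e = \<bar>m\<bar> + \<bar>b\<bar> + sqrt h"
    have R: "r \<le> R" "r \<le> R'" "0 < R" "0 < R'" using A pos by (auto simp: R_def R'_def r_def)
    have sq: "R\<^sup>2 = z + \<epsilon>" "R'\<^sup>2 = z' + \<epsilon>" using A pos by (auto simp: R_def R'_def)
    have h0: "0 \<le> h" "h' \<le> 1" using A by auto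
    have e0: "0 \<le> e" "\<bar>m\<bar> \<le> e" "\<bar>b\<bar> \<le> e" "sqrt h \<le> e" using h0 by (auto simp: e_def)
    have "h = (sqrt h)\<^sup>2" using h0 by simp
    also have "\<dots> \<le> e\<^sup>2" using e0 h0 by (intro power_mono) auto
    finally have he: "h' \<le> e\<^sup>2" using A by simp
    have mb: "\<bar>m\<bar> \<le> (K + \<delta>) / 2"
    proof -
      have "2 * m = (z' - z) - \<delta> * h'" "\<delta> * h' \<le> \<delta> * 1" "0 \<le> \<delta> * h'" using A pos h0 by (auto intro: mult_left_mono)
      moreover have "0 \<le> z" "z \<le> K" "0 \<le> z'" "z' \<le> K" using A by auto
      ultimately have "m \<le> (K + \<delta>) / 2" "- m \<le> (K + \<delta>) / 2" using pos by argo+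
      then show ?thesis by (simp add: abs_le_iff)
    qed
    have eE: "e \<le> E" using mb A h0 real_sqrt_le_1_iff[of h] unfolding e_def E_def by (smt (verit))
    have e2: "e\<^sup>2 \<le> E * e" unfolding power2_eq_square using eE e0 by (intro mult_right_mono)
    have e3: "e ^ 4 \<le> E * e ^ 3" using mult_right_mono[OF eE, of "e ^ 3"] e0 by (simp add: eval_nat_numeral)
    have e4: "e ^ 3 \<le> E * e\<^sup>2" using mult_right_mono[OF eE, of "e ^ 2"] e0 by (simp add: eval_nat_numeral)
    have DR: "D * (R + R') = d" using A sq by (simp add: D_def d_def power2_eq_square algebra_simps)
    have de: "\<bar>d\<bar> \<le> (2 + \<delta> * E) * e"
    proof -
      have "\<bar>d\<bar> \<le> 2 * \<bar>m\<bar> + \<delta> * h'"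
        using abs_triangle_ineq[of "2 * m" "\<delta> * h'"] A pos unfolding d_def by (simp add: abs_mult)
      also have "\<dots> \<le> 2 * e + \<delta> * (E * e)" using e0 he e2 pos by (intro add_mono mult_left_mono) auto
      finally show ?thesis by (simp add: algebra_simps)
    qed
    have De: "\<bar>D\<bar> \<le> c1 * e"
    proof -
      have "\<bar>D\<bar> * (2 * r) \<le> \<bar>D\<bar> * (R + R')" using R by (intro mult_left_mono) auto
      also have "\<dots> = \<bar>d\<bar>" using DR R by (simp flip: DR add: abs_mult)
      also note de
      finally show ?thesis using r unfolding c1_def by (simp add: field_simps)
    qed
    \<comment> \<open>\<open>w\<close> is the first-order part of the exponent; \<open>q\<close>
      consists of its second-order terms and the third-order remainder \<open>x1\<close>.\<close>
    define w where "w = - \<gamma> * (m / R - b)"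
    define x1 where "x1 = \<gamma> / (2 * R) * ((m * \<delta> * h' + \<delta>\<^sup>2 * h'\<^sup>2 / 4) / R\<^sup>2 - D ^ 3 / R - D ^ 4 / (4 * R\<^sup>2))"
    define q where "q = - \<gamma> * \<delta> * h' / (2 * R) + \<gamma> * m\<^sup>2 / (2 * R ^ 3) + x1"
    have key: "- \<gamma> * (D - b) = w + q"
    proof -
      have R'D: "R' = R + D" by (simp add: D_def)
      \<comment> \<open>Solving \<open>D * (2 * R + D) = d\<close> for its linear term leaves a
        multiple of \<open>D\<^sup>2\<close>, and squaring the same relation expands
        \<open>D\<^sup>2\<close> up to third order.\<close>
      have D2: "D = d / (2 * R) - D\<^sup>2 / (2 * R)" using DR R unfolding R'D by (simp add: field_simps power2_eq_square)
      have d2: "d\<^sup>2 = D\<^sup>2 * (2 * R + D)\<^sup>2" using DR unfolding R'D by (metis add.assoc mult_2 power_mult_distrib)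
      have "D\<^sup>2 = d\<^sup>2 / (4 * R\<^sup>2) - D ^ 3 / R - D ^ 4 / (4 * R\<^sup>2)"
        unfolding d2 using R by (simp add: field_simps power2_eq_square eval_nat_numeral)
      moreover have "d\<^sup>2 = 4 * m\<^sup>2 + 4 * (m * \<delta> * h' + \<delta>\<^sup>2 * h'\<^sup>2 / 4)"
        by (simp add: d_def power2_eq_square algebra_simps)
      ultimately have D3: "D\<^sup>2 = m\<^sup>2 / R\<^sup>2 + ((m * \<delta> * h' + \<delta>\<^sup>2 * h'\<^sup>2 / 4) / R\<^sup>2 - D ^ 3 / R - D ^ 4 / (4 * R\<^sup>2))"
        using R by (simp add: add_divide_distrib)
      have "- \<gamma> * (D - b) = - \<gamma> * (d / (2 * R) - b) + \<gamma> / (2 * R) * D\<^sup>2"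
        by (subst D2) (simp add: algebra_simps)
      also have "\<dots> = w + q"
        unfolding D3 w_def q_def x1_def d_def using R
        by (simp add: add_divide_distrib ring_distribs power2_eq_square power3_eq_cube)
      finally show ?thesis .
    qed
    have x1: "\<bar>x1\<bar> \<le> c2 * e ^ 3"
    proof -
      have a1: "\<bar>m * \<delta> * h'\<bar> \<le> \<delta> * e ^ 3"
      proof -
        have "\<bar>m\<bar> * h' \<le> e * e\<^sup>2" using e0 he A by (intro mult_mono) auto
        then have "\<delta> * (\<bar>m\<bar> * h') \<le> \<delta> * (e * e\<^sup>2)" using pos by (intro mult_left_mono) auto
        then show ?thesis using A pos by (simp add: abs_mult eval_nat_numeral mult_ac)
      qed
      have a2: "\<bar>\<delta>\<^sup>2 * h'\<^sup>2 / 4\<bar> \<le> \<delta>\<^sup>2 * E / 4 * e ^ 3"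
      proof -
        have "h'\<^sup>2 \<le> (e\<^sup>2)\<^sup>2" using he A by (intro power_mono) auto
        also have "\<dots> = e ^ 4" by simp
        also note e3
        finally have "\<delta>\<^sup>2 * h'\<^sup>2 \<le> \<delta>\<^sup>2 * (E * e ^ 3)" by (intro mult_left_mono) auto
        then show ?thesis by (simp add: mult_ac)
      qed
      have a3: "\<bar>D ^ 3 / R\<bar> \<le> c1 ^ 3 / r * e ^ 3"
      proof -
        have "\<bar>D\<bar> ^ 3 \<le> (c1 * e) ^ 3" using De by (intro power_mono) auto
        then have "\<bar>D\<bar> ^ 3 / R \<le> (c1 * e) ^ 3 / r" using R r c e0 by (intro frac_le) auto
        then show ?thesis using R by (simp add: power_abs power_mult_distrib)
      qed
      have a4: "\<bar>D ^ 4 / (4 * R\<^sup>2)\<bar> \<le> c1 ^ 4 * E / (4 * r\<^sup>2) * e ^ 3"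
      proof -
        have "\<bar>D\<bar> ^ 4 \<le> (c1 * e) ^ 4" using De by (intro power_mono) auto
        also have "\<dots> \<le> c1 ^ 4 * (E * e ^ 3)" unfolding power_mult_distrib using e3 by (intro mult_left_mono) auto
        finally have "\<bar>D\<bar> ^ 4 / (4 * R\<^sup>2) \<le> c1 ^ 4 * (E * e ^ 3) / (4 * r\<^sup>2)"
          using R r c e0 E by (intro frac_le mult_left_mono power_mono mult_nonneg_nonneg) auto
        then show ?thesis using R by (simp add: power_abs mult_ac)
      qed
      have a5: "\<bar>(m * \<delta> * h' + \<delta>\<^sup>2 * h'\<^sup>2 / 4) / R\<^sup>2\<bar> \<le> (\<delta> + \<delta>\<^sup>2 * E / 4) / r\<^sup>2 * e ^ 3"
      proof -
        have "\<bar>m * \<delta> * h' + \<delta>\<^sup>2 * h'\<^sup>2 / 4\<bar> \<le> (\<delta> + \<delta>\<^sup>2 * E / 4) * e ^ 3"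
          using a1 a2 abs_triangle_ineq[of "m * \<delta> * h'" "\<delta>\<^sup>2 * h'\<^sup>2 / 4"] by (simp add: distrib_right)
        then have "\<bar>m * \<delta> * h' + \<delta>\<^sup>2 * h'\<^sup>2 / 4\<bar> / R\<^sup>2 \<le> (\<delta> + \<delta>\<^sup>2 * E / 4) * e ^ 3 / r\<^sup>2"
          using R r pos E e0 by (intro frac_le power_mono) auto
        then show ?thesis using R by simp
      qed
      have "\<bar>(m * \<delta> * h' + \<delta>\<^sup>2 * h'\<^sup>2 / 4) / R\<^sup>2 - D ^ 3 / R - D ^ 4 / (4 * R\<^sup>2)\<bar>
        \<le> ((\<delta> + \<delta>\<^sup>2 * E / 4) / r\<^sup>2 + c1 ^ 3 / r + c1 ^ 4 * E / (4 * r\<^sup>2)) * e ^ 3" (is "\<bar>?a\<bar> \<le> ?b * e ^ 3")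
        unfolding distrib_right using a3 a4 a5 by linarith
      moreover have "\<gamma> / (2 * R) \<le> \<gamma> / (2 * r)" using R r pos by (intro divide_left_mono) auto
      ultimately have "\<gamma> / (2 * R) * \<bar>?a\<bar> \<le> \<gamma> / (2 * r) * (?b * e ^ 3)" using R r pos by (intro mult_mono) auto
      then show ?thesis unfolding x1_def c2_def using R pos by (simp add: abs_mult mult.assoc)
    qed
    have w: "\<bar>w\<bar> \<le> c3 * e"
    proof -
      have "\<bar>m\<bar> / R \<le> e / r" using R r e0 by (intro frac_le) auto
      then have "\<bar>m / R - b\<bar> \<le> (1 / r + 1) * e" using e0 R abs_triangle_ineq4[of "m / R" b] by (simp add: distrib_right)
      then have "\<gamma> * \<bar>m / R - b\<bar> \<le> \<gamma> * ((1 / r + 1) * e)" using pos by (intro mult_left_mono) auto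
      then show ?thesis unfolding w_def c3_def using pos by (simp add: abs_mult mult.assoc)
    qed
    have q: "\<bar>q\<bar> \<le> c4 * e\<^sup>2"
    proof -
      have "\<bar>- \<gamma> * \<delta> * h' / (2 * R)\<bar> \<le> \<gamma> * \<delta> / (2 * r) * e\<^sup>2"
      proof -
        have "\<gamma> * \<delta> * h' / (2 * R) \<le> \<gamma> * \<delta> * e\<^sup>2 / (2 * r)"
          using R r pos he A by (intro frac_le mult_left_mono) auto
        then show ?thesis using R pos A by (simp add: abs_mult)
      qed
      moreover have "\<bar>\<gamma> * m\<^sup>2 / (2 * R ^ 3)\<bar> \<le> \<gamma> / (2 * r ^ 3) * e\<^sup>2"
      proof -
        have "m\<^sup>2 \<le> e\<^sup>2" using e0 by (simp add: abs_le_square_iff[symmetric])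
        then have "\<gamma> * m\<^sup>2 / (2 * R ^ 3) \<le> \<gamma> * e\<^sup>2 / (2 * r ^ 3)"
          using R r pos by (intro frac_le mult_left_mono power_mono[of r R]) auto
        then show ?thesis using R pos by (simp add: abs_mult)
      qed
      moreover have "\<bar>x1\<bar> \<le> c2 * E * e\<^sup>2" using x1 mult_left_mono[OF e4 c(2)] by (simp add: mult.assoc)
      ultimately show ?thesis unfolding q_def c4_def distrib_right by linarith
    qed
    have z: "\<bar>w + q\<bar> \<le> c5 * e"
    proof -
      have "c4 * e\<^sup>2 \<le> c4 * (E * e)" using e2 c by (intro mult_left_mono)
      then show ?thesis using w q unfolding c5_def by (simp add: distrib_right mult.assoc)
    qed
    have z2: "(w + q)\<^sup>2 \<le> w\<^sup>2 + (2 * c3 * c4 + c4\<^sup>2 * E) * e ^ 3"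
    proof -
      have "w * q \<le> \<bar>w\<bar> * \<bar>q\<bar>" by (metis abs_ge_self abs_mult)
      also have "\<dots> \<le> (c3 * e) * (c4 * e\<^sup>2)" using w q c e0 by (intro mult_mono) auto
      finally have 1: "w * q \<le> c3 * c4 * e ^ 3" by (simp add: eval_nat_numeral mult_ac)
      have "q\<^sup>2 \<le> (c4 * e\<^sup>2)\<^sup>2" using q c by (intro abs_le_square_iff[THEN iffD1]) auto
      also have "\<dots> = c4\<^sup>2 * e ^ 4" by (simp add: power_mult_distrib)
      also have "\<dots> \<le> c4\<^sup>2 * (E * e ^ 3)" using e3 by (intro mult_left_mono) auto
      finally have 2: "q\<^sup>2 \<le> c4\<^sup>2 * E * e ^ 3" by (simp add: mult.assoc)
      have "(w + q)\<^sup>2 = w\<^sup>2 + 2 * (w * q) + q\<^sup>2" by (simp add: power2_sum)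
      then show ?thesis using 1 2 by (simp add: distrib_right)
    qed
    have z3: "exp \<bar>w + q\<bar> * \<bar>w + q\<bar> ^ 3 \<le> exp (c5 * E) * c5 ^ 3 * e ^ 3"
    proof -
      have "c5 * e \<le> c5 * E" using eE c by (intro mult_left_mono)
      then have "exp \<bar>w + q\<bar> \<le> exp (c5 * E)" using z by simp
      moreover have "\<bar>w + q\<bar> ^ 3 \<le> (c5 * e) ^ 3" using z by (intro power_mono) auto
      ultimately have "exp \<bar>w + q\<bar> * \<bar>w + q\<bar> ^ 3 \<le> exp (c5 * E) * (c5 * e) ^ 3" by (intro mult_mono) auto
      then show ?thesis by (simp add: power_mult_distrib mult.assoc)
    qed
    have w2: "w\<^sup>2 / 2 = \<gamma>\<^sup>2 / 2 * (m / R - b)\<^sup>2" by (simp add: w_def power_mult_distrib)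
    \<comment> \<open>Of the quadratic term only \<open>w\<^sup>2\<close> is kept. The mixed
      product, the square of \<open>q\<close> and the cubic remainder all go into the error of order
      \<open>e ^ 3\<close>.\<close>
    have "exp (w + q) \<le> 1 + (w + q) + (w + q)\<^sup>2 / 2 + exp \<bar>w + q\<bar> * \<bar>w + q\<bar> ^ 3" by (rule exp_le_cubic)
    also have "\<dots> \<le> 1 + (w + (- \<gamma> * \<delta> * h' / (2 * R) + \<gamma> * m\<^sup>2 / (2 * R ^ 3))) + w\<^sup>2 / 2 + C * e ^ 3"
    proof -
      have "C * e ^ 3 = c2 * e ^ 3 + (2 * c3 * c4 + c4\<^sup>2 * E) * e ^ 3 / 2 + exp (c5 * E) * c5 ^ 3 * e ^ 3"
        by (simp add: C_def distrib_right)
      moreover have "x1 \<le> c2 * e ^ 3" using x1 by (rule order_trans[OF abs_ge_self])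
      moreover have "q = (- \<gamma> * \<delta> * h' / (2 * R) + \<gamma> * m\<^sup>2 / (2 * R ^ 3)) + x1" by (rule q_def)
      ultimately show ?thesis using z2 z3 by argo
    qed
    also have "C * e ^ 3 \<le> C * (9 * (\<bar>m\<bar> ^ 3 + \<bar>b\<bar> ^ 3 + sqrt h ^ 3))"
      unfolding e_def using C h0 by (intro mult_left_mono sum3_power3_le) auto
    finally have "exp (- \<gamma> * (D - b)) \<le> 1 + (w + (- \<gamma> * \<delta> * h' / (2 * R) + \<gamma> * m\<^sup>2 / (2 * R ^ 3))) + w\<^sup>2 / 2 + C * (9 * (\<bar>m\<bar> ^ 3 + \<bar>b\<bar> ^ 3 + sqrt h ^ 3))"
      unfolding key by simp
    moreover have "exp (- \<gamma> * (sqrt (z' + \<epsilon>) - sqrt (z + \<epsilon>) - b)) \<le> 1 - \<gamma> * (m / sqrt (z + \<epsilon>) - b) + \<gamma> * m\<^sup>2 / (2 * sqrt (z + \<epsilon>) ^ 3)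
      + \<gamma>\<^sup>2 / 2 * (m / sqrt (z + \<epsilon>) - b)\<^sup>2 - \<gamma> * \<delta> * h' / (2 * sqrt (z + \<epsilon>)) + 9 * C * (\<bar>m\<bar> ^ 3 + \<bar>b\<bar> ^ 3 + sqrt h ^ 3)"
      if "exp (- \<gamma> * (D - b)) \<le> 1 + (w + (- \<gamma> * \<delta> * h' / (2 * R) + \<gamma> * m\<^sup>2 / (2 * R ^ 3))) + w\<^sup>2 / 2 + C * (9 * (\<bar>m\<bar> ^ 3 + \<bar>b\<bar> ^ 3 + sqrt h ^ 3))"
    proof -
      have eq: "1 - \<gamma> * (m / R - b) + \<gamma> * m\<^sup>2 / (2 * R ^ 3) + \<gamma>\<^sup>2 / 2 * (m / R - b)\<^sup>2 - \<gamma> * \<delta> * h' / (2 * R) + 9 * C * s =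
        1 + (w + (- \<gamma> * \<delta> * h' / (2 * R) + \<gamma> * m\<^sup>2 / (2 * R ^ 3))) + w\<^sup>2 / 2 + C * (9 * s)" for s
        unfolding w2 unfolding w_def by simp
      from ord_le_eq_trans[OF that eq[symmetric]] show ?thesis unfolding D_def R_def R'_def .
    qed
    ultimately show "exp (- \<gamma> * (sqrt (z' + \<epsilon>) - sqrt (z + \<epsilon>) - b)) \<le> 1 - \<gamma> * (m / sqrt (z + \<epsilon>) - b) + \<gamma> * m\<^sup>2 / (2 * sqrt (z + \<epsilon>) ^ 3)
      + \<gamma>\<^sup>2 / 2 * (m / sqrt (z + \<epsilon>) - b)\<^sup>2 - \<gamma> * \<delta> * h' / (2 * sqrt (z + \<epsilon>)) + 9 * C * (\<bar>m\<bar> ^ 3 + \<bar>b\<bar> ^ 3 + sqrt h ^ 3)"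
      by blast
  qed
qed

text \<open>With \<open>\<gamma> = 1 / sqrt \<epsilon>\<close> the drift on the left is nonpositive for \<open>x\<^sup>2 = z\<close>.\<close>

lemma bessel_drift_le:
  fixes \<epsilon> \<gamma> \<delta> z x K :: real
  assumes \<epsilon>: "0 < \<epsilon>" and \<gamma>: "\<gamma> = 1 / sqrt \<epsilon>" and \<delta>: "1 \<le> \<delta>" and z: "0 \<le> z" "z \<le> K" and x: "0 \<le> x" "x\<^sup>2 \<le> K"
  defines "R \<equiv> sqrt (z + \<epsilon>)"
  shows "\<gamma> / (2 * R ^ 3) * x\<^sup>2 + \<gamma>\<^sup>2 / 2 * (x / R - 1)\<^sup>2 - \<gamma> * \<delta> / (2 * R)
    \<le> (\<gamma> * sqrt K / sqrt \<epsilon> ^ 3 + \<gamma>\<^sup>2 / 2 * (2 * sqrt K / sqrt \<epsilon> + 2) / sqrt \<epsilon>) * sqrt \<bar>x\<^sup>2 - z\<bar>"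
proof -
  define y where "y = sqrt z"
  define r where "r = sqrt \<epsilon>"
  have K0: "0 \<le> K" using z by linarith
  have r: "0 < r" "\<gamma> = 1 / r" "0 < \<gamma>" using \<epsilon> \<gamma> by (auto simp: r_def)
  have R: "r \<le> R" "0 < R" "R\<^sup>2 = y\<^sup>2 + r\<^sup>2" "y \<le> R" using \<epsilon> z by (auto simp: R_def r_def y_def)
  have y: "0 \<le> y" "y\<^sup>2 = z" "y \<le> sqrt K" using z by (auto simp: y_def)
  have xK: "x \<le> sqrt K" using x by (simp add: real_le_rsqrt)
  \<comment> \<open>From \<open>R\<^sup>2 = y\<^sup>2 + r\<^sup>2\<close> one gets
    \<open>0 \<le> 1 - y / R \<le> r\<^sup>2 / R\<^sup>2\<close>. The choice
    \<open>\<gamma> = 1 / r\<close> makes the squared term at most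
    \<open>\<gamma> r\<^sup>2 / (2 R ^ 3)\<close>, which completes the first term to
    \<open>\<gamma> / (2 R)\<close>; here \<open>1 \<le> \<delta>\<close> enters.\<close>
  have 0: "\<gamma> / (2 * R ^ 3) * y\<^sup>2 + \<gamma>\<^sup>2 / 2 * (y / R - 1)\<^sup>2 - \<gamma> * \<delta> / (2 * R) \<le> 0"
  proof -
    have a: "0 \<le> 1 - y / R" using R by simp
    have b: "1 - y / R \<le> r\<^sup>2 / R\<^sup>2"
    proof -
      have "(R - y) * R \<le> (R - y) * (R + y)" using R y by (intro mult_left_mono) auto
      also have "\<dots> = r\<^sup>2" using R by (simp add: power2_eq_square algebra_simps)
      finally have "(R - y) * R / R\<^sup>2 \<le> r\<^sup>2 / R\<^sup>2" by (rule divide_right_mono) simp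
      moreover have "(R - y) * R / R\<^sup>2 = 1 - y / R" using R(2) by (simp add: power2_eq_square diff_divide_distrib)
      ultimately show ?thesis by simp
    qed
    have "(y / R - 1)\<^sup>2 = (1 - y / R)\<^sup>2" by (simp add: power2_commute)
    also have "\<dots> \<le> (r\<^sup>2 / R\<^sup>2)\<^sup>2" using a b by (intro power_mono)
    finally have "\<gamma>\<^sup>2 / 2 * (y / R - 1)\<^sup>2 \<le> \<gamma>\<^sup>2 / 2 * (r\<^sup>2 / R\<^sup>2)\<^sup>2" by (intro mult_left_mono) auto
    also have "\<dots> = \<gamma> / 2 * (r ^ 3 / R ^ 4)" using r by (simp add: power2_eq_square eval_nat_numeral)
    also have "\<dots> \<le> \<gamma> / 2 * (r\<^sup>2 / R ^ 3)"
    proof (intro mult_left_mono)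
      have "r ^ 3 / R ^ 4 = (r / R) * (r\<^sup>2 / R ^ 3)" by (simp add: eval_nat_numeral)
      also have "\<dots> \<le> 1 * (r\<^sup>2 / R ^ 3)" using R r by (intro mult_right_mono) auto
      finally show "r ^ 3 / R ^ 4 \<le> r\<^sup>2 / R ^ 3" by simp
    qed (use r in auto)
    finally have c: "\<gamma>\<^sup>2 / 2 * (y / R - 1)\<^sup>2 \<le> \<gamma> / 2 * (r\<^sup>2 / R ^ 3)" .
    have "\<gamma> / (2 * R ^ 3) * y\<^sup>2 + \<gamma> / 2 * (r\<^sup>2 / R ^ 3) = \<gamma> / (2 * R ^ 3) * R\<^sup>2"
      unfolding R(3) by (simp add: distrib_left)
    also have "\<dots> = \<gamma> * 1 / (2 * R)" using R(2) by (simp add: eval_nat_numeral)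
    also have "\<dots> \<le> \<gamma> * \<delta> / (2 * R)" using R(2) r \<delta> by (intro divide_right_mono mult_left_mono) auto
    finally show ?thesis using c by linarith
  qed
  \<comment> \<open>The root is Hoelder continuous with exponent one half. The drift is Lipschitz in
    \<open>x\<close> on \<open>[0, sqrt K]\<close>, so replacing \<open>y\<close> by
    \<open>x\<close> costs a multiple of \<open>sqrt \<bar>x\<^sup>2 - z\<bar>\<close>.\<close>
  have 1: "\<bar>x - y\<bar> \<le> sqrt \<bar>x\<^sup>2 - z\<bar>"
  proof (rule real_le_rsqrt)
    have "\<bar>x - y\<bar> * \<bar>x - y\<bar> \<le> \<bar>x - y\<bar> * (x + y)" using x y by (intro mult_left_mono) auto
    also have "\<dots> = \<bar>(x - y) * (x + y)\<bar>" using x y by (simp add: abs_mult)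
    also have "(x - y) * (x + y) = x\<^sup>2 - z" using y by (simp add: power2_eq_square algebra_simps)
    finally show "\<bar>x - y\<bar>\<^sup>2 \<le> \<bar>x\<^sup>2 - z\<bar>" by (simp add: power2_eq_square)
  qed
  have 2: "\<gamma> / (2 * R ^ 3) * x\<^sup>2 - \<gamma> / (2 * R ^ 3) * y\<^sup>2 \<le> \<gamma> * sqrt K / r ^ 3 * \<bar>x - y\<bar>"
  proof -
    have "x\<^sup>2 - y\<^sup>2 = (x - y) * (x + y)" by (simp add: power2_eq_square algebra_simps)
    also have "\<dots> \<le> \<bar>x - y\<bar> * (2 * sqrt K)" using x y xK K0 by (intro mult_mono) auto
    finally have "\<gamma> / (2 * R ^ 3) * (x\<^sup>2 - y\<^sup>2) \<le> \<gamma> / (2 * R ^ 3) * (\<bar>x - y\<bar> * (2 * sqrt K))" using r R by (intro mult_left_mono) auto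
    also have "\<dots> \<le> \<gamma> / (2 * r ^ 3) * (\<bar>x - y\<bar> * (2 * sqrt K))"
      using r R K0 by (intro mult_right_mono divide_left_mono mult_left_mono power_mono mult_pos_pos zero_less_power) auto
    finally show ?thesis unfolding right_diff_distrib by (simp add: mult_ac)
  qed
  have 3: "(x / R - 1)\<^sup>2 - (y / R - 1)\<^sup>2 \<le> (2 * sqrt K / r + 2) / r * \<bar>x - y\<bar>"
  proof -
    have "(x / R - 1)\<^sup>2 - (y / R - 1)\<^sup>2 = ((x - y) / R) * ((x + y) / R - 2)"
      by (simp add: algebra_simps power2_eq_square add_divide_distrib diff_divide_distrib)
    also have "\<dots> \<le> \<bar>(x - y) / R\<bar> * \<bar>(x + y) / R - 2\<bar>" by (metis abs_ge_self abs_mult)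
    also have "\<dots> \<le> (\<bar>x - y\<bar> / r) * (2 * sqrt K / r + 2)"
    proof (rule mult_mono)
      show "\<bar>(x - y) / R\<bar> \<le> \<bar>x - y\<bar> / r" using R r by (simp add: frac_le)
      have "(x + y) / R \<le> 2 * sqrt K / r" using x y xK R r K0 by (intro frac_le) auto
      moreover have "0 \<le> (x + y) / R" using x y R by simp
      ultimately show "\<bar>(x + y) / R - 2\<bar> \<le> 2 * sqrt K / r + 2" by linarith
    qed (use r K0 in auto)
    finally show ?thesis by (simp add: mult_ac)
  qed
  have 4: "\<gamma>\<^sup>2 / 2 * (x / R - 1)\<^sup>2 - \<gamma>\<^sup>2 / 2 * (y / R - 1)\<^sup>2 \<le> \<gamma>\<^sup>2 / 2 * ((2 * sqrt K / r + 2) / r * \<bar>x - y\<bar>)"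
    unfolding right_diff_distrib[symmetric] using 3 by (intro mult_left_mono) auto
  have "\<gamma> / (2 * R ^ 3) * x\<^sup>2 + \<gamma>\<^sup>2 / 2 * (x / R - 1)\<^sup>2 - \<gamma> * \<delta> / (2 * R)
    \<le> (\<gamma> * sqrt K / r ^ 3 + \<gamma>\<^sup>2 / 2 * (2 * sqrt K / r + 2) / r) * \<bar>x - y\<bar>"
    using 0 2 4 by (simp add: distrib_right mult.assoc)
  also have "\<dots> \<le> (\<gamma> * sqrt K / r ^ 3 + \<gamma>\<^sup>2 / 2 * (2 * sqrt K / r + 2) / r) * sqrt \<bar>x\<^sup>2 - z\<bar>"
  proof (rule mult_left_mono[OF 1])
    show "0 \<le> \<gamma> * sqrt K / r ^ 3 + \<gamma>\<^sup>2 / 2 * (2 * sqrt K / r + 2) / r"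
      using r(1,3) K0 by (intro add_nonneg_nonneg mult_nonneg_nonneg divide_nonneg_nonneg) auto
  qed
  finally show ?thesis by (simp add: r_def)
qed

section \<open>The processes stopped while they are bounded\<close>

context squared_bessel
begin

lemma bracket_cmult: "bracket (\<lambda>\<omega>. r * l \<omega>) (\<lambda>\<omega>. r * \<theta> \<omega>) p t \<omega> = r\<^sup>2 * bracket l \<theta> p t \<omega>"
proof -
  have "(r * l \<omega> * sqrt (Z s \<omega>) + r * \<theta> \<omega>)\<^sup>2 = r\<^sup>2 * (l \<omega> * sqrt (Z s \<omega>) + \<theta> \<omega>)\<^sup>2" for s
    by (simp add: power_mult_distrib[symmetric] algebra_simps)
  then show ?thesis unfolding bracket_def by simp
qed

lemma measurable_min_stopped:
  fixes Y :: "real \<Rightarrow> 'a \<Rightarrow> real"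
  assumes "stopping \<sigma>" "0 \<le> t" and Y: "\<And>u. 0 \<le> u \<Longrightarrow> u \<le> t \<Longrightarrow> Y u \<in> borel_measurable (F u)"
    and cont: "\<And>\<omega>. \<omega> \<in> space M \<Longrightarrow> continuous_on {0..t} (\<lambda>u. Y u \<omega>)"
  shows "(\<lambda>\<omega>. Y (min t (\<sigma> \<omega>)) \<omega>) \<in> borel_measurable (F t)"
proof -
  have "(\<lambda>\<omega>. Y (min t (max 0 (\<sigma> \<omega>))) \<omega>) \<in> borel_measurable (F t)"
    by (rule measurable_stopped[OF assms(1) _ assms(2) Y cont]) auto
  moreover have "max 0 (\<sigma> \<omega>) = \<sigma> \<omega>" if "\<omega> \<in> space (F t)" for \<omega>
    using assms(1) that space_F[OF assms(2)] unfolding stopping_def by auto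
  ultimately show ?thesis by (subst measurable_cong[where g="\<lambda>\<omega>. Y (min t (max 0 (\<sigma> \<omega>))) \<omega>"]) auto
qed

end

text \<open>Localisation. Up to and including \<open>\<sigma>\<close> both \<open>Z\<close> and
  \<open>B\<close> are bounded, so the increments of the stopped processes are bounded and have all
  moments. The intended \<open>\<sigma>\<close> is the first time at which either of them reaches a
  high level, cut off at a finite horizon.\<close>

locale stopped_bessel = squared_bessel M F B Z \<delta> x0
  for M :: "'a measure" and F :: "real \<Rightarrow> 'a measure" and B Z :: "real \<Rightarrow> 'a \<Rightarrow> real" and \<delta> x0 :: real +
  fixes \<sigma> :: "'a \<Rightarrow> real" and K :: real
  assumes \<sigma>: "stopping \<sigma>" and K: "0 < K"
    and bound: "\<And>\<omega> s. \<omega> \<in> space M \<Longrightarrow> 0 \<le> s \<Longrightarrow> s \<le> \<sigma> \<omega> \<Longrightarrow> Z s \<omega> \<le> K \<and> \<bar>B s \<omega>\<bar> \<le> K"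
begin

abbreviation "Zs \<equiv> \<lambda>t \<omega>. Z (min t (\<sigma> \<omega>)) \<omega>"
abbreviation "Bs \<equiv> \<lambda>t \<omega>. B (min t (\<sigma> \<omega>)) \<omega>"
abbreviation "Ns \<equiv> \<lambda>t \<omega>. N (min t (\<sigma> \<omega>)) \<omega>"

lemma sigma_nonneg: "\<omega> \<in> space M \<Longrightarrow> 0 \<le> \<sigma> \<omega>"
  using \<sigma> unfolding stopping_def by blast

lemma Z_cont_Icc: "\<omega> \<in> space M \<Longrightarrow> continuous_on {0..t} (\<lambda>s. Z s \<omega>)"
  by (rule continuous_on_subset[OF Z_continuous]) auto

lemma B_cont_Icc: "\<omega> \<in> space M \<Longrightarrow> continuous_on {0..t} (\<lambda>s. B s \<omega>)"
  by (rule continuous_on_subset[OF continuous]) auto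

lemma N_cont_Icc: "\<omega> \<in> space M \<Longrightarrow> continuous_on {0..t} (\<lambda>s. N s \<omega>)"
  unfolding N_def by (intro continuous_intros Z_cont_Icc) auto

lemma measurable_Zs: "0 \<le> t \<Longrightarrow> Zs t \<in> borel_measurable (F t)"
  by (rule measurable_min_stopped[OF \<sigma>]) (auto intro: Z_adapted Z_cont_Icc)

lemma measurable_Bs: "0 \<le> t \<Longrightarrow> Bs t \<in> borel_measurable (F t)"
  by (rule measurable_min_stopped[OF \<sigma>]) (auto intro: adapted B_cont_Icc)

lemma measurable_Ns: "0 \<le> t \<Longrightarrow> Ns t \<in> borel_measurable (F t)"
  by (rule measurable_min_stopped[OF \<sigma>]) (auto intro: measurable_N N_cont_Icc)

lemma Zs_bounds: "\<omega> \<in> space M \<Longrightarrow> 0 \<le> t \<Longrightarrow> 0 \<le> Zs t \<omega> \<and> Zs t \<omega> \<le> K"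
  using bound[of \<omega> "min t (\<sigma> \<omega>)"] Z_nonneg[of \<omega> "min t (\<sigma> \<omega>)"] sigma_nonneg[of \<omega>] by auto

lemma Bs_bounds: "\<omega> \<in> space M \<Longrightarrow> 0 \<le> t \<Longrightarrow> \<bar>Bs t \<omega>\<bar> \<le> K"
  using bound[of \<omega> "min t (\<sigma> \<omega>)"] sigma_nonneg[of \<omega>] by auto

text \<open>The bound comes from the equation, which expresses \<open>N\<close> by \<open>Z\<close>
  and the time, and not from any estimate of a stochastic integral.\<close>

lemma Ns_diff_bound:
  assumes "\<omega> \<in> space M" "0 \<le> p" "p \<le> t"
  shows "\<bar>Ns t \<omega> - Ns p \<omega>\<bar> \<le> (K + \<bar>\<delta>\<bar> * (t - p)) / 2"
proof -
  have "\<bar>\<delta> * (min t (\<sigma> \<omega>) - min p (\<sigma> \<omega>))\<bar> \<le> \<bar>\<delta>\<bar> * (t - p)"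
    unfolding abs_mult using assms by (intro mult_left_mono) auto
  moreover have "\<bar>Zs t \<omega> - Zs p \<omega>\<bar> \<le> K" using Zs_bounds[OF assms(1), of t] Zs_bounds[OF assms(1), of p] assms by auto
  moreover have "\<bar>2 * (Ns t \<omega> - Ns p \<omega>)\<bar> \<le> \<bar>Zs t \<omega> - Zs p \<omega>\<bar> + \<bar>\<delta> * (min t (\<sigma> \<omega>) - min p (\<sigma> \<omega>))\<bar>"
  proof -
    have "2 * (Ns t \<omega> - Ns p \<omega>) = (Zs t \<omega> - Zs p \<omega>) - \<delta> * (min t (\<sigma> \<omega>) - min p (\<sigma> \<omega>))"
      unfolding N_def by (simp add: field_simps)
    then show ?thesis by (metis abs_triangle_ineq4)
  qed
  ultimately have "2 * \<bar>Ns t \<omega> - Ns p \<omega>\<bar> \<le> K + \<bar>\<delta>\<bar> * (t - p)" unfolding abs_mult by simp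
  then show ?thesis by simp
qed

lemma measurable_bracket_stopped:
  assumes pt: "0 \<le> p" "p \<le> t" and l: "l \<in> borel_measurable (F p)" and \<theta>: "\<theta> \<in> borel_measurable (F p)"
  shows "(\<lambda>\<omega>. bracket l \<theta> (min p (\<sigma> \<omega>)) (min t (\<sigma> \<omega>)) \<omega>) \<in> borel_measurable (F t)"
proof -
  have "(\<lambda>\<omega>. bracket l \<theta> p (min t (max p (\<sigma> \<omega>))) \<omega>) \<in> borel_measurable (F t)"
  proof (rule measurable_stopped[OF \<sigma> pt])
    show "bracket l \<theta> p u \<in> borel_measurable (F u)" if "p \<le> u" "u \<le> t" for u
      using measurable_bracket[of p u l \<theta>] measurable_F_mono[OF pt(1) that(1)] l \<theta> pt that by auto
    show "continuous_on {p..t} (\<lambda>u. bracket l \<theta> p u \<omega>)" if "\<omega> \<in> space M" for \<omega>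
      unfolding bracket_def by (intro indefinite_integral_continuous_1 integrable_continuous_real continuous_integrand that pt)
  qed
  moreover have "bracket l \<theta> p (min t (max p (\<sigma> \<omega>))) \<omega> = bracket l \<theta> (min p (\<sigma> \<omega>)) (min t (\<sigma> \<omega>)) \<omega>" for \<omega>
  proof (cases "\<sigma> \<omega> \<le> p")
    case True
    then have "min t (max p (\<sigma> \<omega>)) = p" "min t (\<sigma> \<omega>) = \<sigma> \<omega>" "min p (\<sigma> \<omega>) = \<sigma> \<omega>" using pt by auto
    then show ?thesis by simp
  next
    case False
    then have "min t (max p (\<sigma> \<omega>)) = min t (\<sigma> \<omega>)" "min p (\<sigma> \<omega>) = p" using pt by auto
    then show ?thesis by simp
  qed
  ultimately show ?thesis by simp
qed

text \<open>Scaling \<open>l\<close> and \<open>\<theta>\<close> by \<open>r\<close> multiplies the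
  bracket by \<open>r\<^sup>2\<close>, which is the form required by \<open>exp_le_moments\<close>;
  the deterministic bound \<open>a\<close> uses \<open>sqrt Z \<le> sqrt K\<close> up to
  \<open>\<sigma>\<close>. As \<open>V\<close> is arbitrary, the increment \<open>y\<close> has
  conditional mean zero, a conditional second moment dominated by the bracket and a fourth moment of
  order \<open>(t - p)\<^sup>2\<close>.\<close>

lemma stopped_moments:
  assumes pt: "0 \<le> p" "p < t" and l: "l \<in> borel_measurable (F p)" "\<And>\<omega>. \<omega> \<in> space M \<Longrightarrow> \<bar>l \<omega>\<bar> \<le> L"
    and \<theta>: "\<theta> \<in> borel_measurable (F p)" "\<And>\<omega>. \<omega> \<in> space M \<Longrightarrow> \<bar>\<theta> \<omega>\<bar> \<le> L" and L: "0 < L"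
    and V: "V \<in> borel_measurable (F p)" "\<And>\<omega>. \<omega> \<in> space M \<Longrightarrow> 0 \<le> V \<omega>" "\<And>\<omega>. \<omega> \<in> space M \<Longrightarrow> V \<omega> \<le> v"
  defines "y \<equiv> \<lambda>\<omega>. l \<omega> * (Ns t \<omega> - Ns p \<omega>) + \<theta> \<omega> * (Bs t \<omega> - Bs p \<omega>)"
    and "a \<equiv> (L * sqrt K + L)\<^sup>2 * (t - p)"
  shows "expectation (\<lambda>\<omega>. V \<omega> * y \<omega>) = 0"
    and "expectation (\<lambda>\<omega>. V \<omega> * (y \<omega>)\<^sup>2) \<le> expectation (\<lambda>\<omega>. V \<omega> * bracket l \<theta> (min p (\<sigma> \<omega>)) (min t (\<sigma> \<omega>)) \<omega>)"
    and "expectation (\<lambda>\<omega>. V \<omega> * (y \<omega>) ^ 4) \<le> 24 * a\<^sup>2 * expectation V"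
    and "\<And>\<omega>. \<omega> \<in> space M \<Longrightarrow> bracket l \<theta> (min p (\<sigma> \<omega>)) (min t (\<sigma> \<omega>)) \<omega> \<le> a"
proof -
  let ?A = "\<lambda>\<omega>. bracket l \<theta> (min p (\<sigma> \<omega>)) (min t (\<sigma> \<omega>)) \<omega>"
  have t0: "0 \<le> t" "p \<le> t" using pt by auto
  have [measurable]: "l \<in> borel_measurable M" "\<theta> \<in> borel_measurable M" and VM: "V \<in> borel_measurable M"
    using l(1) \<theta>(1) V(1) by (auto intro: measurable_F_M[OF pt(1)])
  have [measurable]: "Ns t \<in> borel_measurable M" "Ns p \<in> borel_measurable M" "Bs t \<in> borel_measurable M" "Bs p \<in> borel_measurable M"
    using measurable_F_M[OF t0(1) measurable_Ns[OF t0(1)]] measurable_F_M[OF pt(1) measurable_Ns[OF pt(1)]]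
      measurable_F_M[OF t0(1) measurable_Bs[OF t0(1)]] measurable_F_M[OF pt(1) measurable_Bs[OF pt(1)]] by auto
  have ym: "y \<in> borel_measurable M" unfolding y_def by measurable
  have Am: "?A \<in> borel_measurable M"
    using measurable_F_M[OF t0(1) measurable_bracket_stopped[OF pt(1) t0(2) l(1) \<theta>(1)]] .
  show A: "?A \<omega> \<le> a" if \<omega>: "\<omega> \<in> space M" for \<omega>
  proof -
    have s0: "0 \<le> \<sigma> \<omega>" using sigma_nonneg[OF \<omega>] .
    have "?A \<omega> \<le> (L * sqrt K + L)\<^sup>2 * (min t (\<sigma> \<omega>) - min p (\<sigma> \<omega>))"
    proof (rule bracket_le[OF \<omega>])
      fix s assume s: "min p (\<sigma> \<omega>) \<le> s" "s \<le> min t (\<sigma> \<omega>)"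
      then have "0 \<le> s" "s \<le> \<sigma> \<omega>" using pt s0 by auto
      then have "sqrt (Z s \<omega>) \<le> sqrt K" "0 \<le> sqrt (Z s \<omega>)" using bound[OF \<omega>, of s] Z_nonneg[OF \<omega>, of s] by auto
      then have "\<bar>l \<omega> * sqrt (Z s \<omega>)\<bar> \<le> L * sqrt K" unfolding abs_mult using l(2)[OF \<omega>] L by (intro mult_mono) auto
      then have "\<bar>l \<omega> * sqrt (Z s \<omega>) + \<theta> \<omega>\<bar> \<le> L * sqrt K + L" using \<theta>(2)[OF \<omega>] by linarith
      from power_mono[OF this, of 2] show "(l \<omega> * sqrt (Z s \<omega>) + \<theta> \<omega>)\<^sup>2 \<le> (L * sqrt K + L)\<^sup>2" by simp
    qed (use pt s0 in auto)
    also have "\<dots> \<le> a" unfolding a_def using pt by (intro mult_left_mono) auto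
    finally show ?thesis .
  qed
  have a0: "0 < a" unfolding a_def using L K pt by (intro mult_pos_pos zero_less_power add_pos_pos) auto
  have yb: "\<bar>y \<omega>\<bar> \<le> L * ((K + \<bar>\<delta>\<bar> * (t - p)) / 2) + L * (2 * K)" if \<omega>: "\<omega> \<in> space M" for \<omega>
  proof -
    have "\<bar>l \<omega> * (Ns t \<omega> - Ns p \<omega>)\<bar> \<le> L * ((K + \<bar>\<delta>\<bar> * (t - p)) / 2)"
      unfolding abs_mult using l(2)[OF \<omega>] Ns_diff_bound[OF \<omega> pt(1) t0(2)] L by (intro mult_mono) auto
    moreover have "\<bar>\<theta> \<omega> * (Bs t \<omega> - Bs p \<omega>)\<bar> \<le> L * (2 * K)"
      unfolding abs_mult using \<theta>(2)[OF \<omega>] Bs_bounds[OF \<omega> t0(1)] Bs_bounds[OF \<omega> pt(1)] L by (intro mult_mono) auto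
    ultimately show ?thesis unfolding y_def by linarith
  qed
  have le: "(\<integral>\<^sup>+\<omega>. ennreal (V \<omega> * exp (r * y \<omega> - r\<^sup>2 * ?A \<omega> / 2)) \<partial>M) \<le> (\<integral>\<^sup>+\<omega>. ennreal (V \<omega>) \<partial>M)" for r
  proof -
    have "(\<integral>\<^sup>+\<omega>. ennreal (V \<omega> * exp (r * l \<omega> * (Ns t \<omega> - Ns p \<omega>) + r * \<theta> \<omega> * (Bs t \<omega> - Bs p \<omega>)
      - bracket (\<lambda>\<omega>. r * l \<omega>) (\<lambda>\<omega>. r * \<theta> \<omega>) (min p (\<sigma> \<omega>)) (min t (\<sigma> \<omega>)) \<omega> / 2)) \<partial>M) \<le> (\<integral>\<^sup>+\<omega>. ennreal (V \<omega>) \<partial>M)"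
    proof (rule N_exp_stopped_le[OF \<sigma> pt(1) t0(2) _ _ _ V(1,2)])
      show "\<bar>r * l \<omega>\<bar> \<le> \<bar>r\<bar> * L" if "\<omega> \<in> space M" for \<omega>
        unfolding abs_mult using l(2)[OF that] by (intro mult_left_mono) auto
    qed (use l \<theta> in auto)
    then show ?thesis unfolding bracket_cmult y_def by (simp add: distrib_left mult.assoc)
  qed
  note R = exp_le_moments[OF ym Am VM V(2,3) bracket_nonneg A a0 yb le]
  show "expectation (\<lambda>\<omega>. V \<omega> * y \<omega>) = 0" by (rule R(1))
  show "expectation (\<lambda>\<omega>. V \<omega> * (y \<omega>)\<^sup>2) \<le> expectation (\<lambda>\<omega>. V \<omega> * ?A \<omega>)" by (rule R(2))
  show "expectation (\<lambda>\<omega>. V \<omega> * (y \<omega>) ^ 4) \<le> 24 * a\<^sup>2 * expectation V" by (rule R(3))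
qed

end

section \<open>Bounded random variables and interpolation between powers\<close>

context prob_space
begin

text \<open>A class closed under the ring operations, so that integrability of the long polynomial
  expressions below follows by rules instead of explicit bounds.\<close>

definition bounded_rv :: "('a \<Rightarrow> real) \<Rightarrow> bool" where
  "bounded_rv f \<longleftrightarrow> f \<in> borel_measurable M \<and> (\<exists>c. \<forall>\<omega>\<in>space M. \<bar>f \<omega>\<bar> \<le> c)"

lemma bounded_rvI: "f \<in> borel_measurable M \<Longrightarrow> (\<And>\<omega>. \<omega> \<in> space M \<Longrightarrow> \<bar>f \<omega>\<bar> \<le> c) \<Longrightarrow> bounded_rv f"
  unfolding bounded_rv_def by blast

lemma bounded_rv_measurable: "bounded_rv f \<Longrightarrow> f \<in> borel_measurable M"
  unfolding bounded_rv_def by blast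

lemma bounded_rv_integrable: "bounded_rv f \<Longrightarrow> integrable M f"
proof -
  assume f: "bounded_rv f"
  then obtain c where "\<And>\<omega>. \<omega> \<in> space M \<Longrightarrow> \<bar>f \<omega>\<bar> \<le> c" unfolding bounded_rv_def by blast
  then show ?thesis using f unfolding bounded_rv_def by (intro integrable_const_bound[of _ c] AE_I2) auto
qed

lemma bounded_rv_const: "bounded_rv (\<lambda>_. c)"
  by (rule bounded_rvI[of _ "\<bar>c\<bar>"]) auto

lemma bounded_rv_add: "bounded_rv f \<Longrightarrow> bounded_rv g \<Longrightarrow> bounded_rv (\<lambda>\<omega>. f \<omega> + g \<omega>)"
proof -
  assume fg: "bounded_rv f" "bounded_rv g"
  then obtain c d where cd: "\<And>\<omega>. \<omega> \<in> space M \<Longrightarrow> \<bar>f \<omega>\<bar> \<le> c" "\<And>\<omega>. \<omega> \<in> space M \<Longrightarrow> \<bar>g \<omega>\<bar> \<le> d"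
    unfolding bounded_rv_def by blast
  have "\<bar>f \<omega> + g \<omega>\<bar> \<le> c + d" if "\<omega> \<in> space M" for \<omega>
    using cd[OF that] by (intro order_trans[OF abs_triangle_ineq add_mono])
  then show ?thesis by (rule bounded_rvI[OF borel_measurable_add[OF fg[THEN bounded_rv_measurable]]])
qed

lemma bounded_rv_mult: "bounded_rv f \<Longrightarrow> bounded_rv g \<Longrightarrow> bounded_rv (\<lambda>\<omega>. f \<omega> * g \<omega>)"
proof -
  assume fg: "bounded_rv f" "bounded_rv g"
  then obtain c d where cd: "\<And>\<omega>. \<omega> \<in> space M \<Longrightarrow> \<bar>f \<omega>\<bar> \<le> c" "\<And>\<omega>. \<omega> \<in> space M \<Longrightarrow> \<bar>g \<omega>\<bar> \<le> d"
    unfolding bounded_rv_def by blast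
  have "\<bar>f \<omega> * g \<omega>\<bar> \<le> c * d" if "\<omega> \<in> space M" for \<omega>
    unfolding abs_mult using cd[OF that] by (intro mult_mono) (auto intro: order_trans[OF abs_ge_zero])
  then show ?thesis by (rule bounded_rvI[OF borel_measurable_times[OF fg[THEN bounded_rv_measurable]]])
qed

lemma bounded_rv_diff: "bounded_rv f \<Longrightarrow> bounded_rv g \<Longrightarrow> bounded_rv (\<lambda>\<omega>. f \<omega> - g \<omega>)"
  using bounded_rv_add[of f "\<lambda>\<omega>. -1 * g \<omega>"] bounded_rv_mult[of "\<lambda>_. -1" g] bounded_rv_const by simp

lemma bounded_rv_power: "bounded_rv f \<Longrightarrow> bounded_rv (\<lambda>\<omega>. f \<omega> ^ n)"
  by (induction n) (auto intro: bounded_rv_const bounded_rv_mult)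

lemma bounded_rv_abs: "bounded_rv f \<Longrightarrow> bounded_rv (\<lambda>\<omega>. \<bar>f \<omega>\<bar>)"
  unfolding bounded_rv_def by auto

lemmas bounded_rv_intros = bounded_rv_const bounded_rv_add bounded_rv_mult bounded_rv_diff bounded_rv_power bounded_rv_abs

end

text \<open>Makes third moments accessible through second and fourth ones. For increments over a
  step of width \<open>k ^ 4\<close>, both summands have mean of order \<open>k ^ 6\<close>.\<close>

lemma abs_power3_le:
  fixes k m :: real assumes "0 < k"
  shows "\<bar>m\<bar> ^ 3 \<le> m ^ 4 / k\<^sup>2 + k\<^sup>2 * m\<^sup>2"
proof -
  have "0 \<le> (m\<^sup>2 / k - k * \<bar>m\<bar>)\<^sup>2" by simp
  also have "\<dots> = m ^ 4 / k\<^sup>2 + k\<^sup>2 * m\<^sup>2 - 2 * \<bar>m\<bar> ^ 3"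
    using assms by (simp add: power2_diff power_divide power_mult_distrib) (simp add: power2_eq_square power3_eq_cube)
  finally have "2 * \<bar>m\<bar> ^ 3 \<le> m ^ 4 / k\<^sup>2 + k\<^sup>2 * m\<^sup>2" by simp
  moreover have "0 \<le> \<bar>m\<bar> ^ 3" by simp
  ultimately show ?thesis by linarith
qed

text \<open>Follows from \<open>(sqrt x - k)\<^sup>2 \<ge> 0\<close>. The free parameter lets the
  mean of a root be bounded by the mean of its argument.\<close>

lemma sqrt_le_linear: "0 < k \<Longrightarrow> 0 \<le> x \<Longrightarrow> sqrt x \<le> k + x / k" for k x :: real
proof -
  assume k: "0 < k" "0 \<le> x"
  have "0 \<le> (sqrt x - k)\<^sup>2" by simp
  also have "\<dots> = x - 2 * k * sqrt x + k\<^sup>2" using k by (simp add: power2_diff mult.commute)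
  finally have "k * (2 * sqrt x) \<le> k * (k + x / k)" using k by (simp add: distrib_left power2_eq_square)
  then have "2 * sqrt x \<le> k + x / k" using k by (simp only: mult_le_cancel_left_pos)
  then show ?thesis using k real_sqrt_ge_zero[OF k(2)] by linarith
qed

section \<open>The error of freezing \<open>Z\<close> at the left end of a step\<close>

context stopped_bessel
begin

lemma measurable_sigma: "\<sigma> \<in> borel_measurable M"
proof (rule borel_measurableI_le)
  fix u :: real
  show "{\<omega> \<in> space M. \<sigma> \<omega> \<le> u} \<in> events"
  proof (cases "0 \<le> u")
    case True
    then show ?thesis using \<sigma> subalg[OF True] unfolding stopping_def subalgebra_def by blast
  next
    case False
    then have "{\<omega> \<in> space M. \<sigma> \<omega> \<le> u} = {}" using sigma_nonneg by force
    then show ?thesis by (simp only: sets.empty_sets)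
  qed
qed

lemma bounded_rv_Zs: "0 \<le> t \<Longrightarrow> bounded_rv (Zs t)"
  by (rule bounded_rvI[OF measurable_F_M[OF _ measurable_Zs], of t K]) (use Zs_bounds in auto)

lemma bounded_rv_Bs: "0 \<le> t \<Longrightarrow> bounded_rv (Bs t)"
  by (rule bounded_rvI[OF measurable_F_M[OF _ measurable_Bs], of t K]) (use Bs_bounds in auto)

lemma bounded_rv_Ns_diff: "0 \<le> p \<Longrightarrow> p \<le> t \<Longrightarrow> bounded_rv (\<lambda>\<omega>. Ns t \<omega> - Ns p \<omega>)"
  by (rule bounded_rvI[OF borel_measurable_diff[OF measurable_F_M[OF _ measurable_Ns] measurable_F_M[OF _ measurable_Ns]], of t p "(K + \<bar>\<delta>\<bar> * (t - p)) / 2"])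
     (use Ns_diff_bound in \<open>simp_all del: le_divide_eq_numeral1\<close>)

lemma bounded_rv_bracket:
  assumes "0 \<le> p" "p \<le> t" "l \<in> borel_measurable (F p)" "\<theta> \<in> borel_measurable (F p)"
    "\<And>\<omega>. \<omega> \<in> space M \<Longrightarrow> bracket l \<theta> (min p (\<sigma> \<omega>)) (min t (\<sigma> \<omega>)) \<omega> \<le> a"
  shows "bounded_rv (\<lambda>\<omega>. bracket l \<theta> (min p (\<sigma> \<omega>)) (min t (\<sigma> \<omega>)) \<omega>)"
  by (rule bounded_rvI[OF measurable_F_M[OF _ measurable_bracket_stopped], of t p l \<theta> a])
     (use assms bracket_nonneg in \<open>auto simp: abs_of_nonneg\<close>)

lemma Ns_second_moment:
  assumes "0 \<le> p" "p < u"
  shows "expectation (\<lambda>\<omega>. (Ns u \<omega> - Ns p \<omega>)\<^sup>2) \<le> (sqrt K + 1)\<^sup>2 * (u - p)"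
proof -
  note m = stopped_moments[OF assms, of "\<lambda>_. 1" 1 "\<lambda>_. 0" "\<lambda>_. 1" 1, simplified]
  have "expectation (\<lambda>\<omega>. bracket (\<lambda>_. 1) (\<lambda>_. 0) (min p (\<sigma> \<omega>)) (min u (\<sigma> \<omega>)) \<omega>) \<le> expectation (\<lambda>_. (sqrt K + 1)\<^sup>2 * (u - p))"
    by (rule integral_mono[OF bounded_rv_integrable[OF bounded_rv_bracket]]) (use assms m(4) in auto)
  with m(2) show ?thesis by (simp add: prob_space)
qed

text \<open>The inequality \<open>sqrt x \<le> k + x / k\<close> is used twice, as
  \<open>\<bar>m\<bar> \<le> k\<^sup>2 + m\<^sup>2 / k\<^sup>2\<close> for the increment
  \<open>m\<close> of \<open>N\<close> and then for the increment of \<open>Z\<close>. As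
  \<open>m\<^sup>2\<close> has mean of order \<open>k ^ 4\<close>, what results is of order
  \<open>k\<close>, the fourth root of the step width.\<close>

lemma expectation_sqrt_increment:
  assumes p: "0 \<le> p" "p \<le> u" and k: "0 < k" "k \<le> 1" "u - p \<le> k ^ 4"
  shows "expectation (\<lambda>\<omega>. sqrt \<bar>Zs u \<omega> - Zs p \<omega>\<bar>) \<le> (3 + 2 * (sqrt K + 1)\<^sup>2 + \<bar>\<delta>\<bar>) * k"
proof (cases "u = p")
  case True
  then show ?thesis using k K by simp
next
  case False
  then have pu: "p < u" using p by simp
  have u0: "0 \<le> u" using p by simp
  let ?m = "\<lambda>\<omega>. Ns u \<omega> - Ns p \<omega>"
  have bm: "bounded_rv ?m" by (rule bounded_rv_Ns_diff[OF p])
  have "expectation (\<lambda>\<omega>. sqrt \<bar>Zs u \<omega> - Zs p \<omega>\<bar>) \<le> expectation (\<lambda>\<omega>. (3 + \<bar>\<delta>\<bar>) * k + (2 / k ^ 3) * (?m \<omega>)\<^sup>2)"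
  proof (rule integral_mono)
    have "bounded_rv (\<lambda>\<omega>. sqrt \<bar>Zs u \<omega> - Zs p \<omega>\<bar>)"
    proof (rule bounded_rvI)
      show "(\<lambda>\<omega>. sqrt \<bar>Zs u \<omega> - Zs p \<omega>\<bar>) \<in> borel_measurable M"
        using bounded_rv_measurable[OF bounded_rv_Zs[OF u0]] bounded_rv_measurable[OF bounded_rv_Zs[OF p(1)]] by measurable
      show "\<bar>sqrt \<bar>Zs u \<omega> - Zs p \<omega>\<bar>\<bar> \<le> sqrt K" if "\<omega> \<in> space M" for \<omega>
        using Zs_bounds[OF that u0] Zs_bounds[OF that p(1)] by (simp add: abs_le_iff)
    qed
    then show "integrable M (\<lambda>\<omega>. sqrt \<bar>Zs u \<omega> - Zs p \<omega>\<bar>)" by (rule bounded_rv_integrable)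
    show "integrable M (\<lambda>\<omega>. (3 + \<bar>\<delta>\<bar>) * k + (2 / k ^ 3) * (?m \<omega>)\<^sup>2)"
      by (intro bounded_rv_integrable bounded_rv_intros bm)
    fix \<omega> assume \<omega>: "\<omega> \<in> space M"
    have "\<bar>?m \<omega>\<bar> \<le> k\<^sup>2 + (?m \<omega>)\<^sup>2 / k\<^sup>2" using sqrt_le_linear[of "k\<^sup>2" "(?m \<omega>)\<^sup>2"] k by simp
    moreover have "\<bar>\<delta> * (min u (\<sigma> \<omega>) - min p (\<sigma> \<omega>))\<bar> \<le> \<bar>\<delta>\<bar> * k\<^sup>2"
    proof -
      have "k ^ 4 \<le> k\<^sup>2" using k by (intro power_decreasing) auto
      moreover have "min u (\<sigma> \<omega>) - min p (\<sigma> \<omega>) \<le> u - p" "0 \<le> min u (\<sigma> \<omega>) - min p (\<sigma> \<omega>)" using p by auto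
      ultimately have "\<bar>min u (\<sigma> \<omega>) - min p (\<sigma> \<omega>)\<bar> \<le> k\<^sup>2" using k(3) by simp
      then show ?thesis unfolding abs_mult by (intro mult_left_mono) auto
    qed
    moreover have "Zs u \<omega> - Zs p \<omega> = 2 * ?m \<omega> + \<delta> * (min u (\<sigma> \<omega>) - min p (\<sigma> \<omega>))"
      unfolding N_def by (simp add: field_simps)
    moreover have "\<bar>2 * ?m \<omega> + \<delta> * (min u (\<sigma> \<omega>) - min p (\<sigma> \<omega>))\<bar> \<le> 2 * \<bar>?m \<omega>\<bar> + \<bar>\<delta> * (min u (\<sigma> \<omega>) - min p (\<sigma> \<omega>))\<bar>"
    proof -
      have "\<bar>2 * x + y\<bar> \<le> 2 * \<bar>x\<bar> + \<bar>y\<bar>" for x y :: real by arith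
      then show ?thesis .
    qed
    ultimately have "\<bar>Zs u \<omega> - Zs p \<omega>\<bar> \<le> (2 + \<bar>\<delta>\<bar>) * k\<^sup>2 + 2 * ((?m \<omega>)\<^sup>2 / k\<^sup>2)" by (simp add: distrib_right)
    then have "\<bar>Zs u \<omega> - Zs p \<omega>\<bar> / k \<le> ((2 + \<bar>\<delta>\<bar>) * k\<^sup>2 + 2 * ((?m \<omega>)\<^sup>2 / k\<^sup>2)) / k" using k by (intro divide_right_mono) auto
    also have "\<dots> = (2 + \<bar>\<delta>\<bar>) * k + (2 / k ^ 3) * (?m \<omega>)\<^sup>2"
      using k by (simp add: add_divide_distrib power2_eq_square power3_eq_cube)
    finally show "sqrt \<bar>Zs u \<omega> - Zs p \<omega>\<bar> \<le> (3 + \<bar>\<delta>\<bar>) * k + (2 / k ^ 3) * (?m \<omega>)\<^sup>2"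
      using sqrt_le_linear[OF k(1), of "\<bar>Zs u \<omega> - Zs p \<omega>\<bar>"] by (simp add: distrib_right)
  qed
  also have "\<dots> = (3 + \<bar>\<delta>\<bar>) * k + (2 / k ^ 3) * expectation (\<lambda>\<omega>. (?m \<omega>)\<^sup>2)"
    using bounded_rv_integrable[OF bounded_rv_power[OF bm, of 2]] by (simp add: prob_space)
  also have "(2 / k ^ 3) * expectation (\<lambda>\<omega>. (?m \<omega>)\<^sup>2) \<le> (2 / k ^ 3) * ((sqrt K + 1)\<^sup>2 * k ^ 4)"
  proof (rule mult_left_mono)
    have "(sqrt K + 1)\<^sup>2 * (u - p) \<le> (sqrt K + 1)\<^sup>2 * k ^ 4" using k by (intro mult_left_mono) auto
    then show "expectation (\<lambda>\<omega>. (?m \<omega>)\<^sup>2) \<le> (sqrt K + 1)\<^sup>2 * k ^ 4"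
      using Ns_second_moment[OF p(1) pu] by linarith
  qed (use k in auto)
  also have "\<dots> = 2 * (sqrt K + 1)\<^sup>2 * k" using k by (simp add: eval_nat_numeral)
  finally show ?thesis by (simp add: distrib_right)
qed

lemma continuous_sqrt_increment:
  assumes "\<omega> \<in> space M" "0 \<le> p"
  shows "continuous_on {p..t} (\<lambda>u. sqrt \<bar>Zs u \<omega> - Zs p \<omega>\<bar>)"
proof -
  have "continuous_on {p..t} (\<lambda>u. Zs u \<omega>)"
    by (rule continuous_on_compose2[OF Z_continuous[OF assms(1)]])
       (use assms sigma_nonneg in \<open>auto intro!: continuous_intros\<close>)
  then show ?thesis by (intro continuous_intros)
qed

text \<open>By Tonelli's theorem the time integral of the freezing error is reduced to a single
  time. It is of order \<open>k\<close> times the length of the interval, hence negligible against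
  the length.\<close>

lemma integral_sqrt_increment:
  assumes p: "0 \<le> p" "p \<le> t" and k: "0 < k" "k \<le> 1" "t - p \<le> k ^ 4"
  defines "S \<equiv> \<lambda>\<omega>. integral {p..t} (\<lambda>u. sqrt \<bar>Zs u \<omega> - Zs p \<omega>\<bar>)"
  shows "bounded_rv S" "expectation S \<le> (3 + 2 * (sqrt K + 1)\<^sup>2 + \<bar>\<delta>\<bar>) * k * (t - p)"
proof -
  have t0: "0 \<le> t" using p by simp
  \<comment> \<open>Clamped times make \<open>f\<close> jointly measurable for all real
    \<open>u\<close>; on \<open>{p..t}\<close> it is the integrand.\<close>
  define f where "f = (\<lambda>(\<omega>, u). sqrt \<bar>Z (max 0 (min t (min u (\<sigma> \<omega>)))) \<omega> - Zs p \<omega>\<bar>)"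
  have id: "(\<lambda>\<omega>. \<omega>) \<in> measurable M (F t)" by (rule measurable_F_M[OF t0]) simp
  have "(\<lambda>x. (min (snd x) (\<sigma> (fst x)), fst x)) \<in> measurable (M \<Otimes>\<^sub>M lborel) (borel \<Otimes>\<^sub>M F t)"
    using measurable_sigma measurable_compose[OF measurable_fst id] by measurable
  from measurable_compose[OF this Z_progressive[OF t0]]
  have fm0: "(\<lambda>x. Z (max 0 (min t (min (snd x) (\<sigma> (fst x))))) (fst x)) \<in> borel_measurable (M \<Otimes>\<^sub>M lborel)" by simp
  have Zpm: "Zs p \<in> borel_measurable M" using bounded_rv_measurable[OF bounded_rv_Zs[OF p(1)]] .
  have fm[measurable]: "f \<in> borel_measurable (M \<Otimes>\<^sub>M lborel)"
    unfolding f_def split_beta using fm0 measurable_compose[OF measurable_fst Zpm] by measurable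
  have f: "f (\<omega>, u) = sqrt \<bar>Zs u \<omega> - Zs p \<omega>\<bar>" if "\<omega> \<in> space M" "u \<in> {p..t}" for \<omega> u
    using that p sigma_nonneg[OF that(1)] unfolding f_def by (simp add: min.absorb2 min.assoc[symmetric] max.absorb2)
  have si: "set_integrable lborel {p..t} (\<lambda>u. sqrt \<bar>Zs u \<omega> - Zs p \<omega>\<bar>)" if "\<omega> \<in> space M" for \<omega>
    by (rule borel_integrable_atLeastAtMost'[OF continuous_sqrt_increment[OF that p(1)]])
  have S: "S \<omega> = (LINT u:{p..t}|lborel. sqrt \<bar>Zs u \<omega> - Zs p \<omega>\<bar>)" if "\<omega> \<in> space M" for \<omega>
    unfolding S_def using set_borel_integral_eq_integral[OF si[OF that]] by simp
  have S': "S \<omega> = (\<integral>u. indicator {p..t} u *\<^sub>R f (\<omega>, u) \<partial>lborel)" if "\<omega> \<in> space M" for \<omega>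
    unfolding S[OF that] set_lebesgue_integral_def using f[OF that]
    by (intro Bochner_Integration.integral_cong) (auto split: split_indicator)
  have "(\<lambda>\<omega>. \<integral>u. indicator {p..t} u *\<^sub>R f (\<omega>, u) \<partial>lborel) \<in> borel_measurable M"
    by (rule lborel.borel_measurable_lebesgue_integral) (simp add: split_beta, measurable)
  then have Sm: "S \<in> borel_measurable M" using S' by (subst measurable_cong) auto
  have Sb: "0 \<le> S \<omega> \<and> S \<omega> \<le> sqrt K * (t - p)" if \<omega>: "\<omega> \<in> space M" for \<omega>
  proof -
    have int: "(\<lambda>u. sqrt \<bar>Zs u \<omega> - Zs p \<omega>\<bar>) integrable_on {p..t}"
      by (rule integrable_continuous_real[OF continuous_sqrt_increment[OF \<omega> p(1)]])
    have "S \<omega> \<le> integral {p..t} (\<lambda>u. sqrt K)" unfolding S_def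
    proof (rule integral_le[OF int])
      fix u assume "u \<in> {p..t}"
      then have "0 \<le> u" using p by simp
      then show "sqrt \<bar>Zs u \<omega> - Zs p \<omega>\<bar> \<le> sqrt K" using Zs_bounds[OF \<omega>, of u] Zs_bounds[OF \<omega> p(1)] by (simp add: abs_le_iff)
    qed auto
    moreover have "0 \<le> S \<omega>" unfolding S_def by (rule integral_nonneg[OF int]) simp
    ultimately show ?thesis using p by (simp add: mult.commute)
  qed
  show bS: "bounded_rv S" by (rule bounded_rvI[OF Sm, of "sqrt K * (t - p)"]) (use Sb in auto)
  let ?c = "(3 + 2 * (sqrt K + 1)\<^sup>2 + \<bar>\<delta>\<bar>) * k"
  have c0: "0 \<le> ?c" using k K by simp
  interpret P: pair_sigma_finite M lborel ..
  have "ennreal (expectation S) = (\<integral>\<^sup>+\<omega>. ennreal (S \<omega>) \<partial>M)"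
    using Sb by (intro nn_integral_eq_integral[symmetric] bounded_rv_integrable bS) auto
  also have "\<dots> = (\<integral>\<^sup>+\<omega>. (\<integral>\<^sup>+u. indicator {p..t} u * ennreal (f (\<omega>, u)) \<partial>lborel) \<partial>M)"
  proof (rule nn_integral_cong)
    fix \<omega> assume \<omega>: "\<omega> \<in> space M"
    have "ennreal (S \<omega>) = (\<integral>\<^sup>+u. ennreal (indicator {p..t} u *\<^sub>R sqrt \<bar>Zs u \<omega> - Zs p \<omega>\<bar>) \<partial>lborel)"
      unfolding S[OF \<omega>] set_lebesgue_integral_def using si[OF \<omega>] unfolding set_integrable_def
      by (intro nn_integral_eq_integral[symmetric]) auto
    also have "\<dots> = (\<integral>\<^sup>+u. indicator {p..t} u * ennreal (f (\<omega>, u)) \<partial>lborel)"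
      using f[OF \<omega>] by (intro nn_integral_cong) (auto split: split_indicator)
    finally show "ennreal (S \<omega>) = (\<integral>\<^sup>+u. indicator {p..t} u * ennreal (f (\<omega>, u)) \<partial>lborel)" .
  qed
  also have "\<dots> = (\<integral>\<^sup>+u. (\<integral>\<^sup>+\<omega>. indicator {p..t} u * ennreal (f (\<omega>, u)) \<partial>M) \<partial>lborel)"
    by (rule P.Fubini'[symmetric]) (simp add: split_beta, measurable)
  also have "\<dots> \<le> (\<integral>\<^sup>+u. ennreal ?c * indicator {p..t} u \<partial>lborel)"
  proof (rule nn_integral_mono)
    fix u
    show "(\<integral>\<^sup>+\<omega>. indicator {p..t} u * ennreal (f (\<omega>, u)) \<partial>M) \<le> ennreal ?c * indicator {p..t} u"
    proof (cases "u \<in> {p..t}")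
      case True
      then have u: "p \<le> u" "u \<le> t" "0 \<le> u" "u - p \<le> k ^ 4" using p k by auto
      have "(\<integral>\<^sup>+\<omega>. indicator {p..t} u * ennreal (f (\<omega>, u)) \<partial>M) = (\<integral>\<^sup>+\<omega>. ennreal (sqrt \<bar>Zs u \<omega> - Zs p \<omega>\<bar>) \<partial>M)"
        using True f by (intro nn_integral_cong) auto
      also have "\<dots> = ennreal (expectation (\<lambda>\<omega>. sqrt \<bar>Zs u \<omega> - Zs p \<omega>\<bar>))"
      proof (intro nn_integral_eq_integral bounded_rv_integrable bounded_rvI)
        show "(\<lambda>\<omega>. sqrt \<bar>Zs u \<omega> - Zs p \<omega>\<bar>) \<in> borel_measurable M"
          using bounded_rv_measurable[OF bounded_rv_Zs[OF u(3)]] Zpm by measurable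
        show "\<bar>sqrt \<bar>Zs u \<omega> - Zs p \<omega>\<bar>\<bar> \<le> sqrt K" if "\<omega> \<in> space M" for \<omega>
          using Zs_bounds[OF that u(3)] Zs_bounds[OF that p(1)] by (simp add: abs_le_iff)
      qed auto
      also have "\<dots> \<le> ennreal ?c" by (intro ennreal_leI expectation_sqrt_increment p u k)
      finally show ?thesis using True by simp
    qed simp
  qed
  also have "\<dots> = ennreal ?c * ennreal (t - p)" using p by (subst nn_integral_cmult_indicator) auto
  also have "\<dots> = ennreal (?c * (t - p))" using c0 p by (simp add: ennreal_mult)
  finally show "expectation S \<le> ?c * (t - p)" using c0 p by (simp add: ennreal_le_iff)
qed

text \<open>\<open>U \<epsilon>\<close> is a supermartingale. As \<open>\<epsilon>\<close> tends to \<open>0\<close>, Markov's inequality for it yields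
  \<open>sqrt Z - B \<ge> x0\<close>.\<close>

definition U :: "real \<Rightarrow> real \<Rightarrow> 'a \<Rightarrow> real" where
  "U \<epsilon> t \<omega> = exp (- (1 / sqrt \<epsilon>) * (sqrt (Zs t \<omega> + \<epsilon>) - Bs t \<omega>))"

lemma U_bounds:
  assumes "0 < \<epsilon>" "\<omega> \<in> space M" "0 \<le> t"
  shows "0 \<le> U \<epsilon> t \<omega>" "U \<epsilon> t \<omega> \<le> exp (K / sqrt \<epsilon>)"
proof -
  show "0 \<le> U \<epsilon> t \<omega>" unfolding U_def by simp
  have "- (sqrt (Zs t \<omega> + \<epsilon>) - Bs t \<omega>) \<le> K"
  proof -
    have "0 \<le> sqrt (Zs t \<omega> + \<epsilon>)" using Zs_bounds[OF assms(2,3)] assms(1) by simp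
    then show ?thesis using Bs_bounds[OF assms(2,3)] by linarith
  qed
  then have "(1 / sqrt \<epsilon>) * (- (sqrt (Zs t \<omega> + \<epsilon>) - Bs t \<omega>)) \<le> (1 / sqrt \<epsilon>) * K" using assms by (intro mult_left_mono) auto
  then have "- (1 / sqrt \<epsilon>) * (sqrt (Zs t \<omega> + \<epsilon>) - Bs t \<omega>) \<le> K / sqrt \<epsilon>" by (simp only: minus_mult_left[symmetric] minus_mult_right[symmetric]) simp
  then show "U \<epsilon> t \<omega> \<le> exp (K / sqrt \<epsilon>)" unfolding U_def by (simp only: exp_le_cancel_iff)
qed

lemma measurable_U: "0 \<le> t \<Longrightarrow> U \<epsilon> t \<in> borel_measurable (F t)"
  unfolding U_def[abs_def] using measurable_Zs[of t] measurable_Bs[of t] by measurable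

lemma bounded_rv_U: "0 < \<epsilon> \<Longrightarrow> 0 \<le> t \<Longrightarrow> bounded_rv (U \<epsilon> t)"
  by (rule bounded_rvI[OF measurable_F_M[OF _ measurable_U], of t \<epsilon> "exp (K / sqrt \<epsilon>)"]) (use U_bounds in auto)

text \<open>The relative drift of \<open>U\<close> over one step, with \<open>R\<close> frozen at
  the left end. Pointwise the integrand is that of \<open>bessel_drift_le\<close> at
  \<open>x = sqrt (Z s \<omega>)\<close> and \<open>z = Zs p \<omega>\<close>, so nothing but the
  integrated freezing error remains as a bound.\<close>

lemma drift_integral_le:
  assumes \<epsilon>: "0 < \<epsilon>" and \<delta>: "1 \<le> \<delta>" and \<gamma>: "\<gamma> = 1 / sqrt \<epsilon>" and \<omega>: "\<omega> \<in> space M" and p: "0 \<le> p" "p \<le> t"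
    and R: "R = sqrt (Zs p \<omega> + \<epsilon>)" and l: "l \<omega> = 1 / R"
  shows "\<gamma> / (2 * R ^ 3) * bracket (\<lambda>_. 1) (\<lambda>_. 0) (min p (\<sigma> \<omega>)) (min t (\<sigma> \<omega>)) \<omega>
      + \<gamma>\<^sup>2 / 2 * bracket l (\<lambda>_. -1) (min p (\<sigma> \<omega>)) (min t (\<sigma> \<omega>)) \<omega> - \<gamma> * \<delta> / (2 * R) * (min t (\<sigma> \<omega>) - min p (\<sigma> \<omega>))
    \<le> (\<gamma> * sqrt K / sqrt \<epsilon> ^ 3 + \<gamma>\<^sup>2 / 2 * (2 * sqrt K / sqrt \<epsilon> + 2) / sqrt \<epsilon>) * integral {p..t} (\<lambda>u. sqrt \<bar>Zs u \<omega> - Zs p \<omega>\<bar>)"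
    (is "?L \<le> ?c * ?S")
proof -
  let ?p = "min p (\<sigma> \<omega>)" and ?t = "min t (\<sigma> \<omega>)"
  have pt: "0 \<le> ?p" "?p \<le> ?t" using p sigma_nonneg[OF \<omega>] by auto
  have c0: "0 \<le> ?c" using \<epsilon> \<gamma> K by (intro add_nonneg_nonneg mult_nonneg_nonneg divide_nonneg_nonneg) auto
  have i1: "((\<lambda>s. (1 * sqrt (Z s \<omega>) + 0)\<^sup>2) has_integral bracket (\<lambda>_. 1) (\<lambda>_. 0) ?p ?t \<omega>) {?p..?t}"
    unfolding bracket_def by (rule integrable_integral[OF integrable_continuous_real[OF continuous_integrand[OF \<omega> pt(1)]]])
  have i2: "((\<lambda>s. (l \<omega> * sqrt (Z s \<omega>) + -1)\<^sup>2) has_integral bracket l (\<lambda>_. -1) ?p ?t \<omega>) {?p..?t}"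
    unfolding bracket_def by (rule integrable_integral[OF integrable_continuous_real[OF continuous_integrand[OF \<omega> pt(1)]]])
  have i3: "((\<lambda>s. \<gamma> * \<delta> / (2 * R)) has_integral \<gamma> * \<delta> / (2 * R) * (?t - ?p)) {?p..?t}"
    using has_integral_const_real[of "\<gamma> * \<delta> / (2 * R)" ?p ?t] pt by (simp add: mult.commute)
  have i: "((\<lambda>s. \<gamma> / (2 * R ^ 3) * (1 * sqrt (Z s \<omega>) + 0)\<^sup>2 + \<gamma>\<^sup>2 / 2 * (l \<omega> * sqrt (Z s \<omega>) + -1)\<^sup>2 - \<gamma> * \<delta> / (2 * R)) has_integral ?L) {?p..?t}"
    by (intro has_integral_diff has_integral_add has_integral_mult_right i1 i2 i3)
  have iS: "(\<lambda>u. sqrt \<bar>Zs u \<omega> - Zs p \<omega>\<bar>) integrable_on {q..r}" if "0 \<le> q" for q r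
  proof -
    have "continuous_on {q..r} (\<lambda>u. Zs u \<omega>)"
      by (rule continuous_on_compose2[OF Z_continuous[OF \<omega>]])
         (use that sigma_nonneg[OF \<omega>] in \<open>auto intro!: continuous_intros\<close>)
    then show ?thesis by (intro integrable_continuous_real continuous_intros)
  qed
  have "?L \<le> ?c * integral {?p..?t} (\<lambda>u. sqrt \<bar>Zs u \<omega> - Zs p \<omega>\<bar>)"
  proof (rule has_integral_le[OF i has_integral_mult_right[OF integrable_integral[OF iS[OF pt(1)]]]])
    fix s assume s: "s \<in> {?p..?t}"
    then have s0: "0 \<le> s" "s \<le> \<sigma> \<omega>" using pt by auto
    have Zs: "Zs s \<omega> = Z s \<omega>" using s0 by (simp add: min.absorb1)
    have "\<gamma> / (2 * R ^ 3) * (sqrt (Z s \<omega>))\<^sup>2 + \<gamma>\<^sup>2 / 2 * (sqrt (Z s \<omega>) / R - 1)\<^sup>2 - \<gamma> * \<delta> / (2 * R)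
      \<le> ?c * sqrt \<bar>(sqrt (Z s \<omega>))\<^sup>2 - Zs p \<omega>\<bar>"
      unfolding R using Zs_bounds[OF \<omega> p(1)] Z_nonneg[OF \<omega> s0(1)] bound[OF \<omega> s0]
      by (intro bessel_drift_le[OF \<epsilon> \<gamma> \<delta>]) auto
    then show "\<gamma> / (2 * R ^ 3) * (1 * sqrt (Z s \<omega>) + 0)\<^sup>2 + \<gamma>\<^sup>2 / 2 * (l \<omega> * sqrt (Z s \<omega>) + -1)\<^sup>2 - \<gamma> * \<delta> / (2 * R) \<le> ?c * sqrt \<bar>Zs s \<omega> - Zs p \<omega>\<bar>"
      unfolding l Zs using Z_nonneg[OF \<omega> s0(1)] by simp
  qed
  \<comment> \<open>The stopped interval is contained in \<open>{p..t}\<close> or reduces to a point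
    if \<open>\<sigma> \<omega> \<le> p\<close>. The integrand is nonnegative, so enlarging the
    interval is harmless.\<close>
  also have "\<dots> \<le> ?c * ?S"
  proof (rule mult_left_mono[OF _ c0])
    show "integral {?p..?t} (\<lambda>u. sqrt \<bar>Zs u \<omega> - Zs p \<omega>\<bar>) \<le> ?S"
    proof (cases "\<sigma> \<omega> \<le> p")
      case True
      then have "?p = \<sigma> \<omega>" "?t = \<sigma> \<omega>" using p by auto
      then show ?thesis using integral_nonneg[OF iS[OF p(1)], of t] by simp
    next
      case False
      then have "{?p..?t} \<subseteq> {p..t}" by auto
      then show ?thesis by (intro integral_subset_le iS pt p) auto
    qed
  qed
  finally show ?thesis .
qed

section \<open>One step of the supermartingale, up to a negligible error\<close>

lemma expectation_mono_bounded:
  "bounded_rv f \<Longrightarrow> bounded_rv g \<Longrightarrow> (\<And>\<omega>. \<omega> \<in> space M \<Longrightarrow> f \<omega> \<le> g \<omega>) \<Longrightarrow> expectation f \<le> expectation g"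
  by (intro integral_mono bounded_rv_integrable)

text \<open>The error is of smaller order than the step width, with \<open>C\<close> independent of
  the step, so it disappears when the steps of a partition are added up. The quotient of
  \<open>U \<epsilon> t\<close> and \<open>U \<epsilon> p\<close> is expanded by
  \<open>exp_step_bound\<close> and weighted with \<open>U \<epsilon> p\<close>, which is known at
  time \<open>p\<close>. The linear term has mean zero and the squares are dominated by brackets;
  together with the term in \<open>\<delta>\<close> these form the drift, which is nonpositive up to
  the freezing error.\<close>

lemma U_step:
  assumes \<epsilon>: "0 < \<epsilon>" and \<delta>: "1 \<le> \<delta>"
  shows "\<exists>C\<ge>0. \<forall>p t k. 0 \<le> p \<and> p < t \<and> t - p = k ^ 4 \<and> 0 < k \<and> k \<le> 1 \<longrightarrow>
    expectation (U \<epsilon> t) \<le> expectation (U \<epsilon> p) + C * k * (t - p)"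
proof -
  define \<gamma> where "\<gamma> = 1 / sqrt \<epsilon>"
  have \<gamma>: "0 < \<gamma>" using \<epsilon> by (simp add: \<gamma>_def)
  have \<delta>0: "0 < \<delta>" using \<delta> by simp
  define v where "v = exp (K / sqrt \<epsilon>)"
  obtain C1 where C1: "0 \<le> C1" and step: "\<And>z z' b m h' h. 0 \<le> z \<Longrightarrow> z \<le> K \<Longrightarrow> 0 \<le> z' \<Longrightarrow> z' \<le> K \<Longrightarrow> \<bar>b\<bar> \<le> 2 * K \<Longrightarrow> 0 \<le> h' \<Longrightarrow> h' \<le> h \<Longrightarrow> h \<le> 1
    \<Longrightarrow> z' - z = 2 * m + \<delta> * h' \<Longrightarrow>
    exp (- \<gamma> * (sqrt (z' + \<epsilon>) - sqrt (z + \<epsilon>) - b)) \<le> 1 - \<gamma> * (m / sqrt (z + \<epsilon>) - b) + \<gamma> * m\<^sup>2 / (2 * sqrt (z + \<epsilon>) ^ 3)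
      + \<gamma>\<^sup>2 / 2 * (m / sqrt (z + \<epsilon>) - b)\<^sup>2 - \<gamma> * \<delta> * h' / (2 * sqrt (z + \<epsilon>)) + C1 * (\<bar>m\<bar> ^ 3 + \<bar>b\<bar> ^ 3 + sqrt h ^ 3)"
    using exp_step_bound[OF \<epsilon> \<gamma> \<delta>0 K] by blast
  define C2 where "C2 = \<gamma> * sqrt K / sqrt \<epsilon> ^ 3 + \<gamma>\<^sup>2 / 2 * (2 * sqrt K / sqrt \<epsilon> + 2) / sqrt \<epsilon>"
  have C2: "0 \<le> C2" unfolding C2_def using \<epsilon> \<gamma> K by (intro add_nonneg_nonneg mult_nonneg_nonneg divide_nonneg_nonneg) auto
  define C3 where "C3 = 3 + 2 * (sqrt K + 1)\<^sup>2 + \<bar>\<delta>\<bar>"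
  define A where "A = (sqrt K + 1)\<^sup>2"
  define C where "C = v * C2 * C3 + C1 * (2 * (24 * A\<^sup>2 + A) + 1) * v"
  have v: "0 < v" by (simp add: v_def)
  have A: "0 \<le> A" "0 \<le> C3" by (auto simp: A_def C3_def)
  have C: "0 \<le> C" unfolding C_def using C1 C2 A v by simp
  show ?thesis
  proof (intro exI[of _ C] conjI allI impI)
    show "0 \<le> C" by (rule C)
    fix p t k :: real assume asm: "0 \<le> p \<and> p < t \<and> t - p = k ^ 4 \<and> 0 < k \<and> k \<le> 1"
    then have p: "0 \<le> p" "p < t" "p \<le> t" "0 \<le> t" and k: "0 < k" "k \<le> 1" "t - p = k ^ 4" by auto
    let ?V = "U \<epsilon> p" and ?R = "\<lambda>\<omega>. sqrt (Zs p \<omega> + \<epsilon>)"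
    let ?m = "\<lambda>\<omega>. Ns t \<omega> - Ns p \<omega>" and ?b = "\<lambda>\<omega>. Bs t \<omega> - Bs p \<omega>"
    let ?h = "\<lambda>\<omega>. min t (\<sigma> \<omega>) - min p (\<sigma> \<omega>)"
    let ?l = "\<lambda>\<omega>. 1 / ?R \<omega>"
    let ?y = "\<lambda>\<omega>. ?l \<omega> * ?m \<omega> + -1 * ?b \<omega>"
    let ?a = "\<lambda>\<omega>. \<gamma> / (2 * ?R \<omega> ^ 3)"
    let ?br1 = "\<lambda>\<omega>. bracket (\<lambda>_. 1) (\<lambda>_. 0) (min p (\<sigma> \<omega>)) (min t (\<sigma> \<omega>)) \<omega>"
    let ?br2 = "\<lambda>\<omega>. bracket ?l (\<lambda>_. -1) (min p (\<sigma> \<omega>)) (min t (\<sigma> \<omega>)) \<omega>"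
    let ?S = "\<lambda>\<omega>. integral {p..t} (\<lambda>u. sqrt \<bar>Zs u \<omega> - Zs p \<omega>\<bar>)"
    have R: "sqrt \<epsilon> \<le> ?R \<omega>" "0 < ?R \<omega>" if "\<omega> \<in> space M" for \<omega>
      using Zs_bounds[OF that p(1)] \<epsilon> by auto
    have Vm: "?V \<in> borel_measurable (F p)" by (rule measurable_U[OF p(1)])
    have V0: "0 \<le> ?V \<omega>" "?V \<omega> \<le> v" if "\<omega> \<in> space M" for \<omega>
      using U_bounds[OF \<epsilon> that p(1)] by (auto simp: v_def)
    note [measurable] = measurable_Zs[OF p(1)]
    have lm: "?l \<in> borel_measurable (F p)" by measurable
    have am: "?a \<in> borel_measurable (F p)" by measurable
    define L where "L = 1 / sqrt \<epsilon> + 1"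
    have L: "0 < L" "1 \<le> L" using \<epsilon> by (auto simp: L_def add_pos_pos)
    have lL: "\<bar>?l \<omega>\<bar> \<le> L" if "\<omega> \<in> space M" for \<omega>
    proof -
      have "1 / ?R \<omega> \<le> 1 / sqrt \<epsilon>" using R[OF that] \<epsilon> by (intro divide_left_mono) auto
      then show ?thesis using R[OF that] by (simp add: L_def)
    qed
    have a: "0 \<le> ?a \<omega>" "?a \<omega> \<le> \<gamma> / (2 * sqrt \<epsilon> ^ 3)" if "\<omega> \<in> space M" for \<omega>
      using R[OF that] \<gamma> \<epsilon> by (auto intro!: divide_left_mono mult_left_mono power_mono mult_pos_pos)
    have bV: "bounded_rv ?V" by (rule bounded_rv_U[OF \<epsilon> p(1)])
    have bm: "bounded_rv ?m" by (rule bounded_rv_Ns_diff[OF p(1,3)])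
    have bb: "bounded_rv ?b" by (intro bounded_rv_diff bounded_rv_Bs p)
    have bl: "bounded_rv ?l" by (rule bounded_rvI[OF measurable_F_M[OF p(1) lm] lL])
    have ba: "bounded_rv ?a"
    proof (rule bounded_rvI[OF measurable_F_M[OF p(1) am]])
      show "\<bar>?a \<omega>\<bar> \<le> \<gamma> / (2 * sqrt \<epsilon> ^ 3)" if "\<omega> \<in> space M" for \<omega>
        using a[OF that] by (simp only: abs_of_nonneg)
    qed
    have bY: "bounded_rv ?y" by (intro bounded_rv_intros bl bm bb)
    have bh: "bounded_rv ?h"
    proof (rule bounded_rvI[of _ "t - p"])
      show "?h \<in> borel_measurable M" using measurable_sigma by measurable
    qed (use p in auto)
    have bS: "bounded_rv ?S" and ES: "expectation ?S \<le> C3 * k * (t - p)"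
      using integral_sqrt_increment[OF p(1,3) k(1,2) eq_refl[OF k(3)]] by (auto simp: C3_def)
    have one: "\<And>\<omega>. \<bar>1::real\<bar> \<le> L" "\<And>\<omega>. \<bar>-1::real\<bar> \<le> L" using L by auto
    \<comment> \<open>\<open>M1\<close> concerns \<open>N / R - B\<close>, the martingale part of
      the exponent with \<open>R\<close> frozen at \<open>p\<close>. \<open>M2\<close> and
      \<open>M3\<close> concern \<open>N\<close> and \<open>B\<close> alone and control the error
      terms; \<open>M2\<close> also treats the term with \<open>R ^ 3\<close>.\<close>
    note M1 = stopped_moments[OF p(1,2) lm lL borel_measurable_const one(2) L(1)]
    have zero: "\<And>\<omega>. \<bar>0::real\<bar> \<le> 1" "\<And>\<omega>. \<bar>1::real\<bar> \<le> 1" by auto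
    note M2 = stopped_moments[OF p(1,2) borel_measurable_const zero(2) borel_measurable_const zero(1) zero_less_one]
    note M3 = stopped_moments[OF p(1,2) borel_measurable_const zero(1) borel_measurable_const zero(2) zero_less_one]
    \<comment> \<open>Coefficients depending on the state at time \<open>p\<close> are absorbed in
      the weight, which only has to be bounded, nonnegative and known at that time.\<close>
    have wa: "(\<lambda>\<omega>. ?V \<omega> * ?a \<omega>) \<in> borel_measurable (F p)" using Vm am by (rule borel_measurable_times)
    have wa0: "0 \<le> ?V \<omega> * ?a \<omega>" "?V \<omega> * ?a \<omega> \<le> v * (\<gamma> / (2 * sqrt \<epsilon> ^ 3))" if "\<omega> \<in> space M" for \<omega>
      using V0[OF that] a[OF that] v by (intro mult_nonneg_nonneg mult_mono; simp)+
    have wy: "(\<lambda>\<omega>. ?V \<omega> * (\<gamma>\<^sup>2 / 2)) \<in> borel_measurable (F p)" using Vm by measurable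
    have wy0: "0 \<le> ?V \<omega> * (\<gamma>\<^sup>2 / 2)" "?V \<omega> * (\<gamma>\<^sup>2 / 2) \<le> v * (\<gamma>\<^sup>2 / 2)" if "\<omega> \<in> space M" for \<omega>
      using V0[OF that] by (auto intro!: mult_nonneg_nonneg mult_right_mono)
    have b1: "bounded_rv ?br1"
      by (rule bounded_rv_bracket[OF p(1,3) borel_measurable_const borel_measurable_const M2(4)[OF Vm V0]])
    have b2: "bounded_rv ?br2"
      by (rule bounded_rv_bracket[OF p(1,3) lm borel_measurable_const M1(4)[OF _ Vm V0]])
    have E1: "expectation (\<lambda>\<omega>. ?V \<omega> * ?y \<omega>) = 0" by (rule M1(1)[OF _ Vm V0])
    have E2: "expectation (\<lambda>\<omega>. ?V \<omega> * ?a \<omega> * (?m \<omega>)\<^sup>2) \<le> expectation (\<lambda>\<omega>. ?V \<omega> * ?a \<omega> * ?br1 \<omega>)"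
      using M2(2)[OF wa wa0] by simp
    have E3: "expectation (\<lambda>\<omega>. ?V \<omega> * (\<gamma>\<^sup>2 / 2) * (?y \<omega>)\<^sup>2) \<le> expectation (\<lambda>\<omega>. ?V \<omega> * (\<gamma>\<^sup>2 / 2) * ?br2 \<omega>)"
      by (rule M1(2)[OF _ wy wy0])
    have EV: "expectation ?V \<le> v" "0 \<le> expectation ?V"
    proof -
      have "expectation ?V \<le> expectation (\<lambda>_. v)" by (rule expectation_mono_bounded[OF bV bounded_rv_const V0(2)])
      then show "expectation ?V \<le> v" by (simp add: prob_space)
      show "0 \<le> expectation ?V" using V0 by (intro Bochner_Integration.integral_nonneg) auto
    qed
    have mom: "expectation (\<lambda>\<omega>. ?V \<omega> * (f \<omega>) ^ 4) \<le> 24 * A\<^sup>2 * v * k ^ 8"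
      "expectation (\<lambda>\<omega>. ?V \<omega> * (f \<omega>)\<^sup>2) \<le> A * v * k ^ 4"
      if f: "expectation (\<lambda>\<omega>. ?V \<omega> * (f \<omega>) ^ 4) \<le> 24 * ((1 * sqrt K + 1)\<^sup>2 * (t - p))\<^sup>2 * expectation ?V"
        "expectation (\<lambda>\<omega>. ?V \<omega> * (f \<omega>)\<^sup>2) \<le> expectation (\<lambda>\<omega>. ?V \<omega> * g \<omega>)"
        and g: "bounded_rv g" "\<And>\<omega>. \<omega> \<in> space M \<Longrightarrow> g \<omega> \<le> (1 * sqrt K + 1)\<^sup>2 * (t - p)" for f g
    proof -
      have "24 * ((1 * sqrt K + 1)\<^sup>2 * (t - p))\<^sup>2 * expectation ?V \<le> 24 * ((1 * sqrt K + 1)\<^sup>2 * (t - p))\<^sup>2 * v"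
        using EV by (intro mult_left_mono) auto
      also have "\<dots> = 24 * A\<^sup>2 * v * k ^ 8" unfolding k(3) A_def by (simp add: power_mult_distrib)
      finally show "expectation (\<lambda>\<omega>. ?V \<omega> * (f \<omega>) ^ 4) \<le> 24 * A\<^sup>2 * v * k ^ 8" using f(1) by linarith
      have "expectation (\<lambda>\<omega>. ?V \<omega> * g \<omega>) \<le> expectation (\<lambda>\<omega>. ?V \<omega> * (A * k ^ 4))"
      proof (rule expectation_mono_bounded)
        show "?V \<omega> * g \<omega> \<le> ?V \<omega> * (A * k ^ 4)" if "\<omega> \<in> space M" for \<omega>
          using g(2)[OF that] V0[OF that] unfolding k(3) A_def by (intro mult_left_mono) auto
      qed (intro bounded_rv_intros bV g)+
      also have "\<dots> = expectation ?V * (A * k ^ 4)" by simp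
      also have "\<dots> \<le> v * (A * k ^ 4)" using EV A k by (intro mult_right_mono) auto
      finally show "expectation (\<lambda>\<omega>. ?V \<omega> * (f \<omega>)\<^sup>2) \<le> A * v * k ^ 4" using f(2) by (simp add: mult_ac)
    qed
    have m: "expectation (\<lambda>\<omega>. ?V \<omega> * (?m \<omega>) ^ 4) \<le> 24 * A\<^sup>2 * v * k ^ 8" "expectation (\<lambda>\<omega>. ?V \<omega> * (?m \<omega>)\<^sup>2) \<le> A * v * k ^ 4"
      using mom[of ?m ?br1] M2(2,3)[OF Vm V0] b1 M2(4)[OF Vm V0] by simp_all
    have "bounded_rv (\<lambda>\<omega>. bracket (\<lambda>_. 0) (\<lambda>_. 1) (min p (\<sigma> \<omega>)) (min t (\<sigma> \<omega>)) \<omega>)"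
      by (rule bounded_rv_bracket[OF p(1,3) borel_measurable_const borel_measurable_const M3(4)[OF Vm V0]])
    then have b: "expectation (\<lambda>\<omega>. ?V \<omega> * (?b \<omega>) ^ 4) \<le> 24 * A\<^sup>2 * v * k ^ 8" "expectation (\<lambda>\<omega>. ?V \<omega> * (?b \<omega>)\<^sup>2) \<le> A * v * k ^ 4"
      using mom[of ?b "\<lambda>\<omega>. bracket (\<lambda>_. 0) (\<lambda>_. 1) (min p (\<sigma> \<omega>)) (min t (\<sigma> \<omega>)) \<omega>"] M3(2,3)[OF Vm V0] M3(4)[OF Vm V0] by simp_all
    \<comment> \<open>The drift that is left once squared increments are replaced by
      brackets.\<close>
    let ?G = "\<lambda>\<omega>. ?V \<omega> * ?a \<omega> * ?br1 \<omega> + ?V \<omega> * (\<gamma>\<^sup>2 / 2) * ?br2 \<omega> - ?V \<omega> * (\<gamma> * \<delta> / 2 * ?l \<omega> * ?h \<omega>)"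
    have G: "expectation ?G \<le> v * C2 * C3 * k * (t - p)"
    proof -
      have "expectation ?G \<le> expectation (\<lambda>\<omega>. v * C2 * ?S \<omega>)"
      proof (rule expectation_mono_bounded)
        fix \<omega> assume \<omega>: "\<omega> \<in> space M"
        have "?a \<omega> * ?br1 \<omega> + \<gamma>\<^sup>2 / 2 * ?br2 \<omega> - \<gamma> * \<delta> / (2 * ?R \<omega>) * ?h \<omega> \<le> C2 * ?S \<omega>"
          unfolding C2_def by (rule drift_integral_le[where l="?l" and R="?R \<omega>", OF \<epsilon> \<delta> \<gamma>_def \<omega> p(1,3)]) simp_all
        then have "?V \<omega> * (?a \<omega> * ?br1 \<omega> + \<gamma>\<^sup>2 / 2 * ?br2 \<omega> - \<gamma> * \<delta> / (2 * ?R \<omega>) * ?h \<omega>) \<le> ?V \<omega> * (C2 * ?S \<omega>)"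
          using V0[OF \<omega>] by (intro mult_left_mono)
        also have "\<dots> \<le> v * (C2 * ?S \<omega>)"
        proof (rule mult_right_mono[OF V0(2)[OF \<omega>]])
          have "0 \<le> ?S \<omega>"
            by (rule integral_nonneg[OF integrable_continuous_real[OF continuous_sqrt_increment[OF \<omega> p(1)]]]) simp
          then show "0 \<le> C2 * ?S \<omega>" using C2 by simp
        qed
        finally show "?G \<omega> \<le> v * C2 * ?S \<omega>" by (simp add: right_diff_distrib distrib_left mult.assoc)
      qed (intro bounded_rv_intros bV ba b1 b2 bl bh bS)+
      also have "\<dots> = v * C2 * expectation ?S" by simp
      also have "\<dots> \<le> v * C2 * (C3 * k * (t - p))" using ES v C2 by (intro mult_left_mono) auto
      finally show ?thesis by (simp add: mult.assoc)
    qed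
    \<comment> \<open>The cubic errors after interpolation between squares and fourth powers, each
      of order \<open>k ^ 6\<close>. The last summand stems from
      \<open>sqrt (t - p) = k\<^sup>2\<close>.\<close>
    let ?E = "\<lambda>\<omega>. ?V \<omega> * (?m \<omega>) ^ 4 / k\<^sup>2 + k\<^sup>2 * (?V \<omega> * (?m \<omega>)\<^sup>2) + (?V \<omega> * (?b \<omega>) ^ 4 / k\<^sup>2 + k\<^sup>2 * (?V \<omega> * (?b \<omega>)\<^sup>2)) + k ^ 6 * ?V \<omega>"
    have bE: "bounded_rv ?E" unfolding divide_inverse by (intro bounded_rv_intros bV bm bb)
    have E: "expectation ?E \<le> (2 * (24 * A\<^sup>2 + A) + 1) * v * k ^ 6"
    proof -
      note i = bounded_rv_integrable[OF bounded_rv_mult[OF bV bounded_rv_power]]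
      have "expectation ?E = expectation (\<lambda>\<omega>. ?V \<omega> * (?m \<omega>) ^ 4) / k\<^sup>2 + k\<^sup>2 * expectation (\<lambda>\<omega>. ?V \<omega> * (?m \<omega>)\<^sup>2)
        + (expectation (\<lambda>\<omega>. ?V \<omega> * (?b \<omega>) ^ 4) / k\<^sup>2 + k\<^sup>2 * expectation (\<lambda>\<omega>. ?V \<omega> * (?b \<omega>)\<^sup>2)) + k ^ 6 * expectation ?V"
        using i[OF bm, of 4] i[OF bm, of 2] i[OF bb, of 4] i[OF bb, of 2] bounded_rv_integrable[OF bV] by simp
      also have "\<dots> \<le> 24 * A\<^sup>2 * v * k ^ 8 / k\<^sup>2 + k\<^sup>2 * (A * v * k ^ 4) + (24 * A\<^sup>2 * v * k ^ 8 / k\<^sup>2 + k\<^sup>2 * (A * v * k ^ 4)) + k ^ 6 * v"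
        using m b EV(1) k by (intro add_mono divide_right_mono mult_left_mono) auto
      also have "\<dots> = (2 * (24 * A\<^sup>2 + A) + 1) * v * k ^ 6"
      proof -
        have k8: "k ^ 8 = k ^ 6 * k\<^sup>2" by (simp flip: power_add)
        have "x * (y * k\<^sup>2) / k\<^sup>2 = x * y" for x y :: real using k(1) by simp
        then have "24 * A\<^sup>2 * v * k ^ 8 / k\<^sup>2 = 24 * A\<^sup>2 * v * k ^ 6" unfolding k8 by this
        moreover have "k\<^sup>2 * (A * v * k ^ 4) = A * v * (k\<^sup>2 * k ^ 4)" by (simp only: mult_ac)
        moreover have "k\<^sup>2 * k ^ 4 = k ^ 6" by (simp flip: power_add)
        ultimately show ?thesis by (simp add: distrib_right distrib_left mult_ac)
      qed
      finally show ?thesis .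
    qed
    have "expectation (U \<epsilon> t) \<le> expectation (\<lambda>\<omega>. ?V \<omega> - \<gamma> * (?V \<omega> * ?y \<omega>) + ?V \<omega> * ?a \<omega> * (?m \<omega>)\<^sup>2
      + ?V \<omega> * (\<gamma>\<^sup>2 / 2) * (?y \<omega>)\<^sup>2 - ?V \<omega> * (\<gamma> * \<delta> / 2 * ?l \<omega> * ?h \<omega>) + C1 * ?E \<omega>)" (is "_ \<le> expectation ?W")
    proof (rule expectation_mono_bounded)
      show "bounded_rv (U \<epsilon> t)" by (rule bounded_rv_U[OF \<epsilon> p(4)])
      show "bounded_rv ?W" by (intro bounded_rv_intros bV bY ba bm bl bh bE)
      fix \<omega> assume \<omega>: "\<omega> \<in> space M"
      have "U \<epsilon> t \<omega> = ?V \<omega> * exp (- \<gamma> * (sqrt (Zs t \<omega> + \<epsilon>) - sqrt (Zs p \<omega> + \<epsilon>) - ?b \<omega>))"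
        unfolding U_def \<gamma>_def[symmetric] by (simp add: algebra_simps flip: exp_add)
      also have "\<dots> \<le> ?V \<omega> * (1 - \<gamma> * (?m \<omega> / ?R \<omega> - ?b \<omega>) + \<gamma> * (?m \<omega>)\<^sup>2 / (2 * ?R \<omega> ^ 3)
        + \<gamma>\<^sup>2 / 2 * (?m \<omega> / ?R \<omega> - ?b \<omega>)\<^sup>2 - \<gamma> * \<delta> * ?h \<omega> / (2 * ?R \<omega>) + C1 * (\<bar>?m \<omega>\<bar> ^ 3 + \<bar>?b \<omega>\<bar> ^ 3 + sqrt (t - p) ^ 3))"
      proof (rule mult_left_mono[OF step V0(1)[OF \<omega>]])
        show "\<bar>?b \<omega>\<bar> \<le> 2 * K" using Bs_bounds[OF \<omega> p(4)] Bs_bounds[OF \<omega> p(1)] by linarith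
        show "?h \<omega> \<le> t - p" "0 \<le> ?h \<omega>" using p by auto
        show "t - p \<le> 1" unfolding k(3) using k by (intro power_le_one) auto
        show "Zs t \<omega> - Zs p \<omega> = 2 * ?m \<omega> + \<delta> * ?h \<omega>" unfolding N_def by (simp add: field_simps)
      qed (use Zs_bounds[OF \<omega> p(1)] Zs_bounds[OF \<omega> p(4)] in auto)
      also have "\<dots> \<le> ?V \<omega> * (1 - \<gamma> * (?m \<omega> / ?R \<omega> - ?b \<omega>) + \<gamma> * (?m \<omega>)\<^sup>2 / (2 * ?R \<omega> ^ 3)
        + \<gamma>\<^sup>2 / 2 * (?m \<omega> / ?R \<omega> - ?b \<omega>)\<^sup>2 - \<gamma> * \<delta> * ?h \<omega> / (2 * ?R \<omega>)
        + C1 * (((?m \<omega>) ^ 4 / k\<^sup>2 + k\<^sup>2 * (?m \<omega>)\<^sup>2) + ((?b \<omega>) ^ 4 / k\<^sup>2 + k\<^sup>2 * (?b \<omega>)\<^sup>2) + k ^ 6))"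
      proof (intro mult_left_mono[OF _ V0(1)[OF \<omega>]] add_left_mono mult_left_mono[OF _ C1] add_mono abs_power3_le k)
        have "sqrt (t - p) = k\<^sup>2" unfolding k(3) by (rule real_sqrt_unique) simp_all
        then show "sqrt (t - p) ^ 3 \<le> k ^ 6" by (simp flip: power_mult)
      qed
      also have "\<dots> = ?W \<omega>"
      proof -
        have id: "V * (1 - g * y + g * n / (2 * r3) + g\<^sup>2 / 2 * y\<^sup>2 - g * d * h / (2 * r) + c * (e1 / q + q * e2 + (e3 / q + q * e4) + e5)) =
          V - g * (V * y) + V * (g / (2 * r3)) * n + V * (g\<^sup>2 / 2) * y\<^sup>2 - V * (g * d / 2 * (1 / r) * h)
            + c * (V * e1 / q + q * (V * e2) + (V * e3 / q + q * (V * e4)) + e5 * V)" for V g y n r3 d h r c e1 e2 e3 e4 e5 q :: real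
          by (simp add: right_diff_distrib distrib_left mult_ac)
        have y: "?m \<omega> / ?R \<omega> - ?b \<omega> = ?y \<omega>" by simp
        show ?thesis unfolding y by (rule id)
      qed
      finally show "U \<epsilon> t \<omega> \<le> ?W \<omega>" .
    qed
    also have "expectation ?W = expectation ?V - \<gamma> * expectation (\<lambda>\<omega>. ?V \<omega> * ?y \<omega>) + expectation (\<lambda>\<omega>. ?V \<omega> * ?a \<omega> * (?m \<omega>)\<^sup>2)
      + expectation (\<lambda>\<omega>. ?V \<omega> * (\<gamma>\<^sup>2 / 2) * (?y \<omega>)\<^sup>2) - expectation (\<lambda>\<omega>. ?V \<omega> * (\<gamma> * \<delta> / 2 * ?l \<omega> * ?h \<omega>)) + C1 * expectation ?E"
    proof -
      have "integrable M ?V" "integrable M (\<lambda>\<omega>. ?V \<omega> * ?y \<omega>)" "integrable M (\<lambda>\<omega>. ?V \<omega> * ?a \<omega> * (?m \<omega>)\<^sup>2)"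
        "integrable M (\<lambda>\<omega>. ?V \<omega> * (\<gamma>\<^sup>2 / 2) * (?y \<omega>)\<^sup>2)" "integrable M (\<lambda>\<omega>. ?V \<omega> * (\<gamma> * \<delta> / 2 * ?l \<omega> * ?h \<omega>))" "integrable M ?E"
        by (intro bounded_rv_integrable bounded_rv_intros bV bY ba bm bl bh bE)+
      then show ?thesis
        by (simp only: Bochner_Integration.integral_add Bochner_Integration.integral_diff integral_mult_right_zero
            integrable_mult_right Bochner_Integration.integrable_add Bochner_Integration.integrable_diff)
    qed
    also have "\<dots> \<le> expectation ?V + expectation ?G + C1 * expectation ?E"
    proof -
      have "expectation ?G = expectation (\<lambda>\<omega>. ?V \<omega> * ?a \<omega> * ?br1 \<omega>) + expectation (\<lambda>\<omega>. ?V \<omega> * (\<gamma>\<^sup>2 / 2) * ?br2 \<omega>)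
        - expectation (\<lambda>\<omega>. ?V \<omega> * (\<gamma> * \<delta> / 2 * ?l \<omega> * ?h \<omega>))"
      proof -
        have "integrable M (\<lambda>\<omega>. ?V \<omega> * ?a \<omega> * ?br1 \<omega>)" "integrable M (\<lambda>\<omega>. ?V \<omega> * (\<gamma>\<^sup>2 / 2) * ?br2 \<omega>)"
          "integrable M (\<lambda>\<omega>. ?V \<omega> * (\<gamma> * \<delta> / 2 * ?l \<omega> * ?h \<omega>))"
          by (intro bounded_rv_integrable bounded_rv_intros bV ba bl bh b1 b2)+
        then show ?thesis
          by (simp only: Bochner_Integration.integral_add Bochner_Integration.integral_diff Bochner_Integration.integrable_add)
      qed
      then show ?thesis using E2 E3 unfolding E1 by linarith
    qed
    also have "\<dots> \<le> expectation ?V + v * C2 * C3 * k * (t - p) + C1 * ((2 * (24 * A\<^sup>2 + A) + 1) * v * k ^ 6)"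
      using G mult_left_mono[OF E C1] by linarith
    also have "\<dots> \<le> expectation ?V + C * k * (t - p)"
    proof -
      \<comment> \<open>The cubic error is even smaller than the freezing error, whose size is
        \<open>k ^ 5 = k * (t - p)\<close>.\<close>
      have "k ^ 6 \<le> k ^ 5" using k by (intro power_decreasing) auto
      also have "\<dots> = k * (t - p)" unfolding k(3) by (simp add: eval_nat_numeral)
      finally have "C1 * ((2 * (24 * A\<^sup>2 + A) + 1) * v) * k ^ 6 \<le> C1 * ((2 * (24 * A\<^sup>2 + A) + 1) * v) * (k * (t - p))"
        using C1 A v by (intro mult_left_mono) auto
      then show ?thesis unfolding C_def by (simp add: distrib_right mult.assoc)
    qed
    finally show "expectation (U \<epsilon> t) \<le> expectation (U \<epsilon> p) + C * k * (t - p)" .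
  qed
qed

end

section \<open>From one step to the comparison with \<open>B\<close>\<close>

context stopped_bessel
begin

text \<open>Over \<open>n + 1\<close> steps of equal width the errors add up to
  \<open>C * k * T\<close>, where \<open>k\<close> is the fourth root of the width and tends to
  zero. The condition \<open>T \<le> real (Suc n)\<close> ensures \<open>k \<le> 1\<close>.\<close>

lemma U_le:
  assumes \<epsilon>: "0 < \<epsilon>" and \<delta>: "1 \<le> \<delta>" and T: "0 < T"
  shows "expectation (U \<epsilon> T) \<le> expectation (U \<epsilon> 0)"
proof -
  obtain C where C: "0 \<le> C" and step: "\<And>p t k. 0 \<le> p \<Longrightarrow> p < t \<Longrightarrow> t - p = k ^ 4 \<Longrightarrow> 0 < k \<Longrightarrow> k \<le> 1 \<Longrightarrow>
    expectation (U \<epsilon> t) \<le> expectation (U \<epsilon> p) + C * k * (t - p)"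
    using U_step[OF \<epsilon> \<delta>] by blast
  let ?k = "\<lambda>n. root 4 (T / real (Suc n))"
  have le: "expectation (U \<epsilon> T) \<le> expectation (U \<epsilon> 0) + C * ?k n * T" if n: "T \<le> real (Suc n)" for n
  proof -
    let ?h = "T / real (Suc n)"
    have h: "0 < ?h" "?h \<le> 1" using T n by auto
    have k: "?h = ?k n ^ 4" "0 < ?k n" "?k n \<le> 1" using h by auto
    have "expectation (U \<epsilon> (real j * ?h)) \<le> expectation (U \<epsilon> 0) + C * ?k n * (real j * ?h)" for j
    proof (induction j)
      case (Suc j)
      have d: "real (Suc j) * ?h - real j * ?h = ?h" by (simp only: left_diff_distrib[symmetric]) simp
      have "expectation (U \<epsilon> (real (Suc j) * ?h)) \<le> expectation (U \<epsilon> (real j * ?h)) + C * ?k n * (real (Suc j) * ?h - real j * ?h)"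
      proof (rule step)
        show "0 \<le> real j * ?h" using T by simp
        show "real j * ?h < real (Suc j) * ?h" using h(1) by (intro mult_strict_right_mono) auto
        show "real (Suc j) * ?h - real j * ?h = ?k n ^ 4" unfolding d by (rule k(1))
      qed (rule k)+
      also note Suc.IH
      finally show ?case by (simp only: right_diff_distrib) simp
    qed simp
    from this[of "Suc n"] show ?thesis by simp
  qed
  have "(\<lambda>n. T / real (Suc n)) \<longlonglongrightarrow> 0" by real_asymp
  from tendsto_real_root[OF this, of 4] have "?k \<longlonglongrightarrow> 0" by simp
  then have "(\<lambda>n. expectation (U \<epsilon> 0) + C * ?k n * T) \<longlonglongrightarrow> expectation (U \<epsilon> 0) + C * 0 * T"
    by (intro tendsto_intros)
  moreover have "\<exists>n0. \<forall>n\<ge>n0. expectation (U \<epsilon> T) \<le> expectation (U \<epsilon> 0) + C * ?k n * T"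
  proof -
    obtain n0 :: nat where "T \<le> real n0" using real_arch_simple by blast
    then show ?thesis by (intro exI[of _ n0] allI impI le) (simp add: order_trans)
  qed
  ultimately show ?thesis using LIMSEQ_le_const by fastforce
qed

text \<open>On the event, \<open>U \<epsilon> T\<close> is at least
  \<open>exp (- (x0 - r + sqrt \<epsilon>) / sqrt \<epsilon>)\<close> because
  \<open>sqrt (Z + \<epsilon>) \<le> sqrt Z + sqrt \<epsilon>\<close>, while the mean of
  \<open>U \<epsilon> 0\<close> is at most \<open>exp (- x0 / sqrt \<epsilon>)\<close>. The quotient
  is \<open>exp (1 - r / sqrt \<epsilon>)\<close>: the regularisation costs a constant factor only,
  and the gain from \<open>r\<close> is unbounded as \<open>\<epsilon>\<close> tends to
  zero.\<close>

lemma stopped_prob_le: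
  assumes \<delta>: "1 \<le> \<delta>" and T: "0 < T" and x0: "0 \<le> x0" and r: "0 < r"
  shows "prob {\<omega> \<in> space M. T \<le> \<sigma> \<omega> \<and> sqrt (Z T \<omega>) - B T \<omega> \<le> x0 - r} = 0"
proof -
  let ?A = "{\<omega> \<in> space M. T \<le> \<sigma> \<omega> \<and> sqrt (Z T \<omega>) - B T \<omega> \<le> x0 - r}"
  have [measurable]: "\<sigma> \<in> borel_measurable M" "Z T \<in> borel_measurable M" "B T \<in> borel_measurable M"
    using measurable_sigma measurable_F_M[of T, OF _ Z_adapted] measurable_F_M[of T, OF _ adapted] T by auto
  have A: "?A \<in> events" by measurable
  have bound: "prob ?A \<le> exp (1 - r / sqrt \<epsilon>)" if \<epsilon>: "0 < \<epsilon>" for \<epsilon>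
  proof -
    let ?g = "1 / sqrt \<epsilon>"
    let ?e = "exp (- ?g * (x0 - r + sqrt \<epsilon>))"
    have g: "0 < ?g" using \<epsilon> by simp
    have "expectation (\<lambda>\<omega>. ?e * indicator ?A \<omega>) \<le> expectation (U \<epsilon> T)"
    proof (rule expectation_mono_bounded)
      show "bounded_rv (\<lambda>\<omega>. ?e * indicator ?A \<omega>)"
        by (rule bounded_rvI[of _ ?e]) (use A in \<open>auto split: split_indicator\<close>)
      show "bounded_rv (U \<epsilon> T)" using bounded_rv_U[OF \<epsilon>, of T] T by simp
      fix \<omega> assume \<omega>: "\<omega> \<in> space M"
      show "?e * indicator ?A \<omega> \<le> U \<epsilon> T \<omega>"
      proof (cases "\<omega> \<in> ?A")
        case True
        then have "min T (\<sigma> \<omega>) = T" by auto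
        have "sqrt (Z T \<omega> + \<epsilon>) \<le> sqrt (Z T \<omega>) + sqrt \<epsilon>"
          using Z_nonneg[OF \<omega>, of T] T \<epsilon> by (intro sqrt_add_le_add_sqrt) auto
        then have "sqrt (Z T \<omega> + \<epsilon>) - B T \<omega> \<le> x0 - r + sqrt \<epsilon>" using True by simp
        then have "?g * (sqrt (Z T \<omega> + \<epsilon>) - B T \<omega>) \<le> ?g * (x0 - r + sqrt \<epsilon>)" using g by (intro mult_left_mono) auto
        then have "- ?g * (x0 - r + sqrt \<epsilon>) \<le> - ?g * (sqrt (Z T \<omega> + \<epsilon>) - B T \<omega>)" by (simp only: mult_minus_left neg_le_iff_le)
        then show ?thesis using True \<open>min T (\<sigma> \<omega>) = T\<close> unfolding U_def by (simp only: exp_le_cancel_iff indicator_simps mult_1_right)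
      qed (use U_bounds[OF \<epsilon> \<omega>, of T] T in simp)
    qed
    also have "\<dots> \<le> expectation (U \<epsilon> 0)" by (rule U_le[OF \<epsilon> \<delta> T])
    also have "\<dots> \<le> expectation (\<lambda>_. exp (- ?g * x0))"
    proof (rule expectation_mono_bounded[OF bounded_rv_U[OF \<epsilon>] bounded_rv_const])
      fix \<omega> assume \<omega>: "\<omega> \<in> space M"
      have "min 0 (\<sigma> \<omega>) = 0" using sigma_nonneg[OF \<omega>] by simp
      then have "U \<epsilon> 0 \<omega> = exp (- ?g * sqrt (x0\<^sup>2 + \<epsilon>))" unfolding U_def using Z_start[OF \<omega>] start[OF \<omega>] by simp
      moreover have "x0 \<le> sqrt (x0\<^sup>2 + \<epsilon>)" using x0 \<epsilon> by (intro real_le_rsqrt) auto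
      then have "?g * x0 \<le> ?g * sqrt (x0\<^sup>2 + \<epsilon>)" using g by (intro mult_left_mono) auto
      ultimately show "U \<epsilon> 0 \<omega> \<le> exp (- ?g * x0)" by simp
    qed simp
    finally have "?e * prob ?A \<le> exp (- ?g * x0)" using A by (simp add: prob_space)
    moreover have "exp (- ?g * x0) = ?e * exp (1 - r / sqrt \<epsilon>)"
    proof -
      have "- ?g * x0 = - ?g * (x0 - r + sqrt \<epsilon>) + (1 - r / sqrt \<epsilon>)" using \<epsilon> by (simp add: field_simps)
      then show ?thesis by (simp only: exp_add)
    qed
    ultimately show ?thesis by simp
  qed
  have "((\<lambda>\<epsilon>. exp (1 - r / sqrt \<epsilon>)) \<longlongrightarrow> 0) (at_right 0)" using r by real_asymp
  moreover have "\<forall>\<^sub>F \<epsilon> in at_right 0. prob ?A \<le> exp (1 - r / sqrt \<epsilon>)"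
    using eventually_at_right_less[of "0::real"] by eventually_elim (rule bound)
  ultimately have "prob ?A \<le> 0"
    by (intro tendsto_lowerbound[of "\<lambda>\<epsilon>. exp (1 - r / sqrt \<epsilon>)"]) auto
  then show ?thesis by (simp add: measure_le_0_iff)
qed

end

context brownian_filtration
begin

text \<open>No overshoot: the strict bound before the hitting time passes to the hitting time itself
  by continuity. The condition on \<open>Y 0\<close> covers a hitting time equal to zero.\<close>

lemma hit_le_level:
  fixes Y :: "real \<Rightarrow> 'a \<Rightarrow> real"
  assumes T: "0 \<le> T" and cont: "continuous_on {0..T} (\<lambda>s. Y s \<omega>)" and Y0: "Y 0 \<omega> \<le> K" and s: "0 \<le> s" "s \<le> hit Y K T \<omega>"
  shows "Y s \<omega> \<le> K"
proof (cases "s < hit Y K T \<omega>")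
  case True
  then show ?thesis using hit_less[where Y=Y, OF T cont s(1)] by (simp add: less_imp_le)
next
  case False
  then have s_eq: "s = hit Y K T \<omega>" using s by simp
  show ?thesis
  proof (cases "s = 0")
    case False
    then have s0: "0 < s" using s by simp
    have sT: "s \<le> T" using s_eq hit_bounds[where Y=Y, OF T cont] by simp
    show ?thesis
    proof (rule continuous_le_on_closure[where f="\<lambda>s. Y s \<omega>" and S="{0..<s}"])
      show "continuous_on (closure {0..<s}) (\<lambda>s. Y s \<omega>)"
        using s0 sT by (intro continuous_on_subset[OF cont]) auto
      show "s \<in> closure {0..<s}" using s0 by simp
      fix u assume "u \<in> {0..<s}"
      then show "Y u \<omega> \<le> K" using hit_less[where Y=Y, OF T cont, of u K] s_eq by (simp add: less_imp_le)
    qed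
  qed (use Y0 in simp)
qed

end

context squared_bessel
begin

text \<open>Localisation at the first time that \<open>max Z \<bar>B\<bar>\<close> reaches a level
  above its initial value \<open>x0\<^sup>2\<close>. Countably many null sets are discarded, one for
  each level and each gap \<open>1 / (j + 1)\<close>. A given path is bounded on
  \<open>{0..T}\<close>, so some level is not reached and the stopping time equals
  \<open>T\<close>.\<close>

lemma AE_sqrt_Z_ge:
  assumes \<delta>: "1 \<le> \<delta>" and T: "0 < T" and x0: "0 \<le> x0"
  shows "AE \<omega> in M. x0 + B T \<omega> \<le> sqrt (Z T \<omega>)"
proof -
  define Q where "Q = (\<lambda>s \<omega>. max (Z s \<omega>) \<bar>B s \<omega>\<bar>)"
  have T0: "0 \<le> T" using T by simp
  have Qm: "Q s \<in> borel_measurable (F s)" if "0 \<le> s" for s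
    unfolding Q_def using Z_adapted[OF that] adapted[OF that] by measurable
  have Qc: "continuous_on {0..} (\<lambda>s. Q s \<omega>)" if "\<omega> \<in> space M" for \<omega>
    unfolding Q_def using Z_continuous[OF that] continuous[OF that] by (intro continuous_intros)
  have QcT: "continuous_on {0..T} (\<lambda>s. Q s \<omega>)" if "\<omega> \<in> space M" for \<omega>
    by (rule continuous_on_subset[OF Qc[OF that]]) auto
  have *: "AE \<omega> in M. \<not> (T \<le> hit Q (real n + x0\<^sup>2 + 1) T \<omega> \<and> sqrt (Z T \<omega>) - B T \<omega> \<le> x0 - inverse (real (Suc j)))" for n j :: nat
  proof -
    let ?K = "real n + x0\<^sup>2 + 1"
    have K0: "0 < ?K" by (simp add: add_nonneg_pos)
    have st: "stopping (hit Q ?K T)" by (rule stopping_hit[OF T0 Qm Qc])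
    interpret S: stopped_bessel M F B Z \<delta> x0 "hit Q ?K T" ?K
    proof unfold_locales
      fix \<omega> s assume \<omega>: "\<omega> \<in> space M" and s: "0 \<le> s" "s \<le> hit Q ?K T \<omega>"
      have "Q 0 \<omega> \<le> ?K" using Z_start[OF \<omega>] start[OF \<omega>] by (simp add: Q_def)
      from hit_le_level[OF T0 QcT[OF \<omega>] this s] show "Z s \<omega> \<le> ?K \<and> \<bar>B s \<omega>\<bar> \<le> ?K" by (simp add: Q_def)
    qed (use st K0 in auto)
    have "prob {\<omega> \<in> space M. T \<le> hit Q ?K T \<omega> \<and> sqrt (Z T \<omega>) - B T \<omega> \<le> x0 - inverse (real (Suc j))} = 0"
      by (rule S.stopped_prob_le[OF \<delta> T x0]) simp
    moreover have "{\<omega> \<in> space M. T \<le> hit Q ?K T \<omega> \<and> sqrt (Z T \<omega>) - B T \<omega> \<le> x0 - inverse (real (Suc j))} \<in> events"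
    proof -
      have [measurable]: "hit Q ?K T \<in> borel_measurable M" "Z T \<in> borel_measurable M" "B T \<in> borel_measurable M"
        using S.measurable_sigma measurable_F_M[of T, OF _ Z_adapted] measurable_F_M[of T, OF _ adapted] T by auto
      show ?thesis by measurable
    qed
    ultimately show ?thesis by (intro AE_I[where N="{\<omega> \<in> space M. T \<le> hit Q ?K T \<omega> \<and> sqrt (Z T \<omega>) - B T \<omega> \<le> x0 - inverse (real (Suc j))}"])
        (auto simp: emeasure_eq_measure)
  qed
  then have "AE \<omega> in M. \<forall>n j. \<not> (T \<le> hit Q (real n + x0\<^sup>2 + 1) T \<omega> \<and> sqrt (Z T \<omega>) - B T \<omega> \<le> x0 - inverse (real (Suc j)))"
    by (simp only: AE_all_countable) blast
  then show ?thesis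
  proof (rule AE_mp, intro AE_I2 impI)
    fix \<omega> assume \<omega>: "\<omega> \<in> space M"
      and H: "\<forall>n j. \<not> (T \<le> hit Q (real n + x0\<^sup>2 + 1) T \<omega> \<and> sqrt (Z T \<omega>) - B T \<omega> \<le> x0 - inverse (real (Suc j)))"
    obtain s0 where s0: "\<forall>s\<in>{0..T}. Q s \<omega> \<le> Q s0 \<omega>"
      using continuous_attains_sup[OF _ _ QcT[OF \<omega>]] T by auto
    obtain n :: nat where n: "Q s0 \<omega> \<le> real n" using real_arch_simple by blast
    have "T \<le> hit Q (real n + x0\<^sup>2 + 1) T \<omega>"
    proof (rule ccontr)
      assume "\<not> ?thesis"
      then have lt: "hit Q (real n + x0\<^sup>2 + 1) T \<omega> < T" by simp
      from hit_ge[where Y=Q, OF T0 QcT[OF \<omega>] lt] have "real n + x0\<^sup>2 + 1 \<le> Q (hit Q (real n + x0\<^sup>2 + 1) T \<omega>) \<omega>" .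
      moreover have "Q (hit Q (real n + x0\<^sup>2 + 1) T \<omega>) \<omega> \<le> Q s0 \<omega>"
        using s0 hit_bounds[where Y=Q, OF T0 QcT[OF \<omega>], of "real n + x0\<^sup>2 + 1"] by auto
      ultimately show False using n zero_le_power2[of x0] by linarith
    qed
    then have j: "x0 - inverse (real (Suc j)) < sqrt (Z T \<omega>) - B T \<omega>" for j using H by (meson not_le)
    show "x0 + B T \<omega> \<le> sqrt (Z T \<omega>)"
    proof (rule ccontr)
      assume "\<not> ?thesis"
      then have "0 < x0 - (sqrt (Z T \<omega>) - B T \<omega>)" by simp
      then obtain j where "inverse (real (Suc j)) < x0 - (sqrt (Z T \<omega>) - B T \<omega>)" using reals_Archimedean by blast
      then show False using j[of j] by linarith
    qed
  qed
qed

section \<open>Upper bound and optional stopping at the truncated hitting time\<close>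

lemma Z_hit:
  assumes \<omega>: "\<omega> \<in> space M" and T: "0 \<le> T" and c: "x0\<^sup>2 < c\<^sup>2"
  shows "0 \<le> hit Z (c\<^sup>2) T \<omega>" "hit Z (c\<^sup>2) T \<omega> \<le> T" "Z (hit Z (c\<^sup>2) T \<omega>) \<omega> \<le> c\<^sup>2"
    "hit Z (c\<^sup>2) T \<omega> < T \<Longrightarrow> Z (hit Z (c\<^sup>2) T \<omega>) \<omega> = c\<^sup>2"
    "\<And>s. 0 \<le> s \<Longrightarrow> s \<le> hit Z (c\<^sup>2) T \<omega> \<Longrightarrow> Z s \<omega> \<le> c\<^sup>2"
proof -
  have cont: "continuous_on {0..T} (\<lambda>s. Z s \<omega>)" by (rule continuous_on_subset[OF Z_continuous[OF \<omega>]]) auto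
  have Z0: "Z 0 \<omega> \<le> c\<^sup>2" using Z_start[OF \<omega>] c by simp
  show 1: "0 \<le> hit Z (c\<^sup>2) T \<omega>" "hit Z (c\<^sup>2) T \<omega> \<le> T" using hit_bounds[where Y=Z, OF T cont] by auto
  show 2: "Z s \<omega> \<le> c\<^sup>2" if "0 \<le> s" "s \<le> hit Z (c\<^sup>2) T \<omega>" for s by (rule hit_le_level[OF T cont Z0 that])
  show 3: "Z (hit Z (c\<^sup>2) T \<omega>) \<omega> \<le> c\<^sup>2" by (rule 2[OF 1(1) order_refl])
  show "Z (hit Z (c\<^sup>2) T \<omega>) \<omega> = c\<^sup>2" if "hit Z (c\<^sup>2) T \<omega> < T"
    using 3 hit_ge[where Y=Z, OF T cont that] by simp
qed

lemma stopping_hit_Z: "0 \<le> T \<Longrightarrow> stopping (hit Z K T)"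
  by (rule stopping_hit[OF _ Z_adapted Z_continuous])

lemma measurable_hit_Z:
  assumes "0 \<le> T"
  shows "hit Z K T \<in> borel_measurable M"
proof (rule borel_measurableI_le)
  fix u :: real
  show "{\<omega> \<in> space M. hit Z K T \<omega> \<le> u} \<in> events"
  proof (cases "0 \<le> u")
    case True
    then show ?thesis using stopping_hit_Z[OF assms] subalg[OF True] unfolding stopping_def subalgebra_def by blast
  next
    case False
    have "0 \<le> hit Z K T \<omega>" if "\<omega> \<in> space M" for \<omega>
      using stopping_hit_Z[OF assms, of K] that unfolding stopping_def by blast
    then have "{\<omega> \<in> space M. hit Z K T \<omega> \<le> u} = {}" using False by fastforce
    then show ?thesis by (simp only: sets.empty_sets)
  qed
qed

lemma stopped_Z_exp_le:
  fixes l :: real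
  assumes T: "0 \<le> T" and c: "x0\<^sup>2 < c\<^sup>2"
  defines "\<sigma> \<equiv> hit Z (c\<^sup>2) T"
  shows "(\<integral>\<^sup>+\<omega>. ennreal (exp (l * N (\<sigma> \<omega>) \<omega> - l\<^sup>2 * bracket (\<lambda>_. 1) (\<lambda>_. 0) 0 (\<sigma> \<omega>) \<omega> / 2)) \<partial>M) \<le> 1"
    and "\<And>\<omega>. \<omega> \<in> space M \<Longrightarrow> bracket (\<lambda>_. 1) (\<lambda>_. 0) 0 (\<sigma> \<omega>) \<omega> \<le> c\<^sup>2 * T"
proof -
  have st: "stopping \<sigma>" unfolding \<sigma>_def by (rule stopping_hit_Z[OF T])
  have "(\<integral>\<^sup>+\<omega>. ennreal (1 * exp (l * (N (min T (\<sigma> \<omega>)) \<omega> - N (min 0 (\<sigma> \<omega>)) \<omega>) +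
      0 * (B (min T (\<sigma> \<omega>)) \<omega> - B (min 0 (\<sigma> \<omega>)) \<omega>) - bracket (\<lambda>_. l) (\<lambda>_. 0) (min 0 (\<sigma> \<omega>)) (min T (\<sigma> \<omega>)) \<omega> / 2)) \<partial>M)
    \<le> (\<integral>\<^sup>+\<omega>. ennreal 1 \<partial>M)"
    by (rule N_exp_stopped_le[OF st order_refl T, where L="\<bar>l\<bar>"]) auto
  also have "\<dots> = 1" using emeasure_space_1 by simp
  also have "(\<integral>\<^sup>+\<omega>. ennreal (1 * exp (l * (N (min T (\<sigma> \<omega>)) \<omega> - N (min 0 (\<sigma> \<omega>)) \<omega>) +
      0 * (B (min T (\<sigma> \<omega>)) \<omega> - B (min 0 (\<sigma> \<omega>)) \<omega>) - bracket (\<lambda>_. l) (\<lambda>_. 0) (min 0 (\<sigma> \<omega>)) (min T (\<sigma> \<omega>)) \<omega> / 2)) \<partial>M)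
    = (\<integral>\<^sup>+\<omega>. ennreal (exp (l * N (\<sigma> \<omega>) \<omega> - l\<^sup>2 * bracket (\<lambda>_. 1) (\<lambda>_. 0) 0 (\<sigma> \<omega>) \<omega> / 2)) \<partial>M)"
  proof (rule nn_integral_cong)
    fix \<omega> assume \<omega>: "\<omega> \<in> space M"
    have "min T (\<sigma> \<omega>) = \<sigma> \<omega>" "min 0 (\<sigma> \<omega>) = 0" using Z_hit[OF \<omega> T c] unfolding \<sigma>_def by auto
    moreover have "N 0 \<omega> = 0" using Z_start[OF \<omega>] by (simp add: N_def)
    moreover have "bracket (\<lambda>_. l) (\<lambda>_. 0) 0 (\<sigma> \<omega>) \<omega> = l\<^sup>2 * bracket (\<lambda>_. 1) (\<lambda>_. 0) 0 (\<sigma> \<omega>) \<omega>"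
      using bracket_cmult[of l "\<lambda>_. 1" "\<lambda>_. 0"] by simp
    ultimately show "ennreal (1 * exp (l * (N (min T (\<sigma> \<omega>)) \<omega> - N (min 0 (\<sigma> \<omega>)) \<omega>) +
      0 * (B (min T (\<sigma> \<omega>)) \<omega> - B (min 0 (\<sigma> \<omega>)) \<omega>) - bracket (\<lambda>_. l) (\<lambda>_. 0) (min 0 (\<sigma> \<omega>)) (min T (\<sigma> \<omega>)) \<omega> / 2))
      = ennreal (exp (l * N (\<sigma> \<omega>) \<omega> - l\<^sup>2 * bracket (\<lambda>_. 1) (\<lambda>_. 0) 0 (\<sigma> \<omega>) \<omega> / 2))" by simp
  qed
  finally show "(\<integral>\<^sup>+\<omega>. ennreal (exp (l * N (\<sigma> \<omega>) \<omega> - l\<^sup>2 * bracket (\<lambda>_. 1) (\<lambda>_. 0) 0 (\<sigma> \<omega>) \<omega> / 2)) \<partial>M) \<le> 1" .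
  show "bracket (\<lambda>_. 1) (\<lambda>_. 0) 0 (\<sigma> \<omega>) \<omega> \<le> c\<^sup>2 * T" if \<omega>: "\<omega> \<in> space M" for \<omega>
  proof -
    note Zh = Z_hit[OF \<omega> T c, folded \<sigma>_def]
    have "bracket (\<lambda>_. 1) (\<lambda>_. 0) 0 (\<sigma> \<omega>) \<omega> \<le> c\<^sup>2 * (\<sigma> \<omega> - 0)"
      by (rule bracket_le[OF \<omega> order_refl Zh(1)]) (use Zh(5) Z_nonneg[OF \<omega>] in auto)
    also have "\<dots> \<le> c\<^sup>2 * T" using Zh(2) by (intro mult_left_mono) auto
    finally show ?thesis .
  qed
qed

lemma hit_prob_le:
  assumes T: "0 < T" and c: "x0\<^sup>2 < c\<^sup>2" and D: "0 \<le> c\<^sup>2 - x0\<^sup>2 - \<delta> * T" and \<delta>: "0 < \<delta>"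
  shows "prob {\<omega> \<in> space M. \<exists>s\<in>{0..T}. c\<^sup>2 \<le> Z s \<omega>} \<le> exp (- ((c\<^sup>2 - x0\<^sup>2 - \<delta> * T)\<^sup>2 / (8 * c\<^sup>2 * T)))"
proof -
  let ?A = "{\<omega> \<in> space M. \<exists>s\<in>{0..T}. c\<^sup>2 \<le> Z s \<omega>}"
  define d where "d = c\<^sup>2 - x0\<^sup>2 - \<delta> * T"
  \<comment> \<open>Maximises \<open>l * (d / 2) - l\<^sup>2 * (c\<^sup>2 * T) / 2\<close>, with
    maximum \<open>d\<^sup>2 / (8 * c\<^sup>2 * T)\<close>. When the level is reached by time
    \<open>T\<close>, \<open>2 N = c\<^sup>2 - x0\<^sup>2 - \<delta> s \<ge> d\<close> at the
    hitting time \<open>s\<close>.\<close>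
  define l where "l = d / (2 * c\<^sup>2 * T)"
  have T0: "0 \<le> T" using T by simp
  have c0: "0 < c\<^sup>2" using c zero_le_power2[of x0] by linarith
  have l0: "0 \<le> l" unfolding l_def using D c0 T by (simp add: d_def)
  have el: "l * (d / 2) - l\<^sup>2 * (c\<^sup>2 * T) / 2 = d\<^sup>2 / (8 * c\<^sup>2 * T)"
    unfolding l_def using c0 T by (simp add: field_simps power2_eq_square)
  have A: "?A \<in> events"
  proof -
    have "{\<omega> \<in> space M. \<forall>s\<in>{0..T}. Z s \<omega> < c\<^sup>2} \<in> sets (F T)"
      by (rule sets_path_less[OF T0 measurable_Z continuous_on_subset[OF Z_continuous]]) auto
    then have "{\<omega> \<in> space M. \<forall>s\<in>{0..T}. Z s \<omega> < c\<^sup>2} \<in> events" using subalg[OF T0] unfolding subalgebra_def by blast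
    then have "space M - {\<omega> \<in> space M. \<forall>s\<in>{0..T}. Z s \<omega> < c\<^sup>2} \<in> events" by (rule sets.compl_sets)
    also have "space M - {\<omega> \<in> space M. \<forall>s\<in>{0..T}. Z s \<omega> < c\<^sup>2} = ?A" by (auto simp: not_less)
    finally show ?thesis .
  qed
  let ?s = "hit Z (c\<^sup>2) T"
  have "ennreal (exp (d\<^sup>2 / (8 * c\<^sup>2 * T)) * prob ?A) = (\<integral>\<^sup>+\<omega>. ennreal (exp (d\<^sup>2 / (8 * c\<^sup>2 * T))) * indicator ?A \<omega> \<partial>M)"
    using A by (subst nn_integral_cmult_indicator) (auto simp: emeasure_eq_measure ennreal_mult')
  also have "\<dots> \<le> (\<integral>\<^sup>+\<omega>. ennreal (exp (l * N (?s \<omega>) \<omega> - l\<^sup>2 * bracket (\<lambda>_. 1) (\<lambda>_. 0) 0 (?s \<omega>) \<omega> / 2)) \<partial>M)"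
  proof (rule nn_integral_mono)
    fix \<omega> assume \<omega>: "\<omega> \<in> space M"
    show "ennreal (exp (d\<^sup>2 / (8 * c\<^sup>2 * T))) * indicator ?A \<omega> \<le> ennreal (exp (l * N (?s \<omega>) \<omega> - l\<^sup>2 * bracket (\<lambda>_. 1) (\<lambda>_. 0) 0 (?s \<omega>) \<omega> / 2))"
    proof (cases "\<omega> \<in> ?A")
      case True
      note Zh = Z_hit[OF \<omega> T0 c]
      have "Z (?s \<omega>) \<omega> = c\<^sup>2"
      \<comment> \<open>The value \<open>T\<close> of the truncated time is ambiguous: the level is
        reached exactly at \<open>T\<close>, or not by then. On \<open>?A\<close> only the former is
        possible.\<close>
      proof (cases "?s \<omega> < T")
        case False
        then have sT: "?s \<omega> = T" using Zh(2) by simp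
        from True obtain s where s: "0 \<le> s" "s \<le> T" "c\<^sup>2 \<le> Z s \<omega>" by auto
        have "\<not> s < ?s \<omega>" using hit_less[where Y=Z, OF T0 continuous_on_subset[OF Z_continuous[OF \<omega>]], of s "c\<^sup>2"] s by force
        then have "s = T" using s sT by simp
        then show ?thesis using s sT Zh(3) by simp
      qed (rule Zh(4))
      moreover have "\<delta> * ?s \<omega> \<le> \<delta> * T" using Zh(2) \<delta> by (intro mult_left_mono) auto
      ultimately have "d / 2 \<le> N (?s \<omega>) \<omega>" unfolding N_def d_def by simp
      then have "l * (d / 2) \<le> l * N (?s \<omega>) \<omega>" using l0 by (intro mult_left_mono)
      moreover have "l\<^sup>2 * bracket (\<lambda>_. 1) (\<lambda>_. 0) 0 (?s \<omega>) \<omega> \<le> l\<^sup>2 * (c\<^sup>2 * T)"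
        using stopped_Z_exp_le(2)[OF T0 c \<omega>] by (intro mult_left_mono) auto
      ultimately have "d\<^sup>2 / (8 * c\<^sup>2 * T) \<le> l * N (?s \<omega>) \<omega> - l\<^sup>2 * bracket (\<lambda>_. 1) (\<lambda>_. 0) 0 (?s \<omega>) \<omega> / 2"
        unfolding el[symmetric] by simp
      then show ?thesis using True by (simp add: ennreal_leI)
    qed simp
  qed
  also have "\<dots> \<le> 1" by (rule stopped_Z_exp_le(1)[OF T0 c])
  finally have "exp (d\<^sup>2 / (8 * c\<^sup>2 * T)) * prob ?A \<le> 1" by (simp add: ennreal_le_1)
  then have "prob ?A \<le> 1 / exp (d\<^sup>2 / (8 * c\<^sup>2 * T))" by (simp add: field_simps)
  then show ?thesis by (simp add: d_def exp_minus inverse_eq_divide)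
qed

lemma expectation_hit:
  assumes T: "0 \<le> T" and c: "x0\<^sup>2 < c\<^sup>2"
  shows "\<delta> * expectation (hit Z (c\<^sup>2) T) = expectation (\<lambda>\<omega>. Z (hit Z (c\<^sup>2) T \<omega>) \<omega>) - x0\<^sup>2"
    and "bounded_rv (hit Z (c\<^sup>2) T)" and "bounded_rv (\<lambda>\<omega>. Z (hit Z (c\<^sup>2) T \<omega>) \<omega>)"
proof -
  let ?s = "hit Z (c\<^sup>2) T"
  have st: "stopping ?s" by (rule stopping_hit_Z[OF T])
  show b1: "bounded_rv ?s" by (rule bounded_rvI[OF measurable_hit_Z[OF T], where c=T]) (use Z_hit[OF _ T c] in auto)
  have "(\<lambda>\<omega>. Z (min T (?s \<omega>)) \<omega>) \<in> borel_measurable (F T)"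
    by (rule measurable_min_stopped[OF st T Z_adapted continuous_on_subset[OF Z_continuous]]) auto
  then have "(\<lambda>\<omega>. Z (min T (?s \<omega>)) \<omega>) \<in> borel_measurable M" by (rule measurable_F_M[OF T])
  moreover have "min T (?s \<omega>) = ?s \<omega>" if "\<omega> \<in> space M" for \<omega> using Z_hit[OF that T c] by auto
  ultimately have Zm: "(\<lambda>\<omega>. Z (?s \<omega>) \<omega>) \<in> borel_measurable M" by (subst measurable_cong[where g="\<lambda>\<omega>. Z (min T (?s \<omega>)) \<omega>"]) auto
  show b2: "bounded_rv (\<lambda>\<omega>. Z (?s \<omega>) \<omega>)"
    by (rule bounded_rvI[OF Zm, of "c\<^sup>2"]) (use Z_hit[OF _ T c] Z_nonneg in auto)
  have b3: "bounded_rv (\<lambda>\<omega>. N (?s \<omega>) \<omega>)"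
    unfolding N_def divide_inverse by (intro bounded_rv_intros b1 b2)
  then obtain b where b: "\<And>\<omega>. \<omega> \<in> space M \<Longrightarrow> \<bar>N (?s \<omega>) \<omega>\<bar> \<le> b" unfolding bounded_rv_def by blast
  let ?A = "\<lambda>\<omega>. bracket (\<lambda>_. 1) (\<lambda>_. 0) 0 (?s \<omega>) \<omega>"
  have Am: "?A \<in> borel_measurable M"
  proof -
    have "(\<lambda>\<omega>. bracket (\<lambda>_. 1) (\<lambda>_. 0) 0 (min T (?s \<omega>)) \<omega>) \<in> borel_measurable (F T)"
    proof (rule measurable_min_stopped[OF st T])
      show "bracket (\<lambda>_. 1) (\<lambda>_. 0) 0 u \<in> borel_measurable (F u)" if "0 \<le> u" for u
        by (rule measurable_bracket) (use that in auto)
      show "continuous_on {0..T} (\<lambda>u. bracket (\<lambda>_. 1) (\<lambda>_. 0) 0 u \<omega>)" if "\<omega> \<in> space M" for \<omega>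
        unfolding bracket_def by (intro indefinite_integral_continuous_1 integrable_continuous_real continuous_integrand that order_refl)
    qed
    then have "(\<lambda>\<omega>. bracket (\<lambda>_. 1) (\<lambda>_. 0) 0 (min T (?s \<omega>)) \<omega>) \<in> borel_measurable M" by (rule measurable_F_M[OF T])
    moreover have "min T (?s \<omega>) = ?s \<omega>" if "\<omega> \<in> space M" for \<omega> using Z_hit[OF that T c] by auto
    ultimately show ?thesis by (subst measurable_cong[where g="\<lambda>\<omega>. bracket (\<lambda>_. 1) (\<lambda>_. 0) 0 (min T (?s \<omega>)) \<omega>"]) auto
  qed
  have "expectation (\<lambda>\<omega>. 1 * N (?s \<omega>) \<omega>) = 0"
  proof (rule exp_le_moments(1)[where A="?A" and v=1 and a="c\<^sup>2 * T + 1" and b=b])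
    show "?A \<omega> \<le> c\<^sup>2 * T + 1" if "\<omega> \<in> space M" for \<omega> using stopped_Z_exp_le(2)[OF T c that] by simp
    show "(\<integral>\<^sup>+\<omega>. ennreal (1 * exp (r * N (?s \<omega>) \<omega> - r\<^sup>2 * ?A \<omega> / 2)) \<partial>M) \<le> (\<integral>\<^sup>+\<omega>. ennreal 1 \<partial>M)" for r
      using stopped_Z_exp_le(1)[OF T c, of r] emeasure_space_1 by simp
    \<comment> \<open>The summand \<open>1\<close> keeps the bound positive when
      \<open>T = 0\<close>.\<close>
    show "0 < c\<^sup>2 * T + 1" using T by (simp add: add_nonneg_pos)
  qed (use bounded_rv_measurable[OF b3] Am b bracket_nonneg in auto)
  then have "expectation (\<lambda>\<omega>. (Z (?s \<omega>) \<omega> - x0\<^sup>2 - \<delta> * ?s \<omega>) / 2) = 0" by (simp add: N_def)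
  then show "\<delta> * expectation ?s = expectation (\<lambda>\<omega>. Z (?s \<omega>) \<omega>) - x0\<^sup>2"
    using bounded_rv_integrable[OF b1] bounded_rv_integrable[OF b2] by (simp add: prob_space)
qed

end

section \<open>The mean of the hitting time and the lower bound\<close>

text \<open>The level set of a continuous path is closed. So a path that avoids \<open>c\<close> on
  \<open>{0..T}\<close> also avoids it for a while after \<open>T\<close>, and the infimum exceeds
  \<open>T\<close>.\<close>

lemma hitting_time_le_iff:
  assumes cont: "continuous_on {0..} (\<lambda>t. X t \<omega>)" and T: "0 \<le> T"
  shows "hitting_time X c \<omega> \<le> ennreal T \<longleftrightarrow> (\<exists>s\<in>{0..T}. X s \<omega> = c)"
proof
  assume "\<exists>s\<in>{0..T}. X s \<omega> = c"
  then obtain s where s: "0 \<le> s" "s \<le> T" "X s \<omega> = c" by auto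
  then have "hitting_time X c \<omega> \<le> ennreal s" unfolding hitting_time_def by (intro Inf_lower) auto
  then show "hitting_time X c \<omega> \<le> ennreal T" using s by (meson ennreal_leI order_trans)
next
  assume le: "hitting_time X c \<omega> \<le> ennreal T"
  show "\<exists>s\<in>{0..T}. X s \<omega> = c"
  proof (rule ccontr)
    assume no: "\<not> ?thesis"
    \<comment> \<open>Visits after \<open>T + 1\<close> are irrelevant; \<open>m\<close> is the
      first visit in this window, or its right end if there is none, and bounds all visits from
      below.\<close>
    let ?S = "{t \<in> {0..T + 1}. X t \<omega> = c}"
    have cl: "closed ?S"
      by (rule continuous_closed_preimage_constant[OF continuous_on_subset[OF cont]]) auto
    define m where "m = (if ?S = {} then T + 1 else Inf ?S)"
    have bdd: "bdd_below ?S" by (rule bdd_belowI[of _ 0]) auto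
    have m: "T < m"
    proof (cases "?S = {}")
      case False
      then have "Inf ?S \<in> ?S" using cl bdd by (intro closed_contains_Inf)
      then have "m \<in> ?S" using False unfolding m_def by (simp only: if_False)
      then show ?thesis using no by force
    qed (simp add: m_def)
    have mle: "m \<le> T + 1 \<or> m = T + 1"
    proof (cases "?S = {}")
      case False
      then have "Inf ?S \<in> ?S" using cl bdd by (intro closed_contains_Inf)
      then have "m \<in> ?S" using False unfolding m_def by (simp only: if_False)
      then show ?thesis by simp
    qed (simp add: m_def)
    have "ennreal m \<le> hitting_time X c \<omega>"
      unfolding hitting_time_def
    proof (rule Inf_greatest)
      fix x assume "x \<in> {ennreal t |t. 0 \<le> t \<and> X t \<omega> = c}"
      then obtain t where t: "x = ennreal t" "0 \<le> t" "X t \<omega> = c" by auto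
      have "m \<le> t"
      proof (cases "t \<le> T + 1")
        case True
        then have tS: "t \<in> ?S" using t by simp
        then have "?S \<noteq> {}" by blast
        then have "m = Inf ?S" unfolding m_def by (simp only: if_False)
        then show ?thesis using cInf_lower[OF tS bdd] by simp
      qed (use mle in auto)
      then show "ennreal m \<le> x" unfolding t(1) by (rule ennreal_leI)
    qed
    then have "ennreal m \<le> ennreal T" using le by (rule order_trans)
    then show False using m T by (simp add: ennreal_le_iff)
  qed
qed

section \<open>The hitting time without truncation\<close>

context squared_bessel
begin

lemma hit_Z_mono:
  assumes \<omega>: "\<omega> \<in> space M" and T: "0 \<le> T" "T \<le> T'"
  shows "hit Z K T \<omega> \<le> hit Z K T' \<omega>"
proof (rule ccontr)
  assume lt: "\<not> ?thesis"
  have cont: "continuous_on {0..u} (\<lambda>s. Z s \<omega>)" for u by (rule continuous_on_subset[OF Z_continuous[OF \<omega>]]) auto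
  have T': "0 \<le> T'" using T by simp
  have "hit Z K T' \<omega> < T'" using lt hit_bounds(2)[where Y=Z, OF T(1) cont, of K] T by linarith
  from hit_ge[where Y=Z, OF T' cont this] have "K \<le> Z (hit Z K T' \<omega>) \<omega>" .
  moreover have "Z (hit Z K T' \<omega>) \<omega> < K"
    using hit_less[where Y=Z, OF T(1) cont hit_bounds(1)[where Y=Z, OF T' cont], of K K] lt by simp
  ultimately show False by simp
qed

context
  fixes c :: real
  assumes x0: "0 \<le> x0" and c: "x0 < c" and \<delta>: "0 < \<delta>"
begin

lemma c2: "x0\<^sup>2 < c\<^sup>2" using x0 c by (simp add: power_strict_mono)

text \<open>A finite supremum lies below some horizon \<open>n\<close>, and a truncated hitting time
  below its horizon is a genuine one. If the level is never reached, the truncated times equal the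
  horizons and the supremum is infinite.\<close>

lemma hitting_time_eq_SUP:
  assumes \<omega>: "\<omega> \<in> space M"
  shows "hitting_time (\<lambda>t \<omega>. sqrt (Z t \<omega>)) c \<omega> = (SUP n. ennreal (hit Z (c\<^sup>2) (real n) \<omega>))" (is "?h = ?S")
proof (rule antisym)
  have eq: "sqrt (Z t \<omega>) = c \<longleftrightarrow> Z t \<omega> = c\<^sup>2" if "0 \<le> t" for t
    using Z_nonneg[OF \<omega> that] x0 c by auto
  show "?S \<le> ?h"
    unfolding hitting_time_def
  proof (intro SUP_least Inf_greatest)
    fix n x assume "x \<in> {ennreal t |t. 0 \<le> t \<and> sqrt (Z t \<omega>) = c}"
    then obtain t where t: "x = ennreal t" "0 \<le> t" "Z t \<omega> = c\<^sup>2" using eq by auto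
    have cont: "continuous_on {0..real n} (\<lambda>s. Z s \<omega>)" by (rule continuous_on_subset[OF Z_continuous[OF \<omega>]]) auto
    have "hit Z (c\<^sup>2) (real n) \<omega> \<le> t"
      using hit_less[where Y=Z, OF of_nat_0_le_iff cont t(2), of "c\<^sup>2"] t(3) by force
    then show "ennreal (hit Z (c\<^sup>2) (real n) \<omega>) \<le> x" unfolding t(1) by (rule ennreal_leI)
  qed
  show "?h \<le> ?S"
  proof (cases "?S = \<top>")
    case False
    then obtain b where b: "0 \<le> b" "?S = ennreal b" by (cases ?S) auto
    obtain n :: nat where n: "b < real n" using reals_Archimedean2 by blast
    have "ennreal (hit Z (c\<^sup>2) (real n) \<omega>) \<le> ?S" by (rule SUP_upper) simp
    then have hb: "hit Z (c\<^sup>2) (real n) \<omega> \<le> b" unfolding b(2) using b(1) by (simp add: ennreal_le_iff)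
    note Zh = Z_hit[OF \<omega> of_nat_0_le_iff c2, of n]
    have "Z (hit Z (c\<^sup>2) (real n) \<omega>) \<omega> = c\<^sup>2" using Zh(4) hb n by simp
    then have "?h \<le> ennreal (hit Z (c\<^sup>2) (real n) \<omega>)"
      unfolding hitting_time_def using Zh(1) eq by (intro Inf_lower) auto
    also have "\<dots> \<le> ?S" by (rule SUP_upper) simp
    finally show ?thesis .
  next
    case True
    show ?thesis unfolding True by (rule top_greatest)
  qed
qed

text \<open>Monotone convergence of the truncated means. At the truncated times
  \<open>Z \<le> c\<^sup>2\<close>, which already bounds the mean, so the hitting time is finite
  almost surely. This in turn implies that \<open>Z\<close> at the truncated times is eventually
  equal to \<open>c\<^sup>2\<close>, and dominated convergence yields the exact value.\<close>

lemma nn_integral_hitting_time: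
  "(\<integral>\<^sup>+\<omega>. hitting_time (\<lambda>t \<omega>. sqrt (Z t \<omega>)) c \<omega> \<partial>M) = ennreal ((c\<^sup>2 - x0\<^sup>2) / \<delta>)"
proof -
  let ?s = "\<lambda>n::nat. hit Z (c\<^sup>2) (real n)"
  let ?Z = "\<lambda>n \<omega>. Z (?s n \<omega>) \<omega>"
  note E = expectation_hit[OF of_nat_0_le_iff c2]
  have [measurable]: "?s n \<in> borel_measurable M" for n by (rule measurable_hit_Z) simp
  have s0: "0 \<le> ?s n \<omega>" if "\<omega> \<in> space M" for n \<omega> using Z_hit(1)[OF that of_nat_0_le_iff c2] .
  have mono: "?s m \<omega> \<le> ?s n \<omega>" if "\<omega> \<in> space M" "m \<le> n" for m n \<omega>
    using hit_Z_mono[OF that(1), of "real m" "real n"] that(2) by simp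
  have Es: "expectation (?s n) = (expectation (?Z n) - x0\<^sup>2) / \<delta>" for n
    using E(1)[of n] \<delta> by (simp add: field_simps)
  have Zc: "expectation (?Z n) \<le> c\<^sup>2" for n
  proof -
    have "expectation (?Z n) \<le> expectation (\<lambda>_. c\<^sup>2)"
      by (rule integral_mono[OF bounded_rv_integrable[OF E(3)]]) (use Z_hit(3)[OF _ of_nat_0_le_iff c2] in auto)
    then show ?thesis by (simp add: prob_space)
  qed
  have nn: "(\<integral>\<^sup>+\<omega>. ennreal (?s n \<omega>) \<partial>M) = ennreal (expectation (?s n))" for n
    using s0 by (intro nn_integral_eq_integral bounded_rv_integrable E(2)) auto
  have "(\<integral>\<^sup>+\<omega>. hitting_time (\<lambda>t \<omega>. sqrt (Z t \<omega>)) c \<omega> \<partial>M) = (\<integral>\<^sup>+\<omega>. (SUP n. ennreal (?s n \<omega>)) \<partial>M)"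
    by (intro nn_integral_cong hitting_time_eq_SUP)
  also have "\<dots> = (SUP n. \<integral>\<^sup>+\<omega>. ennreal (?s n \<omega>) \<partial>M)"
    by (rule nn_integral_monotone_convergence_SUP_AE) (rule AE_I2, rule ennreal_leI, rule mono, simp_all)
  finally have SUP: "(\<integral>\<^sup>+\<omega>. hitting_time (\<lambda>t \<omega>. sqrt (Z t \<omega>)) c \<omega> \<partial>M) = (SUP n. ennreal (expectation (?s n)))"
    and SUP': "(\<integral>\<^sup>+\<omega>. (SUP n. ennreal (?s n \<omega>)) \<partial>M) = (SUP n. ennreal (expectation (?s n)))"
    using \<open>(\<integral>\<^sup>+\<omega>. (SUP n. ennreal (?s n \<omega>)) \<partial>M) = (SUP n. \<integral>\<^sup>+\<omega>. ennreal (?s n \<omega>) \<partial>M)\<close> unfolding nn by auto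
  have "(SUP n. ennreal (expectation (?s n))) \<le> ennreal ((c\<^sup>2 - x0\<^sup>2) / \<delta>)"
    unfolding Es using Zc \<delta> by (intro SUP_least ennreal_leI divide_right_mono) auto
  then have "(\<integral>\<^sup>+\<omega>. (SUP n. ennreal (?s n \<omega>)) \<partial>M) < \<infinity>"
    unfolding SUP' infinity_ennreal_def by (rule le_less_trans) (rule ennreal_less_top)
  then have "(\<integral>\<^sup>+\<omega>. (SUP n. ennreal (?s n \<omega>)) \<partial>M) \<noteq> \<infinity>" by (rule less_imp_neq)
  then have fin: "AE \<omega> in M. (SUP n. ennreal (?s n \<omega>)) \<noteq> \<infinity>" by (intro nn_integral_PInf_AE) auto
  have "(\<lambda>n. expectation (?Z n)) \<longlonglongrightarrow> expectation (\<lambda>_. c\<^sup>2)"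
  proof (rule integral_dominated_convergence[where w="\<lambda>_. c\<^sup>2"])
    show "?Z n \<in> borel_measurable M" for n by (rule bounded_rv_measurable[OF E(3)])
    show "AE \<omega> in M. norm (?Z n \<omega>) \<le> c\<^sup>2" for n
      using Z_hit(1,3)[OF _ of_nat_0_le_iff c2] Z_nonneg by (intro AE_I2) auto
    show "AE \<omega> in M. (\<lambda>n. ?Z n \<omega>) \<longlonglongrightarrow> c\<^sup>2"
      using fin
    proof (rule AE_mp, intro AE_I2 impI)
      fix \<omega> assume \<omega>: "\<omega> \<in> space M" and f: "(SUP n. ennreal (?s n \<omega>)) \<noteq> \<infinity>"
      then obtain b where b: "0 \<le> b" "(SUP n. ennreal (?s n \<omega>)) = ennreal b" by (cases "SUP n. ennreal (?s n \<omega>)") auto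
      obtain n0 :: nat where n0: "b < real n0" using reals_Archimedean2 by blast
      have "?Z n \<omega> = c\<^sup>2" if "n0 \<le> n" for n
      proof -
        have "ennreal (?s n \<omega>) \<le> (SUP n. ennreal (?s n \<omega>))" by (rule SUP_upper) simp
        then have "?s n \<omega> \<le> b" unfolding b(2) using b(1) by (simp add: ennreal_le_iff)
        then show ?thesis using n0 that by (intro Z_hit(4)[OF \<omega> of_nat_0_le_iff c2]) simp
      qed
      then have "\<forall>\<^sub>F n in sequentially. ?Z n \<omega> = c\<^sup>2" by (auto simp: eventually_sequentially)
      then show "(\<lambda>n. ?Z n \<omega>) \<longlonglongrightarrow> c\<^sup>2" by (rule tendsto_eventually)
    qed
  qed auto
  then have "(\<lambda>n. (expectation (?Z n) - x0\<^sup>2) / \<delta>) \<longlonglongrightarrow> (c\<^sup>2 - x0\<^sup>2) / \<delta>"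
    using \<delta> by (intro tendsto_intros) (auto simp: prob_space)
  then have "(\<lambda>n. ennreal (expectation (?s n))) \<longlonglongrightarrow> ennreal ((c\<^sup>2 - x0\<^sup>2) / \<delta>)"
    unfolding Es by (rule tendsto_ennrealI)
  moreover have "incseq (\<lambda>n. ennreal (expectation (?s n)))"
    unfolding incseq_def
    by (intro allI impI ennreal_leI integral_mono bounded_rv_integrable E(2) mono)
  then have "(\<lambda>n. ennreal (expectation (?s n))) \<longlonglongrightarrow> (SUP n. ennreal (expectation (?s n)))" by (rule LIMSEQ_SUP)
  ultimately show ?thesis unfolding SUP by (rule LIMSEQ_unique[rotated])
qed

lemma reaches_iff:
  assumes \<omega>: "\<omega> \<in> space M" and T: "0 \<le> T"
  shows "(\<exists>s\<in>{0..T}. sqrt (Z s \<omega>) = c) \<longleftrightarrow> (\<exists>s\<in>{0..T}. c\<^sup>2 \<le> Z s \<omega>)"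
proof
  assume "\<exists>s\<in>{0..T}. sqrt (Z s \<omega>) = c"
  then obtain s where "s \<in> {0..T}" "sqrt (Z s \<omega>) = c" by blast
  then show "\<exists>s\<in>{0..T}. c\<^sup>2 \<le> Z s \<omega>" using Z_nonneg[OF \<omega>, of s] by (intro bexI[of _ s]) auto
next
  assume "\<exists>s\<in>{0..T}. c\<^sup>2 \<le> Z s \<omega>"
  then obtain s where s: "0 \<le> s" "s \<le> T" "c\<^sup>2 \<le> Z s \<omega>" by auto
  have "continuous_on {0..s} (\<lambda>t. Z t \<omega>)" by (rule continuous_on_subset[OF Z_continuous[OF \<omega>]]) auto
  then obtain u where "0 \<le> u" "u \<le> s" "Z u \<omega> = c\<^sup>2"
    using IVT'[of "\<lambda>t. Z t \<omega>" 0 "c\<^sup>2" s] s Z_start[OF \<omega>] c2 by auto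
  then show "\<exists>s\<in>{0..T}. sqrt (Z s \<omega>) = c" using s x0 c by (intro bexI[of _ u]) auto
qed

end

end

section \<open>Gaussian tail and the lower bound\<close>

text \<open>Substituting \<open>a + s * z\<close> and using \<open>(a + s * z)\<^sup>2 \<le> 2 *
  (a\<^sup>2 + s\<^sup>2 * z\<^sup>2)\<close> bounds the density from below by a multiple of
  \<open>exp (- z\<^sup>2)\<close>, whose integral over the half-line is \<open>sqrt pi / 2\<close>.
  The resulting factor is \<open>1 / (2 * sqrt 2)\<close>, and
  \<open>2 * sqrt 2 \<le> 3\<close>.\<close>

lemma (in prob_space) normal_tail_ge:
  assumes X: "distributed M lborel X (\<lambda>x. ennreal (normal_density 0 s x))" and s: "0 < s" and a: "0 \<le> a"
  shows "prob {\<omega> \<in> space M. a \<le> X \<omega>} \<ge> 1 / 3 * exp (- (a\<^sup>2 / s\<^sup>2))"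
proof -
  let ?w = "exp (- (a\<^sup>2 / s\<^sup>2))"
  have sq: "(\<integral>\<^sup>+z. ennreal (indicator {0..} z *\<^sub>R exp (- z\<^sup>2)) \<partial>lborel) = ennreal (sqrt pi / 2)"
    using gaussian_moment_0 by (subst nn_integral_eq_integral) (auto simp: has_bochner_integral_iff)
  have "ennreal (1 / 3 * ?w) \<le> ennreal (1 / sqrt (2 * pi) * ?w * (sqrt pi / 2))"
  proof (rule ennreal_leI)
    have "1 / sqrt (2 * pi) * ?w * (sqrt pi / 2) = ?w * (1 / (2 * sqrt 2))"
      by (simp add: real_sqrt_mult)
    moreover have "1 / 3 \<le> 1 / (2 * sqrt 2)"
    proof (rule divide_left_mono)
      have "sqrt 2 \<le> 3 / 2" by (rule real_le_lsqrt) (auto simp: power2_eq_square)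
      then show "2 * sqrt 2 \<le> 3" by simp
    qed auto
    ultimately show "1 / 3 * ?w \<le> 1 / sqrt (2 * pi) * ?w * (sqrt pi / 2)"
      using mult_left_mono[of "1 / 3" "1 / (2 * sqrt 2)" ?w] by simp
  qed
  also have "\<dots> = ennreal (1 / sqrt (2 * pi) * ?w) * (\<integral>\<^sup>+z. ennreal (indicator {0..} z *\<^sub>R exp (- z\<^sup>2)) \<partial>lborel)"
    unfolding sq by (rule ennreal_mult) auto
  also have "\<dots> = (\<integral>\<^sup>+z. ennreal (1 / sqrt (2 * pi) * ?w) * ennreal (indicator {0..} z *\<^sub>R exp (- z\<^sup>2)) \<partial>lborel)"
    by (rule nn_integral_cmult[symmetric]) measurable
  also have "\<dots> \<le> (\<integral>\<^sup>+z. ennreal s * (ennreal (normal_density 0 s (a + s * z)) * indicator {a..} (a + s * z)) \<partial>lborel)"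
  proof (rule nn_integral_mono)
    fix z :: real
    show "ennreal (1 / sqrt (2 * pi) * ?w) * ennreal (indicator {0..} z *\<^sub>R exp (- z\<^sup>2))
      \<le> ennreal s * (ennreal (normal_density 0 s (a + s * z)) * indicator {a..} (a + s * z))"
    proof (cases "0 \<le> z")
      case True
      have "0 \<le> (a - s * z)\<^sup>2" by simp
      then have "(a + s * z)\<^sup>2 \<le> 2 * (a\<^sup>2 + s\<^sup>2 * z\<^sup>2)" by (simp add: power2_eq_square algebra_simps)
      then have "(a + s * z)\<^sup>2 / (2 * s\<^sup>2) \<le> 2 * (a\<^sup>2 + s\<^sup>2 * z\<^sup>2) / (2 * s\<^sup>2)" by (rule divide_right_mono) simp
      also have "\<dots> = a\<^sup>2 / s\<^sup>2 + z\<^sup>2" using s by (simp add: add_divide_distrib)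
      finally have "exp (- (a\<^sup>2 / s\<^sup>2)) * exp (- z\<^sup>2) \<le> exp (- ((a + s * z)\<^sup>2 / (2 * s\<^sup>2)))" by (simp flip: exp_add)
      then have "1 / sqrt (2 * pi) * (?w * exp (- z\<^sup>2)) \<le> 1 / sqrt (2 * pi) * exp (- ((a + s * z)\<^sup>2 / (2 * s\<^sup>2)))"
        by (intro mult_left_mono) auto
      also have "\<dots> = s * normal_density 0 s (a + s * z)"
        using s by (simp add: normal_density_def real_sqrt_mult)
      finally show ?thesis using True s by (simp add: ennreal_mult'[symmetric] ennreal_leI mult.assoc)
    qed simp
  qed
  also have "\<dots> = ennreal s * (\<integral>\<^sup>+z. ennreal (normal_density 0 s (a + s * z)) * indicator {a..} (a + s * z) \<partial>lborel)"
    by (rule nn_integral_cmult) measurable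
  also have "\<dots> = (\<integral>\<^sup>+x. ennreal (normal_density 0 s x) * indicator {a..} x \<partial>lborel)"
    using nn_integral_real_affine[of "\<lambda>x. ennreal (normal_density 0 s x) * indicator {a..} x" s a] s by simp
  also have "\<dots> = emeasure M (X -` {a..} \<inter> space M)"
    by (rule distributed_emeasure[OF X, symmetric]) simp
  also have "X -` {a..} \<inter> space M = {\<omega> \<in> space M. a \<le> X \<omega>}" by auto
  finally show ?thesis by (simp add: emeasure_eq_measure ennreal_le_iff)
qed

lemma (in squared_bessel) hit_prob_ge:
  assumes T: "0 < T" and x0: "0 \<le> x0" and c: "x0 < c" and \<delta>: "1 \<le> \<delta>"
  shows "prob {\<omega> \<in> space M. \<exists>s\<in>{0..T}. c\<^sup>2 \<le> Z s \<omega>} \<ge> 1 / 3 * exp (- ((c - x0)\<^sup>2 / T))"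
proof -
  have T0: "0 \<le> T" using T by simp
  let ?A = "{\<omega> \<in> space M. \<exists>s\<in>{0..T}. c\<^sup>2 \<le> Z s \<omega>}"
  have A: "?A \<in> events"
  proof -
    have "{\<omega> \<in> space M. \<forall>s\<in>{0..T}. Z s \<omega> < c\<^sup>2} \<in> sets (F T)"
      by (rule sets_path_less[OF T0 measurable_Z continuous_on_subset[OF Z_continuous]]) auto
    then have "{\<omega> \<in> space M. \<forall>s\<in>{0..T}. Z s \<omega> < c\<^sup>2} \<in> events" using subalg[OF T0] unfolding subalgebra_def by blast
    then have "space M - {\<omega> \<in> space M. \<forall>s\<in>{0..T}. Z s \<omega> < c\<^sup>2} \<in> events" by (rule sets.compl_sets)
    also have "space M - {\<omega> \<in> space M. \<forall>s\<in>{0..T}. Z s \<omega> < c\<^sup>2} = ?A" by (auto simp: not_less)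
    finally show ?thesis .
  qed
  have "1 / 3 * exp (- ((c - x0)\<^sup>2 / (sqrt (T - 0))\<^sup>2)) \<le> prob {\<omega> \<in> space M. c - x0 \<le> B T \<omega> - B 0 \<omega>}"
    by (rule normal_tail_ge[OF increment_distr[OF order_refl T]]) (use T c in auto)
  also have "{\<omega> \<in> space M. c - x0 \<le> B T \<omega> - B 0 \<omega>} = {\<omega> \<in> space M. c - x0 \<le> B T \<omega>}" using start by auto
  also have "prob {\<omega> \<in> space M. c - x0 \<le> B T \<omega>} \<le> prob ?A"
  proof (rule finite_measure_mono_AE[OF _ A])
    show "AE \<omega> in M. \<omega> \<in> {\<omega> \<in> space M. c - x0 \<le> B T \<omega>} \<longrightarrow> \<omega> \<in> ?A"
      using AE_sqrt_Z_ge[OF \<delta> T x0]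
    proof (rule AE_mp, intro AE_I2 impI)
      fix \<omega> assume \<omega>: "\<omega> \<in> space M" "x0 + B T \<omega> \<le> sqrt (Z T \<omega>)" "\<omega> \<in> {\<omega> \<in> space M. c - x0 \<le> B T \<omega>}"
      then have "c \<le> sqrt (Z T \<omega>)" by simp
      then have "c\<^sup>2 \<le> (sqrt (Z T \<omega>))\<^sup>2" using x0 c by (intro power_mono) auto
      then have "c\<^sup>2 \<le> Z T \<omega>" using Z_nonneg[OF \<omega>(1) T0] by simp
      then show "\<omega> \<in> ?A" using \<omega>(1) T0 by auto
    qed
  qed
  finally show ?thesis using T by simp
qed

section \<open>Bessel processes\<close>

lemma sets_augmented_filtration:
  assumes "\<And>s. 0 \<le> s \<Longrightarrow> \<beta> s \<in> borel_measurable M"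
  shows "sets (augmented_filtration M \<beta> t) = sigma_sets (space M) ({\<beta> s -` B \<inter> space M | s B. 0 \<le> s \<and> s \<le> t \<and> B \<in> sets borel} \<union> null_sets M)"
    and "space (augmented_filtration M \<beta> t) = space M"
    and "subalgebra M (augmented_filtration M \<beta> t)"
proof -
  let ?G = "{\<beta> s -` B \<inter> space M | s B. 0 \<le> s \<and> s \<le> t \<and> B \<in> sets borel} \<union> null_sets M"
  have G: "?G \<subseteq> sets M" using assms by (auto intro: measurable_sets)
  then have G': "?G \<subseteq> Pow (space M)" using sets.space_closed by blast
  show 1: "sets (augmented_filtration M \<beta> t) = sigma_sets (space M) ?G" "space (augmented_filtration M \<beta> t) = space M"
    unfolding augmented_filtration_def by (rule sets_measure_of[OF G'], rule space_measure_of_conv)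
  show "subalgebra M (augmented_filtration M \<beta> t)"
    unfolding subalgebra_def 1 using sets.sigma_sets_subset[OF G] by blast
qed

lemma
  assumes \<beta>: "\<And>s. 0 \<le> s \<Longrightarrow> \<beta> s \<in> borel_measurable M"
  shows augmented_filtration_mono: "s \<le> t \<Longrightarrow> sets (augmented_filtration M \<beta> s) \<subseteq> sets (augmented_filtration M \<beta> t)"
    and augmented_filtration_null: "A \<in> null_sets M \<Longrightarrow> A \<in> sets (augmented_filtration M \<beta> t)"
    and augmented_filtration_measurable: "0 \<le> s \<Longrightarrow> s \<le> t \<Longrightarrow> \<beta> s \<in> borel_measurable (augmented_filtration M \<beta> t)"
proof -
  have sets: "sets (augmented_filtration M \<beta> u) = sigma_sets (space M) ({\<beta> s -` B \<inter> space M | s B. 0 \<le> s \<and> s \<le> u \<and> B \<in> sets borel} \<union> null_sets M)"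
    "space (augmented_filtration M \<beta> u) = space M" for u
    using sets_augmented_filtration[of \<beta> M u] \<beta> by blast+
  show "s \<le> t \<Longrightarrow> sets (augmented_filtration M \<beta> s) \<subseteq> sets (augmented_filtration M \<beta> t)"
    unfolding sets by (intro sigma_sets_mono' Un_mono order_refl) (blast intro: order_trans)
  show "A \<in> null_sets M \<Longrightarrow> A \<in> sets (augmented_filtration M \<beta> t)"
    unfolding sets by (intro sigma_sets.Basic) auto
  show "\<beta> s \<in> borel_measurable (augmented_filtration M \<beta> t)" if "0 \<le> s" "s \<le> t"
  proof (rule measurableI)
    fix C :: "real set" assume "C \<in> sets borel"
    then show "\<beta> s -` C \<inter> space (augmented_filtration M \<beta> t) \<in> sets (augmented_filtration M \<beta> t)"
      unfolding sets using that by (intro sigma_sets.Basic) auto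
  qed simp
qed

text \<open>Cylinder sets modulo null sets form an intersection-stable generator of the augmented filtration.\<close>

lemma wiener_increment_indep:
  fixes M :: "'a measure"
  assumes W: "wiener_process M \<beta>" and st: "0 \<le> s" "s < t"
  shows "prob_space.indep_set M (sets (augmented_filtration M \<beta> s)) {(\<lambda>\<omega>. \<beta> t \<omega> - \<beta> s \<omega>) -` C \<inter> space M | C. C \<in> sets borel}"
proof -
  interpret prob_space M using W unfolding wiener_process_def by blast
  have \<beta>: "\<beta> u \<in> borel_measurable M" if "0 \<le> u" for u using W that unfolding wiener_process_def by blast
  have \<beta>0: "AE \<omega> in M. \<beta> 0 \<omega> = 0" using W unfolding wiener_process_def by blast
  let ?D = "\<lambda>\<omega>. \<beta> t \<omega> - \<beta> s \<omega>"
  have Dm[measurable]: "?D \<in> borel_measurable M" using st by (intro borel_measurable_diff \<beta>) auto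
  let ?I = "{?D -` C \<inter> space M | C. C \<in> sets borel}"
  define Cyl where "Cyl = {S \<in> events. \<exists>T D. finite T \<and> T \<subseteq> {0..s} \<and> D \<in> sets (\<Pi>\<^sub>M u\<in>T. (borel :: real measure)) \<and>
    (AE \<omega> in M. \<omega> \<in> S \<longleftrightarrow> (\<lambda>u\<in>T. \<beta> u \<omega>) \<in> D)}"
  have CylI: "S \<in> Cyl" if "S \<in> events" "finite T" "T \<subseteq> {0..s}" "D \<in> sets (\<Pi>\<^sub>M u\<in>T. (borel :: real measure))"
    "AE \<omega> in M. \<omega> \<in> S \<longleftrightarrow> (\<lambda>u\<in>T. \<beta> u \<omega>) \<in> D" for S T D
    unfolding Cyl_def using that by blast
  have augS: "sets (augmented_filtration M \<beta> s) = sigma_sets (space M) ({\<beta> u -` B \<inter> space M | u B. 0 \<le> u \<and> u \<le> s \<and> B \<in> sets borel} \<union> null_sets M)"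
    using sets_augmented_filtration(1)[of \<beta> M s] \<beta> by blast
  have Int: "Int_stable Cyl"
  proof (rule Int_stableI)
    fix S1 S2 assume "S1 \<in> Cyl" "S2 \<in> Cyl"
    then obtain T1 D1 T2 D2 where S: "S1 \<in> events" "S2 \<in> events" "finite T1" "T1 \<subseteq> {0..s}" "D1 \<in> sets (\<Pi>\<^sub>M u\<in>T1. (borel :: real measure))"
      "finite T2" "T2 \<subseteq> {0..s}" "D2 \<in> sets (\<Pi>\<^sub>M u\<in>T2. (borel :: real measure))"
      and ae: "AE \<omega> in M. \<omega> \<in> S1 \<longleftrightarrow> (\<lambda>u\<in>T1. \<beta> u \<omega>) \<in> D1" "AE \<omega> in M. \<omega> \<in> S2 \<longleftrightarrow> (\<lambda>u\<in>T2. \<beta> u \<omega>) \<in> D2"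
      unfolding Cyl_def by blast
    let ?P = "\<Pi>\<^sub>M u\<in>T1 \<union> T2. (borel :: real measure)"
    let ?D = "((\<lambda>f. restrict f T1) -` D1 \<inter> space ?P) \<inter> ((\<lambda>f. restrict f T2) -` D2 \<inter> space ?P)"
    have D: "?D \<in> sets ?P"
      using S by (intro sets.Int measurable_sets[OF measurable_restrict_subset]) auto
    have aeD: "AE \<omega> in M. \<omega> \<in> S1 \<inter> S2 \<longleftrightarrow> (\<lambda>u\<in>T1 \<union> T2. \<beta> u \<omega>) \<in> ?D"
      using ae
    proof eventually_elim
      fix \<omega> assume h: "\<omega> \<in> S1 \<longleftrightarrow> (\<lambda>u\<in>T1. \<beta> u \<omega>) \<in> D1" "\<omega> \<in> S2 \<longleftrightarrow> (\<lambda>u\<in>T2. \<beta> u \<omega>) \<in> D2"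
      have "restrict (\<lambda>u\<in>T1 \<union> T2. \<beta> u \<omega>) T1 = (\<lambda>u\<in>T1. \<beta> u \<omega>)" "restrict (\<lambda>u\<in>T1 \<union> T2. \<beta> u \<omega>) T2 = (\<lambda>u\<in>T2. \<beta> u \<omega>)"
        by (auto simp: restrict_def)
      moreover have "(\<lambda>u\<in>T1 \<union> T2. \<beta> u \<omega>) \<in> space ?P" by (simp add: space_PiM)
      ultimately show "\<omega> \<in> S1 \<inter> S2 \<longleftrightarrow> (\<lambda>u\<in>T1 \<union> T2. \<beta> u \<omega>) \<in> ?D" using h by simp
    qed
    show "S1 \<inter> S2 \<in> Cyl" by (rule CylI[OF _ _ _ D aeD]) (use S in auto)
  qed
  have ind: "indep_set Cyl ?I"
    unfolding indep_sets2_eq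
  proof (intro conjI ballI)
    show "Cyl \<subseteq> events" unfolding Cyl_def by blast
    show "?I \<subseteq> events" using Dm by (auto intro: measurable_sets)
    fix S I assume "S \<in> Cyl" "I \<in> ?I"
    then obtain T D C where S: "S \<in> events" "finite T" "T \<subseteq> {0..s}" "D \<in> sets (\<Pi>\<^sub>M u\<in>T. (borel :: real measure))"
      and ae: "AE \<omega> in M. \<omega> \<in> S \<longleftrightarrow> (\<lambda>u\<in>T. \<beta> u \<omega>) \<in> D" and I: "I = ?D -` C \<inter> space M" and C: "C \<in> sets borel"
      unfolding Cyl_def by blast
    \<comment> \<open>Adding \<open>0\<close> and \<open>s\<close> to the times of the cylinder
      makes each \<open>\<beta> u\<close> a sum of increments from time zero, and lets the list end
      where the increment \<open>?D\<close> starts. The sequence \<open>ts\<close> runs through the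
      list and continues with \<open>t\<close>, so that \<open>?D\<close> is its increment number
      \<open>n\<close>.\<close>
    define L where "L = sorted_list_of_set (insert 0 (insert s T))"
    define n where "n = length L - 1"
    have fin: "finite (insert 0 (insert s T))" using S(2) by simp
    have setL: "set L = insert 0 (insert s T)" unfolding L_def by (rule set_sorted_list_of_set[OF fin])
    have sL: "sorted L" unfolding L_def by (rule sorted_sorted_list_of_set)
    have lL: "length L = Suc n" unfolding n_def using setL by (cases L) auto
    define ts where "ts = (\<lambda>i. if i \<le> n then L ! i else t)"
    have Lmem: "L ! i \<in> {0..s}" if "i \<le> n" for i
    proof -
      have "L ! i \<in> set L" using that lL by (intro nth_mem) simp
      then show ?thesis unfolding setL using S(3) st by auto
    qed
    have ts0: "ts 0 = 0"
    proof -
      obtain i where i: "i < length L" "L ! i = 0" using setL by (metis in_set_conv_nth insertI1)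
      then have "L ! 0 \<le> 0" using sL sorted_nth_mono[of L 0 i] by simp
      then show ?thesis using Lmem[of 0] by (simp add: ts_def)
    qed
    have tsn: "ts n = s"
    proof -
      obtain i where i: "i < length L" "L ! i = s" using setL by (metis in_set_conv_nth insertI1 insertI2)
      then have "s \<le> L ! n" using sL sorted_nth_mono[of L i n] lL by simp
      then show ?thesis using Lmem[of n] by (simp add: ts_def)
    qed
    have ts_mono: "ts i \<le> ts (Suc i)" if "i < Suc n" for i
    proof (cases "i < n")
      case True
      then show ?thesis unfolding ts_def using sL lL by (simp add: sorted_nth_mono)
    next
      case False
      then have "i = n" using that by simp
      then show ?thesis using tsn st by (simp add: ts_def)
    qed
    let ?Y = "\<lambda>i \<omega>. \<beta> (ts (Suc i)) \<omega> - \<beta> (ts i) \<omega>"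
    have iv: "indep_vars (\<lambda>_. borel) ?Y {..<Suc n}"
      using W ts0 ts_mono unfolding wiener_process_def by simp
    \<comment> \<open>The first \<open>n\<close> increments carry the cylinder event and the last
      one carries \<open>I\<close>; disjoint blocks of independent variables are
      independent.\<close>
    have iv2: "indep_var (\<Pi>\<^sub>M i\<in>{..<n}. borel) (\<lambda>\<omega>. \<lambda>i\<in>{..<n}. ?Y i \<omega>) (\<Pi>\<^sub>M i\<in>{n}. borel) (\<lambda>\<omega>. \<lambda>i\<in>{n}. ?Y i \<omega>)"
      by (rule indep_var_restrict[OF iv]) auto
    define ix where "ix u = (SOME i. i \<le> n \<and> ts i = u)" for u
    have ix: "ix u \<le> n \<and> ts (ix u) = u" if "u \<in> T" for u
    proof -
      have "u \<in> set L" using that setL by auto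
      then obtain i where "i < length L" "L ! i = u" by (auto simp: in_set_conv_nth)
      then have "i \<le> n \<and> ts i = u" using lL by (simp add: ts_def)
      then show ?thesis unfolding ix_def by (rule someI)
    qed
    \<comment> \<open>Partial sums recover the values at the times of \<open>T\<close> from the
      increments, up to \<open>\<beta> 0\<close>, which is zero almost surely; \<open>ix u\<close>
      is a position of \<open>u\<close> in the list.\<close>
    define h where "h = (\<lambda>f. \<lambda>u\<in>T. \<Sum>j<ix u. f j :: real)"
    have hm: "h \<in> measurable (\<Pi>\<^sub>M i\<in>{..<n}. borel) (\<Pi>\<^sub>M u\<in>T. borel)"
      unfolding h_def
    proof (rule measurable_restrict)
      fix u assume "u \<in> T"
      then show "(\<lambda>f. \<Sum>j<ix u. f j :: real) \<in> borel_measurable (\<Pi>\<^sub>M i\<in>{..<n}. borel)"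
        using ix[of u] by (intro borel_measurable_sum measurable_component_singleton) auto
    qed
    let ?P = "\<Pi>\<^sub>M i\<in>{..<n}. (borel :: real measure)" and ?P' = "\<Pi>\<^sub>M i\<in>{n}. (borel :: real measure)"
    let ?Xa = "h -` D \<inter> space ?P" and ?Xb = "(\<lambda>f. f n) -` C \<inter> space ?P'"
    have Xa: "?Xa \<in> sets ?P" by (rule measurable_sets[OF hm S(4)])
    have Xb: "?Xb \<in> sets ?P'" by (rule measurable_sets[OF _ C], rule measurable_component_singleton) simp
    have I': "I = (\<lambda>\<omega>. \<lambda>i\<in>{n}. ?Y i \<omega>) -` ?Xb \<inter> space M"
      unfolding I using tsn by (auto simp: ts_def space_PiM)
    let ?S' = "(\<lambda>\<omega>. \<lambda>i\<in>{..<n}. ?Y i \<omega>) -` ?Xa \<inter> space M"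
    have tele: "(\<Sum>j<k. ?Y j \<omega>) = \<beta> (ts k) \<omega> - \<beta> (ts 0) \<omega>" for k \<omega>
      by (induction k) auto
    have Ym: "(\<lambda>\<omega>. \<lambda>i\<in>{..<n}. ?Y i \<omega>) \<in> measurable M ?P" using iv2 by (rule indep_var_rv1)
    have S'm: "?S' \<in> events" by (rule measurable_sets[OF Ym Xa])
    have Im: "I \<in> events" unfolding I by (rule measurable_sets[OF Dm C])
    have ae': "AE \<omega> in M. \<omega> \<in> S \<longleftrightarrow> \<omega> \<in> ?S'"
      using AE_space ae \<beta>0
    proof eventually_elim
      fix \<omega> assume \<omega>: "\<omega> \<in> space M" and h1: "\<omega> \<in> S \<longleftrightarrow> (\<lambda>u\<in>T. \<beta> u \<omega>) \<in> D" and h2: "\<beta> 0 \<omega> = 0"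
      have "h (\<lambda>i\<in>{..<n}. ?Y i \<omega>) = (\<lambda>u\<in>T. \<beta> u \<omega>)"
      proof -
        have "(\<Sum>j<ix u. (\<lambda>i\<in>{..<n}. ?Y i \<omega>) j) = \<beta> u \<omega>" if "u \<in> T" for u
        proof -
          have "(\<Sum>j<ix u. (\<lambda>i\<in>{..<n}. ?Y i \<omega>) j) = (\<Sum>j<ix u. ?Y j \<omega>)"
            using ix[OF that] by (intro sum.cong) auto
          then show ?thesis using tele[of \<omega> "ix u"] ix[OF that] h2 ts0 by simp
        qed
        then show ?thesis unfolding h_def by (auto simp: restrict_def)
      qed
      moreover have "(\<lambda>i\<in>{..<n}. ?Y i \<omega>) \<in> space ?P" by (simp add: space_PiM)
      ultimately show "\<omega> \<in> S \<longleftrightarrow> \<omega> \<in> ?S'" using h1 \<omega> by simp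
    qed
    have "prob (S \<inter> I) = prob (?S' \<inter> I)"
      using ae' S(1) S'm Im by (intro finite_measure_eq_AE) (auto elim!: eventually_mono)
    also have "?S' \<inter> I = (\<lambda>\<omega>. (\<lambda>i\<in>{..<n}. ?Y i \<omega>, \<lambda>i\<in>{n}. ?Y i \<omega>)) -` (?Xa \<times> ?Xb) \<inter> space M"
      unfolding I' by auto
    also have "prob \<dots> = prob ?S' * prob I"
      unfolding I' by (rule indep_varD[OF iv2 Xa Xb])
    also have "prob ?S' = prob S"
      using ae' S(1) S'm by (intro finite_measure_eq_AE) (auto elim!: eventually_mono)
    finally show "prob (S \<inter> I) = prob S * prob I" .
  qed
  have IntI: "Int_stable ?I"
  proof (rule Int_stableI)
    fix a b assume "a \<in> ?I" "b \<in> ?I"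
    then obtain C1 C2 where "a = ?D -` C1 \<inter> space M" "b = ?D -` C2 \<inter> space M" "C1 \<in> sets borel" "C2 \<in> sets borel" by blast
    then show "a \<inter> b \<in> ?I" by (intro CollectI exI[of _ "C1 \<inter> C2"]) auto
  qed
  have "indep_set (sigma_sets (space M) Cyl) (sigma_sets (space M) ?I)"
    by (rule indep_set_sigma_sets[OF ind Int IntI])
  moreover have "sets (augmented_filtration M \<beta> s) \<subseteq> sigma_sets (space M) Cyl"
    unfolding augS
  proof (rule sigma_sets_mono, rule subsetI)
    fix A assume "A \<in> {\<beta> u -` C \<inter> space M | u C. 0 \<le> u \<and> u \<le> s \<and> C \<in> sets borel} \<union> null_sets M"
    then show "A \<in> sigma_sets (space M) Cyl"
    proof
      assume "A \<in> {\<beta> u -` C \<inter> space M | u C. 0 \<le> u \<and> u \<le> s \<and> C \<in> sets borel}"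
      then obtain u C where A: "A = \<beta> u -` C \<inter> space M" "0 \<le> u" "u \<le> s" "C \<in> sets borel" by blast
      let ?P = "\<Pi>\<^sub>M u\<in>{u}. (borel :: real measure)"
      have D: "(\<lambda>f. f u) -` C \<inter> space ?P \<in> sets ?P" by (rule measurable_sets[OF _ A(4)], rule measurable_component_singleton) simp
      have aeD: "AE \<omega> in M. \<omega> \<in> A \<longleftrightarrow> (\<lambda>v\<in>{u}. \<beta> v \<omega>) \<in> (\<lambda>f. f u) -` C \<inter> space ?P"
        by (rule AE_I2) (auto simp: A(1) space_PiM)
      have "A \<in> events" unfolding A(1) by (rule measurable_sets[OF \<beta>[OF A(2)] A(4)])
      then have "A \<in> Cyl" by (rule CylI[OF _ _ _ D aeD]) (use A in auto)
      then show ?thesis by (rule sigma_sets.Basic)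
    next
      assume A: "A \<in> null_sets M"
      \<comment> \<open>Up to a null set, \<open>A\<close> is the empty cylinder over no times at
        all.\<close>
      have "AE \<omega> in M. \<omega> \<in> A \<longleftrightarrow> (\<lambda>v\<in>{}. \<beta> v \<omega>) \<in> {}" using AE_not_in[OF A] by simp
      then have "A \<in> Cyl" by (rule CylI[rotated 4]) (use A in auto)
      then show ?thesis by (rule sigma_sets.Basic)
    qed
  qed
  moreover have "?I \<subseteq> sigma_sets (space M) ?I" by auto
  ultimately show ?thesis unfolding indep_sets2_eq by blast
qed

section \<open>Modification on a null set\<close>

lemma measurable_clamp_pair:
  fixes T :: real
  assumes "0 \<le> T"
  shows "(\<lambda>(s, \<omega>). (max 0 (min T s), \<omega>)) \<in> measurable (borel \<Otimes>\<^sub>M G) (restrict_space borel {0..T} \<Otimes>\<^sub>M G)"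
proof -
  have "(\<lambda>x. max 0 (min T (fst x))) \<in> measurable (borel \<Otimes>\<^sub>M G) (restrict_space borel {0..T})"
    by (rule measurable_restrict_space2) (use assms in auto)
  then show ?thesis unfolding split_beta by (intro measurable_Pair measurable_snd)
qed

text \<open>A Bessel process solves the equation only almost surely. Redefining the driving process and the solution on
  a null set, which belongs to every \<open>\<sigma>\<close>-algebra of the augmented filtration, makes continuity and the initial
  values hold everywhere.\<close>

lemma bessel_process_modification:
  fixes M :: "'a measure"
  assumes "bessel_process M \<delta> x0 X"
  shows "\<exists>F B Z A. squared_bessel M F B Z \<delta> x0 \<and> A \<in> null_sets M
    \<and> (\<forall>\<omega>\<in>space M - A. \<forall>t\<ge>0. sqrt (Z t \<omega>) = X t \<omega>)
    \<and> (\<forall>t\<ge>0. (\<lambda>\<omega>. (X t \<omega>)\<^sup>2) \<in> borel_measurable (F t))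
    \<and> (\<forall>\<omega>\<in>space M. continuous_on {0..} (\<lambda>t. (X t \<omega>)\<^sup>2) \<and> (\<forall>t\<ge>0. 0 \<le> X t \<omega>))"
proof -
  from assms obtain \<beta> where X0: "\<And>\<omega> t. \<omega> \<in> space M \<Longrightarrow> 0 \<le> t \<Longrightarrow> 0 \<le> X t \<omega>" and W: "wiener_process M \<beta>"
    and sol: "squared_bessel_solution M \<beta> \<delta> x0 (\<lambda>t \<omega>. (X t \<omega>)\<^sup>2)"
    unfolding bessel_process_def by blast
  interpret prob_space M using W unfolding wiener_process_def by blast
  let ?Y = "\<lambda>t \<omega>. (X t \<omega>)\<^sup>2"
  let ?F = "augmented_filtration M \<beta>"
  have \<beta>: "\<And>u. 0 \<le> u \<Longrightarrow> \<beta> u \<in> borel_measurable M" using W unfolding wiener_process_def by blast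
  have \<beta>0: "AE \<omega> in M. \<beta> 0 \<omega> = 0" and \<beta>c: "AE \<omega> in M. continuous_on {0..} (\<lambda>t. \<beta> t \<omega>)"
    and \<beta>d: "\<And>s t. 0 \<le> s \<Longrightarrow> s < t \<Longrightarrow> distributed M lborel (\<lambda>\<omega>. \<beta> t \<omega> - \<beta> s \<omega>) (\<lambda>x. ennreal (normal_density 0 (sqrt (t - s)) x))"
    using W unfolding wiener_process_def by blast+
  have Ym: "\<And>t. 0 \<le> t \<Longrightarrow> ?Y t \<in> borel_measurable (?F t)" and Yc: "\<And>\<omega>. \<omega> \<in> space M \<Longrightarrow> continuous_on {0..} (\<lambda>t. ?Y t \<omega>)"
    and ito: "\<And>t. 0 \<le> t \<Longrightarrow> \<exists>J. has_ito_integral M ?F \<beta> (\<lambda>s \<omega>. sqrt \<bar>?Y s \<omega>\<bar>) t J \<and> (AE \<omega> in M. ?Y t \<omega> = x0\<^sup>2 + 2 * J \<omega> + \<delta> * t)"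
    using sol unfolding squared_bessel_solution_def by blast+
  have sub: "subalgebra M (?F t)" for t by (rule sets_augmented_filtration(3)) (rule \<beta>)
  have nullF: "C \<in> sets (?F t)" if "C \<in> null_sets M" for C t by (rule augmented_filtration_null[OF _ that]) (rule \<beta>)
  have monoF: "sets (?F s) \<subseteq> sets (?F t)" if "s \<le> t" for s t by (rule augmented_filtration_mono[OF _ that]) (rule \<beta>)
  have \<beta>F: "\<beta> s \<in> borel_measurable (?F t)" if "0 \<le> s" "s \<le> t" for s t by (rule augmented_filtration_measurable[OF _ that]) (rule \<beta>)
  have FM: "f \<in> borel_measurable M" if "f \<in> borel_measurable (?F t)" for t and f :: "'a \<Rightarrow> real" using measurable_from_subalg[OF sub that] .

  \<comment> \<open>The initial value is hidden in the equation at time zero: all simple integrals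
    vanish there, so their limit in probability \<open>J\<close> is zero almost surely.\<close>
  have Y0: "AE \<omega> in M. ?Y 0 \<omega> = x0\<^sup>2"
  proof -
    from ito[of 0] obtain J where J: "has_ito_integral M ?F \<beta> (\<lambda>s \<omega>. sqrt \<bar>?Y s \<omega>\<bar>) 0 J" "AE \<omega> in M. ?Y 0 \<omega> = x0\<^sup>2 + 2 * J \<omega> + \<delta> * 0" by auto
    from J(1) obtain n ts \<xi> where s: "\<And>k. simple_integrand M ?F (n k) (ts k) (\<xi> k)"
      and lim: "\<And>\<epsilon>. \<epsilon> > 0 \<Longrightarrow> (\<lambda>k. measure M {\<omega> \<in> space M. \<bar>simple_ito_integral \<beta> (n k) (ts k) (\<xi> k) 0 \<omega> - J \<omega>\<bar> > \<epsilon>}) \<longlonglongrightarrow> 0"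
      and Jm[measurable]: "J \<in> borel_measurable M"
      unfolding has_ito_integral_def by blast
    have z: "simple_ito_integral \<beta> (n k) (ts k) (\<xi> k) 0 \<omega> = 0" for k \<omega>
    proof -
      have m: "0 \<le> ts k i" if "i \<le> n k" for i
        using that
      proof (induction i)
        case (Suc i)
        then have "ts k i \<le> ts k (Suc i)" using s[of k] by (simp add: simple_integrand_def)
        then show ?case using Suc by simp
      qed (use s[of k] in \<open>simp add: simple_integrand_def\<close>)
      show ?thesis unfolding simple_ito_integral_def using m by (intro sum.neutral) (simp add: min_absorb2)
    qed
    have "prob {\<omega> \<in> space M. inverse (real (Suc j)) < \<bar>J \<omega>\<bar>} = 0" for j
      using lim[of "inverse (real (Suc j))"] unfolding z by (simp add: LIMSEQ_const_iff)
    then have "AE \<omega> in M. \<not> inverse (real (Suc j)) < \<bar>J \<omega>\<bar>" for j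
      by (intro AE_I[where N="{\<omega> \<in> space M. inverse (real (Suc j)) < \<bar>J \<omega>\<bar>}"]) (auto simp: emeasure_eq_measure)
    then have "AE \<omega> in M. \<forall>j. \<not> inverse (real (Suc j)) < \<bar>J \<omega>\<bar>" by (simp only: AE_all_countable) blast
    with J(2) show ?thesis
    proof eventually_elim
      fix \<omega> assume h: "?Y 0 \<omega> = x0\<^sup>2 + 2 * J \<omega> + \<delta> * 0" "\<forall>j. \<not> inverse (real (Suc j)) < \<bar>J \<omega>\<bar>"
      have "J \<omega> = 0"
      proof (rule ccontr)
        assume "J \<omega> \<noteq> 0"
        then obtain j where "inverse (real (Suc j)) < \<bar>J \<omega>\<bar>" using reals_Archimedean[of "\<bar>J \<omega>\<bar>"] by auto
        then show False using h(2) by blast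
      qed
      then show "?Y 0 \<omega> = x0\<^sup>2" using h(1) by simp
    qed
  qed
  have "AE \<omega> in M. \<beta> 0 \<omega> = 0 \<and> continuous_on {0..} (\<lambda>t. \<beta> t \<omega>) \<and> ?Y 0 \<omega> = x0\<^sup>2"
    using \<beta>0 \<beta>c Y0 by eventually_elim blast
  then obtain A where A0: "{\<omega> \<in> space M. \<not> (\<beta> 0 \<omega> = 0 \<and> continuous_on {0..} (\<lambda>t. \<beta> t \<omega>) \<and> ?Y 0 \<omega> = x0\<^sup>2)} \<subseteq> A"
    "emeasure M A = 0" "A \<in> sets M" by (rule AE_E)
  then have A: "A \<in> null_sets M" by (simp add: null_setsI)
  have good: "\<beta> 0 \<omega> = 0" "continuous_on {0..} (\<lambda>t. \<beta> t \<omega>)" "?Y 0 \<omega> = x0\<^sup>2" if "\<omega> \<in> space M" "\<omega> \<notin> A" for \<omega>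
    using A0(1) that by blast+
  define B where "B = (\<lambda>t \<omega>. if \<omega> \<in> A then 0 else \<beta> t \<omega>)"
  define Z where "Z = (\<lambda>t \<omega>. if \<omega> \<in> A then x0\<^sup>2 else ?Y t \<omega>)"
  have notA: "AE \<omega> in M. \<omega> \<notin> A" by (rule AE_not_in[OF A])
  have AF: "A \<inter> space (?F t) \<in> sets (?F t)" for t using nullF[OF A, of t] by (intro sets.Int) auto
  have BF: "B s \<in> borel_measurable (?F t)" if "0 \<le> s" "s \<le> t" for s t
    unfolding B_def using \<beta>F[OF that] AF[of t] by (intro measurable_If_set) auto
  have ZF: "Z t \<in> borel_measurable (?F t)" if "0 \<le> t" for t
    unfolding Z_def using Ym[OF that] AF[of t] by (intro measurable_If_set) auto
  have BM: "B s \<in> borel_measurable M" if "0 \<le> s" for s using FM[OF BF[OF that order_refl]] .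
  have bf: "brownian_filtration M ?F B"
  proof unfold_locales
    show "subalgebra M (?F t)" for t by (rule sub)
    show "sets (?F s) \<subseteq> sets (?F t)" if "s \<le> t" for s t by (rule monoF[OF that])
    show "B t \<in> borel_measurable (?F t)" if "0 \<le> t" for t by (rule BF[OF that order_refl])
    show "B 0 \<omega> = 0" if "\<omega> \<in> space M" for \<omega> using good(1)[OF that] by (simp add: B_def)
    show "continuous_on {0..} (\<lambda>t. B t \<omega>)" if "\<omega> \<in> space M" for \<omega>
      using good(2)[OF that] by (cases "\<omega> \<in> A") (simp_all add: B_def)
    fix s t :: real assume st: "0 \<le> s" "s < t"
    then have t0: "0 \<le> t" by simp
    have Dm: "(\<lambda>\<omega>. B t \<omega> - B s \<omega>) \<in> borel_measurable M" "(\<lambda>\<omega>. \<beta> t \<omega> - \<beta> s \<omega>) \<in> borel_measurable M"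
      using BM[OF t0] BM[OF st(1)] \<beta>[OF t0] \<beta>[OF st(1)] by (auto intro: borel_measurable_diff)
    have ae: "AE \<omega> in M. B t \<omega> - B s \<omega> = \<beta> t \<omega> - \<beta> s \<omega>"
      using notA by eventually_elim (simp add: B_def)
    have "distr M lborel (\<lambda>\<omega>. B t \<omega> - B s \<omega>) = distr M lborel (\<lambda>\<omega>. \<beta> t \<omega> - \<beta> s \<omega>)"
      using Dm ae by (intro distr_cong_AE) auto
    then show "distributed M lborel (\<lambda>\<omega>. B t \<omega> - B s \<omega>) (\<lambda>x. ennreal (normal_density 0 (sqrt (t - s)) x))"
      using \<beta>d[OF st] Dm(1) unfolding distributed_def by simp
    show "indep_set (sets (?F s)) {(\<lambda>\<omega>. B t \<omega> - B s \<omega>) -` C \<inter> space M | C. C \<in> sets borel}"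
      unfolding indep_sets2_eq
    proof (intro conjI ballI)
      show "sets (?F s) \<subseteq> events" using sub[of s] unfolding subalgebra_def by blast
      show "{(\<lambda>\<omega>. B t \<omega> - B s \<omega>) -` C \<inter> space M | C. C \<in> sets borel} \<subseteq> events"
        using Dm(1) by (auto intro: measurable_sets)
      fix S I assume S: "S \<in> sets (?F s)" and "I \<in> {(\<lambda>\<omega>. B t \<omega> - B s \<omega>) -` C \<inter> space M | C. C \<in> sets borel}"
      then obtain C where C: "I = (\<lambda>\<omega>. B t \<omega> - B s \<omega>) -` C \<inter> space M" "C \<in> sets borel" by blast
      let ?I = "(\<lambda>\<omega>. \<beta> t \<omega> - \<beta> s \<omega>) -` C \<inter> space M"
      have SM: "S \<in> events" using S sub[of s] unfolding subalgebra_def by blast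
      have IM: "I \<in> events" "?I \<in> events" unfolding C(1) using Dm C(2) by (auto intro: measurable_sets)
      have "prob (S \<inter> I) = prob (S \<inter> ?I)"
        by (rule finite_measure_eq_AE) (use ae SM IM in \<open>auto simp: C(1) elim!: eventually_mono\<close>)
      also have "\<dots> = prob S * prob ?I"
        using wiener_increment_indep[OF W st] S C(2) unfolding indep_sets2_eq by blast
      also have "prob ?I = prob I"
        by (rule finite_measure_eq_AE) (use ae IM in \<open>auto simp: C(1) elim!: eventually_mono\<close>)
      finally show "prob (S \<inter> I) = prob S * prob I" .
    qed
  qed
  interpret brownian_filtration M ?F B by (rule bf)
  have prog: "(\<lambda>(s, \<omega>). sqrt \<bar>?Y (max 0 (min T s)) \<omega>\<bar>) \<in> borel_measurable (borel \<Otimes>\<^sub>M ?F T)" if T: "0 \<le> T" for T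
  proof -
    from ito[OF T] obtain J where "has_ito_integral M ?F \<beta> (\<lambda>s \<omega>. sqrt \<bar>?Y s \<omega>\<bar>) T J" by blast
    then have "(\<lambda>(s, \<omega>). sqrt \<bar>?Y s \<omega>\<bar>) \<in> borel_measurable (restrict_space borel {0..T} \<Otimes>\<^sub>M ?F T)"
      using T unfolding has_ito_integral_def by blast
    from measurable_compose[OF measurable_clamp_pair[OF T] this] show ?thesis by (simp add: split_beta)
  qed
  have sb: "squared_bessel M ?F B Z \<delta> x0"
  proof unfold_locales
    show "Z t \<in> borel_measurable (?F t)" if "0 \<le> t" for t by (rule ZF[OF that])
    show "continuous_on {0..} (\<lambda>t. Z t \<omega>)" if "\<omega> \<in> space M" for \<omega>
      using Yc[OF that] by (cases "\<omega> \<in> A") (simp_all add: Z_def)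
    show "Z 0 \<omega> = x0\<^sup>2" if "\<omega> \<in> space M" for \<omega> using good(3)[OF that] by (simp add: Z_def)
    show "0 \<le> Z t \<omega>" for t \<omega> by (simp add: Z_def)
    show "(\<lambda>(s, \<omega>). Z (max 0 (min T s)) \<omega>) \<in> borel_measurable (borel \<Otimes>\<^sub>M ?F T)" if T: "0 \<le> T" for T
    proof -
      have A': "{x \<in> space (borel \<Otimes>\<^sub>M ?F T). snd x \<in> A} \<in> sets (borel \<Otimes>\<^sub>M ?F T)"
      proof -
        have "snd -` A \<inter> space (borel \<Otimes>\<^sub>M ?F T) \<in> sets (borel \<Otimes>\<^sub>M ?F T)"
          by (rule measurable_sets[OF measurable_snd nullF[OF A]])
        then show ?thesis by (simp add: vimage_def Int_def conj_commute)
      qed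
      \<comment> \<open>Progressive measurability is given for the integrand, the root of
        \<open>?Y\<close>; squaring transfers it to \<open>?Y\<close>.\<close>
      have "(\<lambda>x. (sqrt \<bar>?Y (max 0 (min T (fst x))) (snd x)\<bar>)\<^sup>2) \<in> borel_measurable (borel \<Otimes>\<^sub>M ?F T)"
        using prog[OF T] unfolding split_beta by (rule borel_measurable_power)
      then have "(\<lambda>x. if snd x \<in> A then x0\<^sup>2 else (sqrt \<bar>?Y (max 0 (min T (fst x))) (snd x)\<bar>)\<^sup>2) \<in> borel_measurable (borel \<Otimes>\<^sub>M ?F T)"
        using A' by (intro measurable_If) auto
      moreover have "(sqrt \<bar>y\<^sup>2\<bar>)\<^sup>2 = y\<^sup>2" for y :: real by simp
      ultimately show ?thesis unfolding Z_def split_beta by (simp only:)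
    qed
    show "\<exists>G I Q. (\<forall>k. step_pair (G k) (I k)) \<and>
      (\<forall>k. \<forall>\<omega>\<in>space M. I k 0 \<omega> = 0 \<and> (\<lambda>s. G k s \<omega>) \<in> borel_measurable borel) \<and>
      conv0 (\<lambda>k \<omega>. ennreal \<bar>I k t \<omega> - (Z t \<omega> - x0\<^sup>2 - \<delta> * t) / 2\<bar>) \<and> conv0 Q \<and>
      (\<forall>k. \<forall>\<omega>\<in>space M. (\<integral>\<^sup>+s\<in>{0<..t}. ennreal ((G k s \<omega> - sqrt (Z s \<omega>))\<^sup>2) \<partial>lborel) \<le> Q k \<omega>)"
      if t: "0 \<le> t" for t
    proof -
      from ito[OF t] obtain J where J: "has_ito_integral M ?F \<beta> (\<lambda>s \<omega>. sqrt \<bar>?Y s \<omega>\<bar>) t J" "AE \<omega> in M. ?Y t \<omega> = x0\<^sup>2 + 2 * J \<omega> + \<delta> * t" by auto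
      from J(1) obtain n ts \<xi> where s: "\<And>k. simple_integrand M ?F (n k) (ts k) (\<xi> k)"
        and lim1: "\<And>\<epsilon>. \<epsilon> > 0 \<Longrightarrow> (\<lambda>k. measure M {\<omega> \<in> space M.
             (\<integral>\<^sup>+ s\<in>{0..t}. ennreal ((simple_process (n k) (ts k) (\<xi> k) s \<omega> - sqrt \<bar>?Y s \<omega>\<bar>)\<^sup>2) \<partial>lborel) > ennreal \<epsilon>}) \<longlonglongrightarrow> 0"
        and lim2: "\<And>\<epsilon>. \<epsilon> > 0 \<Longrightarrow> (\<lambda>k. measure M {\<omega> \<in> space M. \<bar>simple_ito_integral \<beta> (n k) (ts k) (\<xi> k) t \<omega> - J \<omega>\<bar> > \<epsilon>}) \<longlonglongrightarrow> 0"
        and Jm[measurable]: "J \<in> borel_measurable M"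
        unfolding has_ito_integral_def by blast
      let ?G = "\<lambda>k. simple_process (n k) (ts k) (\<xi> k)" and ?I = "\<lambda>k. simple_ito_integral B (n k) (ts k) (\<xi> k)"
      let ?q = "\<lambda>k \<omega>. \<integral>\<^sup>+ s\<in>{0..t}. ennreal ((?G k s \<omega> - sqrt \<bar>?Y s \<omega>\<bar>)\<^sup>2) \<partial>lborel"
      \<comment> \<open>The bound has to hold at every point. On \<open>A\<close> the redefined
        \<open>Z\<close> is unrelated to the approximations, so the trivial bound
        \<open>\<top>\<close> is taken there, and a null set does not affect convergence in
        probability.\<close>
      let ?Q = "\<lambda>k \<omega>. if \<omega> \<in> A then \<top> else ?q k \<omega>"
      have tsn: "0 \<le> ts k i" if "i \<le> n k" for k i
        using that
      proof (induction i)
        case (Suc i)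
        then have "ts k i \<le> ts k (Suc i)" using s[of k] by (simp add: simple_integrand_def)
        then show ?case using Suc by simp
      qed (use s[of k] in \<open>simp add: simple_integrand_def\<close>)
      have \<xi>m: "\<xi> k i \<in> borel_measurable M" if "i < n k" for k i
        using s[of k] that FM unfolding simple_integrand_def by blast
      have sp: "step_pair (?G k) (?I k)" for k by (rule step_pair_simple[OF s])
      have I0: "?I k 0 \<omega> = 0" for k \<omega>
        unfolding simple_ito_integral_def using tsn[of _ k] by (intro sum.neutral) (simp add: min_absorb2)
      have Gs: "(\<lambda>s. ?G k s \<omega>) \<in> borel_measurable borel" for k \<omega>
        unfolding simple_process_def by measurable
      have Gj: "(\<lambda>x. ?G k (snd x) (fst x)) \<in> borel_measurable (M \<Otimes>\<^sub>M lborel)" for k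
        unfolding simple_process_def
      proof (intro borel_measurable_sum borel_measurable_times)
        fix i assume "i \<in> {..<n k}"
        then show "(\<lambda>x. \<xi> k i (fst x)) \<in> borel_measurable (M \<Otimes>\<^sub>M lborel)"
          using \<xi>m[of i k] by (intro measurable_compose[OF measurable_fst]) auto
        show "(\<lambda>x. indicat_real {ts k i<..ts k (Suc i)} (snd x)) \<in> borel_measurable (M \<Otimes>\<^sub>M lborel)" by measurable
      qed
      \<comment> \<open>Joint measurability is what makes the squared distance \<open>?q k\<close> a
        random variable; clamped times extend the integrand to all real times.\<close>
      have Hj: "(\<lambda>x. sqrt \<bar>?Y (max 0 (min t (snd x))) (fst x)\<bar>) \<in> borel_measurable (M \<Otimes>\<^sub>M lborel)"
      proof -
        have id: "(\<lambda>\<omega>. \<omega>) \<in> measurable M (?F t)" by (rule measurable_F_M[OF t]) simp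
        have "(\<lambda>x. (snd x, fst x)) \<in> measurable (M \<Otimes>\<^sub>M lborel) (borel \<Otimes>\<^sub>M ?F t)"
          using measurable_compose[OF measurable_fst id] by measurable
        from measurable_compose[OF this prog[OF t]] show ?thesis by simp
      qed
      have qm: "?q k \<in> borel_measurable M" for k
      proof -
        have "(\<lambda>(\<omega>, s). ennreal ((?G k s \<omega> - sqrt \<bar>?Y (max 0 (min t s)) \<omega>\<bar>)\<^sup>2) * indicator {0..t} s) \<in> borel_measurable (M \<Otimes>\<^sub>M lborel)"
          unfolding split_beta using Gj[of k] Hj by measurable
        then have "(\<lambda>\<omega>. \<integral>\<^sup>+ s. ennreal ((?G k s \<omega> - sqrt \<bar>?Y (max 0 (min t s)) \<omega>\<bar>)\<^sup>2) * indicator {0..t} s \<partial>lborel) \<in> borel_measurable M"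
          by (rule lborel.borel_measurable_nn_integral)
        also have "(\<lambda>\<omega>. \<integral>\<^sup>+ s. ennreal ((?G k s \<omega> - sqrt \<bar>?Y (max 0 (min t s)) \<omega>\<bar>)\<^sup>2) * indicator {0..t} s \<partial>lborel) = ?q k"
          by (intro ext nn_integral_cong) (auto split: split_indicator)
        finally show ?thesis .
      qed
      have Qm: "?Q k \<in> borel_measurable M" for k
        using qm[of k] A0(3) by (intro measurable_If_set) auto
      have Q: "conv0 ?Q"
        unfolding conv0_def
      proof (intro conjI allI impI Qm)
        fix \<epsilon> :: real assume \<epsilon>: "\<epsilon> > 0"
        have "prob {\<omega> \<in> space M. ennreal \<epsilon> < ?Q k \<omega>} = prob {\<omega> \<in> space M. ennreal \<epsilon> < ?q k \<omega>}" for k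
        proof (rule finite_measure_eq_AE)
          show "AE \<omega> in M. (\<omega> \<in> {\<omega> \<in> space M. ennreal \<epsilon> < ?Q k \<omega>}) = (\<omega> \<in> {\<omega> \<in> space M. ennreal \<epsilon> < ?q k \<omega>})"
            using notA by eventually_elim simp
          show "{\<omega> \<in> space M. ennreal \<epsilon> < ?Q k \<omega>} \<in> events" using Qm[of k] by measurable
          show "{\<omega> \<in> space M. ennreal \<epsilon> < ?q k \<omega>} \<in> events" using qm[of k] by measurable
        qed
        then show "(\<lambda>k. prob {\<omega> \<in> space M. ennreal \<epsilon> < ?Q k \<omega>}) \<longlonglongrightarrow> 0" using lim1[OF \<epsilon>] by simp
      qed
      have Im: "?I k t \<in> borel_measurable M" for k
      proof -
        have "(\<lambda>\<omega>. ?I k t \<omega> - ?I k 0 \<omega>) \<in> borel_measurable M"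
          by (rule measurable_F_M[OF t step_pair_measurable[OF sp order_refl t]])
        then show ?thesis unfolding I0 by simp
      qed
      have I\<beta>: "simple_ito_integral \<beta> (n k) (ts k) (\<xi> k) t \<in> borel_measurable M" for k
        unfolding simple_ito_integral_def[abs_def]
      proof (intro borel_measurable_sum borel_measurable_times borel_measurable_diff \<beta>)
        fix i assume i: "i \<in> {..<n k}"
        then show "\<xi> k i \<in> borel_measurable M" using \<xi>m by simp
        show "0 \<le> min (ts k (Suc i)) t" "0 \<le> min (ts k i) t" using tsn[of "Suc i" k] tsn[of i k] t i by auto
      qed
      have Zm: "Z t \<in> borel_measurable M" using FM[OF ZF[OF t]] .
      have DIm: "(\<lambda>\<omega>. ennreal \<bar>?I k t \<omega> - (Z t \<omega> - x0\<^sup>2 - \<delta> * t) / 2\<bar>) \<in> borel_measurable M" for k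
        using Im[of k] Zm by measurable
      have I: "conv0 (\<lambda>k \<omega>. ennreal \<bar>?I k t \<omega> - (Z t \<omega> - x0\<^sup>2 - \<delta> * t) / 2\<bar>)"
        unfolding conv0_def
      proof (intro conjI allI impI DIm)
        fix \<epsilon> :: real assume \<epsilon>: "\<epsilon> > 0"
        have "prob {\<omega> \<in> space M. ennreal \<epsilon> < ennreal \<bar>?I k t \<omega> - (Z t \<omega> - x0\<^sup>2 - \<delta> * t) / 2\<bar>}
          = prob {\<omega> \<in> space M. \<epsilon> < \<bar>simple_ito_integral \<beta> (n k) (ts k) (\<xi> k) t \<omega> - J \<omega>\<bar>}" for k
        proof (rule finite_measure_eq_AE)
          show "AE \<omega> in M. (\<omega> \<in> {\<omega> \<in> space M. ennreal \<epsilon> < ennreal \<bar>?I k t \<omega> - (Z t \<omega> - x0\<^sup>2 - \<delta> * t) / 2\<bar>})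
            = (\<omega> \<in> {\<omega> \<in> space M. \<epsilon> < \<bar>simple_ito_integral \<beta> (n k) (ts k) (\<xi> k) t \<omega> - J \<omega>\<bar>})"
            using notA J(2)
          proof eventually_elim
            fix \<omega> assume h: "\<omega> \<notin> A" "?Y t \<omega> = x0\<^sup>2 + 2 * J \<omega> + \<delta> * t"
            have "?I k t \<omega> = simple_ito_integral \<beta> (n k) (ts k) (\<xi> k) t \<omega>" using h(1) by (simp add: simple_ito_integral_def B_def)
            moreover have "(Z t \<omega> - x0\<^sup>2 - \<delta> * t) / 2 = J \<omega>" using h by (simp add: Z_def)
            ultimately show "(\<omega> \<in> {\<omega> \<in> space M. ennreal \<epsilon> < ennreal \<bar>?I k t \<omega> - (Z t \<omega> - x0\<^sup>2 - \<delta> * t) / 2\<bar>})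
              = (\<omega> \<in> {\<omega> \<in> space M. \<epsilon> < \<bar>simple_ito_integral \<beta> (n k) (ts k) (\<xi> k) t \<omega> - J \<omega>\<bar>})"
              using \<epsilon> by (simp add: ennreal_less_iff)
          qed
          show "{\<omega> \<in> space M. ennreal \<epsilon> < ennreal \<bar>?I k t \<omega> - (Z t \<omega> - x0\<^sup>2 - \<delta> * t) / 2\<bar>} \<in> events"
            using DIm[of k] by measurable
          show "{\<omega> \<in> space M. \<epsilon> < \<bar>simple_ito_integral \<beta> (n k) (ts k) (\<xi> k) t \<omega> - J \<omega>\<bar>} \<in> events"
            using I\<beta>[of k] by measurable
        qed
        then show "(\<lambda>k. prob {\<omega> \<in> space M. ennreal \<epsilon> < ennreal \<bar>?I k t \<omega> - (Z t \<omega> - x0\<^sup>2 - \<delta> * t) / 2\<bar>}) \<longlonglongrightarrow> 0"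
          using lim2[OF \<epsilon>] by simp
      qed
      have le: "(\<integral>\<^sup>+s\<in>{0<..t}. ennreal ((?G k s \<omega> - sqrt (Z s \<omega>))\<^sup>2) \<partial>lborel) \<le> ?Q k \<omega>" for k \<omega>
      proof (cases "\<omega> \<in> A")
        case False
        then have "(\<integral>\<^sup>+s\<in>{0<..t}. ennreal ((?G k s \<omega> - sqrt (Z s \<omega>))\<^sup>2) \<partial>lborel) \<le> ?q k \<omega>"
          by (intro nn_integral_mono) (auto simp: Z_def split: split_indicator)
        then show ?thesis using False by simp
      qed simp
      show ?thesis
        by (intro exI[of _ ?G] exI[of _ ?I] exI[of _ ?Q] conjI allI ballI sp I0 Gs I Q le)
    qed
  qed
  have "sqrt (Z t \<omega>) = X t \<omega>" if "\<omega> \<in> space M - A" "0 \<le> t" for \<omega> t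
    using X0[OF _ that(2)] that(1) by (simp add: Z_def)
  then show ?thesis
    by (intro exI[of _ ?F] exI[of _ B] exI[of _ Z] exI[of _ A] conjI ballI allI impI sb A Ym Yc X0)
qed

section \<open>Transfer to the given Bessel process\<close>

lemma hitting_time_cong:
  assumes "\<And>t. 0 \<le> t \<Longrightarrow> X t \<omega> = Y t \<omega>"
  shows "hitting_time X c \<omega> = hitting_time Y c \<omega>"
proof -
  have "{ennreal t | t. 0 \<le> t \<and> X t \<omega> = c} = {ennreal t | t. 0 \<le> t \<and> Y t \<omega> = c}"
    by (rule Collect_cong) (metis assms)
  then show ?thesis unfolding hitting_time_def by (simp only:)
qed

theorem proposition3p1:
  fixes M :: "'a measure" and X :: "real \<Rightarrow> 'a \<Rightarrow> real" and c x0 \<delta> \<eta> :: real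
  assumes "c > 0" and "0 \<le> x0" and "x0 < c"
    and "\<delta> > 0" and "0 < \<eta>" and "\<eta> < 1"
    and "bessel_process M \<delta> x0 X"
  shows "measure M {\<omega> \<in> space M. hitting_time X c \<omega>
             \<le> ennreal (1 - \<eta>) * (\<integral>\<^sup>+ \<omega>'. hitting_time X c \<omega>' \<partial>M)}
           = measure M {\<omega> \<in> space M. hitting_time X c \<omega> \<le> ennreal ((c\<^sup>2 - x0\<^sup>2) / \<delta> * (1 - \<eta>))}
         \<and> measure M {\<omega> \<in> space M. hitting_time X c \<omega> \<le> ennreal ((c\<^sup>2 - x0\<^sup>2) / \<delta> * (1 - \<eta>))}
           \<le> exp (- (\<delta> / 8 * ((c\<^sup>2 - x0\<^sup>2) / c\<^sup>2) * (\<eta>\<^sup>2 / (1 - \<eta>))))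
         \<and> (\<delta> > 1 \<longrightarrow>
             measure M {\<omega> \<in> space M. hitting_time X c \<omega>
               \<le> ennreal (2 * c * ((c - x0) / (\<delta> - 1)) * (1 - \<eta>))}
             \<ge> 1 / 3 * exp (- (2 * (\<delta> - 1) * ((c - x0) / c) * (1 / (1 - \<eta>)))))"
proof -
  note c = \<open>c > 0\<close> \<open>x0 < c\<close> and x0 = \<open>0 \<le> x0\<close> and \<delta> = \<open>\<delta> > 0\<close> and \<eta> = \<open>0 < \<eta>\<close> \<open>\<eta> < 1\<close>
  obtain F B Z A where sb: "squared_bessel M F B Z \<delta> x0" and A: "A \<in> null_sets M"
    and mod: "\<forall>\<omega>\<in>space M - A. \<forall>t\<ge>0. sqrt (Z t \<omega>) = X t \<omega>"
    and ad: "\<forall>t\<ge>0. (\<lambda>\<omega>. (X t \<omega>)\<^sup>2) \<in> borel_measurable (F t)"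
    and path: "\<forall>\<omega>\<in>space M. continuous_on {0..} (\<lambda>t. (X t \<omega>)\<^sup>2) \<and> (\<forall>t\<ge>0. 0 \<le> X t \<omega>)"
    using bessel_process_modification[OF assms(7)] by (elim exE conjE)
  have ZX: "sqrt (Z t \<omega>) = X t \<omega>" if "\<omega> \<in> space M" "\<omega> \<notin> A" "0 \<le> t" for \<omega> t
    using mod that by simp
  have XF: "(\<lambda>\<omega>. (X t \<omega>)\<^sup>2) \<in> borel_measurable (F t)" if "0 \<le> t" for t using ad that by simp
  have X2: "continuous_on {0..} (\<lambda>t. (X t \<omega>)\<^sup>2)" and X0: "0 \<le> t \<Longrightarrow> 0 \<le> X t \<omega>" if "\<omega> \<in> space M" for \<omega> t
    using path that by simp_all
  interpret squared_bessel M F B Z \<delta> x0 by (rule sb)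
  have Xc: "continuous_on {0..} (\<lambda>t. X t \<omega>)" if \<omega>: "\<omega> \<in> space M" for \<omega>
  proof -
    have "continuous_on {0..} (\<lambda>t. sqrt ((X t \<omega>)\<^sup>2))" by (intro continuous_intros X2[OF \<omega>])
    then show ?thesis by (rule continuous_on_eq) (simp add: X0[OF \<omega>])
  qed
  \<comment> \<open>The bridge between the two formulations: \<open>hitting_time\<close> concerns
    the given process, the estimates concern its modification. Since the space need not be complete,
    measurability of the former event does not follow from that of the latter and is proved on its
    own.\<close>
  have event: "prob {\<omega> \<in> space M. hitting_time X c \<omega> \<le> ennreal T} = prob {\<omega> \<in> space M. \<exists>s\<in>{0..T}. c\<^sup>2 \<le> Z s \<omega>}"
    if T: "0 \<le> T" for T
  proof (rule finite_measure_eq_AE)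
    have path: "{\<omega> \<in> space M. \<forall>s\<in>{0..T}. Y s \<omega> < K} \<in> events"
      if "\<And>t. 0 \<le> t \<Longrightarrow> Y t \<in> borel_measurable (F t)" "\<And>\<omega>. \<omega> \<in> space M \<Longrightarrow> continuous_on {0..} (\<lambda>t. Y t \<omega>)" for Y and K :: real
    proof -
      have "{\<omega> \<in> space M. \<forall>s\<in>{0..T}. Y s \<omega> < K} \<in> sets (F T)"
        by (rule sets_path_less[OF T]) (auto intro: measurable_F_mono that(1) continuous_on_subset[OF that(2)])
      then show ?thesis using subalg[OF T] unfolding subalgebra_def by blast
    qed
    have hit: "hitting_time X c \<omega> \<le> ennreal T \<longleftrightarrow> (\<exists>s\<in>{0..T}. X s \<omega> = c)" if "\<omega> \<in> space M" for \<omega>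
      by (rule hitting_time_le_iff[of X \<omega>, OF Xc[OF that] T])
    show "AE \<omega> in M. \<omega> \<in> {\<omega> \<in> space M. hitting_time X c \<omega> \<le> ennreal T} \<longleftrightarrow> \<omega> \<in> {\<omega> \<in> space M. \<exists>s\<in>{0..T}. c\<^sup>2 \<le> Z s \<omega>}"
      using AE_space AE_not_in[OF A]
    proof eventually_elim
      fix \<omega> assume \<omega>: "\<omega> \<in> space M" "\<omega> \<notin> A"
      have "(\<exists>s\<in>{0..T}. X s \<omega> = c) \<longleftrightarrow> (\<exists>s\<in>{0..T}. sqrt (Z s \<omega>) = c)"
        by (rule bex_cong[OF refl]) (simp add: ZX[OF \<omega>])
      then show "\<omega> \<in> {\<omega> \<in> space M. hitting_time X c \<omega> \<le> ennreal T} \<longleftrightarrow> \<omega> \<in> {\<omega> \<in> space M. \<exists>s\<in>{0..T}. c\<^sup>2 \<le> Z s \<omega>}"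
        using \<omega>(1) by (simp add: hit reaches_iff[OF x0 c(2) \<delta> \<omega>(1) T])
    qed
    \<comment> \<open>A continuous path meets \<open>c\<close> exactly if it neither stays below nor
      stays above it throughout. Squares turn both alternatives into strict upper bounds for adapted
      processes, the second one after a change of sign.\<close>
    have "{\<omega> \<in> space M. hitting_time X c \<omega> \<le> ennreal T} =
      space M - ({\<omega> \<in> space M. \<forall>s\<in>{0..T}. (X s \<omega>)\<^sup>2 < c\<^sup>2} \<union> {\<omega> \<in> space M. \<forall>s\<in>{0..T}. - (X s \<omega>)\<^sup>2 < - c\<^sup>2})"
    proof (rule set_eqI)
      fix \<omega>
      show "\<omega> \<in> {\<omega> \<in> space M. hitting_time X c \<omega> \<le> ennreal T} \<longleftrightarrow>
        \<omega> \<in> space M - ({\<omega> \<in> space M. \<forall>s\<in>{0..T}. (X s \<omega>)\<^sup>2 < c\<^sup>2} \<union> {\<omega> \<in> space M. \<forall>s\<in>{0..T}. - (X s \<omega>)\<^sup>2 < - c\<^sup>2})"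
      proof (cases "\<omega> \<in> space M")
        case \<omega>: True
        have sq: "(X s \<omega>)\<^sup>2 < c\<^sup>2 \<longleftrightarrow> X s \<omega> < c" "- (X s \<omega>)\<^sup>2 < - c\<^sup>2 \<longleftrightarrow> c < X s \<omega>" if "s \<in> {0..T}" for s
          using X0[OF \<omega>, of s] c(1) that power_mono_iff[of "X s \<omega>" c 2] power_mono_iff[of c "X s \<omega>" 2]
          by (simp_all add: less_le_not_le)
        then have all: "(\<forall>s\<in>{0..T}. (X s \<omega>)\<^sup>2 < c\<^sup>2) \<longleftrightarrow> (\<forall>s\<in>{0..T}. X s \<omega> < c)"
          "(\<forall>s\<in>{0..T}. - (X s \<omega>)\<^sup>2 < - c\<^sup>2) \<longleftrightarrow> (\<forall>s\<in>{0..T}. c < X s \<omega>)"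
          by (blast intro: ball_cong)+
        have "(\<exists>s\<in>{0..T}. X s \<omega> = c) \<longleftrightarrow> \<not> (\<forall>s\<in>{0..T}. X s \<omega> < c) \<and> \<not> (\<forall>s\<in>{0..T}. c < X s \<omega>)"
        proof (intro iffI)
          assume r: "\<not> (\<forall>s\<in>{0..T}. X s \<omega> < c) \<and> \<not> (\<forall>s\<in>{0..T}. c < X s \<omega>)"
          then obtain a b where ab: "a \<in> {0..T}" "b \<in> {0..T}" "X b \<omega> \<le> c" "c \<le> X a \<omega>"
            unfolding Ball_def not_all not_imp not_less by (elim conjE exE)
          have "connected ((\<lambda>s. X s \<omega>) ` {0..T})"
            by (rule connected_continuous_image[OF continuous_on_subset[OF Xc[OF \<omega>]]]) auto
          then have "c \<in> (\<lambda>s. X s \<omega>) ` {0..T}"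
            by (rule connectedD_interval[OF _ imageI[OF ab(2)] imageI[OF ab(1)] ab(3,4)])
          then show "\<exists>s\<in>{0..T}. X s \<omega> = c" by auto
        qed auto
        then show ?thesis using \<omega> by (simp only: hit all mem_Collect_eq Diff_iff Un_iff simp_thms de_Morgan_disj)
      qed simp
    qed
    also have "\<dots> \<in> events"
      using XF X2 by (intro sets.Diff sets.Un sets.top path borel_measurable_uminus continuous_on_minus)
    finally show "{\<omega> \<in> space M. hitting_time X c \<omega> \<le> ennreal T} \<in> events" .
    have "{\<omega> \<in> space M. \<exists>s\<in>{0..T}. c\<^sup>2 \<le> Z s \<omega>} = space M - {\<omega> \<in> space M. \<forall>s\<in>{0..T}. Z s \<omega> < c\<^sup>2}" by (auto simp: not_less)
    also have "\<dots> \<in> events"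
      by (intro sets.Diff sets.top path Z_adapted Z_continuous)
    finally show "{\<omega> \<in> space M. \<exists>s\<in>{0..T}. c\<^sup>2 \<le> Z s \<omega>} \<in> events" .
  qed
  have D: "0 < c\<^sup>2 - x0\<^sup>2" using c x0 by (simp add: power_strict_mono)
  have "(\<integral>\<^sup>+ \<omega>'. hitting_time X c \<omega>' \<partial>M) = (\<integral>\<^sup>+ \<omega>'. hitting_time (\<lambda>t \<omega>. sqrt (Z t \<omega>)) c \<omega>' \<partial>M)"
  proof (rule nn_integral_cong_AE)
    show "AE \<omega> in M. hitting_time X c \<omega> = hitting_time (\<lambda>t \<omega>. sqrt (Z t \<omega>)) c \<omega>"
      using AE_space AE_not_in[OF A] by eventually_elim (rule hitting_time_cong, simp add: ZX)
  qed
  also have "\<dots> = ennreal ((c\<^sup>2 - x0\<^sup>2) / \<delta>)" by (rule nn_integral_hitting_time[OF x0 c(2) \<delta>])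
  finally have mean: "ennreal (1 - \<eta>) * (\<integral>\<^sup>+ \<omega>'. hitting_time X c \<omega>' \<partial>M) = ennreal ((c\<^sup>2 - x0\<^sup>2) / \<delta> * (1 - \<eta>))"
    using \<eta> ennreal_mult'[of "1 - \<eta>" "(c\<^sup>2 - x0\<^sup>2) / \<delta>"] by (simp only: mult.commute less_imp_le diff_ge_0_iff_ge)
  let ?T = "(c\<^sup>2 - x0\<^sup>2) / \<delta> * (1 - \<eta>)"
  have T: "0 < ?T" using D \<delta> \<eta> by simp
  have d: "c\<^sup>2 - x0\<^sup>2 - \<delta> * ?T = (c\<^sup>2 - x0\<^sup>2) * \<eta>" using \<delta> by (simp add: field_simps)
  have "prob {\<omega> \<in> space M. hitting_time X c \<omega> \<le> ennreal ?T} \<le> exp (- (((c\<^sup>2 - x0\<^sup>2) * \<eta>)\<^sup>2 / (8 * c\<^sup>2 * ?T)))"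
    unfolding event[OF less_imp_le[OF T]] d[symmetric]
    by (rule hit_prob_le[OF T _ _ \<delta>]) (use D \<eta> in \<open>simp_all only: d diff_gt_0_iff_gt, simp\<close>)
  also have "((c\<^sup>2 - x0\<^sup>2) * \<eta>)\<^sup>2 / (8 * c\<^sup>2 * ?T) = \<delta> / 8 * ((c\<^sup>2 - x0\<^sup>2) / c\<^sup>2) * (\<eta>\<^sup>2 / (1 - \<eta>))"
  proof -
    have "(d * \<eta>)\<^sup>2 / (8 * c\<^sup>2 * (d / \<delta> * (1 - \<eta>))) = \<delta> / 8 * (d / c\<^sup>2) * (\<eta>\<^sup>2 / (1 - \<eta>))" if "0 < d" for d
      using that c \<delta> \<eta> by (simp add: field_simps power2_eq_square)
    from this[OF D] show ?thesis .
  qed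
  finally have upper: "prob {\<omega> \<in> space M. hitting_time X c \<omega> \<le> ennreal ?T} \<le> exp (- (\<delta> / 8 * ((c\<^sup>2 - x0\<^sup>2) / c\<^sup>2) * (\<eta>\<^sup>2 / (1 - \<eta>))))" .
  have lower: "1 / 3 * exp (- (2 * (\<delta> - 1) * ((c - x0) / c) * (1 / (1 - \<eta>)))) \<le>
    prob {\<omega> \<in> space M. hitting_time X c \<omega> \<le> ennreal (2 * c * ((c - x0) / (\<delta> - 1)) * (1 - \<eta>))}" if \<delta>1: "1 < \<delta>"
  proof -
    let ?S = "2 * c * ((c - x0) / (\<delta> - 1)) * (1 - \<eta>)"
    have S: "0 < ?S" using c \<eta> \<delta>1 by simp
    \<comment> \<open>At the prescribed horizon the exponent of the comparison bound has the factor
      \<open>1 / 2\<close> where \<open>2\<close> is permitted.\<close>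
    have "(e)\<^sup>2 / (2 * c * (e / k) * h) \<le> 2 * k * (e / c) * (1 / h)" if "0 < e" "0 < k" "0 < h" for e k h :: real
    proof -
      have "e\<^sup>2 / (2 * c * (e / k) * h) = 1 / 2 * (k * (e / c) * (1 / h))"
        using that c by (simp add: field_simps power2_eq_square)
      also have "\<dots> \<le> 2 * (k * (e / c) * (1 / h))" using that c by (intro mult_right_mono) auto
      finally show ?thesis by (simp only: mult.assoc)
    qed
    from this[of "c - x0" "\<delta> - 1" "1 - \<eta>"] have "(c - x0)\<^sup>2 / ?S \<le> 2 * (\<delta> - 1) * ((c - x0) / c) * (1 / (1 - \<eta>))"
      using c \<eta> \<delta>1 by simp
    then have "1 / 3 * exp (- (2 * (\<delta> - 1) * ((c - x0) / c) * (1 / (1 - \<eta>)))) \<le> 1 / 3 * exp (- ((c - x0)\<^sup>2 / ?S))"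
      by simp
    also have "\<dots> \<le> prob {\<omega> \<in> space M. hitting_time X c \<omega> \<le> ennreal ?S}"
      unfolding event[OF less_imp_le[OF S]] by (rule hit_prob_ge[OF S x0 c(2)]) (use \<delta>1 in simp)
    finally show ?thesis .
  qed
  show ?thesis unfolding mean using upper lower by blast
qed

end
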